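(* Let $I \subset \{1,\dots,r\}$ with $\#I \geq 2$. Then $$\mathcal{N}_{G}(D_I)G_K \subsetneqq \bigcap_{i \in I}\big(\mathcal{N}_{G}(D_i)G_K\big),$$ and, for $g \in G$, $D_I\pi(g)$ is a locally divergent orbit such that $\overline{D_I\pi(g)}$ is not an orbit of a torus if and only if $$g \in \bigcap_{i \in I}\big(\mathcal{N}_{G}(D_i)G_K \big) \setminus \mathcal{N}_{G}(D_I)G_K.$$
   Context: $K$ is a number field, $\mathcal{O}$ its ring of integers, $K_1,\dots,K_r$ all its archimedean completions (each is $\mathbb{R}$ or $\mathbb{C}$); throughout $r \geq 2$. $G = \prod_{i=1}^r G_i$ with $G_i = \mathrm{SL}(2,K_i)$, and $\Gamma = \mathrm{SL}(2,\mathcal{O})$ is identified with its image in $G$ under the diagonal embedding. $G_K$ is the image of $\mathrm{SL}(2,K)$ in $G$ under the diagonal embedding. $\pi: G \to G/\Gamma$ is the natural projection. $D_i$ is the connected component of the identity of the diagonal subgroup of $G_i$ (viewed also as a subgroup of $G$, trivial in the other coordinates). For non-empty $I \subset \{1,\dots,r\}$, $D_I = \prod_{i\in I} D_i$, viewed as a subgroup of $G$; $D = D_{\{1,\dots,r\}}$. $\mathcal{N}_G(H)$ is the normalizer of $H$ in $G$, and $\mathcal{N}_G(H)G_K = \{nq : n \in \mathcal{N}_G(H), q \in G_K\}$. A torus in $G$ is a subgroup conjugate to a closed connected subgroup of $D$. A subset of $G/\Gamma$ is an orbit of a torus if it equals $Tx$ for some torus $T$ and some $x \in G/\Gamma$.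 For a closed non-compact subgroup $H$ of $G$, the orbit $Hx$ is divergent if the orbit map $h \mapsto hx$ from $H$ to $G/\Gamma$ is proper. The orbit $D_I\pi(g)$ is locally divergent if $D_i\pi(g)$ is divergent for every $i \in I$. *)

theory Defs
  imports
    "HOL-Analysis.Analysis"
    "HOL-Algebra.Group_Action"
    "HOL-Algebra.Left_Coset"
    "HOL-Algebra.Product_Groups"
begin

section \<open>Number fields and their archimedean completions\<close>

definition number_field :: "'k::field_char_0 itself \<Rightarrow> bool" where
  "number_field _ \<longleftrightarrow>
     (\<exists>B. finite_dimensional_vector_space (\<lambda>(q::rat) (x::'k). of_rat q * x) B)"

definition absolute_value :: "('k::field \<Rightarrow> real) \<Rightarrow> bool" where
  "absolute_value v \<longleftrightarrow>
     (\<forall>x. v x \<ge> 0) \<and> (\<forall>x. v x = 0 \<longleftrightarrow> x = 0) \<and>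
     (\<forall>x y. v (x * y) = v x * v y) \<and> (\<forall>x y. v (x + y) \<le> v x + v y)"

definition archimedean_absolute_value :: "('k::field \<Rightarrow> real) \<Rightarrow> bool" where
  "archimedean_absolute_value v \<longleftrightarrow>
     absolute_value v \<and> \<not> (\<forall>x y. v (x + y) \<le> max (v x) (v y))"

definition equivalent_absolute_values :: "('k::field \<Rightarrow> real) \<Rightarrow> ('k \<Rightarrow> real) \<Rightarrow> bool" where
  "equivalent_absolute_values v w \<longleftrightarrow> (\<exists>s>0. \<forall>x. w x = v x powr s)"

definition field_embedding :: "('k::field \<Rightarrow> complex) \<Rightarrow> bool" where
  "field_embedding \<tau> \<longleftrightarrow>
     \<tau> 1 = 1 \<and> (\<forall>x y. \<tau> (x + y) = \<tau> x + \<tau> y) \<and> (\<forall>x y. \<tau> (x * y) = \<tau> x * \<tau> y)"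

text \<open>
  For an embedding \<open>\<tau>\<close> of \<open>K\<close> into the complex numbers, the completion of \<open>K\<close> with respect to
  the absolute value \<open>x \<mapsto> |\<tau> x|\<close> is realised as the closure of \<open>\<tau>(K)\<close>; it is the set of real
  numbers if \<open>\<tau>\<close> is real, and all complex numbers otherwise.
\<close>

definition completion :: "('k::field \<Rightarrow> complex) \<Rightarrow> complex set" where
  "completion \<tau> = closure (range \<tau>)"

text \<open>
  The completions \<open>completion (\<sigma> i)\<close>, for \<open>i\<close> in the finite index type (which plays the role of
  \<open>{1,\<dots>,r}\<close>), are all the archimedean completions of \<open>K\<close>, each listed once.
  Complex conjugate embeddings induce the same absolute value, so only one of them is listed.
\<close>

definition archimedean_completions :: "('r::finite \<Rightarrow> 'k::field \<Rightarrow> complex) \<Rightarrow> bool" where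
  "archimedean_completions \<sigma> \<longleftrightarrow>
     (\<forall>i. field_embedding (\<sigma> i)) \<and>
     (\<forall>v. archimedean_absolute_value v \<longrightarrow>
        (\<exists>!i. equivalent_absolute_values v (\<lambda>x. norm (\<sigma> i x))))"

section \<open>The groups\<close>

definition SL2 :: "'a::comm_ring_1 set \<Rightarrow> ('a^2^2) monoid" where
  "SL2 R = \<lparr>carrier = {A. (\<forall>i j. A $ i $ j \<in> R) \<and> det A = 1}, mult = (**), one = mat 1\<rparr>"

definition G :: "('r::finite \<Rightarrow> 'k::field \<Rightarrow> complex) \<Rightarrow> ('r \<Rightarrow> complex^2^2) monoid" where
  "G \<sigma> = product_group UNIV (\<lambda>i. SL2 (completion (\<sigma> i)))"

definition G_top :: "('r::finite \<Rightarrow> 'k::field \<Rightarrow> complex) \<Rightarrow> ('r \<Rightarrow> complex^2^2) topology" where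
  "G_top \<sigma> = top_of_set (carrier (G \<sigma>))"

definition diagonal_embedding ::
    "('r::finite \<Rightarrow> 'k::field \<Rightarrow> complex) \<Rightarrow> 'k^2^2 \<Rightarrow> 'r \<Rightarrow> complex^2^2" where
  "diagonal_embedding \<sigma> A = (\<lambda>i. map_matrix (\<sigma> i) A)"

definition G_K :: "('r::finite \<Rightarrow> 'k::field \<Rightarrow> complex) \<Rightarrow> ('r \<Rightarrow> complex^2^2) set" where
  "G_K \<sigma> = diagonal_embedding \<sigma> ` carrier (SL2 UNIV)"

definition \<Gamma> :: "('r::finite \<Rightarrow> 'k::field \<Rightarrow> complex) \<Rightarrow> ('r \<Rightarrow> complex^2^2) set" where
  "\<Gamma> \<sigma> = diagonal_embedding \<sigma> ` carrier (SL2 {x. algebraic_int x})"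

definition diagonal_subgroup :: "complex set \<Rightarrow> (complex^2^2) set" where
  "diagonal_subgroup F = {A \<in> carrier (SL2 F). A $ 1 $ 2 = 0 \<and> A $ 2 $ 1 = 0}"

text \<open>The subgroup \<open>D\<^sub>I\<close> of \<open>G\<close>. In particular \<open>D\<^sub>i\<close>, as a subgroup of \<open>G\<close>, is \<open>D \<sigma> {i}\<close>.\<close>

definition D :: "('r::finite \<Rightarrow> 'k::field \<Rightarrow> complex) \<Rightarrow> 'r set \<Rightarrow> ('r \<Rightarrow> complex^2^2) set" where
  "D \<sigma> I = {g \<in> carrier (G \<sigma>).
     (\<forall>i\<in>I. g i \<in> connected_component_set (diagonal_subgroup (completion (\<sigma> i))) (mat 1)) \<and>
     (\<forall>i. i \<notin> I \<longrightarrow> g i = mat 1)}"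

definition torus :: "('r::finite \<Rightarrow> 'k::field \<Rightarrow> complex) \<Rightarrow> ('r \<Rightarrow> complex^2^2) set \<Rightarrow> bool" where
  "torus \<sigma> T \<longleftrightarrow>
     (\<exists>S. \<exists>a\<in>carrier (G \<sigma>).
        subgroup S (G \<sigma>) \<and> S \<subseteq> D \<sigma> UNIV \<and> closedin (G_top \<sigma>) S \<and> connectedin (G_top \<sigma>) S \<and>
        T = a <#\<^bsub>G \<sigma>\<^esub> S #>\<^bsub>G \<sigma>\<^esub> inv\<^bsub>G \<sigma>\<^esub> a)"

section \<open>The quotient of \<open>G\<close> by \<open>\<Gamma>\<close>, and orbits\<close>

definition quotient_topology :: "'a topology \<Rightarrow> ('a \<Rightarrow> 'b) \<Rightarrow> 'b topology" where
  "quotient_topology X f =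
     topology (\<lambda>U. U \<subseteq> f ` topspace X \<and> openin X {x \<in> topspace X. f x \<in> U})"

lemma openin_quotient_topology:
  "openin (quotient_topology X f) U \<longleftrightarrow>
     U \<subseteq> f ` topspace X \<and> openin X {x \<in> topspace X. f x \<in> U}"
proof -
  have "istopology (\<lambda>U. U \<subseteq> f ` topspace X \<and> openin X {x \<in> topspace X. f x \<in> U})"
    unfolding istopology_def
  proof (intro conjI allI impI)
    fix S T
    assume *: "S \<subseteq> f ` topspace X \<and> openin X {x \<in> topspace X. f x \<in> S}"
      "T \<subseteq> f ` topspace X \<and> openin X {x \<in> topspace X. f x \<in> T}"
    then show "S \<inter> T \<subseteq> f ` topspace X"
      by blast
    have "{x \<in> topspace X. f x \<in> S \<inter> T} =
        {x \<in> topspace X. f x \<in> S} \<inter> {x \<in> topspace X. f x \<in> T}"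
      by blast
    with * show "openin X {x \<in> topspace X. f x \<in> S \<inter> T}"
      by (simp only: openin_Int)
  next
    fix \<K> assume *: "\<forall>K\<in>\<K>. K \<subseteq> f ` topspace X \<and> openin X {x \<in> topspace X. f x \<in> K}"
    then show "\<Union>\<K> \<subseteq> f ` topspace X"
      by blast
    have "{x \<in> topspace X. f x \<in> \<Union>\<K>} = (\<Union>K\<in>\<K>. {x \<in> topspace X. f x \<in> K})"
      by blast
    moreover have "openin X (\<Union>K\<in>\<K>. {x \<in> topspace X. f x \<in> K})"
      using * by (intro openin_Union) blast
    ultimately show "openin X {x \<in> topspace X. f x \<in> \<Union>\<K>}"
      by (simp only:)
  qed
  then show ?thesis
    unfolding quotient_topology_def by (simp only: topology_inverse')
qed

lemma topspace_quotient_topology: "topspace (quotient_topology X f) = f ` topspace X"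
proof -
  have "{x \<in> topspace X. f x \<in> f ` topspace X} = topspace X"
    by blast
  then have "openin (quotient_topology X f) (f ` topspace X)"
    by (simp add: openin_quotient_topology)
  then have "f ` topspace X \<subseteq> topspace (quotient_topology X f)"
    by (rule openin_subset)
  moreover have "topspace (quotient_topology X f) \<subseteq> f ` topspace X"
    using openin_topspace[of "quotient_topology X f"] unfolding openin_quotient_topology by simp
  ultimately show ?thesis
    by (rule subset_antisym[rotated])
qed

lemma quotient_map_quotient_topology: "quotient_map X (quotient_topology X f) f"
  unfolding quotient_map_def topspace_quotient_topology openin_quotient_topology by blast

definition \<pi> ::
    "('r::finite \<Rightarrow> 'k::field \<Rightarrow> complex) \<Rightarrow> ('r \<Rightarrow> complex^2^2) \<Rightarrow> ('r \<Rightarrow> complex^2^2) set" where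
  "\<pi> \<sigma> g = g <#\<^bsub>G \<sigma>\<^esub> \<Gamma> \<sigma>"

definition G_mod_\<Gamma>_top ::
    "('r::finite \<Rightarrow> 'k::field \<Rightarrow> complex) \<Rightarrow> ('r \<Rightarrow> complex^2^2) set topology" where
  "G_mod_\<Gamma>_top \<sigma> = quotient_topology (G_top \<sigma>) (\<pi> \<sigma>)"

text \<open>An element \<open>h\<close> of \<open>G\<close> acts on a left coset \<open>x\<close> of \<open>\<Gamma>\<close> by left translation, \<open>h <# x\<close>.\<close>

definition orbit_of ::
    "('r::finite \<Rightarrow> 'k::field \<Rightarrow> complex) \<Rightarrow> ('r \<Rightarrow> complex^2^2) set \<Rightarrow>
     ('r \<Rightarrow> complex^2^2) set \<Rightarrow> ('r \<Rightarrow> complex^2^2) set set" where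
  "orbit_of \<sigma> H x = (\<lambda>h. h <#\<^bsub>G \<sigma>\<^esub> x) ` H"

definition is_torus_orbit ::
    "('r::finite \<Rightarrow> 'k::field \<Rightarrow> complex) \<Rightarrow> ('r \<Rightarrow> complex^2^2) set set \<Rightarrow> bool" where
  "is_torus_orbit \<sigma> Y \<longleftrightarrow>
     (\<exists>T. \<exists>x\<in>lcosets\<^bsub>G \<sigma>\<^esub> (\<Gamma> \<sigma>). torus \<sigma> T \<and> Y = orbit_of \<sigma> T x)"

text \<open>
  Only meant for closed non-compact subgroups \<open>H\<close> of \<open>G\<close>. The orbit map is continuous, and the
  quotient is locally compact Hausdorff, so that \<open>proper_map\<close> here amounts to preimages of compact
  sets being compact.
\<close>

definition divergent_orbit ::
    "('r::finite \<Rightarrow> 'k::field \<Rightarrow> complex) \<Rightarrow> ('r \<Rightarrow> complex^2^2) set \<Rightarrow>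
     ('r \<Rightarrow> complex^2^2) set \<Rightarrow> bool" where
  "divergent_orbit \<sigma> H x \<longleftrightarrow>
     proper_map (subtopology (G_top \<sigma>) H) (G_mod_\<Gamma>_top \<sigma>) (\<lambda>h. h <#\<^bsub>G \<sigma>\<^esub> x)"

definition locally_divergent_orbit ::
    "('r::finite \<Rightarrow> 'k::field \<Rightarrow> complex) \<Rightarrow> 'r set \<Rightarrow> ('r \<Rightarrow> complex^2^2) \<Rightarrow> bool" where
  "locally_divergent_orbit \<sigma> I g \<longleftrightarrow> (\<forall>i\<in>I. divergent_orbit \<sigma> (D \<sigma> {i}) (\<pi> \<sigma> g))"

end

theory Submission
  imports "Jordan_Normal_Form.Char_Poly" Defs
begin

hide_const (open) Determinant.det Matrix.mat Matrix.row Matrix.col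
hide_type (open) Matrix.vec
no_notation Matrix.vec_index (infixl "$" 100)

text \<open>
  Call \<open>g\<close> aligned on \<open>J\<close> if a single \<open>q\<close> in \<open>SL\<^sub>2(K)\<close> satisfies \<open>g\<^sub>i = n\<^sub>i \<sigma>\<^sub>i(q)\<close> with a monomial
  matrix \<open>n\<^sub>i\<close> for every \<open>i \<in> J\<close>. An element of \<open>G\<close> normalizes \<open>D\<^sub>J\<close> exactly if its components in
  \<open>J\<close> are monomial, so \<open>N(D\<^sub>J) G\<^sub>K\<close> is the set of elements aligned on \<open>J\<close> (\<open>normalizer_G_K_iff\<close>).
  The theorem therefore compares alignment on each single place with alignment on all of \<open>I\<close> at once.
  The inclusion is strict because a unipotent matrix with entries in \<open>K\<close> at all places except one is
  aligned on every place separately, with different witnesses \<open>q\<close> that cannot be made equal.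

  Local divergence is alignment on each place (\<open>divergent_iff_aligned\<close>). A row of \<open>g\<^sub>i\<close> that kills a
  nonzero vector of \<open>K\<^sup>2\<close> keeps the opposite diagonal entry of \<open>d\<close> away from \<open>0\<close> whenever
  \<open>d g \<Gamma>\<close> stays in a bounded set; if both rows do so, then \<open>d\<close> itself stays bounded, and the orbit map
  is proper. Conversely, if the orbit diverges, then the lattices \<open>d g O\<^sup>2\<close> contain arbitrarily
  short vectors as \<open>d\<close> runs to either end of \<open>D\<^sub>i\<close>, since otherwise the orbit would return infinitely
  often to one compact set (\<open>bounded_returns\<close>). Consecutive short vectors are proportional over \<open>K\<close>,
  because their determinant is an algebraic integer that is small at all places, hence zero. So one
  line of \<open>K\<^sup>2\<close> is contracted for all times, which forces the expanding row of \<open>g\<^sub>i\<close> to vanish on it.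

  Suppose that \<open>g\<close> is aligned on \<open>I\<close>, \<open>g = n q\<close>. A convergent sequence \<open>d\<^sub>k q c\<^sub>k\<close> with diagonal
  \<open>d\<^sub>k\<close> and \<open>c\<^sub>k \<in> \<Gamma>\<close> determines convergent quadratic forms \<open>x y \<circ> (q c\<^sub>k)\<close>, which do not depend on
  \<open>d\<^sub>k\<close> and have coefficients in a fixed fractional ideal. These forms are eventually constant, so
  the matrices \<open>q c\<^sub>k\<close> differ by diagonal factors only. Hence the closure of the orbit is a translate of the closure of
  a group of diagonal matrices, and its identity component is the torus whose orbit is sought
  (\<open>connected_part_of_diagonal_group\<close>, \<open>closure_torus_orbit_if_aligned\<close>).

  Suppose that \<open>g\<close> is aligned on each place of \<open>I\<close> but not on \<open>I\<close>. If the closure were an orbit of a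
  torus \<open>T\<close>, then \<open>T\<close> would contain a nontrivial real element of \<open>D\<^sub>I\<close>, because \<open>\<Gamma>\<close> is countable;
  as \<open>T\<close> is abelian, its components in \<open>I\<close> would be diagonal. However, units that are
  large at one place of \<open>I\<close>, small at another one and bounded at all other places
  (\<open>separating_units\<close>) produce a point of the closure that differs from \<open>g\<close> by a unipotent matrix
  incompatible with diagonal components at both places (\<open>not_torus_orbit_if_not_aligned\<close>).

  The arithmetic input is the finiteness of the set of algebraic integers of \<open>K\<close> with bounded
  absolute values at all places, together with the pigeonhole principle for the linear forms that
  the places define on an integral basis; the latter yields small algebraic integers, units and
  independent pairs of short vectors alike.
\<close>

section \<open>Algebraic integers\<close>

text \<open>
  The characteristic polynomial of a rational matrix indexed by an arbitrary finite set, seen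
  from both sides: an eigenvalue in any field of characteristic zero is a root, and every
  complex root is an eigenvalue. This turns multiplication by an element of a number field into
  polynomial equations.
\<close>
lemma char_poly_of_rat:
  fixes c :: "'b \<Rightarrow> 'b \<Rightarrow> rat"
  assumes "finite B"
  obtains p :: "rat poly" where "lead_coeff p = 1" "degree p = card B"
    "(\<And>b b'. b \<in> B \<Longrightarrow> b' \<in> B \<Longrightarrow> c b b' \<in> \<int>) \<Longrightarrow> (\<And>i. coeff p i \<in> \<int>)"
    "\<And>(x::'a::field_char_0) v. (\<And>b. b \<in> B \<Longrightarrow> x * v b = (\<Sum>b'\<in>B. of_rat (c b b') * v b')) \<Longrightarrow>
        \<exists>b\<in>B. v b \<noteq> 0 \<Longrightarrow> poly (map_poly of_rat p) x = 0"
    "\<And>l::complex. poly (map_poly of_rat p) l = 0 \<Longrightarrow>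
        \<exists>w. (\<exists>b\<in>B. w b \<noteq> 0) \<and> (\<forall>b\<in>B. l * w b = (\<Sum>b'\<in>B. of_rat (c b b') * w b'))"
proof -
  define n where "n = card B"
  obtain h where h: "bij_betw h {0..<n} B"
    using ex_bij_betw_nat_finite[OF assms] by (auto simp: n_def)
  define A where "A = Matrix.mat n n (\<lambda>(i,j). c (h i) (h j))"
  have A: "A \<in> carrier_mat n n" by (simp add: A_def)
  define p where "p = char_poly A"
  have hB: "h i \<in> B" if "i < n" for i
    using h that by (auto simp: bij_betw_def)
  have sumB: "(\<Sum>b\<in>B. f b) = (\<Sum>i=0..<n. f (h i))" for f :: "'b \<Rightarrow> 'z::comm_monoid_add"
    using sum.reindex_bij_betw[OF h, of f] by simp
  have hom: "char_poly (map_mat of_rat A) = map_poly (of_rat :: rat \<Rightarrow> 'z::field_char_0) p"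
    by (simp add: p_def of_rat_hom.char_poly_hom[OF A])
  have deg: "degree p = n \<and> coeff p n = 1"
    using degree_monic_char_poly[OF A] by (simp add: p_def)
  show thesis
  proof (rule that[of p])
    show "lead_coeff p = 1" "degree p = card B" using deg by (auto simp: n_def)
  next
    fix i assume int: "\<And>b b'. b \<in> B \<Longrightarrow> b' \<in> B \<Longrightarrow> c b b' \<in> \<int>"
    define A' where "A' = Matrix.mat n n (\<lambda>(i,j). \<lfloor>c (h i) (h j)\<rfloor>)"
    have A': "A' \<in> carrier_mat n n" by (simp add: A'_def)
    have "A = map_mat of_int A'"
      by (rule eq_matI) (auto simp: A_def A'_def int hB)
    then have "p = map_poly of_int (char_poly A')"
      by (simp add: p_def of_int_hom.char_poly_hom[OF A'])
    then show "coeff p i \<in> \<int>"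
      by (simp add: coeff_map_poly)
  next
    fix x :: 'a and v
    assume ev: "\<And>b. b \<in> B \<Longrightarrow> x * v b = (\<Sum>b'\<in>B. of_rat (c b b') * v b')" and "\<exists>b\<in>B. v b \<noteq> 0"
    then obtain b where b: "b \<in> B" "v b \<noteq> 0" by blast
    then obtain i where i: "i < n" "h i = b"
      using h by (force simp: bij_betw_def)
    define V where "V = Matrix.vec n (\<lambda>i. v (h i))"
    have "eigenvector (map_mat of_rat A) V x"
      unfolding eigenvector_def
    proof (intro conjI)
      show "V \<in> carrier_vec (dim_row (map_mat of_rat A))" by (simp add: V_def A_def)
      have "vec_index V i \<noteq> vec_index (0\<^sub>v n) i" using i b by (simp add: V_def)
      then show "V \<noteq> 0\<^sub>v (dim_row (map_mat of_rat A))" by (auto simp: A_def)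
      show "map_mat of_rat A *\<^sub>v V = x \<cdot>\<^sub>v V"
        by (rule eq_vecI) (auto simp: V_def A_def scalar_prod_def sumB ev hB)
    qed
    then have "eigenvalue (map_mat of_rat A) x" by (auto simp: eigenvalue_def)
    then show "poly (map_poly of_rat p) x = 0"
      using eigenvalue_root_char_poly[of "map_mat of_rat A" n x] A by (simp add: hom)
  next
    fix l :: complex assume "poly (map_poly of_rat p) l = 0"
    then have "eigenvalue (map_mat of_rat A) l"
      using eigenvalue_root_char_poly[of "map_mat of_rat A" n l] A by (simp add: hom)
    then obtain V where V: "V \<in> carrier_vec n" "V \<noteq> 0\<^sub>v n" "map_mat of_rat A *\<^sub>v V = l \<cdot>\<^sub>v V"
      using A by (auto simp: eigenvalue_def eigenvector_def)
    define g where "g = inv_into {0..<n} h"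
    have g: "g (h i) = i" if "i < n" for i
      using h that by (simp add: g_def bij_betw_def inv_into_f_f)
    have hg: "g b < n" "h (g b) = b" if b: "b \<in> B" for b
    proof -
      have "b \<in> h ` {0..<n}" using h b by (simp add: bij_betw_def)
      then show "g b < n" "h (g b) = b"
        using inv_into_into[of b h "{0..<n}"] f_inv_into_f[of b h "{0..<n}"] by (auto simp: g_def)
    qed
    obtain i where i: "i < n" "vec_index V i \<noteq> 0"
      using V by (metis carrier_vecD eq_vecI index_zero_vec(1) index_zero_vec(2))
    show "\<exists>w. (\<exists>b\<in>B. w b \<noteq> 0) \<and> (\<forall>b\<in>B. l * w b = (\<Sum>b'\<in>B. of_rat (c b b') * w b'))"
    proof (intro exI conjI ballI)
      show "\<exists>b\<in>B. vec_index V (g b) \<noteq> 0"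
        using i g hB by (intro bexI[of _ "h i"]) auto
      fix b assume b: "b \<in> B"
      have "vec_index (map_mat of_rat A *\<^sub>v V) (g b) = vec_index (l \<cdot>\<^sub>v V) (g b)"
        using V by simp
      then show "l * vec_index V (g b) = (\<Sum>b'\<in>B. of_rat (c b b') * vec_index V (g b'))"
        using hg[OF b] V(1) by (auto simp: A_def scalar_prod_def sumB g)
    qed
  qed
qed

lemma algebraic_int_if_stable:
  fixes x :: "'a::field_char_0"
  assumes "finite B" "\<And>b. b \<in> B \<Longrightarrow> x * v b = (\<Sum>b'\<in>B. of_int (c b b') * v b')" "\<exists>b\<in>B. v b \<noteq> 0"
  shows "algebraic_int x"
proof -
  obtain p :: "rat poly" where p: "lead_coeff p = 1" "\<And>i. coeff p i \<in> \<int>" "poly (map_poly of_rat p) x = 0"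
  proof (rule char_poly_of_rat[OF assms(1), of "\<lambda>b b'. of_int (c b b')", where 'a='a])
    fix p :: "rat poly"
    assume p: "lead_coeff p = 1"
      and int: "\<And>i. (\<And>b b'. b \<in> B \<Longrightarrow> b' \<in> B \<Longrightarrow> rat_of_int (c b b') \<in> \<int>) \<Longrightarrow> coeff p i \<in> \<int>"
      and root: "\<And>(x::'a) v. (\<And>b. b \<in> B \<Longrightarrow> x * v b = (\<Sum>b'\<in>B. of_rat (rat_of_int (c b b')) * v b')) \<Longrightarrow>
        \<exists>b\<in>B. v b \<noteq> 0 \<Longrightarrow> poly (map_poly of_rat p) x = 0"
    show thesis
      by (rule that[OF p]) (use int root[of x v] assms(2,3) in auto)
  qed
  have int: "coeff (map_poly of_rat p :: 'a poly) i \<in> \<int>" for i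
    using p(2)[of i] by (auto simp: coeff_map_poly Ints_def)
  have "lead_coeff (map_poly of_rat p :: 'a poly) = 1"
    using p(1) by (simp add: coeff_map_poly degree_map_poly)
  with int p(3) show ?thesis
    by (intro algebraic_int.intros[of "map_poly of_rat p"]) auto
qed

lemma algebraic_int_power_reduction:
  fixes x :: "'a::field_char_0"
  assumes "algebraic_int x"
  obtains n c where "n > 0" "x ^ n = (\<Sum>i<n. of_int (c i) * x ^ i)"
proof -
  obtain p where p: "poly (map_poly of_int p) x = 0" "lead_coeff p = (1::int)"
    using assms by (auto simp: algebraic_int_altdef_ipoly)
  define n where "n = degree p"
  have "(\<Sum>i\<le>n. of_int (coeff p i) * x ^ i) = 0"
    using p(1) by (simp add: poly_altdef n_def coeff_map_poly degree_map_poly)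
  then have "x ^ n + (\<Sum>i<n. of_int (coeff p i) * x ^ i) = 0"
    using p(2) by (simp add: lessThan_Suc_atMost[symmetric] n_def add.commute)
  then have *: "x ^ n = (\<Sum>i<n. of_int (- coeff p i) * x ^ i)"
    by (simp add: sum_negf eq_neg_iff_add_eq_0)
  show thesis
  proof (cases "n = 0")
    case True then show ?thesis using * by simp
  next
    case False
    then show ?thesis using that[of n "\<lambda>i. - coeff p i"] * by simp
  qed
qed

text \<open>
  If \<open>x\<close> and \<open>y\<close> satisfy monic integral equations of degrees
  \<open>m\<close> and \<open>n\<close>, then multiplication by \<open>x\<close> and by
  \<open>y\<close> preserves the \<open>\<int>\<close>-span of the monomials \<open>x ^ i * y ^
  j\<close> with \<open>i < m\<close>, \<open>j < n\<close>. The matrices \<open>cx\<close> and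
  \<open>cy\<close> describe the two actions.
\<close>
lemma algebraic_int_ring:
  fixes x y :: "'a::field_char_0"
  assumes "algebraic_int x" "algebraic_int y"
  shows algebraic_int_plus: "algebraic_int (x + y)" and algebraic_int_times: "algebraic_int (x * y)"
proof -
  obtain m a where a: "m > 0" "x ^ m = (\<Sum>i<m. of_int (a i) * x ^ i)"
    using algebraic_int_power_reduction[OF assms(1)] by blast
  obtain n b where b: "n > 0" "y ^ n = (\<Sum>i<n. of_int (b i) * y ^ i)"
    using algebraic_int_power_reduction[OF assms(2)] by blast
  define B where "B = {..<m} \<times> {..<n}"
  define v where "v = (\<lambda>(i,j). x ^ i * y ^ j)"
  define cx :: "nat \<times> nat \<Rightarrow> nat \<times> nat \<Rightarrow> int" where "cx = (\<lambda>(i,j) (i',j'). (if j' = j then (if Suc i < m then (if i' = Suc i then 1 else 0) else a i') else 0))"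
  define cy :: "nat \<times> nat \<Rightarrow> nat \<times> nat \<Rightarrow> int" where "cy = (\<lambda>(i,j) (i',j'). (if i' = i then (if Suc j < n then (if j' = Suc j then 1 else 0) else b j') else 0))"
  have fin: "finite B" by (simp add: B_def)
  have prod_sum: "(\<Sum>q\<in>B. F q) = (\<Sum>i<m. \<Sum>j<n. F (i, j))" for F :: "nat \<times> nat \<Rightarrow> 'a"
    by (simp add: B_def sum.cartesian_product)
  have sx: "x * v p = (\<Sum>q\<in>B. of_int (cx p q) * v q)" if p: "p \<in> B" for p
  proof -
    obtain i j where ij: "p = (i,j)" "i < m" "j < n" using p by (auto simp: B_def)
    have "(\<Sum>q\<in>B. of_int (cx p q) * v q) = (\<Sum>i'<m. \<Sum>j'<n. if j' = j then of_int (if Suc i < m then (if i' = Suc i then 1 else 0) else a i') * (x ^ i' * y ^ j') else 0)"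
      unfolding prod_sum by (intro sum.cong refl) (auto simp: cx_def v_def ij)
    also have "\<dots> = (\<Sum>i'<m. of_int (if Suc i < m then (if i' = Suc i then 1 else 0) else a i') * x ^ i') * y ^ j"
      using ij by (simp add: sum_distrib_right mult.assoc)
    also have "(\<Sum>i'<m. of_int (if Suc i < m then (if i' = Suc i then 1 else 0) else a i') * x ^ i') = x ^ Suc i"
    proof (cases "Suc i < m")
      case True
      then have "(\<Sum>i'<m. of_int (if Suc i < m then (if i' = Suc i then 1 else 0) else a i') * x ^ i') = (\<Sum>i'<m. if i' = Suc i then x ^ i' else 0)"
        by (intro sum.cong) auto
      then show ?thesis using True by simp
    next
      case False then have "m = Suc i" using ij by simp
      then show ?thesis using a by simp
    qed
    finally show ?thesis by (simp add: ij v_def)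
  qed
  have sy: "y * v p = (\<Sum>q\<in>B. of_int (cy p q) * v q)" if p: "p \<in> B" for p
  proof -
    obtain i j where ij: "p = (i,j)" "i < m" "j < n" using p by (auto simp: B_def)
    have "(\<Sum>q\<in>B. of_int (cy p q) * v q) = (\<Sum>i'<m. if i' = i then \<Sum>j'<n. of_int (if Suc j < n then (if j' = Suc j then 1 else 0) else b j') * (x ^ i' * y ^ j') else 0)"
      unfolding prod_sum by (intro sum.cong refl) (auto simp: cy_def v_def ij intro!: sum.neutral)
    also have "\<dots> = x ^ i * (\<Sum>j'<n. of_int (if Suc j < n then (if j' = Suc j then 1 else 0) else b j') * y ^ j')"
      using ij by (simp add: sum_distrib_left mult_ac)
    also have "(\<Sum>j'<n. of_int (if Suc j < n then (if j' = Suc j then 1 else 0) else b j') * y ^ j') = y ^ Suc j"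
    proof (cases "Suc j < n")
      case True
      then have "(\<Sum>j'<n. of_int (if Suc j < n then (if j' = Suc j then 1 else 0) else b j') * y ^ j') = (\<Sum>j'<n. if j' = Suc j then y ^ j' else 0)"
        by (intro sum.cong) auto
      then show ?thesis using True by simp
    next
      case False then have "n = Suc j" using ij by simp
      then show ?thesis using b by simp
    qed
    finally show ?thesis by (simp add: ij v_def mult_ac)
  qed
  have nz: "\<exists>p\<in>B. v p \<noteq> 0"
    using a(1) b(1) by (intro bexI[of _ "(0,0)"]) (auto simp: B_def v_def)
  show "algebraic_int (x + y)"
  proof (rule algebraic_int_if_stable[OF fin _ nz, of _ "\<lambda>p q. cx p q + cy p q"])
    fix p assume p: "p \<in> B"
    have "(x + y) * v p = x * v p + y * v p" by (rule distrib_right)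
    also have "\<dots> = (\<Sum>q\<in>B. of_int (cx p q) * v q + of_int (cy p q) * v q)"
      by (simp only: sx[OF p] sy[OF p] sum.distrib)
    also have "\<dots> = (\<Sum>q\<in>B. of_int (cx p q + cy p q) * v q)"
      by (simp only: of_int_add distrib_right)
    finally show "(x + y) * v p = (\<Sum>q\<in>B. of_int (cx p q + cy p q) * v q)" .
  qed
  show "algebraic_int (x * y)"
  proof (rule algebraic_int_if_stable[OF fin _ nz, of _ "\<lambda>p q. \<Sum>r\<in>B. cy p r * cx r q"])
    fix p assume p: "p \<in> B"
    have "x * y * v p = (\<Sum>r\<in>B. of_int (cy p r) * (x * v r))"
      by (simp only: mult.assoc sy[OF p] sum_distrib_left mult.left_commute)
    also have "\<dots> = (\<Sum>r\<in>B. \<Sum>q\<in>B. of_int (cy p r * cx r q) * v q)"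
      by (intro sum.cong refl) (simp only: sx sum_distrib_left of_int_mult mult.assoc)
    also have "\<dots> = (\<Sum>q\<in>B. \<Sum>r\<in>B. of_int (cy p r * cx r q) * v q)"
      by (rule sum.swap[of "\<lambda>r q. of_int (cy p r * cx r q) * v q" B B])
    also have "\<dots> = (\<Sum>q\<in>B. of_int (\<Sum>r\<in>B. cy p r * cx r q) * v q)"
      by (intro sum.cong refl) (simp only: of_int_sum sum_distrib_right)
    finally show "x * y * v p = (\<Sum>q\<in>B. of_int (\<Sum>r\<in>B. cy p r * cx r q) * v q)" .
  qed
qed

lemma algebraic_int_of_int [simp]: "algebraic_int (of_int n :: 'a::field_char_0)"
  by (rule int_imp_algebraic_int) auto

lemma algebraic_int_of_nat [simp]: "algebraic_int (of_nat n :: 'a::field_char_0)"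
  by (rule int_imp_algebraic_int) auto

lemma algebraic_int_diff: 
  fixes x y :: "'a::field_char_0"
  shows "algebraic_int x \<Longrightarrow> algebraic_int y \<Longrightarrow> algebraic_int (x - y)"
  using algebraic_int_plus[of x "-y"] by simp

lemma algebraic_int_sum:
  fixes f :: "'b \<Rightarrow> 'a::field_char_0"
  shows "(\<And>i. i \<in> A \<Longrightarrow> algebraic_int (f i)) \<Longrightarrow> algebraic_int (sum f A)"
  by (induction A rule: infinite_finite_induct) (auto intro: algebraic_int_plus)

section \<open>Number fields as rational vector spaces\<close>

lemma common_denominator:
  assumes "finite S"
  obtains m :: nat where "m > 0" "\<And>q::rat. q \<in> S \<Longrightarrow> of_nat m * q \<in> \<int>"
proof -
  have "\<exists>m::nat. m > 0 \<and> (\<forall>q\<in>S. of_nat m * q \<in> \<int>)"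
    using assms
  proof (induction S)
    case empty show ?case by auto
  next
    case (insert q S)
    then obtain m :: nat where m: "m > 0" "\<forall>q\<in>S. of_nat m * q \<in> \<int>" by blast
    obtain a b where ab: "quotient_of q = (a,b)" by fastforce
    then have b: "b > 0" "q = of_int a / of_int b"
      using quotient_of_denom_pos quotient_of_div by auto
    have "of_nat (nat b * m) * r \<in> \<int>" if r: "r \<in> insert q S" for r
    proof (cases "r = q")
      case True
      then have "of_nat (nat b * m) * r = of_int (int m * a)"
        using b by simp
      then show ?thesis by (metis Ints_of_int)
    next
      case False
      then have "of_nat (nat b * m) * r = of_nat (nat b) * (of_nat m * r)" by simp
      then show ?thesis using m r False by (metis Ints_mult Ints_of_nat insertE)
    qed
    then show ?case using m b by (intro exI[of _ "nat b * m"]) auto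
  qed
  then show thesis using that by blast
qed

definition rational_basis :: "'k::field_char_0 set \<Rightarrow> bool" where
  "rational_basis B \<longleftrightarrow> finite B \<and> (\<forall>x. \<exists>q. x = (\<Sum>b\<in>B. of_rat (q b) * b)) \<and>
     (\<forall>q. (\<Sum>b\<in>B. of_rat (q b) * b) = 0 \<longrightarrow> (\<forall>b\<in>B. q b = 0))"

lemma number_field_has_basis:
  assumes "number_field TYPE('k::field_char_0)"
  obtains B :: "'k::field_char_0 set" where "rational_basis B"
proof -
  obtain B where "finite_dimensional_vector_space (\<lambda>(q::rat) (x::'k). of_rat q * x) B"
    using assms by (auto simp: number_field_def)
  then interpret V: finite_dimensional_vector_space "\<lambda>(q::rat) (x::'k). of_rat q * x" B .
  have "rational_basis B"
    unfolding rational_basis_def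
  proof (intro conjI allI impI ballI)
    show "finite B" by (rule V.finite_Basis)
    fix x :: 'k
    have "x \<in> V.span B" by (simp add: V.span_Basis)
    then show "\<exists>q. x = (\<Sum>b\<in>B. of_rat (q b) * b)"
      using V.span_finite[OF V.finite_Basis] by auto
  next
    fix q b assume "(\<Sum>b\<in>B. of_rat (q b) * b) = 0" "b \<in> B"
    then show "q b = 0"
      using V.independent_Basis V.dependent_finite[OF V.finite_Basis] by blast
  qed
  then show thesis by (rule that)
qed

lemma rational_basis_int_independent:
  assumes B: "rational_basis B" and "(\<Sum>b\<in>B. of_int (z b) * b) = 0" "b \<in> B"
  shows "z b = 0"
proof -
  have "(\<Sum>b\<in>B. of_rat (rat_of_int (z b)) * b) = 0" by (simp only: of_rat_of_int_eq assms(2))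
  with B have "\<forall>b\<in>B. rat_of_int (z b) = 0"
    unfolding rational_basis_def by (elim conjE) (erule allE, erule mp)
  then show ?thesis using assms(3) by simp
qed

definition coord :: "'k::field_char_0 set \<Rightarrow> 'k \<Rightarrow> 'k \<Rightarrow> rat" where
  "coord B x = (SOME q. x = (\<Sum>b\<in>B. of_rat (q b) * b))"

lemma sum_coord:
  assumes "rational_basis B"
  shows "(\<Sum>b\<in>B. of_rat (coord B x b) * b) = x"
proof -
  have "\<exists>q. x = (\<Sum>b\<in>B. of_rat (q b) * b)" using assms by (auto simp: rational_basis_def)
  then show ?thesis unfolding coord_def by (rule someI2_ex) simp
qed

lemma coord_unique:
  assumes "rational_basis B" "x = (\<Sum>b\<in>B. of_rat (q b) * b)" "b \<in> B"
  shows "coord B x b = q b"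
proof -
  have "(\<Sum>b\<in>B. of_rat (coord B x b - q b) * b) = 0"
    using sum_coord[OF assms(1), of x] assms(2) by (simp add: of_rat_diff left_diff_distrib sum_subtractf)
  with assms(1) have "\<forall>b\<in>B. coord B x b - q b = 0"
    unfolding rational_basis_def by (elim conjE) (erule allE, erule mp)
  then show ?thesis using assms(3) by simp
qed

lemma coord_add: "rational_basis B \<Longrightarrow> b \<in> B \<Longrightarrow> coord B (x + y) b = coord B x b + coord B y b"
  by (rule coord_unique) (simp_all add: of_rat_add distrib_right sum.distrib sum_coord)

lemma coord_scale: "rational_basis B \<Longrightarrow> b \<in> B \<Longrightarrow> coord B (of_rat c * x) b = c * coord B x b"
  by (rule coord_unique) (simp_all add: of_rat_mult mult.assoc sum_distrib_left[symmetric] sum_coord)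

text \<open>
  A common denominator of the matrix of multiplication by \<open>x\<close> makes that matrix
  integral, and \<open>algebraic_int_if_stable\<close> applies.
\<close>
lemma denominator_algebraic_int:
  assumes "number_field TYPE('k::field_char_0)"
  obtains m :: nat where "m > 0" "algebraic_int (of_nat m * (x::'k))"
proof -
  obtain B :: "'k set" where B: "rational_basis B" using number_field_has_basis[OF assms] .
  have fin: "finite B" using B by (simp add: rational_basis_def)
  obtain m :: nat where m: "m > 0" "\<And>q. q \<in> (\<lambda>(b,b'). coord B (x * b) b') ` (B \<times> B) \<Longrightarrow> of_nat m * q \<in> \<int>"
    using common_denominator[of "(\<lambda>(b,b'). coord B (x * b) b') ` (B \<times> B)"] fin by blast
  have int: "of_int \<lfloor>of_nat m * coord B (x * b) b'\<rfloor> = of_nat m * coord B (x * b) b'"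
    if "b \<in> B" "b' \<in> B" for b b'
  proof -
    have "coord B (x * b) b' \<in> (\<lambda>(b,b'). coord B (x * b) b') ` (B \<times> B)"
      using that by (intro image_eqI[of _ _ "(b, b')"]) auto
    then have "of_nat m * coord B (x * b) b' \<in> \<int>" by (rule m(2))
    then show ?thesis by (auto elim!: Ints_cases)
  qed
  have "\<exists>b\<in>B. b \<noteq> 0"
  proof (rule ccontr)
    assume "\<not> ?thesis"
    then have "(\<Sum>b\<in>B. of_rat (coord B 1 b) * b) = (0::'k)" by (intro sum.neutral) auto
    then show False using sum_coord[OF B, of 1] by simp
  qed
  moreover have "of_nat m * x * b = (\<Sum>b'\<in>B. of_int \<lfloor>of_nat m * coord B (x * b) b'\<rfloor> * b')" if b: "b \<in> B" for b
  proof -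
    have "of_nat m * x * b = of_nat m * (\<Sum>b'\<in>B. of_rat (coord B (x * b) b') * b')"
      by (simp add: sum_coord[OF B] mult.assoc)
    also have "\<dots> = (\<Sum>b'\<in>B. of_rat (of_nat m * coord B (x * b) b') * b')"
      by (simp add: sum_distrib_left of_rat_mult mult.assoc)
    also have "\<dots> = (\<Sum>b'\<in>B. of_rat (of_int \<lfloor>of_nat m * coord B (x * b) b'\<rfloor>) * b')"
      using b by (intro sum.cong refl) (simp only: int)
    finally show ?thesis by (simp only: of_rat_of_int_eq)
  qed
  ultimately have "algebraic_int (of_nat m * x)"
    by (intro algebraic_int_if_stable[OF fin, of "of_nat m * x" "\<lambda>b. b" "\<lambda>b b'. \<lfloor>of_nat m * coord B (x * b) b'\<rfloor>"])
  then show thesis using that m(1) by blast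
qed

lemma common_denominator_algebraic_int:
  assumes "number_field TYPE('k::field_char_0)" "finite S"
  obtains m :: nat where "m > 0" "\<And>x. x \<in> S \<Longrightarrow> algebraic_int (of_nat m * (x::'k))"
proof -
  have "\<exists>m::nat. m > 0 \<and> (\<forall>x\<in>S. algebraic_int (of_nat m * (x::'k)))"
    using assms(2)
  proof (induction S)
    case empty show ?case by auto
  next
    case (insert y S)
    then obtain m :: nat where m: "m > 0" "\<forall>x\<in>S. algebraic_int (of_nat m * x)" by blast
    obtain n :: nat where n: "n > 0" "algebraic_int (of_nat n * y)"
      using denominator_algebraic_int[OF assms(1)] by blast
    have "algebraic_int (of_nat (m * n) * x)" if x: "x \<in> insert y S" for x
    proof (cases "x = y")
      case True
      have "algebraic_int (of_nat m * (of_nat n * y))"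
        by (rule algebraic_int_times[OF algebraic_int_of_nat n(2)])
      then show ?thesis using True by (simp add: mult.assoc)
    next
      case False
      then have "algebraic_int (of_nat m * x)" using x m(2) by blast
      then have "algebraic_int (of_nat n * (of_nat m * x))"
        by (rule algebraic_int_times[OF algebraic_int_of_nat])
      then show ?thesis by (simp add: mult_ac)
    qed
    then show ?case using m n by (intro exI[of _ "m * n"]) auto
  qed
  then show thesis using that by blast
qed

lemma number_field_integral_basis:
  assumes "number_field TYPE('k::field_char_0)"
  obtains B :: "'k::field_char_0 set" where "rational_basis B" "\<And>b. b \<in> B \<Longrightarrow> algebraic_int b"
proof -
  obtain B :: "'k set" where B: "rational_basis B" using number_field_has_basis[OF assms] .
  then have fin: "finite B" by (simp add: rational_basis_def)
  obtain m :: nat where m: "m > 0" "\<And>x. x \<in> B \<Longrightarrow> algebraic_int (of_nat m * (x::'k))"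
    using common_denominator_algebraic_int[OF assms fin] by blast
  define B' where "B' = (\<lambda>b. of_nat m * b) ` B"
  have inj: "inj_on (\<lambda>b. of_nat m * b) B" using m(1) by (auto simp: inj_on_def)
  have sumB': "(\<Sum>b\<in>B'. of_rat (q b) * b) = (\<Sum>b\<in>B. of_rat (of_nat m * q (of_nat m * b)) * b)" for q
    unfolding B'_def by (subst sum.reindex[OF inj]) (simp add: of_rat_mult mult_ac)
  have "rational_basis B'"
    unfolding rational_basis_def
  proof (intro conjI allI impI)
    show "finite B'" using fin by (simp add: B'_def)
    fix x :: 'k
    show "\<exists>q. x = (\<Sum>b\<in>B'. of_rat (q b) * b)"
    proof
      show "x = (\<Sum>b\<in>B'. of_rat (coord B x (b / of_nat m) / of_nat m) * b)"
        using m(1) by (simp add: sumB' sum_coord[OF B])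
    qed
  next
    fix q :: "'k \<Rightarrow> rat" assume "(\<Sum>b\<in>B'. of_rat (q b) * b) = 0"
    then have "\<forall>b\<in>B. of_nat m * q (of_nat m * b) = 0"
      using B unfolding sumB' rational_basis_def by (elim conjE) (erule allE, erule mp)
    then show "\<forall>b\<in>B'. q b = 0" using m(1) by (auto simp: B'_def)
  qed
  then show thesis by (rule that) (auto simp: B'_def m)
qed

lemma number_field_countable:
  assumes "number_field TYPE('k::field_char_0)"
  shows "countable (UNIV :: 'k set)"
proof -
  obtain B :: "'k set" where B: "rational_basis B" using number_field_has_basis[OF assms] .
  then have fin: "finite B" by (simp add: rational_basis_def)
  have "(UNIV :: 'k set) \<subseteq> (\<lambda>q. \<Sum>b\<in>B. of_rat (q b) * b) ` (PiE B (\<lambda>_. UNIV))"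
  proof
    fix x :: 'k
    have "x = (\<Sum>b\<in>B. of_rat (restrict (coord B x) B b) * b)"
      by (simp add: sum_coord[OF B])
    then show "x \<in> (\<lambda>q. \<Sum>b\<in>B. of_rat (q b) * b) ` (PiE B (\<lambda>_. UNIV))"
      by (intro image_eqI[where x = "restrict (coord B x) B"]) auto
  qed
  moreover have "countable (PiE B (\<lambda>_. UNIV :: rat set))"
    by (rule countable_PiE[OF fin]) auto
  ultimately show ?thesis by (rule countable_subset[OF _ countable_image])
qed

section \<open>Embeddings of a number field\<close>

context
  fixes \<tau> :: "'k::field_char_0 \<Rightarrow> complex"
  assumes emb: "field_embedding \<tau>"
begin

lemma emb_1: "\<tau> 1 = 1" and emb_add: "\<tau> (x + y) = \<tau> x + \<tau> y" and emb_mult: "\<tau> (x * y) = \<tau> x * \<tau> y"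
  using emb by (auto simp: field_embedding_def)

lemma emb_0: "\<tau> 0 = 0"
  using emb_add[of 0 0] by simp

lemma emb_minus: "\<tau> (- x) = - \<tau> x"
  using emb_add[of x "- x"] by (simp add: emb_0 eq_neg_iff_add_eq_0 add.commute)

lemma emb_diff: "\<tau> (x - y) = \<tau> x - \<tau> y"
  using emb_add[of x "- y"] by (simp add: emb_minus)

lemma emb_inverse: "\<tau> (inverse x) = inverse (\<tau> x)"
proof (cases "x = 0")
  case False
  then have "\<tau> x * \<tau> (inverse x) = 1" using emb_mult[of x "inverse x"] by (simp add: emb_1)
  then show ?thesis by (metis inverse_unique)
qed (simp add: emb_0)

lemma emb_divide: "\<tau> (x / y) = \<tau> x / \<tau> y"
  by (simp add: divide_inverse emb_mult emb_inverse)

lemma emb_eq_0: "\<tau> x = 0 \<longleftrightarrow> x = 0"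
proof
  assume *: "\<tau> x = 0"
  show "x = 0"
  proof (rule ccontr)
    assume "x \<noteq> 0"
    then show False using emb_mult[of x "inverse x"] * by (simp add: emb_1)
  qed
qed (simp add: emb_0)

lemma emb_of_nat: "\<tau> (of_nat n) = of_nat n"
  by (induction n) (simp_all add: emb_0 emb_1 emb_add)

lemma emb_of_int: "\<tau> (of_int n) = of_int n"
  by (cases n rule: int_cases2) (simp_all add: emb_of_nat emb_minus)

lemma emb_of_rat: "\<tau> (of_rat q) = of_rat q"
  by (cases q) (simp add: of_rat_rat emb_divide emb_of_int)

lemma emb_sum: "\<tau> (sum f A) = (\<Sum>a\<in>A. \<tau> (f a))"
  by (induction A rule: infinite_finite_induct) (simp_all add: emb_0 emb_add)

lemma emb_power: "\<tau> (x ^ n) = \<tau> x ^ n"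
  by (induction n) (simp_all add: emb_1 emb_mult)

lemma emb_algebraic_int: "algebraic_int x \<Longrightarrow> algebraic_int (\<tau> x)"
proof -
  assume "algebraic_int x"
  then obtain p where p: "poly (map_poly of_int p) x = 0" "lead_coeff p = (1::int)"
    by (auto simp: algebraic_int_altdef_ipoly)
  have "poly (map_poly of_int p) (\<tau> x) = \<tau> (poly (map_poly of_int p) x)"
    by (simp add: poly_altdef coeff_map_poly degree_map_poly emb_sum emb_mult emb_of_int emb_power)
  then show "algebraic_int (\<tau> x)"
    using p by (auto simp: algebraic_int_altdef_ipoly emb_0)
qed

text \<open>
  This is what makes the completeness of the list of completions applicable to an arbitrary
  embedding; the ultrametric inequality fails at \<open>1 + 1\<close>.
\<close>
lemma emb_archimedean: "archimedean_absolute_value (\<lambda>x. norm (\<tau> x))"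
proof -
  have abs: "absolute_value (\<lambda>x. norm (\<tau> x))"
    by (auto simp: absolute_value_def emb_eq_0 emb_mult norm_mult emb_add norm_triangle_ineq)
  have "norm (\<tau> (1 + 1)) > max (norm (\<tau> 1)) (norm (\<tau> 1))"
    using emb_of_nat[of 2] by (simp add: emb_1)
  then have not_ultra: "\<not> (\<forall>x y. norm (\<tau> (x + y)) \<le> max (norm (\<tau> x)) (norm (\<tau> y)))"
    by (intro notI) (metis not_le)
  show ?thesis unfolding archimedean_absolute_value_def using abs not_ultra by (rule conjI)
qed

end

subsection \<open>Embeddings as common eigenvectors\<close>

text \<open>
  Embeddings of \<open>K\<close> with a prescribed value \<open>l\<close> at \<open>x\<close>
  are found as common eigenvectors: a nonzero rational-linear functional \<open>f\<close> that
  is an eigenvector of \<open>f \<mapsto> f \<circ> (y * _)\<close> for every \<open>y\<close>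
  satisfies \<open>f (y * z) = \<nu> y * f z\<close>, and \<open>\<nu>\<close> is
  multiplicative.
\<close>
definition rat_linear :: "('k::field_char_0 \<Rightarrow> complex) \<Rightarrow> bool" where
  "rat_linear f \<longleftrightarrow> (\<forall>x y. f (x + y) = f x + f y) \<and> (\<forall>q x. f (of_rat q * x) = of_rat q * f x)"

lemma rat_linear_0: "rat_linear f \<Longrightarrow> f 0 = 0"
  unfolding rat_linear_def by (metis mult_zero_left of_rat_0)

lemma rat_linear_sum: "rat_linear f \<Longrightarrow> f (\<Sum>a\<in>A. of_rat (q a) * h a) = (\<Sum>a\<in>A. of_rat (q a) * f (h a))"
  by (induction A rule: infinite_finite_induct) (auto simp: rat_linear_0, auto simp: rat_linear_def)

text \<open>
  Among all polynomials \<open>p\<close> for which \<open>p\<close> of the operator \<open>f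
  \<mapsto> f \<circ> (y * _)\<close> annihilates \<open>f\<close>, one of minimal degree has a
  complex root \<open>\<mu>\<close>; the cofactor of \<open>X - \<mu>\<close> applied to
  \<open>f\<close> is a nonzero eigenvector. Since all these operators commute, eigenvector
  properties that \<open>f\<close> already has are preserved.
\<close>
lemma eigenvector_step:
  fixes f :: "'k::field_char_0 \<Rightarrow> complex" and p :: "rat poly"
  assumes f: "rat_linear f" "f z0 \<noteq> 0" and p: "p \<noteq> 0" "poly (map_poly of_rat p) y = 0"
  obtains g \<mu> z1 where "rat_linear g" "g z1 \<noteq> 0" "\<forall>z. g (y * z) = \<mu> * g z"
    "\<forall>a \<nu>. (\<forall>z. f (a * z) = \<nu> * f z) \<longrightarrow> (\<forall>z. g (a * z) = \<nu> * g z)"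
proof -
  define op where "op = (\<lambda>(p::complex poly) z. \<Sum>i\<le>degree p. coeff p i * f (y ^ i * z))"
  have op_ge: "op p z = (\<Sum>i\<le>n. coeff p i * f (y ^ i * z))" if "degree p \<le> n" for p n z
    unfolding op_def using that by (intro sum.mono_neutral_left) (auto simp: coeff_eq_0)
  define P where "P = (\<lambda>(p::complex poly). p \<noteq> 0 \<and> (\<forall>z. op p z = 0))"
  have "P (map_poly of_rat p)"
    unfolding P_def
  proof (intro conjI allI)
    show "(map_poly of_rat p :: complex poly) \<noteq> 0" using p(1) by simp
    fix z
    have "op (map_poly of_rat p) z = (\<Sum>i\<le>degree p. of_rat (coeff p i) * f (y ^ i * z))"
      by (simp add: op_def coeff_map_poly degree_map_poly)
    also have "\<dots> = f (\<Sum>i\<le>degree p. of_rat (coeff p i) * (y ^ i * z))"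
      by (rule rat_linear_sum[OF f(1), symmetric])
    also have "(\<Sum>i\<le>degree p. of_rat (coeff p i) * (y ^ i * z)) = poly (map_poly of_rat p) y * z"
      by (simp add: poly_altdef coeff_map_poly degree_map_poly sum_distrib_right mult.assoc)
    finally show "op (map_poly of_rat p) z = 0"
      using p(2) f(1) by (simp add: rat_linear_0)
  qed
  then obtain p where p: "P p" "\<And>q. P q \<Longrightarrow> degree p \<le> degree q"
    using ex_has_least_nat[of P "map_poly of_rat p" degree] by blast
  have "degree p \<noteq> 0"
  proof
    assume 0: "degree p = 0"
    then have "coeff p 0 * f z0 = 0" using p(1) by (simp add: P_def op_def) (metis mult_1)
    moreover have "coeff p 0 \<noteq> 0" using p(1) 0 by (metis P_def leading_coeff_0_iff)
    ultimately show False using f(2) by simp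
  qed
  then obtain \<mu> where "poly p \<mu> = 0"
    using fundamental_theorem_of_algebra[of p] by (auto simp: constant_degree)
  then obtain r where r: "p = [:- \<mu>, 1:] * r" by (auto simp: poly_eq_0_iff_dvd dvd_def)
  have r0: "r \<noteq> 0" using p(1) r by (auto simp: P_def)
  then have degr: "degree p = Suc (degree r)" unfolding r by (subst degree_mult_eq) auto
  then have "\<not> P r" using p(2)[of r] by auto
  then obtain z1 where z1: "op r z1 \<noteq> 0" using r0 by (auto simp: P_def)
  have eig: "op r (y * z) = \<mu> * op r z" for z
  proof -
    have "0 = op p z" using p(1) by (simp add: P_def)
    also have "\<dots> = (\<Sum>i\<le>Suc (degree r). coeff (pCons 0 r) i * f (y ^ i * z) - \<mu> * (coeff r i * f (y ^ i * z)))"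
      unfolding op_def degr by (intro sum.cong refl) (simp add: r algebra_simps)
    also have "\<dots> = (\<Sum>i\<le>Suc (degree r). coeff (pCons 0 r) i * f (y ^ i * z)) - \<mu> * (\<Sum>i\<le>Suc (degree r). coeff r i * f (y ^ i * z))"
      by (simp only: sum_subtractf sum_distrib_left)
    also have "(\<Sum>i\<le>Suc (degree r). coeff r i * f (y ^ i * z)) = op r z"
      by (rule op_ge[symmetric]) simp
    also have "(\<Sum>i\<le>Suc (degree r). coeff (pCons 0 r) i * f (y ^ i * z)) = op r (y * z)"
      unfolding op_def by (subst sum.atMost_Suc_shift) (simp add: mult_ac)
    finally show ?thesis by simp
  qed
  have lin: "rat_linear (op r)"
    unfolding rat_linear_def
  proof (intro conjI allI)
    fix u v :: 'k
    show "op r (u + v) = op r u + op r v"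
      using f(1) by (simp add: op_def rat_linear_def distrib_left sum.distrib)
  next
    fix q u
    have "f (y ^ i * (of_rat q * u)) = of_rat q * f (y ^ i * u)" for i
      using f(1) by (metis rat_linear_def mult.left_commute)
    then show "op r (of_rat q * u) = of_rat q * op r u"
      by (simp add: op_def sum_distrib_left mult.left_commute)
  qed
  have pres: "op r (a * z) = \<nu> * op r z" if a: "\<forall>z. f (a * z) = \<nu> * f z" for a \<nu> z
  proof -
    have "f (y ^ i * (a * z)) = \<nu> * f (y ^ i * z)" for i
      using a by (metis mult.left_commute)
    then show ?thesis by (simp add: op_def sum_distrib_left mult.left_commute)
  qed
  show thesis
  proof (rule that[OF lin z1])
    show "\<forall>z. op r (y * z) = \<mu> * op r z" using eig by blast
    show "\<forall>a \<nu>. (\<forall>z. f (a * z) = \<nu> * f z) \<longrightarrow> (\<forall>z. op r (a * z) = \<nu> * op r z)"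
      using pres by blast
  qed
qed

definition mult_coord :: "'k::field_char_0 set \<Rightarrow> 'k \<Rightarrow> 'k \<Rightarrow> 'k \<Rightarrow> rat" where
  "mult_coord B x b b' = coord B (x * b) b'"

lemma rational_basis_nonzero:
  assumes B: "rational_basis (B :: 'k::field_char_0 set)"
  shows "\<exists>b\<in>B. b \<noteq> 0"
proof (rule ccontr)
  assume "\<not> ?thesis"
  then have "(\<Sum>b\<in>B. of_rat (coord B 1 b) * b) = (0::'k)" by (intro sum.neutral) auto
  then show False using sum_coord[OF B, of 1] by simp
qed

text \<open>
  Apply the preceding step to the elements of a basis one after the other, then normalize the
  resulting functional to the value \<open>1\<close> at \<open>1\<close>.
\<close>
lemma embedding_of_eigenvector:
  fixes f :: "'k::field_char_0 \<Rightarrow> complex"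
  assumes B: "rational_basis (B :: 'k set)" and f: "rat_linear f" "f z0 \<noteq> 0" and x: "\<And>z. f (x * z) = l * f z"
  obtains \<tau> where "field_embedding \<tau>" "\<tau> x = l"
proof -
  have fin: "finite B" using B by (simp add: rational_basis_def)
  have "\<exists>g z1. rat_linear g \<and> g z1 \<noteq> 0 \<and> (\<forall>z. g (x * z) = l * g z) \<and> (\<forall>b\<in>S. \<exists>\<nu>. \<forall>z. g (b * z) = \<nu> * g z)"
    if "finite S" for S
    using that
  proof (induction S)
    case empty then show ?case using f x by blast
  next
    case (insert y S)
    then obtain g z1 where g: "rat_linear g" "g z1 \<noteq> 0" "\<forall>z. g (x * z) = l * g z" "\<forall>b\<in>S. \<exists>\<nu>. \<forall>z. g (b * z) = \<nu> * g z"
      by blast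
    obtain p :: "rat poly" where p: "p \<noteq> 0" "poly (map_poly of_rat p) y = 0"
    proof (rule char_poly_of_rat[OF fin, of "mult_coord B y", where 'a='k])
      fix p :: "rat poly" assume "lead_coeff p = 1" and
        root: "\<And>(x::'k) v. (\<And>b. b \<in> B \<Longrightarrow> x * v b = (\<Sum>b'\<in>B. of_rat (mult_coord B y b b') * v b')) \<Longrightarrow>
          \<exists>b\<in>B. v b \<noteq> 0 \<Longrightarrow> poly (map_poly of_rat p) x = 0"
      have "poly (map_poly of_rat p) y = 0"
        by (rule root[of y "\<lambda>b. b"]) (auto simp: mult_coord_def sum_coord[OF B] rational_basis_nonzero[OF B])
      moreover have "p \<noteq> 0" using \<open>lead_coeff p = 1\<close> by auto
      ultimately show thesis using that by blast
    qed
    obtain h \<mu> z2 where h: "rat_linear h" "h z2 \<noteq> 0" "\<forall>z. h (y * z) = \<mu> * h z"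
      and pres: "\<forall>a \<nu>. (\<forall>z. g (a * z) = \<nu> * g z) \<longrightarrow> (\<forall>z. h (a * z) = \<nu> * h z)"
      using eigenvector_step[OF g(1,2) p] .
    have "\<exists>\<nu>. \<forall>z. h (b * z) = \<nu> * h z" if "b \<in> insert y S" for b
    proof (cases "b = y")
      case True then show ?thesis using h(3) by blast
    next
      case False
      then have "b \<in> S" using that by simp
      then obtain \<nu> where "\<forall>z. g (b * z) = \<nu> * g z" by (metis g(4))
      then have "\<forall>z. h (b * z) = \<nu> * h z" by (rule pres[THEN spec, of b, THEN spec, of \<nu>, THEN mp])
      then show ?thesis ..
    qed
    moreover have "\<forall>z. h (x * z) = l * h z" using g(3) by (rule pres[THEN spec, of x, THEN spec, of l, THEN mp])
    ultimately show ?case using h(1,2) by (intro exI[of _ h] exI[of _ z2] conjI) auto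
  qed
  from this[OF fin] obtain g z1 where g: "rat_linear g" "g z1 \<noteq> 0" "\<forall>z. g (x * z) = l * g z"
    and "\<forall>b\<in>B. \<exists>\<nu>. \<forall>z. g (b * z) = \<nu> * g z" by blast
  then obtain \<nu> where \<nu>: "\<And>b z. b \<in> B \<Longrightarrow> g (b * z) = \<nu> b * g z" by metis
  have all: "\<exists>m. \<forall>z. g (y * z) = m * g z" for y
  proof (intro exI allI)
    fix z
    have "g (y * z) = g (\<Sum>b\<in>B. of_rat (coord B y b) * (b * z))"
      by (subst sum_coord[OF B, of y, symmetric]) (simp add: sum_distrib_right mult.assoc)
    also have "\<dots> = (\<Sum>b\<in>B. of_rat (coord B y b) * (\<nu> b * g z))"
      by (simp add: rat_linear_sum[OF g(1)] \<nu>)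
    finally show "g (y * z) = (\<Sum>b\<in>B. of_rat (coord B y b) * \<nu> b) * g z"
      by (simp add: sum_distrib_right mult.assoc)
  qed
  have g1: "g 1 \<noteq> 0"
  proof
    assume "g 1 = 0"
    moreover obtain m where "\<forall>z. g (z1 * z) = m * g z" using all by blast
    ultimately have "g (z1 * 1) = 0" by (metis mult_zero_right)
    then show False using g(2) by simp
  qed
  define \<tau> where "\<tau> = (\<lambda>y. g y / g 1)"
  have \<tau>: "g (y * z) = \<tau> y * g z" for y z
  proof -
    obtain m where m: "\<forall>z. g (y * z) = m * g z" using all by blast
    then have "g (y * 1) = m * g 1" by blast
    then show ?thesis using m g1 by (simp add: \<tau>_def)
  qed
  have "field_embedding \<tau>"
    unfolding field_embedding_def
  proof (intro conjI allI)
    show "\<tau> 1 = 1" using g1 by (simp add: \<tau>_def)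
    fix a b
    show "\<tau> (a + b) = \<tau> a + \<tau> b" using g(1) by (simp add: \<tau>_def rat_linear_def add_divide_distrib)
    have "\<tau> (a * b) = g (a * b) / g 1" by (simp add: \<tau>_def)
    then show "\<tau> (a * b) = \<tau> a * \<tau> b" unfolding \<tau> by (simp add: \<tau>_def)
  qed
  moreover have "\<tau> x = l" using g(3) g1 by (simp add: \<tau>_def) (metis mult.right_neutral nonzero_mult_div_cancel_right)
  ultimately show thesis by (rule that)
qed

lemma prod_linear_coeffs:
  fixes as :: "complex list"
  assumes "\<forall>a\<in>set as. algebraic_int a \<and> norm a \<le> C"
  shows "algebraic_int (coeff (\<Prod>a\<leftarrow>as. [:- a, 1:]) i) \<and> norm (coeff (\<Prod>a\<leftarrow>as. [:- a, 1:]) i) \<le> (1 + C) ^ length as"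
  using assms
proof (induction as arbitrary: i)
  case Nil
  show ?case by (cases "i = 0") auto
next
  case (Cons a as)
  define q where "q = (\<Prod>a\<leftarrow>as. [:- a, 1:])"
  have IH: "algebraic_int (coeff q i)" "norm (coeff q i) \<le> (1 + C) ^ length as" for i
    using Cons by (auto simp: q_def)
  have a: "algebraic_int a" "norm a \<le> C" using Cons.prems by auto
  have C: "C \<ge> 0" using a(2) norm_ge_zero[of a] by linarith
  have eq: "coeff (\<Prod>a\<leftarrow>a#as. [:- a, 1:]) i = coeff (pCons 0 q) i - a * coeff q i"
    by (simp add: q_def)
  have p: "algebraic_int (coeff (pCons 0 q) i)" "norm (coeff (pCons 0 q) i) \<le> (1 + C) ^ length as"
    using IH C by (auto simp: coeff_pCons split: nat.split)
  have "norm (coeff (pCons 0 q) i - a * coeff q i) \<le> norm (coeff (pCons 0 q) i) + norm a * norm (coeff q i)"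
    by (metis norm_triangle_ineq4 norm_mult)
  also have "\<dots> \<le> (1 + C) ^ length as + C * (1 + C) ^ length as"
    using p a IH C by (intro add_mono mult_mono) auto
  finally have "norm (coeff (pCons 0 q) i - a * coeff q i) \<le> (1 + C) ^ length (a # as)"
    by (simp add: algebra_simps)
  moreover have "algebraic_int (coeff (pCons 0 q) i - a * coeff q i)"
    by (intro algebraic_int_diff algebraic_int_times p a IH)
  ultimately show ?case unfolding eq by blast
qed

lemma finite_bounded_polys:
  "finite {p :: rat poly. degree p \<le> d \<and> (\<forall>i. coeff p i \<in> \<int> \<and> \<bar>coeff p i\<bar> \<le> of_int M)}"
proof (rule finite_subset)
  show "{p :: rat poly. degree p \<le> d \<and> (\<forall>i. coeff p i \<in> \<int> \<and> \<bar>coeff p i\<bar> \<le> of_int M)}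
      \<subseteq> (\<lambda>xs. Poly (map of_int xs)) ` {xs. set xs \<subseteq> {-M..M} \<and> length xs = Suc d}"
  proof
    fix p :: "rat poly"
    assume "p \<in> {p. degree p \<le> d \<and> (\<forall>i. coeff p i \<in> \<int> \<and> \<bar>coeff p i\<bar> \<le> of_int M)}"
    then have p: "degree p \<le> d" "\<And>i. coeff p i \<in> \<int>" "\<And>i. \<bar>coeff p i\<bar> \<le> of_int M" by auto
    have int: "coeff p i = of_int \<lfloor>coeff p i\<rfloor>" for i using p(2)[of i] by (auto elim!: Ints_cases)
    define xs where "xs = map (\<lambda>i. \<lfloor>coeff p i\<rfloor>) [0..<Suc d]"
    have "\<lfloor>coeff p i\<rfloor> \<in> {-M..M}" for i
    proof -
      have "of_int \<bar>\<lfloor>coeff p i\<rfloor>\<bar> \<le> (of_int M :: rat)"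
        using p(3)[of i] int[of i] by (simp add: of_int_abs)
      then show ?thesis unfolding of_int_le_iff by auto
    qed
    then have "set xs \<subseteq> {-M..M}" "length xs = Suc d" by (auto simp: xs_def)
    moreover have "p = Poly (map of_int xs)"
      using p(1) by (intro poly_eqI) (auto simp: nth_default_def xs_def int[symmetric] coeff_eq_0 simp del: upt_Suc)
    ultimately show "p \<in> (\<lambda>xs. Poly (map of_int xs)) ` {xs. set xs \<subseteq> {-M..M} \<and> length xs = Suc d}" by blast
  qed
  show "finite ((\<lambda>xs. Poly (map rat_of_int xs)) ` {xs. set xs \<subseteq> {-M..M} \<and> length xs = Suc d})"
    by (intro finite_imageI finite_lists_length_eq) simp
qed

text \<open>
  The characteristic polynomial of multiplication by \<open>x\<close> has roots \<open>\<tau>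
  x\<close>, so its coefficients are rational, integral over \<open>\<int>\<close> and bounded
  in terms of \<open>C\<close>. There are only finitely many such polynomials, and each has
  finitely many roots.
\<close>
lemma finite_algebraic_int_bounded_conjugates:
  assumes "number_field TYPE('k::field_char_0)"
  shows "finite {x::'k. algebraic_int x \<and> (\<forall>\<tau>. field_embedding \<tau> \<longrightarrow> norm (\<tau> x) \<le> C)}"
    (is "finite ?S")
proof -
  obtain B :: "'k set" where B: "rational_basis B" using number_field_has_basis[OF assms] .
  then have fin: "finite B" by (simp add: rational_basis_def)
  define M where "M = \<lceil>(1 + C) ^ card B\<rceil>"
  define Ps where "Ps = {p :: rat poly. degree p \<le> card B \<and> (\<forall>i. coeff p i \<in> \<int> \<and> \<bar>coeff p i\<bar> \<le> of_int M)}"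
  have "?S \<subseteq> (\<Union>p\<in>Ps - {0}. {x. poly (map_poly of_rat p) x = 0})"
  proof
    fix x :: 'k assume x: "x \<in> ?S"
    show "x \<in> (\<Union>p\<in>Ps - {0}. {x. poly (map_poly of_rat p) x = 0})"
    proof (rule char_poly_of_rat[OF fin, of "mult_coord B x", where 'a='k])
      fix p :: "rat poly" assume p: "lead_coeff p = 1" "degree p = card B" and
        root: "\<And>(y::'k) v. (\<And>b. b \<in> B \<Longrightarrow> y * v b = (\<Sum>b'\<in>B. of_rat (mult_coord B x b b') * v b')) \<Longrightarrow>
          \<exists>b\<in>B. v b \<noteq> 0 \<Longrightarrow> poly (map_poly of_rat p) y = 0" and
        ev: "\<And>l::complex. poly (map_poly of_rat p) l = 0 \<Longrightarrow>
        \<exists>w. (\<exists>b\<in>B. w b \<noteq> 0) \<and> (\<forall>b\<in>B. l * w b = (\<Sum>b'\<in>B. of_rat (mult_coord B x b b') * w b'))"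
      have "poly (map_poly of_rat p) x = 0"
        by (rule root[of x "\<lambda>b. b"]) (auto simp: mult_coord_def sum_coord[OF B] rational_basis_nonzero[OF B])
      moreover have "p \<noteq> 0" using p(1) by auto
      moreover have "p \<in> Ps"
      proof -
        define P :: "complex poly" where "P = map_poly of_rat p"
        have roots: "algebraic_int l \<and> norm l \<le> C" if l: "poly P l = 0" for l
        proof -
          obtain w where w: "\<exists>b\<in>B. w b \<noteq> 0" "\<And>b. b \<in> B \<Longrightarrow> l * w b = (\<Sum>b'\<in>B. of_rat (mult_coord B x b b') * w b')"
            using ev[of l] l unfolding P_def by blast
          define f where "f = (\<lambda>z. \<Sum>b\<in>B. of_rat (coord B z b) * w b)"
          have lin: "rat_linear f"
            by (auto simp: rat_linear_def f_def coord_add[OF B] coord_scale[OF B] of_rat_add of_rat_mult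
              distrib_right sum.distrib sum_distrib_left mult.assoc)
          have fb: "f b = w b" if "b \<in> B" for b
          proof -
            have "coord B b b' = (if b' = b then 1 else 0)" if "b' \<in> B" for b'
              by (rule coord_unique[OF B _ that]) (use fin \<open>b \<in> B\<close> in \<open>simp add: if_distrib[where f = of_rat] if_distrib[where f = "\<lambda>x. x * _"] cong: if_cong\<close>)
            then have "f b = (\<Sum>b'\<in>B. if b' = b then w b' else 0)"
              unfolding f_def by (intro sum.cong) auto
            then show ?thesis using fin \<open>b \<in> B\<close> by simp
          qed
          have fx: "f (x * z) = l * f z" for z
          proof -
            have xb: "f (x * b) = l * w b" if "b \<in> B" for b
              using w(2)[OF that] by (simp add: f_def mult_coord_def)
            have "f (x * z) = f (\<Sum>b\<in>B. of_rat (coord B z b) * (x * b))"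
              by (subst sum_coord[OF B, of z, symmetric]) (simp add: sum_distrib_left mult.left_commute)
            also have "\<dots> = (\<Sum>b\<in>B. of_rat (coord B z b) * (l * w b))"
              by (simp add: rat_linear_sum[OF lin] xb)
            also have "\<dots> = l * f z" by (simp add: f_def sum_distrib_left mult.left_commute)
            finally show ?thesis .
          qed
          obtain b where "b \<in> B" "f b \<noteq> 0" using w(1) fb by metis
          then obtain \<tau> where \<tau>: "field_embedding \<tau>" "\<tau> x = l"
            using embedding_of_eigenvector[OF B lin _ fx] by metis
          then show ?thesis using x emb_algebraic_int[OF \<tau>(1), of x] by auto
        qed
        have P: "lead_coeff P = 1" "degree P = card B" "P \<noteq> 0"
          using p by (auto simp: P_def coeff_map_poly degree_map_poly)
        obtain as where as: "Polynomial.smult (lead_coeff P) (\<Prod>a\<leftarrow>as. [:- a, 1:]) = P"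
          using fundamental_theorem_algebra_factorized[of P] by blast
        then have as': "P = (\<Prod>a\<leftarrow>as. [:- a, 1:])" using P by simp
        then have len: "length as = card B"
          using P(2) degree_linear_factors[of uminus as] by simp
        have "poly P a = 0" if "a \<in> set as" for a
          unfolding as' using that by (induction as) auto
        then have "\<forall>a\<in>set as. algebraic_int a \<and> norm a \<le> C" using roots by blast
        note co = prod_linear_coeffs[OF this, folded as', unfolded len]
        have coP: "coeff P i = of_rat (coeff p i)" for i by (simp add: P_def coeff_map_poly)
        have "coeff p i \<in> \<int> \<and> \<bar>coeff p i\<bar> \<le> of_int M" for i
        proof
          have "algebraic_int (of_rat (coeff p i) :: complex)" using co[of i] coP by simp
          then have "(of_rat (coeff p i) :: complex) \<in> \<int>"
            by (rule rational_algebraic_int_is_int) simp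
          then obtain n where "(of_rat (coeff p i) :: complex) = of_rat (of_int n)"
            by (auto elim!: Ints_cases)
          then have "coeff p i = of_int n" unfolding of_rat_eq_iff .
          then show "coeff p i \<in> \<int>" by simp
          have "norm (of_rat (coeff p i) :: complex) \<le> of_int M"
            using co[of i] unfolding coP M_def by linarith
          then have "norm (of_int n :: complex) \<le> of_int M" using \<open>coeff p i = of_int n\<close> by simp
          then show "\<bar>coeff p i\<bar> \<le> of_int M"
            using \<open>coeff p i = of_int n\<close> by (simp flip: of_int_abs)
        qed
        then show ?thesis using p(2) by (auto simp: Ps_def)
      qed
      ultimately show ?thesis by blast
    qed
  qed
  moreover have "finite (\<Union>p\<in>Ps - {0}. {x::'k. poly (map_poly of_rat p) x = 0})"
  proof (intro finite_UN_I)
    show "finite (Ps - {0})" using finite_bounded_polys unfolding Ps_def by blast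
    fix p assume "p \<in> Ps - {0}"
    then show "finite {x::'k. poly (map_poly of_rat p) x = 0}"
      by (intro poly_roots_finite) auto
  qed
  ultimately show ?thesis by (rule finite_subset)
qed

section \<open>Independence of embeddings and the pigeonhole principle for linear forms\<close>

text \<open>
  Independence of characters: comparing the relation at \<open>y * x\<close> with \<open>\<tau>0
  y\<close> times the relation at \<open>x\<close> eliminates \<open>\<tau>0\<close>.
\<close>
lemma dedekind_independence:
  fixes c :: "('k::field_char_0 \<Rightarrow> complex) \<Rightarrow> complex"
  assumes "finite E" "\<And>\<tau>. \<tau> \<in> E \<Longrightarrow> field_embedding \<tau>" "\<And>x. (\<Sum>\<tau>\<in>E. c \<tau> * \<tau> x) = 0" "\<tau> \<in> E"
  shows "c \<tau> = 0"
  using assms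
proof (induction E arbitrary: c \<tau>)
  case empty then show ?case by simp
next
  case (insert \<tau>0 E)
  have E: "field_embedding \<tau>" if "\<tau> \<in> insert \<tau>0 E" for \<tau> using insert.prems that by blast
  have eq: "c \<tau>0 * \<tau>0 x + (\<Sum>\<tau>\<in>E. c \<tau> * \<tau> x) = 0" for x
    using insert.prems(2)[of x] insert.hyps by simp
  have zero: "c \<tau> = 0" if \<tau>: "\<tau> \<in> E" for \<tau>
  proof -
    have "\<tau> \<noteq> \<tau>0" using \<tau> insert.hyps by auto
    then obtain y where y: "\<tau> y \<noteq> \<tau>0 y" by fastforce
    have "(\<Sum>\<tau>\<in>E. (c \<tau> * (\<tau> y - \<tau>0 y)) * \<tau> x) = 0" for x
    proof -
      have "(\<Sum>\<tau>\<in>E. (c \<tau> * (\<tau> y - \<tau>0 y)) * \<tau> x) = (\<Sum>\<tau>\<in>E. c \<tau> * \<tau> (y * x)) - \<tau>0 y * (\<Sum>\<tau>\<in>E. c \<tau> * \<tau> x)"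
        unfolding sum_distrib_left sum_subtractf[symmetric]
        by (intro sum.cong refl) (simp add: emb_mult[OF E] algebra_simps)
      also have "\<dots> = - c \<tau>0 * \<tau>0 (y * x) - \<tau>0 y * (- c \<tau>0 * \<tau>0 x)"
      proof -
        have "(\<Sum>\<tau>\<in>E. c \<tau> * \<tau> z) = - c \<tau>0 * \<tau>0 z" for z
          using eq[of z] by (simp add: eq_neg_iff_add_eq_0 add.commute)
        then show ?thesis by simp
      qed
      also have "\<dots> = 0" by (simp add: emb_mult[OF E])
      finally show ?thesis .
    qed
    then have "c \<tau> * (\<tau> y - \<tau>0 y) = 0"
      using insert.IH[of "\<lambda>\<tau>. c \<tau> * (\<tau> y - \<tau>0 y)" \<tau>] E \<tau> by simp
    then show ?thesis using y by simp
  qed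
  then have "(\<Sum>\<tau>\<in>E. c \<tau> * \<tau> 1) = 0" by (intro sum.neutral) auto
  then have "c \<tau>0 = 0" using eq[of 1] emb_1[OF E, of \<tau>0] by simp
  then show ?case using zero insert.prems(3) by auto
qed

lemma underdetermined_system:
  fixes a :: "'p \<Rightarrow> 'b \<Rightarrow> 'f::field"
  assumes "finite B" "finite P" "card B < card P"
  shows "\<exists>c. (\<exists>p\<in>P. c p \<noteq> 0) \<and> (\<forall>b\<in>B. (\<Sum>p\<in>P. c p * a p b) = 0)"
  using assms
proof (induction B arbitrary: P a)
  case empty
  then have "P \<noteq> {}" by auto
  then show ?case by (intro exI[of _ "\<lambda>_. 1"]) auto
next
  case (insert b0 B)
  show ?case
  proof (cases "\<forall>p\<in>P. a p b0 = 0")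
    case True
    have "card B < card P" using insert by simp
    then obtain c where "\<exists>p\<in>P. c p \<noteq> 0" "\<forall>b\<in>B. (\<Sum>p\<in>P. c p * a p b) = 0"
      using insert.IH[of P a] insert.prems by blast
    then show ?thesis using True by (intro exI[of _ c]) auto
  next
    case False
    then obtain p0 where p0: "p0 \<in> P" "a p0 b0 \<noteq> 0" by blast
    define P' where "P' = P - {p0}"
    have P': "finite P'" "card B < card P'" "P = insert p0 P'" "p0 \<notin> P'"
      using insert p0 by (auto simp: P'_def)
    obtain c where c: "\<exists>p\<in>P'. c p \<noteq> 0"
      "\<forall>b\<in>B. (\<Sum>p\<in>P'. c p * (a p b - a p b0 / a p0 b0 * a p0 b)) = 0"
      using insert.IH[OF P'(1,2), of "\<lambda>p b. a p b - a p b0 / a p0 b0 * a p0 b"] by blast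
    define c' where "c' = (\<lambda>p. if p = p0 then - (\<Sum>p\<in>P'. c p * a p b0) / a p0 b0 else c p)"
    have sum: "(\<Sum>p\<in>P. c' p * a p b) = - (\<Sum>p\<in>P'. c p * a p b0) / a p0 b0 * a p0 b + (\<Sum>p\<in>P'. c p * a p b)" for b
    proof -
      have "(\<Sum>p\<in>P'. c' p * a p b) = (\<Sum>p\<in>P'. c p * a p b)"
        using P'(4) by (intro sum.cong) (auto simp: c'_def)
      then show ?thesis unfolding P'(3) using P' by (simp add: c'_def)
    qed
    have "(\<Sum>p\<in>P. c' p * a p b) = 0" if b: "b \<in> insert b0 B" for b
    proof (cases "b = b0")
      case True then show ?thesis using p0 unfolding sum by simp
    next
      case False
      then have "(\<Sum>p\<in>P'. c p * (a p b - a p b0 / a p0 b0 * a p0 b)) = 0" using b c by blast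
      moreover have "(\<Sum>p\<in>P'. c p * (a p b - a p b0 / a p0 b0 * a p0 b)) =
          (\<Sum>p\<in>P'. c p * a p b) - (\<Sum>p\<in>P'. c p * a p b0) / a p0 b0 * a p0 b"
        by (simp add: sum_divide_distrib sum_distrib_right sum_subtractf right_diff_distrib mult.assoc)
      ultimately show ?thesis unfolding sum by simp
    qed
    moreover have "\<exists>p\<in>P. c' p \<noteq> 0"
    proof -
      obtain p where p: "p \<in> P'" "c p \<noteq> 0" using c by blast
      then have "p \<noteq> p0" using P'(4) by auto
      then show ?thesis using p P'(3) by (intro bexI[of _ p]) (auto simp: c'_def)
    qed
    ultimately show ?thesis by (intro exI[of _ c'] conjI ballI)
  qed
qed

lemma pigeonhole_fibre:
  assumes "finite A" "finite Y" "f ` A \<subseteq> Y" "M * card Y < card A"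
  obtains y where "y \<in> Y" "M < card {x\<in>A. f x = y}"
proof -
  have "\<exists>y\<in>Y. M < card {x\<in>A. f x = y}"
  proof (rule ccontr)
    assume "\<not> ?thesis"
    then have le: "card {x\<in>A. f x = y} \<le> M" if "y \<in> Y" for y using that by (auto simp: not_less)
    have "A = (\<Union>y\<in>Y. {x\<in>A. f x = y})" using assms(3) by auto
    then have "card A \<le> (\<Sum>y\<in>Y. card {x\<in>A. f x = y})" by (metis card_UN_le[OF assms(2)])
    also have "\<dots> \<le> (\<Sum>y\<in>Y. M)" by (intro sum_mono le)
    finally show False using assms(4) by (simp add: mult.commute)
  qed
  then show thesis using that by blast
qed

text \<open>
  A quantitative pigeonhole principle in place of Minkowski's theorem. Of the \<open>Q ^ card
  B\<close> integer points of a large cube, more than \<open>M\<close> fall into one box of the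
  partition of the image space into boxes with sides \<open>s p\<close>; differences of such
  points solve the inequalities. It is stated for a whole set of points, rather than a single
  difference, because a set of more than \<open>M\<close> points cannot be concentrated on one
  line later on.
\<close>
lemma pigeonhole_linear_forms:
  fixes L :: "'p \<Rightarrow> 'b \<Rightarrow> real" and s :: "'p \<Rightarrow> real" and M :: nat
  assumes fin: "finite P" "finite B" "card P \<le> card B" and C: "C > 0" "\<And>p. p \<in> P \<Longrightarrow> (\<Sum>b\<in>B. \<bar>L p b\<bar>) \<le> C"
    and s: "\<And>p. p \<in> P \<Longrightarrow> s p > 0" and vol: "real M * (4 * C) ^ card P < (\<Prod>p\<in>P. s p)"
  shows "\<exists>Z :: ('b \<Rightarrow> int) set. finite Z \<and> card Z > M \<and> Z \<subseteq> extensional B \<and>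
    (\<forall>z\<in>Z. \<forall>z'\<in>Z. \<forall>p\<in>P. \<bar>\<Sum>b\<in>B. L p b * real_of_int (z b - z' b)\<bar> < s p)"
proof -
  obtain Q :: nat where Q: "Q \<ge> 1" "\<And>p. p \<in> P \<Longrightarrow> C * Q / s p \<ge> 1"
  proof -
    obtain Q :: nat where Q: "real Q \<ge> 1 + (\<Sum>p\<in>P. s p / C)" using real_arch_simple by blast
    have nonneg: "0 \<le> s p / C" if "p \<in> P" for p using s[OF that] C by simp
    then have "0 \<le> (\<Sum>p\<in>P. s p / C)" by (rule sum_nonneg)
    then have "Q \<ge> 1" using Q by linarith
    moreover have "C * Q / s p \<ge> 1" if p: "p \<in> P" for p
    proof -
      have "s p / C \<le> (\<Sum>p\<in>P. s p / C)" by (rule member_le_sum[OF p]) (use nonneg fin in auto)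
      then have "s p / C \<le> Q" using Q by linarith
      then show ?thesis using s[OF p] C by (simp add: field_simps)
    qed
    ultimately show thesis by (rule that)
  qed
  define A :: "('b \<Rightarrow> int) set" where "A = PiE B (\<lambda>_. {0..<int Q})"
  define v where "v = (\<lambda>(z::'b \<Rightarrow> int) p. \<Sum>b\<in>B. L p b * real_of_int (z b))"
  define cell where "cell = (\<lambda>z. \<lambda>p\<in>P. \<lfloor>v z p / s p\<rfloor>)"
  define Y where "Y = PiE P (\<lambda>p. {\<lfloor>- (C * Q / s p)\<rfloor>..\<lfloor>C * Q / s p\<rfloor>})"
  have "finite A" "finite Y" using fin by (auto simp: A_def Y_def intro!: finite_PiE)
  have cA: "card A = Q ^ card B" using fin by (simp add: A_def card_PiE)
  have im: "cell ` A \<subseteq> Y"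
  proof
    fix y assume "y \<in> cell ` A"
    then obtain z where z: "z \<in> A" "y = cell z" by blast
    have "\<lfloor>v z p / s p\<rfloor> \<in> {\<lfloor>- (C * Q / s p)\<rfloor>..\<lfloor>C * Q / s p\<rfloor>}" if p: "p \<in> P" for p
    proof -
      have "\<bar>v z p\<bar> \<le> (\<Sum>b\<in>B. \<bar>L p b * real_of_int (z b)\<bar>)" unfolding v_def by (rule sum_abs)
      also have "\<dots> \<le> (\<Sum>b\<in>B. \<bar>L p b\<bar> * Q)"
      proof (rule sum_mono)
        fix b assume "b \<in> B"
        then have "z b \<in> {0..<int Q}" using z(1) by (auto simp: A_def)
        then have "\<bar>real_of_int (z b)\<bar> \<le> Q" by simp
        then show "\<bar>L p b * real_of_int (z b)\<bar> \<le> \<bar>L p b\<bar> * Q" unfolding abs_mult by (rule mult_left_mono) simp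
      qed
      also have "\<dots> \<le> C * Q" using C(2)[OF p] by (simp add: sum_distrib_right[symmetric] mult_right_mono)
      finally have "\<bar>v z p\<bar> / s p \<le> C * Q / s p" using s[OF p] by (simp add: divide_right_mono)
      then have "- (C * Q / s p) \<le> v z p / s p" "v z p / s p \<le> C * Q / s p"
        using s[OF p] by (auto simp: field_simps abs_if split: if_splits)
      then show ?thesis by (auto intro: floor_mono)
    qed
    then show "y \<in> Y" unfolding z(2) cell_def Y_def by auto
  qed
  have "real (card Y) = (\<Prod>p\<in>P. real (card {\<lfloor>- (C * Q / s p)\<rfloor>..\<lfloor>C * Q / s p\<rfloor>}))"
    using fin by (simp add: Y_def card_PiE)
  also have "\<dots> \<le> (\<Prod>p\<in>P. 4 * C * Q / s p)"
  proof (rule prod_mono)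
    fix p assume p: "p \<in> P"
    define X where "X = C * Q / s p"
    have "X \<ge> 1" using Q(2)[OF p] by (simp add: X_def)
    have "real (card {\<lfloor>- X\<rfloor>..\<lfloor>X\<rfloor>}) \<le> 4 * X"
    proof -
      have "\<lfloor>- X\<rfloor> \<le> \<lfloor>X\<rfloor>" using \<open>X \<ge> 1\<close> by (intro floor_mono) simp
      then have "real (card {\<lfloor>- X\<rfloor>..\<lfloor>X\<rfloor>}) = of_int (\<lfloor>X\<rfloor> - \<lfloor>- X\<rfloor> + 1)" by simp
      also have "\<dots> \<le> 4 * X" using \<open>X \<ge> 1\<close> by linarith
      finally show ?thesis .
    qed
    then show "0 \<le> real (card {\<lfloor>- (C * Q / s p)\<rfloor>..\<lfloor>C * Q / s p\<rfloor>}) \<and>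
        real (card {\<lfloor>- (C * Q / s p)\<rfloor>..\<lfloor>C * Q / s p\<rfloor>}) \<le> 4 * C * Q / s p" by (simp add: X_def)
  qed
  also have "\<dots> = (4 * C) ^ card P * Q ^ card P / (\<Prod>p\<in>P. s p)"
    by (simp add: prod_dividef power_mult_distrib)
  finally have cY: "real (card Y) \<le> (4 * C) ^ card P * Q ^ card P / (\<Prod>p\<in>P. s p)" .
  have ps: "(\<Prod>p\<in>P. s p) > 0" using s by (intro prod_pos) auto
  have "real (M * card Y) \<le> real M * ((4 * C) ^ card P * Q ^ card P / (\<Prod>p\<in>P. s p))"
    unfolding of_nat_mult by (rule mult_left_mono[OF cY]) simp
  also have "\<dots> = real M * (4 * C) ^ card P / (\<Prod>p\<in>P. s p) * real Q ^ card P" by simp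
  also have "\<dots> < 1 * real Q ^ card P"
    using vol ps Q(1) by (intro mult_strict_right_mono) auto
  also have "\<dots> \<le> real (card A)" using Q(1) fin(3) by (simp add: cA power_increasing)
  finally have "M * card Y < card A" by linarith
  then obtain y where y: "y \<in> Y" "M < card {x\<in>A. cell x = y}"
    using pigeonhole_fibre[OF \<open>finite A\<close> \<open>finite Y\<close> im] by blast
  show ?thesis
  proof (intro exI[of _ "{x\<in>A. cell x = y}"] conjI ballI)
    show "card {x\<in>A. cell x = y} > M" by (rule y(2))
    show "finite {x\<in>A. cell x = y}" using \<open>finite A\<close> by simp
    show "{x\<in>A. cell x = y} \<subseteq> extensional B" by (auto simp: A_def PiE_def)
    fix z z' p assume zz: "z \<in> {x\<in>A. cell x = y}" "z' \<in> {x\<in>A. cell x = y}" and p: "p \<in> P"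
    then have "cell z p = cell z' p" by auto
    then have "\<lfloor>v z p / s p\<rfloor> = \<lfloor>v z' p / s p\<rfloor>" using p by (simp add: cell_def)
    then have "\<bar>v z p / s p - v z' p / s p\<bar> < 1" by linarith
    then have "\<bar>v z p - v z' p\<bar> < s p" using s[OF p] by (simp add: diff_divide_distrib[symmetric] abs_divide)
    also have "v z p - v z' p = (\<Sum>b\<in>B. L p b * real_of_int (z b - z' b))"
      by (simp add: v_def sum_subtractf right_diff_distrib)
    finally show "\<bar>\<Sum>b\<in>B. L p b * real_of_int (z b - z' b)\<bar> < s p" .
  qed
qed

section \<open>The archimedean places\<close>

lemma of_rat_complex: "(of_rat q :: complex) = of_real (of_rat q)"
  by (cases q) (simp add: of_rat_rat)

text \<open>
  The standing hypotheses of the theorem on the field and its places.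
\<close>
locale archimedean_places =
  fixes \<sigma> :: "'r::finite \<Rightarrow> 'k::field_char_0 \<Rightarrow> complex"
  assumes nf: "number_field TYPE('k)" and arch: "archimedean_completions \<sigma>"
begin

lemma emb: "field_embedding (\<sigma> i)"
  using arch by (simp add: archimedean_completions_def)

text \<open>
  The exponent in the equivalence of absolute values is \<open>1\<close>, as both sides are
  \<open>2\<close> at \<open>2\<close>.
\<close>
lemma embedding_norm_place:
  assumes "field_embedding \<tau>"
  obtains i where "\<And>x. norm (\<sigma> i x) = norm (\<tau> x)"
proof -
  obtain i s where s: "s > 0" "\<forall>x. norm (\<sigma> i x) = norm (\<tau> x) powr s"
    using arch emb_archimedean[OF assms]
    unfolding archimedean_completions_def equivalent_absolute_values_def by blast
  have "norm (\<sigma> i 2) = norm (\<tau> 2) powr s" using s(2) by blast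
  then have "(2::real) powr 1 = 2 powr s"
    using emb_of_nat[OF emb, of i 2] emb_of_nat[OF assms, of 2] by simp
  then have "s = 1" by (subst (asm) powr_inj) auto
  then show thesis using that[of i] s by simp
qed

lemma place_unique:
  assumes "\<And>x. norm (\<sigma> i x) = norm (\<sigma> j x)"
  shows "i = j"
proof -
  have "\<exists>!l. equivalent_absolute_values (\<lambda>x. norm (\<sigma> i x)) (\<lambda>x. norm (\<sigma> l x))"
    using arch emb_archimedean[OF emb] unfolding archimedean_completions_def by blast
  moreover have "equivalent_absolute_values (\<lambda>x. norm (\<sigma> i x)) (\<lambda>x. norm (\<sigma> i x))"
    "equivalent_absolute_values (\<lambda>x. norm (\<sigma> i x)) (\<lambda>x. norm (\<sigma> j x))"
    unfolding equivalent_absolute_values_def using assms by (auto intro!: exI[of _ 1])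
  ultimately show ?thesis by blast
qed

lemma finite_bounded: "finite {x. algebraic_int x \<and> (\<forall>i. norm (\<sigma> i x) \<le> C)}"
proof (rule finite_subset[OF _ finite_algebraic_int_bounded_conjugates[OF nf, of C]])
  show "{x. algebraic_int x \<and> (\<forall>i. norm (\<sigma> i x) \<le> C)}
      \<subseteq> {x. algebraic_int x \<and> (\<forall>\<tau>. field_embedding \<tau> \<longrightarrow> norm (\<tau> x) \<le> C)}"
    using embedding_norm_place by (auto; metis)
qed

text \<open>
  Only finitely many values occur.
\<close>
lemma bounded_away_from_0:
  obtains c where "c > 0" "\<And>x i. algebraic_int x \<Longrightarrow> x \<noteq> 0 \<Longrightarrow> (\<And>j. norm (\<sigma> j x) \<le> C) \<Longrightarrow> c \<le> norm (\<sigma> i x)"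
proof -
  define S where "S = {x. algebraic_int x \<and> (\<forall>i. norm (\<sigma> i x) \<le> C)} - {0}"
  define N where "N = insert 1 ((\<lambda>(i,x). norm (\<sigma> i x)) ` (UNIV \<times> S))"
  have fin: "finite N" unfolding N_def S_def by (intro finite.insertI finite_imageI finite_SigmaI finite_Diff finite_bounded) auto
  have "0 < Min N" using fin by (auto simp: Min_gr_iff N_def S_def emb_eq_0[OF emb])
  moreover have "Min N \<le> norm (\<sigma> i x)" if "algebraic_int x" "x \<noteq> 0" "\<And>j. norm (\<sigma> j x) \<le> C" for x i
  proof (rule Min_le[OF fin])
    have "(i, x) \<in> UNIV \<times> S" using that by (auto simp: S_def)
    then show "norm (\<sigma> i x) \<in> N" unfolding N_def by (intro insertI2 image_eqI[of _ _ "(i,x)"]) auto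
  qed
  ultimately show thesis by (rule that)
qed

text \<open>
  This discreteness of the ring of integers in the product of the completions replaces the
  product formula throughout.
\<close>
lemma not_all_small:
  obtains c where "c > 0" "\<And>x. algebraic_int x \<Longrightarrow> (\<And>j. norm (\<sigma> j x) < c) \<Longrightarrow> x = 0"
proof -
  obtain c where c: "c > 0" "\<And>x i. algebraic_int x \<Longrightarrow> x \<noteq> 0 \<Longrightarrow> (\<And>j. norm (\<sigma> j x) \<le> 1) \<Longrightarrow> c \<le> norm (\<sigma> i x)"
    using bounded_away_from_0[of 1] by blast
  show thesis
  proof (rule that[of "min c 1"])
    fix x assume x: "algebraic_int x" "\<And>j. norm (\<sigma> j x) < min c 1"
    show "x = 0"
    proof (rule ccontr)
      assume "x \<noteq> 0"
      have "norm (\<sigma> j x) \<le> 1" for j using x(2)[of j] by simp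
      then have "c \<le> norm (\<sigma> undefined x)" using c(2)[OF x(1) \<open>x \<noteq> 0\<close>] by blast
      then show False using x(2)[of undefined] by simp
    qed
  qed (use c in simp)
qed

text \<open>
  The map \<open>cls\<close> plays the role of reduction modulo \<open>\<delta>\<close>. It
  records the integral parts of the coordinates modulo a denominator \<open>m\<close> of
  \<open>inverse \<delta>\<close>, and the remaining fractional part \<open>fr x\<close>, which
  is an algebraic integer with bounded absolute values and thus takes finitely many values.
\<close>
lemma finite_residues:
  assumes \<delta>: "\<delta> \<noteq> (0::'k)"
  obtains cls :: "'k \<Rightarrow> ('k \<Rightarrow> int) \<times> 'k" where "finite (cls ` {x. algebraic_int x})"
    "\<And>x y. algebraic_int x \<Longrightarrow> algebraic_int y \<Longrightarrow> cls x = cls y \<Longrightarrow> algebraic_int ((x - y) / \<delta>)"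
proof -
  obtain B :: "'k set" where B: "rational_basis B" "\<And>b. b \<in> B \<Longrightarrow> algebraic_int b"
    using number_field_integral_basis[OF nf] by blast
  then have fin: "finite B" by (simp add: rational_basis_def)
  obtain m :: nat where m: "m > 0" "algebraic_int (of_nat m * inverse \<delta>)"
    using denominator_algebraic_int[OF nf, of "inverse \<delta>"] by blast
  define fr where "fr = (\<lambda>x. \<Sum>b\<in>B. of_rat (frac (coord B x b)) * b)"
  define wh where "wh = (\<lambda>x. \<Sum>b\<in>B. of_int \<lfloor>coord B x b\<rfloor> * b)"
  have split: "x = wh x + fr x" for x :: 'k
  proof -
    have "of_rat (coord B x b) = of_int \<lfloor>coord B x b\<rfloor> + (of_rat (frac (coord B x b)) :: 'k)" for b
      by (simp add: frac_def of_rat_diff)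
    then show ?thesis using sum_coord[OF B(1), of x] by (simp add: wh_def fr_def distrib_right sum.distrib)
  qed
  have wh: "algebraic_int (wh x)" for x
    unfolding wh_def by (intro algebraic_int_sum algebraic_int_times B algebraic_int_of_int)
  define cls where "cls = (\<lambda>x. (\<lambda>b\<in>B. \<lfloor>coord B x b\<rfloor> mod int m, fr x))"
  define C where "C = (\<Sum>i\<in>UNIV. \<Sum>b\<in>B. norm (\<sigma> i b))"
  have "norm (\<sigma> i (fr x)) \<le> C" for i x
  proof -
    have "norm (\<sigma> i (fr x)) \<le> (\<Sum>b\<in>B. norm (\<sigma> i (of_rat (frac (coord B x b)) * b)))"
      unfolding fr_def emb_sum[OF emb] by (rule norm_sum)
    also have "\<dots> \<le> (\<Sum>b\<in>B. norm (\<sigma> i b))"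
    proof (rule sum_mono)
      fix b
      have q: "0 \<le> frac (coord B x b)" "frac (coord B x b) \<le> 1"
        using frac_lt_1[of "coord B x b"] by auto
      have "(of_rat (frac (coord B x b)) :: complex) = of_real (of_rat (frac (coord B x b)))"
        by (rule of_rat_complex)
      then have "norm (of_rat (frac (coord B x b)) :: complex) = \<bar>of_rat (frac (coord B x b))\<bar>"
        by (simp only: norm_of_real)
      also have "\<dots> = of_rat (frac (coord B x b))"
        using q(1) by (simp only: abs_of_nonneg zero_le_of_rat_iff)
      also have "\<dots> \<le> of_rat 1" unfolding of_rat_less_eq by (rule q)
      finally have "norm (of_rat (frac (coord B x b)) :: complex) \<le> 1" by simp
      then show "norm (\<sigma> i (of_rat (frac (coord B x b)) * b)) \<le> norm (\<sigma> i b)"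
        by (simp add: emb_mult[OF emb] emb_of_rat[OF emb] norm_mult mult_left_le_one_le)
    qed
    also have "\<dots> \<le> C" unfolding C_def by (rule member_le_sum) (auto intro: sum_nonneg)
    finally show ?thesis .
  qed
  moreover have "algebraic_int (fr x)" if x: "algebraic_int x" for x
  proof -
    have "x - wh x = fr x" using split[of x] by (metis add_diff_cancel_left')
    then show ?thesis using algebraic_int_diff[OF x wh[of x]] by simp
  qed
  ultimately have finfr: "finite (fr ` {x. algebraic_int x})"
    by (intro finite_subset[OF _ finite_bounded[of C]]) auto
  show thesis
  proof (rule that)
    have "cls ` {x. algebraic_int x} \<subseteq> PiE B (\<lambda>_. {0..<int m}) \<times> fr ` {x. algebraic_int x}"
      using m(1) by (auto simp: cls_def)
    then show "finite (cls ` {x. algebraic_int x})"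
      by (rule finite_subset) (intro finite_SigmaI finite_PiE fin finfr, auto)
    fix x y :: 'k assume xy: "cls x = cls y"
    then have "fr x = fr y" by (simp add: cls_def)
    have d: "\<lfloor>coord B x b\<rfloor> - \<lfloor>coord B y b\<rfloor> = int m * ((\<lfloor>coord B x b\<rfloor> - \<lfloor>coord B y b\<rfloor>) div int m)" if "b \<in> B" for b
    proof -
      have "restrict (\<lambda>b. \<lfloor>coord B x b\<rfloor> mod int m) B b = restrict (\<lambda>b. \<lfloor>coord B y b\<rfloor> mod int m) B b"
        using xy by (simp add: cls_def)
      then have "int m dvd \<lfloor>coord B x b\<rfloor> - \<lfloor>coord B y b\<rfloor>" using that by (simp add: mod_eq_dvd_iff)
      then show ?thesis by simp
    qed
    have "x - y = (wh x + fr x) - (wh y + fr y)" by (simp only: split[symmetric])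
    also have "\<dots> = wh x - wh y" using \<open>fr x = fr y\<close> by simp
    also have "\<dots> = (\<Sum>b\<in>B. of_int (\<lfloor>coord B x b\<rfloor> - \<lfloor>coord B y b\<rfloor>) * b)"
      by (simp add: wh_def sum_subtractf left_diff_distrib)
    also have "\<dots> = (\<Sum>b\<in>B. of_int (int m * ((\<lfloor>coord B x b\<rfloor> - \<lfloor>coord B y b\<rfloor>) div int m)) * b)"
      by (intro sum.cong refl) (simp only: d[symmetric])
    also have "\<dots> = of_nat m * (\<Sum>b\<in>B. of_int ((\<lfloor>coord B x b\<rfloor> - \<lfloor>coord B y b\<rfloor>) div int m) * b)"
      by (simp add: sum_distrib_left mult.assoc)
    finally have "(x - y) / \<delta> = (of_nat m * inverse \<delta>) * (\<Sum>b\<in>B. of_int ((\<lfloor>coord B x b\<rfloor> - \<lfloor>coord B y b\<rfloor>) div int m) * b)"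
      by (simp add: divide_inverse mult_ac)
    then show "algebraic_int ((x - y) / \<delta>)"
      by (simp only:) (intro algebraic_int_times m algebraic_int_sum algebraic_int_of_int B)
  qed
qed

definition real_place :: "'r \<Rightarrow> bool" where
  "real_place i \<longleftrightarrow> range (\<sigma> i) \<subseteq> \<real>"

text \<open>
  The real coordinates of the product of the completions: the real part at every place, and also
  the imaginary part (tag \<open>True\<close>) at the complex ones.
\<close>
definition forms :: "('r \<times> bool) set" where
  "forms = Sigma UNIV (\<lambda>j. if real_place j then {False} else {False, True})"

definition part :: "bool \<Rightarrow> complex \<Rightarrow> real" where
  "part b z = (if b then Im z else Re z)"

lemma finite_forms: "finite forms"
  unfolding forms_def by (intro finite_SigmaI) auto

lemma False_in_forms: "(j, False) \<in> forms"
  by (simp add: forms_def)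

lemma card_forms_pos: "card forms > 0"
  using False_in_forms finite_forms by (auto simp: card_gt_0_iff)

lemma norm_less_of_parts:
  assumes "\<And>b. (j, b) \<in> forms \<Longrightarrow> \<bar>part b z\<bar> < s" "real_place j \<Longrightarrow> z \<in> \<real>"
  shows "norm z < 2 * s"
proof -
  have re: "\<bar>Re z\<bar> < s" using assms(1)[OF False_in_forms] by (simp add: part_def)
  have im: "\<bar>Im z\<bar> < s"
  proof (cases "real_place j")
    case True
    then have "Im z = 0" using assms(2) complex_is_Real_iff by blast
    then show ?thesis using re by linarith
  next
    case False
    then show ?thesis using assms(1)[of True] by (simp add: forms_def part_def)
  qed
  show ?thesis using re im cmod_le[of z] by linarith
qed

lemma part_sum: "part b (\<Sum>x\<in>S. f x) = (\<Sum>x\<in>S. part b (f x))"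
  by (simp add: part_def)

lemma part_mult_of_real: "part b (z * of_real r) = part b z * r"
  by (simp add: part_def)

lemma abs_part_le: "\<bar>part b z\<bar> \<le> norm z"
  by (simp add: part_def abs_Re_le_cmod abs_Im_le_cmod)

text \<open>
  The number of real coordinates is the number of embeddings obtained from the \<open>\<sigma>
  j\<close> and their conjugates. These are distinct, hence linearly independent, and therefore
  at most as many as the degree.
\<close>
lemma card_forms_le:
  assumes B: "rational_basis (B :: 'k set)"
  shows "card forms \<le> card B"
proof (rule ccontr)
  assume "\<not> ?thesis"
  define emb_of where "emb_of = (\<lambda>(j,b) x. if b then cnj (\<sigma> j x) else \<sigma> j x)"
  have inj: "inj_on emb_of forms"
  proof (rule inj_onI)
    fix p q assume pq: "p \<in> forms" "q \<in> forms" "emb_of p = emb_of q"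
    obtain j b where p: "p = (j,b)" by (cases p)
    obtain j' b' where q: "q = (j',b')" by (cases q)
    have eq: "(if b then cnj (\<sigma> j x) else \<sigma> j x) = (if b' then cnj (\<sigma> j' x) else \<sigma> j' x)" for x
      using fun_cong[OF pq(3), of x] by (simp add: p q emb_of_def)
    have "norm (\<sigma> j x) = norm (\<sigma> j' x)" for x
      using arg_cong[OF eq[of x], of norm] by (auto split: if_splits)
    then have j: "j = j'" by (rule place_unique)
    have "b = b'"
    proof (rule ccontr)
      assume ne: "b \<noteq> b'"
      then have "cnj (\<sigma> j x) = \<sigma> j x" for x using eq[of x] j by (auto split: if_splits)
      then have "\<sigma> j x \<in> \<real>" for x by (simp add: Reals_cnj_iff)
      then have "real_place j" by (auto simp: real_place_def)
      then show False using pq(1,2) ne j by (auto simp: p q forms_def)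
    qed
    then show "p = q" using j p q by simp
  qed
  define E where "E = emb_of ` forms"
  have "finite E" using finite_forms by (simp add: E_def)
  have "card E = card forms" unfolding E_def by (rule card_image[OF inj])
  then have "card B < card E" using \<open>\<not> card forms \<le> card B\<close> by simp
  moreover have "finite B" using B by (simp add: rational_basis_def)
  ultimately obtain c where c: "\<exists>\<tau>\<in>E. c \<tau> \<noteq> 0" "\<forall>b\<in>B. (\<Sum>\<tau>\<in>E. c \<tau> * \<tau> b) = 0"
    using underdetermined_system[of B E "\<lambda>\<tau> b. \<tau> b"] \<open>finite E\<close> by blast
  have Eemb: "field_embedding \<tau>" if "\<tau> \<in> E" for \<tau>
    using that emb unfolding E_def emb_of_def field_embedding_def by auto
  have "(\<Sum>\<tau>\<in>E. c \<tau> * \<tau> x) = 0" for x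
  proof -
    have "(\<Sum>\<tau>\<in>E. c \<tau> * \<tau> x) = (\<Sum>\<tau>\<in>E. c \<tau> * (\<Sum>b\<in>B. of_rat (coord B x b) * \<tau> b))"
    proof (intro sum.cong refl)
      fix \<tau> assume \<tau>: "\<tau> \<in> E"
      have "\<tau> x = \<tau> (\<Sum>b\<in>B. of_rat (coord B x b) * b)" by (simp add: sum_coord[OF B])
      also have "\<dots> = (\<Sum>b\<in>B. of_rat (coord B x b) * \<tau> b)"
        by (simp add: emb_sum[OF Eemb[OF \<tau>]] emb_mult[OF Eemb[OF \<tau>]] emb_of_rat[OF Eemb[OF \<tau>]])
      finally show "c \<tau> * \<tau> x = c \<tau> * (\<Sum>b\<in>B. of_rat (coord B x b) * \<tau> b)" by simp
    qed
    also have "\<dots> = (\<Sum>\<tau>\<in>E. \<Sum>b\<in>B. of_rat (coord B x b) * (c \<tau> * \<tau> b))"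
      by (simp add: sum_distrib_left mult.left_commute)
    also have "\<dots> = (\<Sum>b\<in>B. \<Sum>\<tau>\<in>E. of_rat (coord B x b) * (c \<tau> * \<tau> b))" by (rule sum.swap)
    also have "\<dots> = (\<Sum>b\<in>B. of_rat (coord B x b) * (\<Sum>\<tau>\<in>E. c \<tau> * \<tau> b))"
      by (simp add: sum_distrib_left)
    also have "\<dots> = 0" using c(2) by (intro sum.neutral) auto
    finally show ?thesis .
  qed
  then have "\<forall>\<tau>\<in>E. c \<tau> = 0" using dedekind_independence[OF \<open>finite E\<close> Eemb, of c] by blast
  then show False using c(1) by blast
qed

section \<open>Units that separate two places\<close>

text \<open>
  Boxes of volume \<open>1\<close>: the side \<open>t j\<close> is counted once at a real place
  and twice at a complex one.
\<close>
definition weight_ok :: "('r \<Rightarrow> real) \<Rightarrow> bool" where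
  "weight_ok t \<longleftrightarrow> (\<forall>j. t j > 0) \<and> (\<Prod>p\<in>forms. t (fst p)) = 1"

text \<open>
  The pigeonhole principle for the coordinates of an integral basis, with \<open>M = 1\<close>.
\<close>
lemma minkowski_box: "\<exists>A>0. \<forall>t. weight_ok t \<longrightarrow> (\<exists>x. algebraic_int x \<and> x \<noteq> 0 \<and> (\<forall>j. norm (\<sigma> j x) \<le> A * t j))"
proof -
  obtain B :: "'k set" where B: "rational_basis B" "\<And>b. b \<in> B \<Longrightarrow> algebraic_int b"
    using number_field_integral_basis[OF nf] by blast
  then have fin: "finite B" by (simp add: rational_basis_def)
  define C where "C = 1 + (\<Sum>i\<in>UNIV. \<Sum>b\<in>B. norm (\<sigma> i b))"
  have "C \<ge> 1" unfolding C_def by (simp add: sum_nonneg)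
  have CL: "(\<Sum>b\<in>B. \<bar>part (snd p) (\<sigma> (fst p) b)\<bar>) \<le> C" for p
  proof -
    have "(\<Sum>b\<in>B. \<bar>part (snd p) (\<sigma> (fst p) b)\<bar>) \<le> (\<Sum>b\<in>B. norm (\<sigma> (fst p) b))"
      by (intro sum_mono abs_part_le)
    also have "\<dots> \<le> (\<Sum>i\<in>UNIV. \<Sum>b\<in>B. norm (\<sigma> i b))"
      by (rule member_le_sum) (auto intro: sum_nonneg)
    finally show ?thesis by (simp add: C_def)
  qed
  define S where "S = 4 * C + 1"
  have S: "S > 4 * C" "S > 0" using \<open>C \<ge> 1\<close> by (auto simp: S_def)
  show ?thesis
  proof (intro exI[of _ "2 * S"] conjI allI impI)
    show "2 * S > 0" using S by simp
    fix t assume t: "weight_ok t"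
    have "(4 * C) ^ card forms < S ^ card forms"
      using S(1) \<open>C \<ge> 1\<close> card_forms_pos by (intro power_strict_mono) auto
    then have "real 1 * (4 * C) ^ card forms < S ^ card forms" by (simp only: of_nat_1 mult_1)
    also have "S ^ card forms = (\<Prod>p\<in>forms. S * t (fst p))"
      using t by (simp add: weight_ok_def prod.distrib)
    finally have vol: "real 1 * (4 * C) ^ card forms < (\<Prod>p\<in>forms. S * t (fst p))" .
    have pos: "S * t (fst p) > 0" for p using S t by (simp add: weight_ok_def)
    have "C > 0" using \<open>C \<ge> 1\<close> by simp
    obtain Z :: "('k \<Rightarrow> int) set" where "finite Z \<and> card Z > 1 \<and> Z \<subseteq> extensional B \<and> (\<forall>z\<in>Z. \<forall>z'\<in>Z. \<forall>p\<in>forms.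
        \<bar>\<Sum>b\<in>B. part (snd p) (\<sigma> (fst p) b) * real_of_int (z b - z' b)\<bar> < S * t (fst p))"
      using pigeonhole_linear_forms[OF finite_forms fin card_forms_le[OF B(1)] \<open>C > 0\<close> CL pos vol] ..
    then have Z: "finite Z" "card Z > 1" "Z \<subseteq> extensional B"
      "\<And>z z' p. z \<in> Z \<Longrightarrow> z' \<in> Z \<Longrightarrow> p \<in> forms \<Longrightarrow>
        \<bar>\<Sum>b\<in>B. part (snd p) (\<sigma> (fst p) b) * real_of_int (z b - z' b)\<bar> < S * t (fst p)"
      by auto
    obtain z z' where z: "z \<in> Z" "z' \<in> Z" "z \<noteq> z'"
      using Z(1,2) by (metis card_le_Suc0_iff_eq not_less One_nat_def)
    define x where "x = (\<Sum>b\<in>B. of_int (z b - z' b) * b)"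
    have "algebraic_int x"
      unfolding x_def by (intro algebraic_int_sum algebraic_int_times B algebraic_int_of_int)
    moreover have "x \<noteq> 0"
    proof
      assume "x = 0"
      then have "z b - z' b = 0" if "b \<in> B" for b
        using rational_basis_int_independent[OF B(1) _ that, of "\<lambda>b. z b - z' b"] by (simp only: x_def)
      then have "z b = z' b" if "b \<in> B" for b using that by simp
      then have "z = z'" using Z(3) z(1,2) by (intro extensionalityI[of z B z']) auto
      then show False using z by simp
    qed
    moreover have "norm (\<sigma> j x) \<le> 2 * S * t j" for j
    proof -
      have "norm (\<sigma> j x) < 2 * (S * t j)"
      proof (rule norm_less_of_parts)
        fix b' assume "(j, b') \<in> forms"
        have "part b' (\<sigma> j x) = (\<Sum>b\<in>B. part b' (\<sigma> j b) * real_of_int (z b - z' b))"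
          unfolding x_def emb_sum[OF emb] part_sum
        proof (intro sum.cong refl)
          fix b
          have "\<sigma> j (of_int (z b - z' b) * b) = \<sigma> j b * of_real (real_of_int (z b - z' b))"
            by (simp only: emb_mult[OF emb] emb_of_int[OF emb] of_real_of_int_eq mult.commute)
          then show "part b' (\<sigma> j (of_int (z b - z' b) * b)) = part b' (\<sigma> j b) * real_of_int (z b - z' b)"
            by (simp only: part_mult_of_real)
        qed
        then show "\<bar>part b' (\<sigma> j x)\<bar> < S * t j" using Z(4)[OF z(1,2) \<open>(j, b') \<in> forms\<close>] by simp
      next
        assume "real_place j" then show "\<sigma> j x \<in> \<real>" by (auto simp: real_place_def)
      qed
      then show ?thesis by simp
    qed
    ultimately show "\<exists>x. algebraic_int x \<and> x \<noteq> 0 \<and> (\<forall>j. norm (\<sigma> j x) \<le> 2 * S * t j)" by blast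
  qed
qed

definition local_degree :: "'r \<Rightarrow> nat" where
  "local_degree j = (if real_place j then 1 else 2)"

lemma prod_forms: "(\<Prod>p\<in>forms. t (fst p)) = (\<Prod>j\<in>UNIV. t j ^ local_degree j)" for t :: "'r \<Rightarrow> real"
proof -
  have "(\<Prod>p\<in>forms. t (fst p)) = (\<Prod>j\<in>UNIV. \<Prod>b\<in>(if real_place j then {False} else {False, True}). t j)"
    unfolding forms_def by (subst prod.Sigma) (auto simp: case_prod_unfold)
  also have "\<dots> = (\<Prod>j\<in>UNIV. t j ^ local_degree j)"
    by (intro prod.cong refl) (auto simp: local_degree_def power2_eq_square)
  finally show ?thesis .
qed

text \<open>
  A box of volume \<open>1\<close> that is long at \<open>i2\<close>, short at \<open>i1\<close>
  and has side \<open>1\<close> elsewhere; the exponents compensate for the different local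
  degrees.
\<close>
definition balanced_weight :: "'r \<Rightarrow> 'r \<Rightarrow> real \<Rightarrow> 'r \<Rightarrow> real" where
  "balanced_weight i1 i2 T j =
     (if j = i2 then T ^ local_degree i1 else if j = i1 then inverse (T ^ local_degree i2) else 1)"

lemma balanced_weight_ok:
  assumes "i1 \<noteq> i2" "T > 0"
  shows "weight_ok (balanced_weight i1 i2 T)" "weight_ok (\<lambda>j. inverse (balanced_weight i1 i2 T j))"
proof -
  have "(\<Prod>j\<in>UNIV. balanced_weight i1 i2 T j ^ local_degree j)
      = (\<Prod>j\<in>{i1,i2}. balanced_weight i1 i2 T j ^ local_degree j)"
    by (rule prod.mono_neutral_right) (auto simp: balanced_weight_def)
  also have "\<dots> = inverse (T ^ local_degree i2) ^ local_degree i1 * (T ^ local_degree i1) ^ local_degree i2"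
    using assms(1) by (simp add: balanced_weight_def)
  also have "\<dots> = 1"
    using assms(2) by (simp add: power_inverse power_mult[symmetric] mult.commute)
  finally have 1: "(\<Prod>p\<in>forms. balanced_weight i1 i2 T (fst p)) = 1" by (simp only: prod_forms)
  show "weight_ok (balanced_weight i1 i2 T)"
    using 1 assms(2) by (auto simp: weight_ok_def balanced_weight_def)
  have "(\<Prod>p\<in>forms. inverse (balanced_weight i1 i2 T (fst p))) = inverse (\<Prod>p\<in>forms. balanced_weight i1 i2 T (fst p))"
    using prod_inversef[of "\<lambda>p. balanced_weight i1 i2 T (fst p)" forms] by (simp only: o_def)
  then have "(\<Prod>p\<in>forms. inverse (balanced_weight i1 i2 T (fst p))) = 1" by (simp only: 1 inverse_1)
  moreover have "inverse (balanced_weight i1 i2 T j) > 0" for j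
    using assms(2) by (simp add: balanced_weight_def)
  ultimately show "weight_ok (\<lambda>j. inverse (balanced_weight i1 i2 T j))"
    unfolding weight_ok_def by blast
qed

text \<open>
  Take algebraic integers \<open>x n\<close> in boxes that become long at \<open>i2\<close> and
  short at \<open>i1\<close>, and \<open>y n\<close> in the inverse boxes. The products \<open>x
  n * y n\<close> have bounded absolute values, so infinitely many of them equal one
  \<open>\<delta>\<close>; among these, infinitely many \<open>x n\<close> are congruent modulo
  \<open>m * \<delta>\<close>. The quotient of two such \<open>x n\<close> is a unit congruent
  to \<open>1\<close> modulo \<open>m\<close>. Only units are needed that move two places in
  opposite directions, so the full unit theorem is replaced by this direct construction.
\<close>
lemma separating_units:
  fixes m :: 'k
  assumes ne: "i1 \<noteq> i2" and m: "algebraic_int m" "m \<noteq> 0"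
  shows "\<exists>C. \<forall>R. \<exists>\<epsilon>. \<epsilon> \<noteq> 0 \<and> algebraic_int ((\<epsilon> - 1) / m) \<and> algebraic_int ((inverse \<epsilon> - 1) / m) \<and>
     norm (\<sigma> i2 \<epsilon>) \<ge> R \<and> norm (\<sigma> i1 (inverse \<epsilon>)) \<ge> R \<and>
     (\<forall>j. j \<noteq> i1 \<longrightarrow> j \<noteq> i2 \<longrightarrow> norm (\<sigma> j \<epsilon>) \<le> C \<and> norm (\<sigma> j (inverse \<epsilon>)) \<le> C)"
proof -
  obtain A where "A > 0 \<and> (\<forall>t. weight_ok t \<longrightarrow> (\<exists>x. algebraic_int x \<and> x \<noteq> 0 \<and> (\<forall>j. norm (\<sigma> j x) \<le> A * t j)))"
    using minkowski_box ..
  then have A: "A > 0" "\<And>t. weight_ok t \<Longrightarrow> \<exists>x. algebraic_int x \<and> x \<noteq> 0 \<and> (\<forall>j. norm (\<sigma> j x) \<le> A * t j)"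
    by simp_all
  define t where "t = (\<lambda>n::nat. balanced_weight i1 i2 (real (Suc n)))"
  have tpos: "t n j > 0" for n j by (simp add: t_def balanced_weight_def)
  have t1: "t n j = 1" if "j \<noteq> i1" "j \<noteq> i2" for n j using that by (simp add: t_def balanced_weight_def)
  have ti2: "t n i2 \<ge> real n" for n
  proof -
    have "real (Suc n) ^ 1 \<le> real (Suc n) ^ local_degree i1"
      by (rule power_increasing) (auto simp: local_degree_def)
    then show ?thesis by (simp add: t_def balanced_weight_def)
  qed
  have ti1: "inverse (t n i1) \<ge> real n" for n
  proof -
    have "real (Suc n) ^ 1 \<le> real (Suc n) ^ local_degree i2"
      by (rule power_increasing) (auto simp: local_degree_def)
    then show ?thesis using ne by (simp add: t_def balanced_weight_def)
  qed
  have "\<exists>x. algebraic_int x \<and> x \<noteq> 0 \<and> (\<forall>j. norm (\<sigma> j x) \<le> A * t n j)" for n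
    unfolding t_def by (rule A(2)[OF balanced_weight_ok(1)[OF ne]]) simp
  then have "\<exists>x. \<forall>n. algebraic_int (x n) \<and> x n \<noteq> 0 \<and> (\<forall>j. norm (\<sigma> j (x n)) \<le> A * t n j)"
    by (intro choice allI)
  then obtain x where x: "\<And>n. algebraic_int (x n)" "\<And>n. x n \<noteq> 0" "\<And>n j. norm (\<sigma> j (x n)) \<le> A * t n j"
    by auto
  have "\<exists>y. algebraic_int y \<and> y \<noteq> 0 \<and> (\<forall>j. norm (\<sigma> j y) \<le> A * inverse (t n j))" for n
    unfolding t_def by (rule A(2)[OF balanced_weight_ok(2)[OF ne]]) simp
  then have "\<exists>y. \<forall>n. algebraic_int (y n) \<and> y n \<noteq> 0 \<and> (\<forall>j. norm (\<sigma> j (y n)) \<le> A * inverse (t n j))"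
    by (intro choice allI)
  then obtain y where y: "\<And>n. algebraic_int (y n)" "\<And>n. y n \<noteq> 0" "\<And>n j. norm (\<sigma> j (y n)) \<le> A * inverse (t n j)"
    by auto
  have xy: "norm (\<sigma> j (x n * y n)) \<le> A\<^sup>2" for n j
  proof -
    have "norm (\<sigma> j (x n * y n)) \<le> (A * t n j) * (A * inverse (t n j))"
      unfolding emb_mult[OF emb] norm_mult using tpos[of n j] A(1) by (intro mult_mono x y) auto
    also have "\<dots> = A\<^sup>2" using tpos[of n j] by (simp add: power2_eq_square field_simps)
    finally show ?thesis .
  qed
  have "finite ((\<lambda>n. x n * y n) ` UNIV)"
    by (rule finite_subset[OF _ finite_bounded[of "A\<^sup>2"]]) (use xy x y in \<open>auto intro: algebraic_int_times\<close>)
  from pigeonhole_infinite[OF infinite_UNIV_nat this]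
  obtain a0 where a0: "infinite {n. x n * y n = x a0 * y a0}" by auto
  define \<delta> where "\<delta> = x a0 * y a0"
  have \<delta>: "\<delta> \<noteq> 0" "m * \<delta> \<noteq> 0" using x y m by (auto simp: \<delta>_def)
  obtain cls :: "'k \<Rightarrow> ('k \<Rightarrow> int) \<times> 'k" where cls: "finite (cls ` {x. algebraic_int x})"
    "\<And>u v. algebraic_int u \<Longrightarrow> algebraic_int v \<Longrightarrow> cls u = cls v \<Longrightarrow> algebraic_int ((u - v) / (m * \<delta>))"
    using finite_residues[OF \<delta>(2)] by blast
  have "finite ((\<lambda>n. cls (x n)) ` {n. x n * y n = \<delta>})"
    by (rule finite_subset[OF _ cls(1)]) (use x in auto)
  from pigeonhole_infinite[OF a0[folded \<delta>_def] this]
  obtain n0 where n0: "x n0 * y n0 = \<delta>" "infinite {n. x n * y n = \<delta> \<and> cls (x n) = cls (x n0)}" by auto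
  define N where "N = {n. x n * y n = \<delta> \<and> cls (x n) = cls (x n0)}"
  obtain c where c: "c > 0" "\<And>z i. algebraic_int z \<Longrightarrow> z \<noteq> 0 \<Longrightarrow> (\<And>j. norm (\<sigma> j z) \<le> A\<^sup>2) \<Longrightarrow> c \<le> norm (\<sigma> i z)"
    using bounded_away_from_0[of "A\<^sup>2"] by blast
  have low: "norm (\<sigma> j (x n)) \<ge> c / A * t n j" for n j
  proof -
    have "c \<le> norm (\<sigma> j (x n * y n))" using x y xy by (intro c algebraic_int_times) auto
    also have "\<dots> \<le> norm (\<sigma> j (x n)) * (A * inverse (t n j))"
      unfolding emb_mult[OF emb] norm_mult by (rule mult_left_mono[OF y(3)]) simp
    finally show ?thesis using A(1) tpos[of n j] by (simp add: field_simps)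
  qed
  define X where "X = (\<Sum>j\<in>UNIV. norm (\<sigma> j (x n0)))"
  have X: "norm (\<sigma> j (x n0)) \<le> X" for j unfolding X_def by (rule member_le_sum) auto
  define X' where "X' = (\<Sum>j\<in>UNIV. norm (\<sigma> j (inverse (x n0))))"
  have X': "norm (\<sigma> j (inverse (x n0))) \<le> X'" for j unfolding X'_def by (rule member_le_sum) auto
  have nX: "norm (\<sigma> j (x n0)) > 0" "norm (\<sigma> j (inverse (x n0))) > 0" for j
    using x(2) by (auto simp: emb_eq_0[OF emb])
  have Xpos: "X > 0" "X' > 0" using X[of undefined] X'[of undefined] nX[of undefined] by linarith+
  show ?thesis
  proof (intro exI[of _ "A * X' + X * A / c"] allI)
    fix R :: real
    obtain n where n: "n \<in> N" "real n \<ge> \<bar>R\<bar> * (A * X' + X * A / c)"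
    proof -
      obtain k :: nat where k: "real k \<ge> \<bar>R\<bar> * (A * X' + X * A / c)" using real_arch_simple by blast
      obtain n where "n \<in> N" "n \<ge> k" using n0(2) unfolding N_def infinite_nat_iff_unbounded_le by blast
      then show thesis using k that[of n] by simp
    qed
    have n': "x n * y n = \<delta>" "cls (x n) = cls (x n0)" using n(1) by (auto simp: N_def)
    define w where "w = (x n - x n0) / (m * \<delta>)"
    have w: "algebraic_int w" unfolding w_def by (rule cls(2)[OF x(1) x(1) n'(2)])
    define \<epsilon> where "\<epsilon> = x n * inverse (x n0)"
    have inv: "inverse \<epsilon> = x n0 * inverse (x n)" using x(2) by (simp add: \<epsilon>_def)
    \<comment> \<open>since \<open>\<delta> = x n0 * y n0 = x n * y n\<close>, division by \<open>x n0\<close> or \<open>x n\<close> costs a factor of \<open>\<delta>\<close> only\<close>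
    have 1: "(\<epsilon> - 1) / m = y n0 * w"
      unfolding w_def \<epsilon>_def n0(1)[symmetric] using x(2)[of n0] y(2)[of n0] m(2) by (simp add: field_simps)
    have 2: "(inverse \<epsilon> - 1) / m = - (y n * w)"
      unfolding w_def inv n'(1)[symmetric] using x(2)[of n] y(2)[of n] m(2) by (simp add: field_simps)
    have eps: "norm (\<sigma> j \<epsilon>) = norm (\<sigma> j (x n)) * norm (\<sigma> j (inverse (x n0)))" for j
      by (simp add: \<epsilon>_def emb_mult[OF emb] norm_mult)
    have inveps: "norm (\<sigma> j (inverse \<epsilon>)) = norm (\<sigma> j (x n0)) / norm (\<sigma> j (x n))" for j
      by (simp add: inv emb_mult[OF emb] emb_inverse[OF emb] norm_mult norm_inverse divide_inverse)
    have big: "\<bar>R\<bar> * (A * X') \<le> real n" "\<bar>R\<bar> * (X * A / c) \<le> real n"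
    proof -
      have "0 \<le> \<bar>R\<bar> * (A * X')" "0 \<le> \<bar>R\<bar> * (X * A / c)" using A(1) c(1) Xpos by auto
      then show "\<bar>R\<bar> * (A * X') \<le> real n" "\<bar>R\<bar> * (X * A / c) \<le> real n"
        using n(2) unfolding distrib_left by linarith+
    qed
    have "R \<le> norm (\<sigma> i2 \<epsilon>)"
    proof -
      have "R \<le> \<bar>R\<bar> * (X * A / c) * (c / A) * inverse X" using A(1) c(1) Xpos by (simp add: field_simps)
      also have "\<dots> \<le> real n * (c / A) * inverse X"
        using big(2) A(1) c(1) Xpos by (intro mult_right_mono) auto
      also have "\<dots> \<le> (c / A * t n i2) * inverse (norm (\<sigma> i2 (x n0)))"
      proof (rule mult_mono)
        show "real n * (c / A) \<le> c / A * t n i2"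
          using mult_left_mono[OF ti2[of n], of "c / A"] A(1) c(1) by (simp add: mult.commute)
        show "inverse X \<le> inverse (norm (\<sigma> i2 (x n0)))" by (rule le_imp_inverse_le[OF X nX(1)])
        show "0 \<le> c / A * t n i2" using A(1) c(1) tpos[of n i2] by simp
      qed (use Xpos in simp)
      also have "\<dots> \<le> norm (\<sigma> i2 (x n)) * inverse (norm (\<sigma> i2 (x n0)))"
        by (rule mult_right_mono[OF low]) simp
      finally show ?thesis by (simp add: eps emb_inverse[OF emb] norm_inverse)
    qed
    moreover have "R \<le> norm (\<sigma> i1 (inverse \<epsilon>))"
    proof -
      have "R \<le> \<bar>R\<bar> * (A * X') * inverse (A * X')" using A(1) Xpos by (simp add: field_simps)
      also have "\<dots> \<le> real n * inverse (A * X')"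
        using big(1) A(1) Xpos by (intro mult_right_mono) auto
      also have "\<dots> \<le> inverse (t n i1) * inverse (A * X')"
        using ti1 A(1) Xpos by (intro mult_right_mono) auto
      also have "\<dots> = inverse X' * inverse (A * t n i1)" by (simp add: mult_ac)
      also have "\<dots> \<le> norm (\<sigma> i1 (x n0)) * inverse (norm (\<sigma> i1 (x n)))"
      proof (rule mult_mono)
        have "inverse X' \<le> inverse (norm (\<sigma> i1 (inverse (x n0))))" by (rule le_imp_inverse_le[OF X' nX(2)])
        then show "inverse X' \<le> norm (\<sigma> i1 (x n0))" by (simp add: emb_inverse[OF emb] norm_inverse)
        have "0 < norm (\<sigma> i1 (x n))" using x(2) by (simp add: emb_eq_0[OF emb])
        then show "inverse (A * t n i1) \<le> inverse (norm (\<sigma> i1 (x n)))"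
          by (rule le_imp_inverse_le[OF x(3)])
        show "0 \<le> inverse (A * t n i1)" using A(1) tpos[of n i1] by simp
      qed simp
      finally show ?thesis by (simp add: inveps divide_inverse)
    qed
    moreover have "norm (\<sigma> j \<epsilon>) \<le> A * X' + X * A / c \<and> norm (\<sigma> j (inverse \<epsilon>)) \<le> A * X' + X * A / c"
      if j: "j \<noteq> i1" "j \<noteq> i2" for j
    proof
      have "norm (\<sigma> j \<epsilon>) \<le> (A * t n j) * X'"
        unfolding eps using A(1) tpos[of n j] by (intro mult_mono x X') auto
      then show "norm (\<sigma> j \<epsilon>) \<le> A * X' + X * A / c" using t1[OF j] A(1) c(1) Xpos by (simp add: add_increasing2)
      have "norm (\<sigma> j (inverse \<epsilon>)) \<le> X / (c / A)"
        unfolding inveps using low[of n j] t1[OF j] A(1) c(1) Xpos X by (intro frac_le) auto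
      then show "norm (\<sigma> j (inverse \<epsilon>)) \<le> A * X' + X * A / c" using A(1) Xpos by (simp add: add_increasing)
    qed
    moreover have "\<epsilon> \<noteq> 0" using x(2) by (simp add: \<epsilon>_def)
    moreover have "algebraic_int ((\<epsilon> - 1) / m)" unfolding 1 by (rule algebraic_int_times[OF y(1) w])
    moreover have "algebraic_int ((inverse \<epsilon> - 1) / m)"
      unfolding 2 using algebraic_int_times[OF y(1) w] by simp
    ultimately show "\<exists>\<epsilon>. \<epsilon> \<noteq> 0 \<and> algebraic_int ((\<epsilon> - 1) / m) \<and> algebraic_int ((inverse \<epsilon> - 1) / m) \<and>
       R \<le> norm (\<sigma> i2 \<epsilon>) \<and> R \<le> norm (\<sigma> i1 (inverse \<epsilon>)) \<and>
       (\<forall>j. j \<noteq> i1 \<longrightarrow> j \<noteq> i2 \<longrightarrow> norm (\<sigma> j \<epsilon>) \<le> A * X' + X * A / c \<and> norm (\<sigma> j (inverse \<epsilon>)) \<le> A * X' + X * A / c)"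
      by (intro exI[of _ \<epsilon>]) auto
  qed
qed

section \<open>Short vectors\<close>

definition int_vec :: "'k \<times> 'k \<Rightarrow> bool" where
  "int_vec v \<longleftrightarrow> algebraic_int (fst v) \<and> algebraic_int (snd v)"

text \<open>
  The component at the place \<open>j\<close> and in the row \<open>a\<close> of the vector
  \<open>g v\<close>, for \<open>v\<close> in \<open>K\<^sup>2\<close>.
\<close>
definition app :: "('r \<Rightarrow> complex^2^2) \<Rightarrow> 'k \<times> 'k \<Rightarrow> 'r \<Rightarrow> 2 \<Rightarrow> complex" where
  "app g v j a = g j $ a $ 1 * \<sigma> j (fst v) + g j $ a $ 2 * \<sigma> j (snd v)"

text \<open>
  Weights that model the action of the diagonal matrix with entries \<open>w j\<close> and
  \<open>inverse (w j)\<close> at each place.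
\<close>
definition wt :: "('r \<Rightarrow> real) \<Rightarrow> 'r \<Rightarrow> 2 \<Rightarrow> real" where
  "wt w j a = (if a = 1 then w j else inverse (w j))"

definition det2 :: "'k \<times> 'k \<Rightarrow> 'k \<times> 'k \<Rightarrow> 'k" where
  "det2 u v = fst u * snd v - snd u * fst v"

definition short_vec :: "('r \<Rightarrow> complex^2^2) \<Rightarrow> ('r \<Rightarrow> real) \<Rightarrow> real \<Rightarrow> bool" where
  "short_vec g w \<epsilon> \<longleftrightarrow> (\<exists>v. int_vec v \<and> v \<noteq> 0 \<and> (\<forall>j a. wt w j a * norm (app g v j a) < \<epsilon>))"

lemma app_diff: "app g (u - v) j a = app g u j a - app g v j a"
  by (simp add: app_def emb_diff[OF emb] algebra_simps)

lemma wt_pos: "(\<And>j. w j > 0) \<Longrightarrow> wt w j a > 0"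
  by (simp add: wt_def)

lemma app_det:
  assumes "det (g j) = 1"
  shows "app g u j 1 * app g v j 2 - app g u j 2 * app g v j 1 = \<sigma> j (det2 u v)"
proof -
  have "app g u j 1 * app g v j 2 - app g u j 2 * app g v j 1 = det (g j) * \<sigma> j (det2 u v)"
    by (simp add: app_def det_2 det2_def emb_diff[OF emb] emb_mult[OF emb] algebra_simps)
  then show ?thesis using assms by simp
qed

lemma app_nonzero:
  assumes "det (g j) = 1" "v \<noteq> 0"
  shows "app g v j 1 \<noteq> 0 \<or> app g v j 2 \<noteq> 0"
proof (rule ccontr)
  assume "\<not> ?thesis"
  then have 0: "app g v j 1 = 0" "app g v j 2 = 0" by auto
  have "\<sigma> j (det2 (1,0) v) = 0" "\<sigma> j (det2 (0,1) v) = 0"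
    using app_det[of g j "(1,0)" v, OF assms(1)] app_det[of g j "(0,1)" v, OF assms(1)] 0 by simp_all
  then show False using assms(2) by (auto simp: emb_eq_0[OF emb] det2_def prod_eq_iff)
qed

lemma int_vec_diff: "int_vec u \<Longrightarrow> int_vec v \<Longrightarrow> int_vec (u - v)"
  by (auto simp: int_vec_def intro: algebraic_int_diff)

lemma prod_forms2:
  assumes "\<And>j. w j > 0"
  shows "(\<Prod>p\<in>forms \<times> (UNIV :: 2 set). S * inverse (wt w (fst (fst p)) (snd p))) = S ^ (2 * card forms)"
proof -
  have "(\<Prod>p\<in>forms \<times> (UNIV :: 2 set). S * inverse (wt w (fst (fst p)) (snd p)))
      = (\<Prod>q\<in>forms. \<Prod>a\<in>(UNIV :: 2 set). S * inverse (wt w (fst q) a))"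
    by (simp add: prod.cartesian_product case_prod_unfold)
  also have "\<dots> = (\<Prod>q\<in>forms. S\<^sup>2)"
  proof (rule prod.cong[OF refl])
    fix q :: "'r \<times> bool"
    have "w (fst q) \<noteq> 0" using assms[of "fst q"] by simp
    then show "(\<Prod>a\<in>(UNIV :: 2 set). S * inverse (wt w (fst q) a)) = S\<^sup>2"
      by (simp add: UNIV_2 wt_def power2_eq_square)
  qed
  finally show ?thesis by (simp add: power_mult)
qed

text \<open>
  Parallel vectors have the same ratio of weighted rows, so the dominant row of one of them is
  dominant for all of them.
\<close>
lemma parallel_row:
  assumes g: "det (g j) = 1" and w: "\<And>j. w j > 0" and u: "u \<noteq> 0" and "det2 d u = 0"
    and rw: "rw = (if wt w j 2 * norm (app g u j 2) \<le> wt w j 1 * norm (app g u j 1) then 1 else 2)"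
  shows "wt w j a * norm (app g d j a) \<le> wt w j rw * norm (app g d j rw)"
proof -
  have wp: "wt w j b > 0" for b by (rule wt_pos[OF w])
  define X where "X = (\<lambda>v b. wt w j b * norm (app g v j b))"
  have X0: "X v b \<ge> 0" for v b using wp[of b] by (simp add: X_def)
  have "app g d j 1 * app g u j 2 = app g d j 2 * app g u j 1"
    using app_det[of g j d u, OF g] assms(4) by (simp add: emb_0[OF emb])
  then have "norm (app g d j 1) * norm (app g u j 2) = norm (app g d j 2) * norm (app g u j 1)"
    by (metis norm_mult)
  then have eq: "X d 1 * X u 2 = X d 2 * X u 1"
    by (simp add: X_def mult_ac)
  have nz: "X u 1 > 0 \<or> X u 2 > 0" using app_nonzero[of g j u] g u wp by (auto simp: X_def)
  have a12: "a = 1 \<or> a = 2" using exhaust_2 by blast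
  have "X d a \<le> X d rw"
  proof (cases "X u 2 \<le> X u 1")
    case True
    then have r: "rw = 1" using rw by (simp add: X_def)
    have "X d 2 * X u 1 \<le> X d 1 * X u 1" unfolding eq[symmetric] using True X0 by (intro mult_left_mono) auto
    then have "X d 2 \<le> X d 1" using True nz by (auto simp: mult_le_cancel_right)
    then show ?thesis using a12 r by auto
  next
    case False
    then have r: "rw = 2" using rw by (simp add: X_def)
    have "X d 1 * X u 2 \<le> X d 2 * X u 2" unfolding eq using False X0 by (intro mult_left_mono) auto
    then have "X d 1 \<le> X d 2" using False nz X0[of u 1] by (auto simp: mult_le_cancel_right)
    then show ?thesis using a12 r by auto
  qed
  then show ?thesis by (simp add: X_def)
qed

text \<open>
  The pigeonhole principle provides more than \<open>M\<close> integral vectors whose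
  differences have weighted size below \<open>2 * S\<close>. If all these differences were
  parallel, each of them would be controlled by one row per place. The \<open>n\<close> real
  coordinates of the dominant rows then distribute the vectors over at most \<open>(10 * S /
  \<epsilon>) ^ n \<le> M\<close> cells of size \<open>\<epsilon> / 2\<close>, and two vectors
  in one cell would differ by a vector shorter than \<open>\<epsilon>\<close>. The count works
  because \<open>S\<close> enters the number of vectors with the exponent \<open>2 * n\<close>,
  but the number of cells with the exponent \<open>n\<close>.
\<close>
lemma two_independent_vectors:
  assumes g: "\<And>j. det (g j) = 1" "\<And>j a b. real_place j \<Longrightarrow> g j $ a $ b \<in> \<real>" and eps: "\<epsilon> > 0"
  shows "\<exists>R. \<forall>w. (\<forall>j. w j > 0) \<longrightarrow> \<not> short_vec g w \<epsilon> \<longrightarrow>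
     (\<exists>u v. int_vec u \<and> int_vec v \<and> det2 u v \<noteq> 0 \<and>
       (\<forall>j a. wt w j a * norm (app g u j a) \<le> R \<and> wt w j a * norm (app g v j a) \<le> R))"
proof -
  obtain B :: "'k set" where B: "rational_basis B" "\<And>b. b \<in> B \<Longrightarrow> algebraic_int b"
    using number_field_integral_basis[OF nf] by blast
  then have fin: "finite B" by (simp add: rational_basis_def)
  define B2 where "B2 = B \<times> (UNIV :: 2 set)"
  define P2 where "P2 = forms \<times> (UNIV :: 2 set)"
  define L where "L = (\<lambda>p be. part (snd (fst p)) (g (fst (fst p)) $ (snd p) $ (snd be) * \<sigma> (fst (fst p)) (fst be)))"
  define C where "C = 1 + (\<Sum>p\<in>P2. \<Sum>be\<in>B2. \<bar>L p be\<bar>)"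
  define n where "n = card forms"
  have n: "n > 0" using card_forms_pos by (simp add: n_def)
  have fin2: "finite P2" "finite B2" using fin finite_forms by (auto simp: P2_def B2_def)
  have cards: "card P2 = 2 * n" "card P2 \<le> card B2"
    using card_forms_le[OF B(1)] by (simp_all add: P2_def B2_def n_def card_cartesian_product)
  have C: "C \<ge> 1" unfolding C_def by (simp add: sum_nonneg)
  then have "C > 0" by simp
  have CL: "(\<Sum>be\<in>B2. \<bar>L p be\<bar>) \<le> C" if "p \<in> P2" for p
  proof -
    have "(\<Sum>be\<in>B2. \<bar>L p be\<bar>) \<le> (\<Sum>p\<in>P2. \<Sum>be\<in>B2. \<bar>L p be\<bar>)"
      by (rule member_le_sum[OF that]) (auto intro: sum_nonneg fin2)
    then show ?thesis by (simp add: C_def)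
  qed
  \<comment> \<open>so large that \<open>S ^ n\<close> exceeds the constants lost in both pigeonhole arguments\<close>
  define S where "S = \<epsilon> + 1 + 2 * (10 / \<epsilon>) ^ n * (4 * C) ^ (2 * n)"
  have S: "S \<ge> \<epsilon>" "S \<ge> 1" "2 * (10 / \<epsilon>) ^ n * (4 * C) ^ (2 * n) < S"
    using eps C by (auto simp: S_def)
  define M where "M = nat \<lceil>(10 * S / \<epsilon>) ^ n\<rceil>"
  have T1: "(10 * S / \<epsilon>) ^ n \<ge> 1" using S eps by (intro one_le_power) (simp add: field_simps)
  have M: "(10 * S / \<epsilon>) ^ n \<le> real M" "real M \<le> 2 * (10 * S / \<epsilon>) ^ n"
    using T1 unfolding M_def by linarith+
  have volM: "real M * (4 * C) ^ (2 * n) < S ^ (2 * n)"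
  proof -
    have "real M * (4 * C) ^ (2 * n) \<le> 2 * (10 * S / \<epsilon>) ^ n * (4 * C) ^ (2 * n)"
      using M(2) C by (intro mult_right_mono) auto
    also have "\<dots> = 2 * (10 / \<epsilon>) ^ n * (4 * C) ^ (2 * n) * S ^ n"
      by (simp add: power_divide power_mult_distrib)
    also have "\<dots> < S * S ^ n" using S by (intro mult_strict_right_mono) auto
    also have "\<dots> \<le> S ^ n * S ^ n" using S(2) n by (intro mult_right_mono self_le_power) auto
    also have "\<dots> = S ^ (2 * n)" by (simp add: power_add[symmetric] mult_2)
    finally show ?thesis .
  qed
  show ?thesis
  proof (intro exI[of _ "2 * S"] allI impI)
    fix w :: "'r \<Rightarrow> real" assume w': "\<forall>j. w j > 0" and ns: "\<not> short_vec g w \<epsilon>"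
    have w: "w j > 0" for j using w' by blast
    have wp: "wt w j a > 0" for j a by (rule wt_pos[OF w])
    define s where "s = (\<lambda>p::('r \<times> bool) \<times> 2. S * inverse (wt w (fst (fst p)) (snd p)))"
    have spos: "s p > 0" for p using wp S(2) by (simp add: s_def)
    have vol: "real M * (4 * C) ^ card P2 < (\<Prod>p\<in>P2. s p)"
    proof -
      have "(\<Prod>p\<in>P2. s p) = S ^ (2 * n)" unfolding s_def P2_def n_def by (rule prod_forms2[OF w])
      then show ?thesis using volM by (simp only: cards(1))
    qed
    obtain Z :: "('k \<times> 2 \<Rightarrow> int) set" where "finite Z \<and> card Z > M \<and> Z \<subseteq> extensional B2 \<and>
        (\<forall>z\<in>Z. \<forall>z'\<in>Z. \<forall>p\<in>P2. \<bar>\<Sum>b\<in>B2. L p b * real_of_int (z b - z' b)\<bar> < s p)"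
      using pigeonhole_linear_forms[OF fin2 cards(2) \<open>C > 0\<close> CL spos vol] ..
    then have Z: "finite Z" "card Z > M" "Z \<subseteq> extensional B2"
      "\<And>z z' p. z \<in> Z \<Longrightarrow> z' \<in> Z \<Longrightarrow> p \<in> P2 \<Longrightarrow> \<bar>\<Sum>b\<in>B2. L p b * real_of_int (z b - z' b)\<bar> < s p"
      by auto
    define V where "V = (\<lambda>z::'k \<times> 2 \<Rightarrow> int. (\<Sum>b\<in>B. of_int (z (b, 1)) * b, \<Sum>b\<in>B. of_int (z (b, 2)) * b))"
    have Vint: "int_vec (V z)" for z
      unfolding int_vec_def V_def fst_conv snd_conv
      by (intro conjI algebraic_int_sum algebraic_int_times B algebraic_int_of_int)
    have Vdiff: "V z - V z' = V (\<lambda>b. z b - z' b)" for z z'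
      by (simp add: V_def sum_subtractf left_diff_distrib)
    have V0: "V z - V z' \<noteq> 0" if zz: "z \<in> Z" "z' \<in> Z" "z \<noteq> z'" for z z'
    proof
      assume "V z - V z' = 0"
      then have "V (\<lambda>b. z b - z' b) = 0" by (simp only: Vdiff)
      then have 0: "(\<Sum>b\<in>B. of_int (z (b, 1) - z' (b, 1)) * b) = 0" "(\<Sum>b\<in>B. of_int (z (b, 2) - z' (b, 2)) * b) = 0"
        by (simp_all only: V_def zero_prod_def prod.inject)
      have "z be = z' be" if mem: "be \<in> B2" for be
      proof -
        obtain b a where be: "be = (b,a)" "b \<in> B" using mem by (auto simp: B2_def)
        have "z (b, 1) - z' (b, 1) = 0" "z (b, 2) - z' (b, 2) = 0"
          using rational_basis_int_independent[OF B(1) 0(1) be(2)] rational_basis_int_independent[OF B(1) 0(2) be(2)] .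
        moreover have "a = 1 \<or> a = 2" using exhaust_2 by blast
        ultimately show ?thesis using be by auto
      qed
      then have "z = z'" using Z(3) zz by (intro extensionalityI[of z B2 z']) auto
      then show False using zz by simp
    qed
    have partapp: "part b' (app g (V z) j a) = (\<Sum>be\<in>B2. L ((j,b'),a) be * real_of_int (z be))" for z j b' a
    proof -
      have "app g (V z) j a = (\<Sum>b\<in>B. \<Sum>e\<in>(UNIV::2 set). (g j $ a $ e * \<sigma> j b) * of_real (real_of_int (z (b, e))))"
        by (simp add: app_def V_def emb_sum[OF emb] emb_mult[OF emb] emb_of_int[OF emb] UNIV_2 sum.distrib sum_distrib_left mult_ac)
      also have "\<dots> = (\<Sum>be\<in>B2. (g j $ a $ (snd be) * \<sigma> j (fst be)) * of_real (real_of_int (z be)))"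
        unfolding B2_def by (simp add: sum.cartesian_product case_prod_unfold)
      finally show ?thesis by (simp only: part_sum part_mult_of_real L_def fst_conv snd_conv)
    qed
    have small: "wt w j a * norm (app g (V z - V z') j a) < 2 * S" if zz: "z \<in> Z" "z' \<in> Z" for z z' j a
    proof -
      have "norm (app g (V z - V z') j a) < 2 * (S * inverse (wt w j a))"
      proof (rule norm_less_of_parts)
        fix b' assume "(j, b') \<in> forms"
        then have "((j,b'),a) \<in> P2" by (simp add: P2_def)
        from Z(4)[OF zz this] show "\<bar>part b' (app g (V z - V z') j a)\<bar> < S * inverse (wt w j a)"
          unfolding Vdiff partapp by (simp add: s_def)
      next
        assume r: "real_place j"
        then have "\<sigma> j x \<in> \<real>" for x by (auto simp: real_place_def)
        then show "app g (V z - V z') j a \<in> \<real>" unfolding app_def by (intro Reals_add Reals_mult g(2) r) auto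
      qed
      then show ?thesis using wp[of j a] by (simp add: field_simps)
    qed
    obtain z0 where z0: "z0 \<in> Z" using Z(2) by (metis card.empty equals0I not_less0)
    have "\<exists>z\<in>Z. \<exists>z'\<in>Z. det2 (V z - V z0) (V z' - V z0) \<noteq> 0"
    proof (rule ccontr)
      assume "\<not> ?thesis"
      then have dep: "det2 (V z - V z0) (V z' - V z0) = 0" if "z \<in> Z" "z' \<in> Z" for z z' using that by blast
      have "M \<ge> 1" using T1 M(1) by linarith
      then have "card Z > 1" using Z(2) by linarith
      then obtain z1 where z1: "z1 \<in> Z" "z1 \<noteq> z0" using Z(1) z0 by (metis card_le_Suc0_iff_eq not_less One_nat_def)
      define u where "u = V z1 - V z0"
      have u: "u \<noteq> 0" unfolding u_def by (rule V0[OF z1(1) z0 z1(2)])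
      define rw where "rw = (\<lambda>j. if wt w j 2 * norm (app g u j 2) \<le> wt w j 1 * norm (app g u j 1) then 1 else (2::2))"
      define val where "val = (\<lambda>z j. of_real (wt w j (rw j)) * app g (V z - V z0) j (rw j))"
      define cell where "cell = (\<lambda>z. \<lambda>p\<in>forms. \<lfloor>2 * part (snd p) (val z (fst p)) / \<epsilon>\<rfloor>)"
      define Y where "Y = PiE forms (\<lambda>_. {\<lfloor>- (4 * S / \<epsilon>)\<rfloor>..\<lfloor>4 * S / \<epsilon>\<rfloor>})"
      have "cell ` Z \<subseteq> Y"
      proof
        fix y assume "y \<in> cell ` Z"
        then obtain z where z: "z \<in> Z" "y = cell z" by blast
        have "\<lfloor>2 * part (snd p) (val z (fst p)) / \<epsilon>\<rfloor> \<in> {\<lfloor>- (4 * S / \<epsilon>)\<rfloor>..\<lfloor>4 * S / \<epsilon>\<rfloor>}" for p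
        proof -
          have "\<bar>part (snd p) (val z (fst p))\<bar> \<le> norm (val z (fst p))" by (rule abs_part_le)
          also have "\<dots> \<le> 2 * S"
            using small[OF z(1) z0, of "fst p" "rw (fst p)"] wp[of "fst p" "rw (fst p)"]
            by (simp add: val_def norm_mult)
          finally have "\<bar>2 * part (snd p) (val z (fst p)) / \<epsilon>\<bar> \<le> 4 * S / \<epsilon>"
            using eps by (simp add: abs_mult divide_right_mono)
          then have "- (4 * S / \<epsilon>) \<le> 2 * part (snd p) (val z (fst p)) / \<epsilon>" "2 * part (snd p) (val z (fst p)) / \<epsilon> \<le> 4 * S / \<epsilon>"
            by linarith+
          then show ?thesis by (auto intro: floor_mono)
        qed
        then show "y \<in> Y" unfolding z(2) cell_def Y_def by auto
      qed
      then have sub: "cell ` Z \<subseteq> Y" .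
      have inj: "inj_on cell Z"
      proof (rule inj_onI, rule ccontr)
        fix z z' assume zz: "z \<in> Z" "z' \<in> Z" "cell z = cell z'" "z \<noteq> z'"
        define d where "d = V z - V z'"
        have "d \<noteq> 0" unfolding d_def by (rule V0[OF zz(1,2,4)])
        have "det2 d u = det2 (V z - V z0) (V z1 - V z0) - det2 (V z' - V z0) (V z1 - V z0)"
          by (simp add: det2_def d_def u_def algebra_simps)
        then have du: "det2 d u = 0" using dep[OF zz(1) z1(1)] dep[OF zz(2) z1(1)] by simp
        have dr: "wt w j (rw j) * norm (app g d j (rw j)) < \<epsilon>" for j
        proof -
          have eq: "val z j - val z' j = of_real (wt w j (rw j)) * app g d j (rw j)"
            by (simp add: val_def d_def app_diff algebra_simps)
          have "norm (val z j - val z' j) < 2 * (\<epsilon> / 2)"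
          proof (rule norm_less_of_parts)
            fix b' assume f: "(j, b') \<in> forms"
            have "cell z (j,b') = cell z' (j,b')" using zz by simp
            then have "\<lfloor>2 * part b' (val z j) / \<epsilon>\<rfloor> = \<lfloor>2 * part b' (val z' j) / \<epsilon>\<rfloor>"
              using f by (simp add: cell_def)
            then have "\<bar>2 * part b' (val z j) / \<epsilon> - 2 * part b' (val z' j) / \<epsilon>\<bar> < 1" by linarith
            then have "\<bar>2 * (part b' (val z j) - part b' (val z' j)) / \<epsilon>\<bar> < 1"
              by (simp add: diff_divide_distrib right_diff_distrib)
            then have "\<bar>2 * (part b' (val z j) - part b' (val z' j))\<bar> < \<epsilon>"
              using eps by (simp only: abs_divide abs_of_pos divide_less_eq_1_pos)
            then have "2 * \<bar>part b' (val z j) - part b' (val z' j)\<bar> < \<epsilon>"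
              by (simp only: abs_mult abs_numeral)
            then have "\<bar>part b' (val z j) - part b' (val z' j)\<bar> < \<epsilon> / 2" by simp
            then show "\<bar>part b' (val z j - val z' j)\<bar> < \<epsilon> / 2" by (simp add: part_def split: if_splits)
          next
            assume r: "real_place j"
            then have "\<sigma> j x \<in> \<real>" for x by (auto simp: real_place_def)
            then show "val z j - val z' j \<in> \<real>" unfolding eq app_def
              by (intro Reals_add Reals_mult g(2) r) auto
          qed
          then show ?thesis using wp[of j "rw j"] unfolding eq by (simp add: norm_mult)
        qed
        have "wt w j a * norm (app g d j a) < \<epsilon>" for j a
        proof -
          have "wt w j a * norm (app g d j a) \<le> wt w j (rw j) * norm (app g d j (rw j))"
            by (rule parallel_row[of g j w u d "rw j" a, OF g(1) w u du]) (simp only: rw_def)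
          then show ?thesis using dr[of j] by (rule order.strict_trans1)
        qed
        moreover have "int_vec d" unfolding d_def by (intro int_vec_diff Vint)
        ultimately have "short_vec g w \<epsilon>" using \<open>d \<noteq> 0\<close> unfolding short_vec_def by blast
        then show False using ns by simp
      qed
      have "finite Y" unfolding Y_def by (intro finite_PiE finite_forms) auto
      then have "card Z \<le> card Y" by (rule card_inj_on_le[OF inj sub])
      then have "real (card Z) \<le> real (card Y)" by simp
      also have "real (card Y) \<le> (10 * S / \<epsilon>) ^ n"
      proof -
        define X where "X = 4 * S / \<epsilon>"
        have "X \<ge> 4" using S(1) eps by (simp add: X_def field_simps)
        then have "\<lfloor>- X\<rfloor> \<le> \<lfloor>X\<rfloor>" by (intro floor_mono) simp
        then have "real (card {\<lfloor>- X\<rfloor>..\<lfloor>X\<rfloor>}) = of_int (\<lfloor>X\<rfloor> - \<lfloor>- X\<rfloor> + 1)" by simp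
        also have "\<dots> \<le> 5 / 2 * X" using \<open>X \<ge> 4\<close> by linarith
        finally have "real (card {\<lfloor>- X\<rfloor>..\<lfloor>X\<rfloor>}) ^ n \<le> (5 / 2 * X) ^ n" by (intro power_mono) auto
        moreover have "card Y = card {\<lfloor>- X\<rfloor>..\<lfloor>X\<rfloor>} ^ n"
          by (simp add: Y_def card_PiE[OF finite_forms] n_def X_def)
        ultimately show ?thesis by (simp add: X_def)
      qed
      also have "\<dots> \<le> real M" by (rule M(1))
      finally show False using Z(2) by simp
    qed
    then obtain z z' where zz: "z \<in> Z" "z' \<in> Z" "det2 (V z - V z0) (V z' - V z0) \<noteq> 0" by blast
    show "\<exists>u v. int_vec u \<and> int_vec v \<and> det2 u v \<noteq> 0 \<and>
       (\<forall>j a. wt w j a * norm (app g u j a) \<le> 2 * S \<and> wt w j a * norm (app g v j a) \<le> 2 * S)"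
      using zz(3) small[OF zz(1) z0] small[OF zz(2) z0]
      by (intro exI[of _ "V z - V z0"] exI[of _ "V z' - V z0"]) (auto intro!: int_vec_diff Vint less_imp_le)
  qed
qed

lemma matrix_apply_app:
  "(g j ** map_matrix (\<sigma> j) A) $ a $ b = app g (A $ 1 $ b, A $ 2 $ b) j a"
  by (simp add: matrix_matrix_mult_def sum_2 app_def map_matrix_def)

text \<open>
  A version of Mahler's criterion that yields reduced bases over the ring of integers without
  any assumption on its class number: the two short vectors \<open>u n\<close>, \<open>v
  n\<close> need not span \<open>O\<^sup>2\<close>. However, their determinants take one value
  \<open>\<delta>\<close> infinitely often, and infinitely many of the pairs agree modulo
  \<open>\<delta>\<close>. The matrix that carries one such pair to a fixed one is in
  \<open>SL\<^sub>2(O)\<close>, and it is as short as the pair itself.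
\<close>
lemma bounded_returns:
  fixes w :: "nat \<Rightarrow> 'r \<Rightarrow> real"
  assumes g: "\<And>j. det (g j) = 1" "\<And>j a b. real_place j \<Longrightarrow> g j $ a $ b \<in> \<real>" and eps: "\<epsilon> > 0"
    and w: "\<And>n j. w n j > 0" and N: "infinite N" "\<And>n. n \<in> N \<Longrightarrow> \<not> short_vec g (w n) \<epsilon>"
  shows "\<exists>R. infinite {n\<in>N. \<exists>A\<in>carrier (SL2 {x. algebraic_int x}).
      \<forall>j a b. wt (w n) j a * norm ((g j ** map_matrix (\<sigma> j) A) $ a $ b) \<le> R}"
proof -
  obtain R where R: "\<forall>w. (\<forall>j. w j > 0) \<longrightarrow> \<not> short_vec g w \<epsilon> \<longrightarrow>
     (\<exists>u v. int_vec u \<and> int_vec v \<and> det2 u v \<noteq> 0 \<and>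
       (\<forall>j a. wt w j a * norm (app g u j a) \<le> R \<and> wt w j a * norm (app g v j a) \<le> R))"
    using two_independent_vectors[OF g eps] ..
  have "\<forall>n\<in>N. \<exists>u v. int_vec u \<and> int_vec v \<and> det2 u v \<noteq> 0 \<and>
       (\<forall>j a. wt (w n) j a * norm (app g u j a) \<le> R \<and> wt (w n) j a * norm (app g v j a) \<le> R)"
  proof
    fix n assume "n \<in> N"
    from R[THEN spec, of "w n"] show "\<exists>u v. int_vec u \<and> int_vec v \<and> det2 u v \<noteq> 0 \<and>
       (\<forall>j a. wt (w n) j a * norm (app g u j a) \<le> R \<and> wt (w n) j a * norm (app g v j a) \<le> R)"
      using w N(2)[OF \<open>n \<in> N\<close>] by simp
  qed
  from bchoice[OF this] obtain u where "\<forall>n\<in>N. \<exists>v. int_vec (u n) \<and> int_vec v \<and> det2 (u n) v \<noteq> 0 \<and>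
       (\<forall>j a. wt (w n) j a * norm (app g (u n) j a) \<le> R \<and> wt (w n) j a * norm (app g v j a) \<le> R)" ..
  from bchoice[OF this] obtain v where uv: "\<forall>n\<in>N. int_vec (u n) \<and> int_vec (v n) \<and> det2 (u n) (v n) \<noteq> 0 \<and>
       (\<forall>j a. wt (w n) j a * norm (app g (u n) j a) \<le> R \<and> wt (w n) j a * norm (app g (v n) j a) \<le> R)" ..
  define \<Delta> where "\<Delta> = (\<lambda>n. det2 (u n) (v n))"
  have wp: "wt (w n) j a > 0" for n j a by (rule wt_pos[OF w])
  have bnd: "norm (\<sigma> j (\<Delta> n)) \<le> 2 * R\<^sup>2" if n: "n \<in> N" for n j
  proof -
    define x where "x = (\<lambda>p a. wt (w n) j a * norm (app g p j a))"
    have wt12: "wt (w n) j 1 * wt (w n) j 2 = 1" using w[of n j] by (simp add: wt_def)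
    have x: "x (u n) a \<le> R" "x (v n) a \<le> R" "x p a \<ge> 0" for a p
      using uv n wp[of n j a] by (auto simp: x_def)
    have R0: "R \<ge> 0" using x(1)[of 1] x(3)[of "u n" 1] by linarith
    have "norm (\<sigma> j (\<Delta> n)) \<le> norm (app g (u n) j 1) * norm (app g (v n) j 2) + norm (app g (u n) j 2) * norm (app g (v n) j 1)"
      unfolding \<Delta>_def app_det[of g j "u n" "v n", OF g(1), symmetric]
      by (metis norm_triangle_ineq4 norm_mult)
    also have "\<dots> = (wt (w n) j 1 * wt (w n) j 2) * (norm (app g (u n) j 1) * norm (app g (v n) j 2) + norm (app g (u n) j 2) * norm (app g (v n) j 1))"
      by (simp only: wt12 mult_1)
    also have "\<dots> = x (u n) 1 * x (v n) 2 + x (u n) 2 * x (v n) 1"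
      by (simp add: x_def algebra_simps)
    also have "\<dots> \<le> R * R + R * R" using R0 by (intro add_mono mult_mono x) auto
    finally show ?thesis by (simp add: power2_eq_square)
  qed
  have int: "algebraic_int (fst (u n))" "algebraic_int (snd (u n))" "algebraic_int (fst (v n))" "algebraic_int (snd (v n))"
    if "n \<in> N" for n using uv that by (auto simp: int_vec_def)
  have "\<Delta> ` N \<subseteq> {x. algebraic_int x \<and> (\<forall>i. norm (\<sigma> i x) \<le> 2 * R\<^sup>2)}"
    using bnd int by (auto simp: \<Delta>_def det2_def intro!: algebraic_int_diff algebraic_int_times)
  then have "finite (\<Delta> ` N)" using finite_bounded finite_subset by blast
  from pigeonhole_infinite[OF N(1) this] obtain n1 where n1: "n1 \<in> N" "infinite {n\<in>N. \<Delta> n = \<Delta> n1}" by auto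
  define \<delta> where "\<delta> = \<Delta> n1"
  have \<delta>0: "\<delta> \<noteq> 0" using uv n1(1) by (simp add: \<delta>_def \<Delta>_def)
  obtain cls :: "'k \<Rightarrow> ('k \<Rightarrow> int) \<times> 'k" where cls: "finite (cls ` {x. algebraic_int x})"
    "\<And>x y. algebraic_int x \<Longrightarrow> algebraic_int y \<Longrightarrow> cls x = cls y \<Longrightarrow> algebraic_int ((x - y) / \<delta>)"
    using finite_residues[OF \<delta>0] by blast
  define N1 where "N1 = {n\<in>N. \<Delta> n = \<delta>}"
  define key where "key = (\<lambda>n. (cls (fst (u n)), cls (snd (u n)), cls (fst (v n)), cls (snd (v n))))"
  define F where "F = cls ` {x. algebraic_int x}"
  have "key ` N1 \<subseteq> F \<times> F \<times> F \<times> F"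
    using int by (auto simp: key_def N1_def F_def)
  moreover have "finite (F \<times> F \<times> F \<times> F)" using cls(1) by (simp add: F_def)
  ultimately have "finite (key ` N1)" by (rule finite_subset)
  moreover have "infinite N1" using n1(2) by (simp add: N1_def \<delta>_def)
  ultimately obtain n0 where n0: "n0 \<in> N1" "infinite {n\<in>N1. key n = key n0}"
    using pigeonhole_infinite[of N1 key] by auto
  define p q r s where pqrs: "p = fst (u n0)" "q = snd (u n0)" "r = fst (v n0)" "s = snd (v n0)"
  have d0: "p * s - q * r = \<delta>" using n0(1) by (simp add: N1_def \<Delta>_def det2_def pqrs)
  define X where "X = (\<Sum>j\<in>UNIV. \<Sum>z\<in>{p,q,r,s}. norm (\<sigma> j (z / \<delta>)))"
  have X: "norm (\<sigma> j (z / \<delta>)) \<le> X" if "z \<in> {p,q,r,s}" for j z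
  proof -
    have "norm (\<sigma> j (z / \<delta>)) \<le> (\<Sum>z\<in>{p,q,r,s}. norm (\<sigma> j (z / \<delta>)))"
      by (rule member_le_sum[OF that]) auto
    also have "\<dots> \<le> X" unfolding X_def by (rule member_le_sum) (auto intro: sum_nonneg)
    finally show ?thesis .
  qed
  have intp: "algebraic_int p" "algebraic_int q" "algebraic_int r" "algebraic_int s"
    using int n0(1) by (auto simp: pqrs N1_def)
  have main: "\<exists>A\<in>carrier (SL2 {x. algebraic_int x}).
      \<forall>j a b. wt (w n) j a * norm ((g j ** map_matrix (\<sigma> j) A) $ a $ b) \<le> R * X + R * X"
    if n: "n \<in> {n\<in>N1. key n = key n0}" for n
  proof -
    have nN: "n \<in> N" "\<Delta> n = \<delta>" using n by (auto simp: N1_def)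
    define a b c d where abcd: "a = fst (u n)" "b = snd (u n)" "c = fst (v n)" "d = snd (v n)"
    have dn: "a * d - b * c = \<delta>" using nN(2) by (simp add: \<Delta>_def det2_def abcd)
    have clseq: "cls a = cls p" "cls b = cls q" "cls c = cls r" "cls d = cls s"
      using n by (auto simp: key_def abcd pqrs)
    have intn: "algebraic_int a" "algebraic_int b" "algebraic_int c" "algebraic_int d"
      using int nN(1) by (auto simp: abcd)
    have D: "algebraic_int ((a - p) / \<delta>)" "algebraic_int ((b - q) / \<delta>)" "algebraic_int ((c - r) / \<delta>)" "algebraic_int ((d - s) / \<delta>)"
      using cls(2) clseq intn intp by blast+
    define A :: "'k^2^2" where "A = vector [vector [(a * s - c * q) / \<delta>, (c * p - a * r) / \<delta>], vector [(b * s - d * q) / \<delta>, (d * p - b * r) / \<delta>]]"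
    have A: "A $ 1 $ 1 = (a * s - c * q) / \<delta>" "A $ 1 $ 2 = (c * p - a * r) / \<delta>"
      "A $ 2 $ 1 = (b * s - d * q) / \<delta>" "A $ 2 $ 2 = (d * p - b * r) / \<delta>"
      by (simp_all add: A_def)
    have "(a * s - c * q) / \<delta> = 1 + ((a - p) / \<delta> * s - (c - r) / \<delta> * q)"
      using \<delta>0 d0 by (simp add: field_simps)
    moreover have "(c * p - a * r) / \<delta> = (c - r) / \<delta> * p - (a - p) / \<delta> * r"
      using \<delta>0 by (simp add: field_simps)
    moreover have "(b * s - d * q) / \<delta> = (b - q) / \<delta> * s - (d - s) / \<delta> * q"
      using \<delta>0 by (simp add: field_simps)
    moreover have "(d * p - b * r) / \<delta> = 1 + ((d - s) / \<delta> * p - (b - q) / \<delta> * r)"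
      using \<delta>0 d0 by (simp add: field_simps)
    moreover have "algebraic_int (1 :: 'k)" using algebraic_int_of_nat[of 1] by simp
    ultimately have Aint: "algebraic_int (A $ i $ j)" for i j
      using exhaust_2[of i] exhaust_2[of j] A
      by (auto simp del: times_divide_eq_left intro!: algebraic_int_plus algebraic_int_diff algebraic_int_times D intp)
    have "det A = ((a * d - b * c) * (p * s - q * r)) / \<delta>\<^sup>2"
      using \<delta>0 by (simp add: det_2 A power2_eq_square field_simps)
    then have "det A = 1" using \<delta>0 by (simp add: dn d0 power2_eq_square)
    then have "A \<in> carrier (SL2 {x. algebraic_int x})" using Aint by (simp add: SL2_def)
    moreover have "wt (w n) j i * norm ((g j ** map_matrix (\<sigma> j) A) $ i $ l) \<le> R * X + R * X" for j i l
    proof -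
      have bd: "wt (w n) j i * norm (app g (u n) j i) \<le> R" "wt (w n) j i * norm (app g (v n) j i) \<le> R"
        using uv nN(1) by auto
      have R0: "R \<ge> 0" using bd(1) wp[of n j i] by (meson dual_order.trans less_imp_le mult_nonneg_nonneg norm_ge_zero)
      have comb: "wt (w n) j i * norm (app g (u n) j i * \<sigma> j (y / \<delta>) - app g (v n) j i * \<sigma> j (z / \<delta>)) \<le> R * X + R * X"
        if yz: "y \<in> {p,q,r,s}" "z \<in> {p,q,r,s}" for y z
      proof -
        have "wt (w n) j i * norm (app g (u n) j i * \<sigma> j (y / \<delta>) - app g (v n) j i * \<sigma> j (z / \<delta>))
            \<le> wt (w n) j i * (norm (app g (u n) j i) * norm (\<sigma> j (y / \<delta>)) + norm (app g (v n) j i) * norm (\<sigma> j (z / \<delta>)))"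
          using wp[of n j i] by (intro mult_left_mono) (metis norm_triangle_ineq4 norm_mult, simp)
        also have "\<dots> = (wt (w n) j i * norm (app g (u n) j i)) * norm (\<sigma> j (y / \<delta>)) + (wt (w n) j i * norm (app g (v n) j i)) * norm (\<sigma> j (z / \<delta>))"
          by (simp add: algebra_simps)
        also have "\<dots> \<le> R * X + R * X"
          using R0 by (intro add_mono mult_mono bd X yz) auto
        finally show ?thesis .
      qed
      have cols: "app g (A $ 1 $ 1, A $ 2 $ 1) j i = app g (u n) j i * \<sigma> j (s / \<delta>) - app g (v n) j i * \<sigma> j (q / \<delta>)"
        "app g (A $ 1 $ 2, A $ 2 $ 2) j i = - (app g (u n) j i * \<sigma> j (r / \<delta>) - app g (v n) j i * \<sigma> j (p / \<delta>))"
        unfolding A app_def fst_conv snd_conv abcd[symmetric]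
        by (simp_all add: emb_divide[OF emb] emb_diff[OF emb] emb_mult[OF emb] diff_divide_distrib algebra_simps)
      show ?thesis
        using exhaust_2[of l] comb[of s q] comb[of r p]
        by (auto simp: matrix_apply_app cols norm_minus_commute simp del: minus_diff_eq)
    qed
    ultimately show ?thesis by blast
  qed
  have "infinite {n\<in>N. \<exists>A\<in>carrier (SL2 {x. algebraic_int x}).
      \<forall>j a b. wt (w n) j a * norm ((g j ** map_matrix (\<sigma> j) A) $ a $ b) \<le> R * X + R * X}"
  proof (rule infinite_super[OF _ n0(2)])
    show "{n\<in>N1. key n = key n0} \<subseteq> {n\<in>N. \<exists>A\<in>carrier (SL2 {x. algebraic_int x}).
      \<forall>j a b. wt (w n) j a * norm ((g j ** map_matrix (\<sigma> j) A) $ a $ b) \<le> R * X + R * X}"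
    proof
      fix n assume n: "n \<in> {n\<in>N1. key n = key n0}"
      then have "n \<in> N" by (simp add: N1_def)
      then show "n \<in> {n\<in>N. \<exists>A\<in>carrier (SL2 {x. algebraic_int x}).
        \<forall>j a b. wt (w n) j a * norm ((g j ** map_matrix (\<sigma> j) A) $ a $ b) \<le> R * X + R * X}"
        using main[OF n] by simp
    qed
  qed
  then show ?thesis ..
qed

end

section \<open>The groups, their diagonal subgroups and normalizers\<close>

lemma mat2_eq_iff:
  "(A :: 'a^2^2) = B \<longleftrightarrow> A$1$1 = B$1$1 \<and> A$1$2 = B$1$2 \<and> A$2$1 = B$2$1 \<and> A$2$2 = B$2$2"
  by (simp add: vec_eq_iff forall_2)

lemma mat2_mult: "((A :: 'a::semiring_1^2^2) ** B) $ i $ j = A$i$1 * B$1$j + A$i$2 * B$2$j"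
  by (simp add: matrix_matrix_mult_def sum_2)

lemma mat2_one: "(mat 1 :: 'a::semiring_1^2^2) $ 1 $ 1 = 1" "(mat 1 :: 'a::semiring_1^2^2) $ 1 $ 2 = 0"
  "(mat 1 :: 'a::semiring_1^2^2) $ 2 $ 1 = 0" "(mat 1 :: 'a::semiring_1^2^2) $ 2 $ 2 = 1"
  by (simp_all add: mat_def)

text \<open>
  The adjugate, which inverts matrices of determinant \<open>1\<close>. Unlike
  \<open>matrix_inv\<close> it is polynomial in the entries.
\<close>
definition adj2 :: "'a::comm_ring_1^2^2 \<Rightarrow> 'a^2^2" where
  "adj2 A = vector [vector [A$2$2, - A$1$2], vector [- A$2$1, A$1$1]]"

lemma adj2_nth: "adj2 A $ 1 $ 1 = A$2$2" "adj2 A $ 1 $ 2 = - A$1$2" "adj2 A $ 2 $ 1 = - A$2$1" "adj2 A $ 2 $ 2 = A$1$1"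
  by (simp_all add: adj2_def)

lemma adj2_mult: "det A = 1 \<Longrightarrow> adj2 A ** A = mat 1" "det A = 1 \<Longrightarrow> A ** adj2 A = mat 1"
  by (simp_all add: mat2_eq_iff mat2_mult mat2_one adj2_nth det_2 algebra_simps)

lemma adj2_cancel:
  assumes "det A = 1"
  shows "B ** A ** adj2 A = B" "B ** adj2 A ** A = B"
  by (simp_all add: matrix_mul_assoc[symmetric] adj2_mult[OF assms])

lemma adj2_cancel_left:
  assumes "det A = 1"
  shows "adj2 A ** (A ** B) = B" "A ** (adj2 A ** B) = B"
  by (simp_all add: matrix_mul_assoc adj2_mult[OF assms])

lemma det_adj2: "det (adj2 A) = det A"
  by (simp add: det_2 adj2_nth)

definition ring_closed :: "'a::comm_ring_1 set \<Rightarrow> bool" where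
  "ring_closed F \<longleftrightarrow> 0 \<in> F \<and> 1 \<in> F \<and> (\<forall>x\<in>F. - x \<in> F) \<and> (\<forall>x\<in>F. \<forall>y\<in>F. x + y \<in> F \<and> x * y \<in> F)"

lemma SL2_carrier: "A \<in> carrier (SL2 F) \<longleftrightarrow> (\<forall>i j. A $ i $ j \<in> F) \<and> det A = 1"
  by (simp add: SL2_def)

lemma SL2_mult: "A \<otimes>\<^bsub>SL2 F\<^esub> B = A ** B" and SL2_one: "\<one>\<^bsub>SL2 F\<^esub> = mat 1"
  by (simp_all add: SL2_def)

lemma SL2_mult_closed: "ring_closed F \<Longrightarrow> A \<in> carrier (SL2 F) \<Longrightarrow> B \<in> carrier (SL2 F) \<Longrightarrow> A ** B \<in> carrier (SL2 F)"
  by (auto simp: SL2_carrier ring_closed_def mat2_mult det_mul)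

lemma SL2_adj2_closed: "ring_closed F \<Longrightarrow> A \<in> carrier (SL2 F) \<Longrightarrow> adj2 A \<in> carrier (SL2 F)"
  by (auto simp: SL2_carrier ring_closed_def forall_2 adj2_nth det_adj2)

lemma SL2_one_closed: "ring_closed F \<Longrightarrow> mat 1 \<in> carrier (SL2 F)"
  by (auto simp: SL2_carrier ring_closed_def forall_2 mat2_one)

lemma SL2_group: "ring_closed F \<Longrightarrow> group (SL2 F)"
proof (rule groupI)
  fix A assume "ring_closed F" "A \<in> carrier (SL2 F)"
  then show "\<exists>B\<in>carrier (SL2 F). B \<otimes>\<^bsub>SL2 F\<^esub> A = \<one>\<^bsub>SL2 F\<^esub>"
    by (intro bexI[of _ "adj2 A"] SL2_adj2_closed) (auto simp: SL2_mult SL2_one adj2_mult SL2_carrier)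
qed (auto simp: SL2_mult SL2_one SL2_mult_closed SL2_one_closed matrix_mul_assoc)

lemma ring_closed_UNIV: "ring_closed UNIV"
  by (simp add: ring_closed_def)

lemma ring_closed_algebraic_int: "ring_closed {x::'a::field_char_0. algebraic_int x}"
  using algebraic_int_of_nat[of 1, where 'a = 'a]
  by (auto simp: ring_closed_def algebraic_int_plus algebraic_int_times)

definition dg :: "complex \<Rightarrow> complex^2^2" where
  "dg t = vector [vector [t, 0], vector [0, inverse t]]"

lemma dg_nth: "dg t $ 1 $ 1 = t" "dg t $ 1 $ 2 = 0" "dg t $ 2 $ 1 = 0" "dg t $ 2 $ 2 = inverse t"
  by (simp_all add: dg_def)

lemma dg_mult: "dg s ** dg t = dg (s * t)"
  by (simp add: mat2_eq_iff mat2_mult dg_nth)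

lemma dg_one: "dg 1 = mat 1"
  by (simp add: mat2_eq_iff dg_nth mat2_one)

lemma det_dg: "t \<noteq> 0 \<Longrightarrow> det (dg t) = 1"
  by (simp add: det_2 dg_nth)

lemma adj2_dg: "adj2 (dg t) = dg (inverse t)"
  by (simp add: mat2_eq_iff dg_nth adj2_nth)

lemma dg_mult_left: "(dg t ** A) $ 1 $ j = t * A $ 1 $ j" "(dg t ** A) $ 2 $ j = inverse t * A $ 2 $ j"
  by (simp_all add: mat2_mult dg_nth)

definition monomial :: "complex^2^2 \<Rightarrow> bool" where
  "monomial A \<longleftrightarrow> A$1$2 = 0 \<and> A$2$1 = 0 \<or> A$1$1 = 0 \<and> A$2$2 = 0"

text \<open>
  The off-diagonal entries of the conjugate are \<open>A$1$1 * A$1$2\<close> and \<open>A$2$1 *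
  A$2$2\<close>, up to the nonzero factor \<open>t - inverse t\<close>.
\<close>
lemma monomial_if_conj_diag:
  assumes "det A = 1" "t * t \<noteq> 1" "t \<noteq> 0" and off: "(A ** dg t ** adj2 A) $ 1 $ 2 = 0" "(A ** dg t ** adj2 A) $ 2 $ 1 = 0"
  shows "monomial A"
proof -
  have ne: "t \<noteq> inverse t" using assms(2,3) by (metis right_inverse)
  have "A$1$1 * A$1$2 * (inverse t - t) = 0" "A$2$1 * A$2$2 * (t - inverse t) = 0"
    using off by (simp_all add: mat2_mult dg_nth adj2_nth algebra_simps)
  then have z: "A$1$1 = 0 \<or> A$1$2 = 0" "A$2$1 = 0 \<or> A$2$2 = 0" using ne by auto
  have "A$1$1 * A$2$2 - A$1$2 * A$2$1 = 1" using assms(1) by (simp add: det_2)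
  then show ?thesis using z by (auto simp: monomial_def)
qed

lemma monomial_conj_dg:
  assumes "monomial A" "det A = 1"
  shows "A ** dg t ** adj2 A = dg t \<or> A ** dg t ** adj2 A = dg (inverse t)"
proof -
  have d: "A$1$1 * A$2$2 - A$1$2 * A$2$1 = 1" using assms(2) by (simp add: det_2)
  consider "A$1$2 = 0" "A$2$1 = 0" | "A$1$1 = 0" "A$2$2 = 0" using assms(1) by (auto simp: monomial_def)
  then show ?thesis
  proof cases
    case 1
    then have d': "A$1$1 * A$2$2 = 1" using d by simp
    have "A$1$1 * t * A$2$2 = (A$1$1 * A$2$2) * t" "A$2$2 * inverse t * A$1$1 = (A$1$1 * A$2$2) * inverse t"
      by (simp_all add: mult_ac)
    then have "A ** dg t ** adj2 A = dg t" using 1 d' by (simp add: mat2_eq_iff mat2_mult dg_nth adj2_nth)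
    then show ?thesis ..
  next
    case 2
    then have d': "- (A$1$2 * A$2$1) = 1" using d by simp
    have "- (A$1$2 * inverse t * A$2$1) = - (A$1$2 * A$2$1) * inverse t" "- (A$2$1 * t * A$1$2) = - (A$1$2 * A$2$1) * t"
      by (simp_all add: mult_ac)
    then have "- (A$1$2 * inverse t * A$2$1) = inverse t" "- (A$2$1 * t * A$1$2) = t"
      unfolding d' by simp_all
    then have "A ** dg t ** adj2 A = dg (inverse t)" using 2 by (simp add: mat2_eq_iff mat2_mult dg_nth adj2_nth)
    then show ?thesis ..
  qed
qed

lemma exp_of_real_square_neq_1:
  assumes "\<tau> \<noteq> 0"
  shows "exp (of_real \<tau>) * exp (of_real \<tau>) \<noteq> (1::complex)"
proof -
  have "exp (of_real \<tau>) * exp (of_real \<tau>) = (of_real (exp (\<tau> + \<tau>)) :: complex)"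
    by (simp only: exp_of_real of_real_mult[symmetric] mult_exp_exp)
  moreover have "exp (\<tau> + \<tau>) \<noteq> 1" using assms by simp
  ultimately show ?thesis by (simp only: of_real_eq_1_iff not_False_eq_True)
qed

lemma monomial_mult: "monomial A \<Longrightarrow> monomial B \<Longrightarrow> monomial (A ** B)"
  by (auto simp: monomial_def mat2_mult)

lemma monomial_adj2: "monomial A \<Longrightarrow> monomial (adj2 A)"
  by (auto simp: monomial_def adj2_nth)

lemma continuous_on_mat2:
  "continuous_on S (f :: _ \<Rightarrow> complex^2^2) \<longleftrightarrow> (\<forall>i j. continuous_on S (\<lambda>x. f x $ i $ j))"
proof
  assume "continuous_on S f"
  then show "\<forall>i j. continuous_on S (\<lambda>x. f x $ i $ j)" by (intro allI continuous_intros)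
next
  assume *: "\<forall>i j. continuous_on S (\<lambda>x. f x $ i $ j)"
  have "continuous_on S (\<lambda>x. \<chi> i. \<chi> j. f x $ i $ j)"
    using * by (intro continuous_on_vec_lambda) auto
  then show "continuous_on S f" by simp
qed

lemma continuous_on_dg_exp: "continuous_on S (\<lambda>z. dg (exp z))"
  unfolding continuous_on_mat2
proof (intro allI)
  fix i j :: 2
  have "continuous_on S (\<lambda>z. exp z :: complex)" "continuous_on S (\<lambda>z. inverse (exp z) :: complex)"
    by (auto intro!: continuous_intros)
  then show "continuous_on S (\<lambda>z. dg (exp z) $ i $ j)"
    using exhaust_2[of i] exhaust_2[of j] by (auto simp: dg_nth)
qed

context archimedean_places
begin

abbreviation K :: "'r \<Rightarrow> complex set" where "K i \<equiv> completion (\<sigma> i)"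

lemma range_subset_K: "\<sigma> i x \<in> K i"
  unfolding completion_def by (intro subsetD[OF closure_subset] rangeI)

lemma closed_K: "closed (K i)"
  by (simp add: completion_def)

lemma Reals_subset_K: "\<real> \<subseteq> K i"
proof
  fix z :: complex assume "z \<in> \<real>"
  then obtain x where z: "z = of_real x" by (auto elim: Reals_cases)
  show "z \<in> K i"
    unfolding completion_def closure_approachable
  proof (intro allI impI)
    fix e :: real assume "e > 0"
    then obtain q where q: "x - e < of_rat q" "of_rat q < x"
      using of_rat_dense[of "x - e" x] by auto
    have "dist (\<sigma> i (of_rat q)) z = \<bar>of_rat q - x\<bar>"
      unfolding z emb_of_rat[OF emb] of_rat_complex dist_norm of_real_diff[symmetric] norm_of_real ..
    also have "\<dots> < e" using q by linarith
    finally show "\<exists>y\<in>range (\<sigma> i). dist y z < e" by blast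
  qed
qed

lemma K_real: "real_place i \<Longrightarrow> K i = \<real>"
  using Reals_subset_K[of i] closure_minimal[of "range (\<sigma> i)" "\<real>"] closed_complex_Reals
  by (auto simp: real_place_def completion_def)

text \<open>
  The image of \<open>K\<close> contains the rational numbers and a number that is not real, so
  its closure contains the real plane spanned by \<open>1\<close> and that number.
\<close>
lemma K_complex:
  assumes "\<not> real_place i"
  shows "K i = UNIV"
proof -
  obtain x0 where "\<sigma> i x0 \<notin> \<real>" using assms by (auto simp: real_place_def)
  then have im: "Im (\<sigma> i x0) \<noteq> 0" by (simp add: complex_is_Real_iff)
  have "z \<in> K i" for z
  proof -
    define b where "b = Im z / Im (\<sigma> i x0)"
    define a where "a = Re z - b * Re (\<sigma> i x0)"
    have z: "z = of_real a + of_real b * \<sigma> i x0"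
      using im by (simp add: complex_eq_iff a_def b_def)
    have "of_real a \<in> closure (range (\<sigma> i))" "of_real b \<in> closure (range (\<sigma> i))"
      using Reals_subset_K[of i] by (auto simp: completion_def)
    then obtain s t where s: "\<forall>n. s n \<in> range (\<sigma> i)" "s \<longlonglongrightarrow> of_real a" and t: "\<forall>n. t n \<in> range (\<sigma> i)" "t \<longlonglongrightarrow> of_real b"
      unfolding closure_sequential by blast
    have mem: "s n + t n * \<sigma> i x0 \<in> range (\<sigma> i)" for n
    proof -
      obtain x y where "s n = \<sigma> i x" "t n = \<sigma> i y" using s t by blast
      then have "s n + t n * \<sigma> i x0 = \<sigma> i (x + y * x0)" by (simp add: emb_add[OF emb] emb_mult[OF emb])
      then show ?thesis by simp
    qed
    have lim: "(\<lambda>n. s n + t n * \<sigma> i x0) \<longlonglongrightarrow> z"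
      unfolding z by (intro tendsto_intros s t)
    show ?thesis unfolding completion_def closure_sequential
      using mem lim by (intro exI[of _ "\<lambda>n. s n + t n * \<sigma> i x0"]) simp
  qed
  then show ?thesis by blast
qed

lemma ring_closed_K: "ring_closed (K i)"
  by (cases "real_place i") (auto simp: K_real K_complex ring_closed_def)

lemma K_inverse: "z \<in> K i \<Longrightarrow> inverse z \<in> K i"
  by (cases "real_place i") (auto simp: K_real K_complex)

lemma K_exp: "z \<in> K i \<Longrightarrow> exp z \<in> K i"
  by (cases "real_place i") (auto simp: K_real K_complex elim!: Reals_cases simp flip: exp_of_real)

lemma K_scaleR: "z \<in> K i \<Longrightarrow> of_real t * z \<in> K i"
  by (cases "real_place i") (auto simp: K_real K_complex)

lemma K_of_real: "of_real t \<in> K i"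
  using Reals_subset_K[of i] by auto

lemma convex_K: "convex (K i)"
proof (cases "real_place i")
  case True
  then show ?thesis by (auto simp: K_real convex_alt elim!: Reals_cases simp: scaleR_conv_of_real simp flip: of_real_diff of_real_mult of_real_add)
qed (simp add: K_complex)

lemma G_carrier: "g \<in> carrier (G \<sigma>) \<longleftrightarrow> (\<forall>i. g i \<in> carrier (SL2 (K i)))"
  by (auto simp: G_def PiE_UNIV_domain)

lemma G_mult: "g \<otimes>\<^bsub>G \<sigma>\<^esub> h = (\<lambda>i. g i ** h i)"
  by (simp add: G_def SL2_mult restrict_def)

lemma G_one: "\<one>\<^bsub>G \<sigma>\<^esub> = (\<lambda>i. mat 1)"
  by (simp add: G_def SL2_one restrict_def)

lemma G_group: "group (G \<sigma>)"
  unfolding G_def by (intro product_group SL2_group ring_closed_K)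

sublocale GG: group "G \<sigma>" by (rule G_group)

lemma G_det: "g \<in> carrier (G \<sigma>) \<Longrightarrow> det (g i) = 1"
  by (simp add: G_carrier SL2_carrier)

lemma G_entry: "g \<in> carrier (G \<sigma>) \<Longrightarrow> g i $ a $ b \<in> K i"
  by (simp add: G_carrier SL2_carrier)

lemma G_inv: "g \<in> carrier (G \<sigma>) \<Longrightarrow> inv\<^bsub>G \<sigma>\<^esub> g = (\<lambda>i. adj2 (g i))"
  by (rule GG.inv_equality)
    (auto simp: G_mult G_one adj2_mult G_det G_carrier intro: SL2_adj2_closed ring_closed_K)

lemma G_adj2_closed: "g \<in> carrier (G \<sigma>) \<Longrightarrow> (\<lambda>i. adj2 (g i)) \<in> carrier (G \<sigma>)"
  by (auto simp: G_carrier intro: SL2_adj2_closed ring_closed_K)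

lemma G_mult_closed: "g \<in> carrier (G \<sigma>) \<Longrightarrow> h \<in> carrier (G \<sigma>) \<Longrightarrow> (\<lambda>i. g i ** h i) \<in> carrier (G \<sigma>)"
  by (auto simp: G_carrier intro: SL2_mult_closed ring_closed_K)

lemma emb_mat_mult: "map_matrix (\<sigma> i) (A ** B) = map_matrix (\<sigma> i) A ** map_matrix (\<sigma> i) B" for A B :: "'k^2^2"
  by (simp add: mat2_eq_iff mat2_mult emb_add[OF emb] emb_mult[OF emb])

lemma emb_mat_adj2: "map_matrix (\<sigma> i) (adj2 A) = adj2 (map_matrix (\<sigma> i) A)" for A :: "'k^2^2"
  by (simp add: mat2_eq_iff adj2_nth emb_minus[OF emb])

lemma emb_mat_det: "det (map_matrix (\<sigma> i) A) = \<sigma> i (det A)" for A :: "'k^2^2"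
  by (simp add: det_2 emb_diff[OF emb] emb_mult[OF emb])

lemma emb_mat_closed: "A \<in> carrier (SL2 UNIV) \<Longrightarrow> diagonal_embedding \<sigma> A \<in> carrier (G \<sigma>)"
  by (auto simp: G_carrier SL2_carrier diagonal_embedding_def range_subset_K emb_mat_det emb_1[OF emb])

abbreviation SLO :: "('k^2^2) set" where "SLO \<equiv> carrier (SL2 {x. algebraic_int x})"

lemma SLO_subset: "SLO \<subseteq> carrier (SL2 UNIV)"
  by (auto simp: SL2_carrier)

lemma Gamma_subset: "\<Gamma> \<sigma> \<subseteq> carrier (G \<sigma>)"
  unfolding \<Gamma>_def using SLO_subset emb_mat_closed by auto

lemma Gamma_subgroup: "subgroup (\<Gamma> \<sigma>) (G \<sigma>)"
proof (rule GG.subgroupI)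
  show "\<Gamma> \<sigma> \<subseteq> carrier (G \<sigma>)" by (rule Gamma_subset)
  show "\<Gamma> \<sigma> \<noteq> {}" unfolding \<Gamma>_def using SL2_one_closed[OF ring_closed_algebraic_int] by blast
  fix a assume a: "a \<in> \<Gamma> \<sigma>"
  then obtain A where A: "A \<in> SLO" "a = diagonal_embedding \<sigma> A" by (auto simp: \<Gamma>_def)
  have "inv\<^bsub>G \<sigma>\<^esub> a = diagonal_embedding \<sigma> (adj2 A)"
    unfolding G_inv[OF subsetD[OF Gamma_subset a]] by (simp add: A(2) diagonal_embedding_def emb_mat_adj2)
  then show "inv\<^bsub>G \<sigma>\<^esub> a \<in> \<Gamma> \<sigma>"
    unfolding \<Gamma>_def by (rule image_eqI) (rule SL2_adj2_closed[OF ring_closed_algebraic_int A(1)])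
  fix b assume "b \<in> \<Gamma> \<sigma>"
  then obtain B where B: "B \<in> SLO" "b = diagonal_embedding \<sigma> B" by (auto simp: \<Gamma>_def)
  have "a \<otimes>\<^bsub>G \<sigma>\<^esub> b = diagonal_embedding \<sigma> (A ** B)"
    by (simp add: G_mult A B diagonal_embedding_def emb_mat_mult)
  then show "a \<otimes>\<^bsub>G \<sigma>\<^esub> b \<in> \<Gamma> \<sigma>"
    unfolding \<Gamma>_def by (rule image_eqI) (rule SL2_mult_closed[OF ring_closed_algebraic_int A(1) B(1)])
qed

lemma Gamma_countable: "countable (\<Gamma> \<sigma>)"
proof -
  have "countable (UNIV :: 'k set)" by (rule number_field_countable[OF nf])
  then have c: "countable (UNIV \<times> UNIV \<times> UNIV \<times> UNIV :: ('k \<times> 'k \<times> 'k \<times> 'k) set)"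
    by (intro countable_SIGMA)
  have "(UNIV :: ('k^2^2) set) \<subseteq> (\<lambda>(a,b,c,d). vector [vector [a,b], vector [c,d]]) ` (UNIV \<times> UNIV \<times> UNIV \<times> UNIV)"
  proof
    fix A :: "'k^2^2"
    show "A \<in> (\<lambda>(a,b,c,d). vector [vector [a,b], vector [c,d]]) ` (UNIV \<times> UNIV \<times> UNIV \<times> UNIV)"
      by (rule image_eqI[of _ _ "(A$1$1, A$1$2, A$2$1, A$2$2)"]) (auto simp: mat2_eq_iff)
  qed
  then have "countable (UNIV :: ('k^2^2) set)"
    by (rule countable_subset) (rule countable_image[OF c])
  then have "countable SLO" by (rule countable_subset[OF subset_UNIV])
  then show ?thesis unfolding \<Gamma>_def by (rule countable_image)
qed

text \<open>
  At a complex place every diagonal matrix is an exponential. At a real place the sign of the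
  entry cannot change along the connected component.
\<close>
lemma diagonal_component:
  "connected_component_set (diagonal_subgroup (K i)) (mat 1) = (\<lambda>z. dg (exp z)) ` K i" (is "?C = ?E")
proof
  have zero: "0 \<in> K i" using ring_closed_K[of i] by (simp add: ring_closed_def)
  have "mat 1 = dg (exp 0)" by (simp add: dg_one)
  then have one: "mat 1 \<in> ?E" using zero by (rule image_eqI)
  have sub: "?E \<subseteq> diagonal_subgroup (K i)"
    using K_exp[of _ i] K_inverse[of _ i] ring_closed_K[of i]
    by (auto simp: diagonal_subgroup_def SL2_carrier forall_2 dg_nth det_dg ring_closed_def)
  have "connected ?E"
    by (rule connected_continuous_image[OF continuous_on_dg_exp convex_connected[OF convex_K]])
  then show "?E \<subseteq> ?C" by (rule connected_component_maximal[OF one _ sub])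
  show "?C \<subseteq> ?E"
  proof
    fix A assume A: "A \<in> ?C"
    then have "A \<in> diagonal_subgroup (K i)" using connected_component_subset by blast
    then have A': "A$1$1 \<in> K i" "A$1$2 = 0" "A$2$1 = 0" "A$1$1 * A$2$2 = 1"
      by (auto simp: diagonal_subgroup_def SL2_carrier det_2)
    then have Adg: "A = dg (A$1$1)" by (auto simp: mat2_eq_iff dg_nth intro: inverse_unique[symmetric])
    have ne: "A$1$1 \<noteq> 0" using A'(4) by auto
    have "\<exists>z\<in>K i. A$1$1 = exp z"
    proof (cases "real_place i")
      case False
      then show ?thesis using ne by (auto simp: K_complex intro: exI[of _ "Ln (A$1$1)"])
    next
      case True
      have conn: "connected ((\<lambda>A. Re (A$1$1)) ` ?C)"
        by (intro connected_continuous_image connected_connected_component continuous_intros)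
      have "0 \<notin> (\<lambda>A. Re (A$1$1)) ` ?C"
      proof
        assume "0 \<in> (\<lambda>A. Re (A$1$1)) ` ?C"
        then obtain B where B: "B \<in> ?C" "Re (B$1$1) = 0" by auto
        then have "B \<in> diagonal_subgroup (K i)" using connected_component_subset by blast
        then have "B$1$1 \<in> \<real>" "B$1$1 * B$2$2 = 1"
          using K_real[OF True] by (auto simp: diagonal_subgroup_def SL2_carrier det_2)
        then have "B$1$1 \<noteq> 0" "Im (B$1$1) = 0" by (auto simp: complex_is_Real_iff)
        then show False using B(2) by (simp add: complex_eq_iff)
      qed
      moreover have "mat 1 \<in> ?C"
        using one sub by (intro subsetD[OF connected_component_maximal[OF one \<open>connected ?E\<close> sub]])
      then have "1 \<in> (\<lambda>A. Re (A$1$1)) ` ?C" by (intro image_eqI[of _ _ "mat 1"]) (auto simp: mat2_one)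
      moreover have "Re (A$1$1) \<in> (\<lambda>A. Re (A$1$1)) ` ?C" using A by blast
      ultimately have "Re (A$1$1) > 0"
        using connectedD_interval[OF conn, of "Re (A$1$1)" 1 0] by (meson not_less zero_le_one)
      moreover have "A$1$1 = of_real (Re (A$1$1))" using A'(1) K_real[OF True] by simp
      ultimately have "A$1$1 = exp (of_real (ln (Re (A$1$1))))" by (simp add: exp_of_real)
      then show ?thesis using K_of_real by blast
    qed
    then show "A \<in> ?E" using Adg by auto
  qed
qed

lemma D_iff: "g \<in> D \<sigma> I \<longleftrightarrow> (\<forall>i\<in>I. \<exists>z\<in>K i. g i = dg (exp z)) \<and> (\<forall>i. i \<notin> I \<longrightarrow> g i = mat 1)"
proof -
  have "g \<in> carrier (G \<sigma>)" if gI: "\<forall>i\<in>I. \<exists>z\<in>K i. g i = dg (exp z)" and gnI: "\<forall>i. i \<notin> I \<longrightarrow> g i = mat 1"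
    unfolding G_carrier
  proof
    fix i
    show "g i \<in> carrier (SL2 (K i))"
    proof (cases "i \<in> I")
      case True
      then obtain z where "z \<in> K i" "g i = dg (exp z)" using gI by blast
      then show ?thesis using K_exp[of z i] K_inverse[of "exp z" i] ring_closed_K[of i]
        by (auto simp: SL2_carrier forall_2 dg_nth det_dg ring_closed_def)
    qed (use gnI SL2_one_closed[OF ring_closed_K] in auto)
  qed
  then show ?thesis unfolding D_def diagonal_component by blast
qed

lemma D_subset: "D \<sigma> I \<subseteq> carrier (G \<sigma>)"
  by (auto simp: D_def)

lemma D_normal_form: "(\<lambda>i. if i \<in> I then dg (exp (z i)) else mat 1) \<in> D \<sigma> I" if "\<And>i. z i \<in> K i"
  using that by (auto simp: D_iff)

lemma conj_in_D:
  assumes h: "\<forall>i\<in>I. monomial (h i)" "\<And>i. det (h i) = 1" and d: "d \<in> D \<sigma> I"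
  shows "(\<lambda>i. h i ** d i ** adj2 (h i)) \<in> D \<sigma> I"
  unfolding D_iff
proof (intro conjI ballI allI impI)
  fix i assume i: "i \<in> I"
  then obtain z where z: "z \<in> K i" "d i = dg (exp z)" using d D_iff by blast
  have "- z \<in> K i" using z ring_closed_K[of i] by (simp add: ring_closed_def)
  then show "\<exists>z\<in>K i. h i ** d i ** adj2 (h i) = dg (exp z)"
    using monomial_conj_dg[of "h i" "exp z"] h i z by (auto simp: exp_minus[symmetric])
next
  fix i assume "i \<notin> I"
  then have "d i = mat 1" using d D_iff by blast
  then show "h i ** d i ** adj2 (h i) = mat 1" using adj2_mult(2)[OF h(2)] by simp
qed

text \<open>
  A monomial matrix conjugates \<open>dg t\<close> to itself or to its inverse. Conversely it
  suffices that the conjugate of one diagonal matrix with distinct eigenvalues, here \<open>dg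
  (exp 1)\<close> at all places of \<open>I\<close>, is diagonal.
\<close>
lemma normalizer_iff: "g \<in> normalizer (G \<sigma>) (D \<sigma> I) \<longleftrightarrow> g \<in> carrier (G \<sigma>) \<and> (\<forall>i\<in>I. monomial (g i))"
proof -
  have norm: "g \<in> normalizer (G \<sigma>) (D \<sigma> I) \<longleftrightarrow> g \<in> carrier (G \<sigma>) \<and>
      g <#\<^bsub>G \<sigma>\<^esub> D \<sigma> I #>\<^bsub>G \<sigma>\<^esub> inv\<^bsub>G \<sigma>\<^esub> g = D \<sigma> I"
    unfolding normalizer_def stabilizer_def using D_subset by auto
  have conj: "g <#\<^bsub>G \<sigma>\<^esub> D \<sigma> I #>\<^bsub>G \<sigma>\<^esub> inv\<^bsub>G \<sigma>\<^esub> g = (\<lambda>d i. g i ** d i ** adj2 (g i)) ` D \<sigma> I" if "g \<in> carrier (G \<sigma>)"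
    unfolding l_coset_def r_coset_def G_inv[OF that] by (auto simp: G_mult)
  show ?thesis
  proof (cases "g \<in> carrier (G \<sigma>)")
    case True
    have det: "det (g i) = 1" for i by (rule G_det[OF True])
    have "(\<lambda>d i. g i ** d i ** adj2 (g i)) ` D \<sigma> I = D \<sigma> I" if mono: "\<forall>i\<in>I. monomial (g i)"
    proof
      show "(\<lambda>d i. g i ** d i ** adj2 (g i)) ` D \<sigma> I \<subseteq> D \<sigma> I" using conj_in_D[OF mono det] by blast
      show "D \<sigma> I \<subseteq> (\<lambda>d i. g i ** d i ** adj2 (g i)) ` D \<sigma> I"
      proof
        fix d assume d: "d \<in> D \<sigma> I"
        have "(\<lambda>i. adj2 (g i) ** d i ** adj2 (adj2 (g i))) \<in> D \<sigma> I"
          by (rule conj_in_D[OF _ _ d]) (use mono det in \<open>auto simp: monomial_adj2 det_adj2\<close>)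
        moreover have "adj2 (adj2 (g i)) = g i" for i by (simp add: mat2_eq_iff adj2_nth)
        ultimately have e: "(\<lambda>i. adj2 (g i) ** d i ** g i) \<in> D \<sigma> I" by simp
        have "g i ** (adj2 (g i) ** d i ** g i) ** adj2 (g i) = d i" for i
          by (simp add: matrix_mul_assoc adj2_mult[OF det] adj2_cancel[OF det])
        then show "d \<in> (\<lambda>d i. g i ** d i ** adj2 (g i)) ` D \<sigma> I"
          by (intro image_eqI[OF _ e]) simp
      qed
    qed
    moreover have "monomial (g i)" if eq: "(\<lambda>d i. g i ** d i ** adj2 (g i)) ` D \<sigma> I = D \<sigma> I" and i: "i \<in> I" for i
    proof -
      define d where "d = (\<lambda>j. if j \<in> I then dg (exp (of_real 1)) else mat 1)"
      have "d \<in> D \<sigma> I" unfolding d_def by (rule D_normal_form[of "\<lambda>_. of_real 1" I]) (rule K_of_real)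
      then have "(\<lambda>i. g i ** d i ** adj2 (g i)) \<in> (\<lambda>d i. g i ** d i ** adj2 (g i)) ` D \<sigma> I" by (rule imageI)
      then have "(\<lambda>i. g i ** d i ** adj2 (g i)) \<in> D \<sigma> I" by (simp only: eq)
      from this[unfolded D_iff, THEN conjunct1, THEN bspec, OF i]
      obtain z where "g i ** d i ** adj2 (g i) = dg (exp z)" by auto
      moreover have "d i = dg (exp (of_real 1))" using i by (simp only: d_def if_True)
      ultimately have eq: "g i ** dg (exp (of_real 1)) ** adj2 (g i) = dg (exp z)" by (simp only:)
      show ?thesis
        by (rule monomial_if_conj_diag[OF det[of i] exp_of_real_square_neq_1[of 1]]) (simp_all only: eq dg_nth exp_not_eq_zero one_neq_zero not_False_eq_True)
    qed
    ultimately show ?thesis unfolding norm using True conj[OF True] by auto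
  qed (simp add: norm)
qed

text \<open>
  Membership in \<open>N(D\<^sub>I) G\<^sub>K\<close>, written as a condition on the components
  in \<open>I\<close> only; the components outside \<open>I\<close> are absorbed by the
  normalizer.
\<close>
definition aligned :: "'r set \<Rightarrow> ('r \<Rightarrow> complex^2^2) \<Rightarrow> bool" where
  "aligned I g \<longleftrightarrow> g \<in> carrier (G \<sigma>) \<and>
     (\<exists>q\<in>carrier (SL2 UNIV). \<forall>i\<in>I. \<exists>n. monomial n \<and> g i = n ** map_matrix (\<sigma> i) q)"

lemma normalizer_G_K_iff: "g \<in> normalizer (G \<sigma>) (D \<sigma> I) <#>\<^bsub>G \<sigma>\<^esub> G_K \<sigma> \<longleftrightarrow> aligned I g"
proof
  assume "g \<in> normalizer (G \<sigma>) (D \<sigma> I) <#>\<^bsub>G \<sigma>\<^esub> G_K \<sigma>"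
  then obtain n q where n: "n \<in> normalizer (G \<sigma>) (D \<sigma> I)" and q: "q \<in> carrier (SL2 UNIV)"
    and g: "g = n \<otimes>\<^bsub>G \<sigma>\<^esub> diagonal_embedding \<sigma> q" by (auto simp: set_mult_def G_K_def)
  then have "g \<in> carrier (G \<sigma>)" by (auto simp: normalizer_iff emb_mat_closed)
  then show "aligned I g" unfolding aligned_def
    using n q g by (auto simp: normalizer_iff G_mult diagonal_embedding_def intro!: bexI[of _ q])
next
  assume "aligned I g"
  then obtain q where g: "g \<in> carrier (G \<sigma>)" and q: "q \<in> carrier (SL2 UNIV)"
    and n: "\<forall>i\<in>I. \<exists>n. monomial n \<and> g i = n ** map_matrix (\<sigma> i) q" unfolding aligned_def by blast
  have detq: "det (map_matrix (\<sigma> i) q) = 1" for i using q by (simp add: emb_mat_det SL2_carrier emb_1[OF emb])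
  define h where "h = (\<lambda>i. g i ** adj2 (map_matrix (\<sigma> i) q))"
  have "h = g \<otimes>\<^bsub>G \<sigma>\<^esub> diagonal_embedding \<sigma> (adj2 q)"
    by (simp add: h_def G_mult diagonal_embedding_def emb_mat_adj2)
  then have "h \<in> carrier (G \<sigma>)"
    using g emb_mat_closed[OF SL2_adj2_closed[OF ring_closed_UNIV q]] by simp
  moreover have "monomial (h i)" if i: "i \<in> I" for i
  proof -
    obtain m where m: "monomial m" "g i = m ** map_matrix (\<sigma> i) q" using n i by blast
    then have "h i = m" by (simp add: h_def adj2_cancel[OF detq])
    then show ?thesis using m by simp
  qed
  ultimately have "h \<in> normalizer (G \<sigma>) (D \<sigma> I)" by (simp add: normalizer_iff)
  moreover have "g = h \<otimes>\<^bsub>G \<sigma>\<^esub> diagonal_embedding \<sigma> q"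
  proof
    fix i
    show "g i = (h \<otimes>\<^bsub>G \<sigma>\<^esub> diagonal_embedding \<sigma> q) i"
      by (simp add: G_mult h_def diagonal_embedding_def adj2_cancel[OF detq])
  qed
  moreover have "diagonal_embedding \<sigma> q \<in> G_K \<sigma>" using q by (auto simp: G_K_def)
  ultimately show "g \<in> normalizer (G \<sigma>) (D \<sigma> I) <#>\<^bsub>G \<sigma>\<^esub> G_K \<sigma>" unfolding set_mult_def by blast
qed

end

section \<open>Convergence and closures in the quotient\<close>

text \<open>
  Convergence in \<open>G\<close> is entrywise at every place.
\<close>
lemma tendsto_fun_mat2_iff:
  fixes f :: "nat \<Rightarrow> 'r \<Rightarrow> complex^2^2"
  shows "f \<longlonglongrightarrow> l \<longleftrightarrow> (\<forall>i a b. (\<lambda>n. f n i $ a $ b) \<longlonglongrightarrow> l i $ a $ b)"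
proof -
  have "f \<longlonglongrightarrow> l \<longleftrightarrow> limitin (product_topology (\<lambda>i. euclidean) UNIV) f l sequentially"
    by (simp only: euclidean_product_topology limitin_canonical_iff)
  also have "\<dots> \<longleftrightarrow> (\<forall>i. (\<lambda>n. f n i) \<longlonglongrightarrow> l i)"
    by (simp add: limitin_componentwise)
  also have "\<dots> \<longleftrightarrow> (\<forall>i a b. (\<lambda>n. f n i $ a $ b) \<longlonglongrightarrow> l i $ a $ b)"
  proof (intro iff_allI)
    fix i
    show "(\<lambda>n. f n i) \<longlonglongrightarrow> l i \<longleftrightarrow> (\<forall>a b. (\<lambda>n. f n i $ a $ b) \<longlonglongrightarrow> l i $ a $ b)"
    proof
      assume "(\<lambda>n. f n i) \<longlonglongrightarrow> l i"
      then show "\<forall>a b. (\<lambda>n. f n i $ a $ b) \<longlonglongrightarrow> l i $ a $ b" by (intro allI tendsto_vec_nth)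
    next
      assume "\<forall>a b. (\<lambda>n. f n i $ a $ b) \<longlonglongrightarrow> l i $ a $ b"
      then show "(\<lambda>n. f n i) \<longlonglongrightarrow> l i" by (intro vec_tendstoI) blast
    qed
  qed
  finally show ?thesis .
qed

lemma tendsto_fun_mult:
  fixes f h :: "nat \<Rightarrow> 'r \<Rightarrow> complex^2^2"
  assumes "f \<longlonglongrightarrow> l" "h \<longlonglongrightarrow> m"
  shows "(\<lambda>n i. f n i ** h n i) \<longlonglongrightarrow> (\<lambda>i. l i ** m i)"
proof -
  have f: "(\<lambda>n. f n i $ a $ b) \<longlonglongrightarrow> l i $ a $ b" and h: "(\<lambda>n. h n i $ a $ b) \<longlonglongrightarrow> m i $ a $ b" for i a b
    using assms unfolding tendsto_fun_mat2_iff by blast+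
  show ?thesis unfolding tendsto_fun_mat2_iff mat2_mult by (intro allI tendsto_add tendsto_mult f h)
qed

lemma tendsto_fun_adj2:
  fixes f :: "nat \<Rightarrow> 'r \<Rightarrow> complex^2^2"
  assumes "f \<longlonglongrightarrow> l"
  shows "(\<lambda>n i. adj2 (f n i)) \<longlonglongrightarrow> (\<lambda>i. adj2 (l i))"
proof -
  have f: "(\<lambda>n. f n i $ a $ b) \<longlonglongrightarrow> l i $ a $ b" for i a b
    using assms unfolding tendsto_fun_mat2_iff by blast
  show ?thesis unfolding tendsto_fun_mat2_iff forall_2 adj2_nth by (intro allI conjI tendsto_minus f)
qed

lemma bounded_convergent_subsequence_fun:
  fixes f :: "nat \<Rightarrow> 'r::finite \<Rightarrow> complex^2^2"
  assumes B: "\<And>n i a b. norm (f n i $ a $ b) \<le> B"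
  obtains l r where "strict_mono r" "(\<lambda>n. f (r n)) \<longlonglongrightarrow> l"
proof -
  define X :: "nat \<Rightarrow> complex^2^2^'r" where "X = (\<lambda>n. \<chi> i. f n i)"
  have "norm (X n) \<le> (\<Sum>i\<in>(UNIV::'r set). \<Sum>a\<in>(UNIV::2 set). \<Sum>b\<in>(UNIV::2 set). B)" for n
  proof -
    have l2: "norm x \<le> (\<Sum>i\<in>UNIV. norm (x $ i))" for x :: "('z::real_normed_vector, 'w::finite) vec"
      unfolding norm_vec_def by (rule L2_set_le_sum) simp
    have "norm (f n i) \<le> (\<Sum>a\<in>(UNIV::2 set). \<Sum>b\<in>(UNIV::2 set). B)" for i
      by (rule order_trans[OF l2]) (intro sum_mono order_trans[OF l2] B)
    then have nx: "norm (X n $ i) \<le> (\<Sum>a\<in>(UNIV::2 set). \<Sum>b\<in>(UNIV::2 set). B)" for i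
      by (simp only: X_def vec_lambda_beta)
    have "norm (X n) \<le> (\<Sum>i\<in>UNIV. norm (X n $ i))" by (rule l2)
    also have "\<dots> \<le> (\<Sum>i\<in>(UNIV::'r set). \<Sum>a\<in>(UNIV::2 set). \<Sum>b\<in>(UNIV::2 set). B)"
      by (rule sum_mono) (rule nx)
    finally show ?thesis .
  qed
  then have "bounded (range X)" unfolding bounded_iff by blast
  then obtain L r where r: "strict_mono r" "(X \<circ> r) \<longlonglongrightarrow> L"
    using bounded_imp_convergent_subsequence by blast
  have "(\<lambda>n. f (r n) i $ a $ b) \<longlonglongrightarrow> L $ i $ a $ b" for i a b
  proof -
    have "(\<lambda>n. (X \<circ> r) n $ i $ a $ b) \<longlonglongrightarrow> L $ i $ a $ b" by (intro tendsto_vec_nth r(2))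
    then show ?thesis by (simp add: X_def o_def)
  qed
  then have "(\<lambda>n. f (r n)) \<longlonglongrightarrow> (\<lambda>i. L $ i)" unfolding tendsto_fun_mat2_iff by blast
  then show thesis using that r(1) by blast
qed

lemma convergent_fun_mat2_bounded:
  fixes f :: "nat \<Rightarrow> 'r::finite \<Rightarrow> complex^2^2"
  assumes "f \<longlonglongrightarrow> l"
  obtains B where "\<And>n i a b. norm (f n i $ a $ b) \<le> B"
proof -
  have "\<exists>B. \<forall>n. norm (f n i $ a $ b) \<le> B" for i a b
  proof -
    have "convergent (\<lambda>n. f n i $ a $ b)" using assms unfolding tendsto_fun_mat2_iff convergent_def by blast
    then have "Bseq (\<lambda>n. f n i $ a $ b)" by (rule convergent_imp_Bseq)
    then show ?thesis unfolding Bseq_def by blast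
  qed
  then have "\<forall>p. \<exists>B. \<forall>n. norm (f n (fst p) $ fst (snd p) $ snd (snd p)) \<le> B" by blast
  from choice[OF this] obtain b where b: "\<forall>p n. norm (f n (fst p) $ fst (snd p) $ snd (snd p)) \<le> b p" ..
  have "norm (f n i $ a $ c) \<le> Max (range b)" for n i a c
  proof -
    have "norm (f n i $ a $ c) \<le> b (i, a, c)" using b[THEN spec, of "(i,a,c)"] by simp
    also have "\<dots> \<le> Max (range b)" by (rule Max_ge) auto
    finally show ?thesis .
  qed
  then show thesis by (rule that)
qed

context archimedean_places
begin

lemma topspace_G_top: "topspace (G_top \<sigma>) = carrier (G \<sigma>)"
  by (simp add: G_top_def)

lemma closed_G: "closed (carrier (G \<sigma>))"
  unfolding closed_sequential_limits
proof (intro allI impI)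
  fix f l assume fl: "(\<forall>n. f n \<in> carrier (G \<sigma>)) \<and> f \<longlonglongrightarrow> l"
  then have lim: "(\<lambda>n. f n i $ a $ b) \<longlonglongrightarrow> l i $ a $ b" for i a b
    unfolding tendsto_fun_mat2_iff by blast
  have "l i $ a $ b \<in> K i" for i a b
    by (rule closed_sequentially[OF closed_K _ lim]) (use fl G_entry in blast)
  moreover have "det (l i) = 1" for i
  proof -
    have "(\<lambda>n. det (f n i)) \<longlonglongrightarrow> det (l i)" unfolding det_2 by (intro tendsto_intros lim)
    moreover have "(\<lambda>n. det (f n i)) = (\<lambda>n. 1)" using fl G_det by auto
    ultimately show ?thesis using LIMSEQ_unique[OF _ tendsto_const] by metis
  qed
  ultimately show "l \<in> carrier (G \<sigma>)" by (simp add: G_carrier SL2_carrier)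
qed

lemma pi_eq: "\<pi> \<sigma> g = (\<lambda>c. g \<otimes>\<^bsub>G \<sigma>\<^esub> c) ` \<Gamma> \<sigma>"
  by (auto simp: \<pi>_def l_coset_def)

lemma one_in_Gamma: "\<one>\<^bsub>G \<sigma>\<^esub> \<in> \<Gamma> \<sigma>"
  by (rule subgroup.one_closed[OF Gamma_subgroup])

lemma pi_eq_iff:
  assumes "g \<in> carrier (G \<sigma>)" "h \<in> carrier (G \<sigma>)"
  shows "\<pi> \<sigma> g = \<pi> \<sigma> h \<longleftrightarrow> (\<exists>c\<in>\<Gamma> \<sigma>. h = g \<otimes>\<^bsub>G \<sigma>\<^esub> c)"
proof
  assume "\<pi> \<sigma> g = \<pi> \<sigma> h"
  moreover have "h \<in> \<pi> \<sigma> h" unfolding pi_eq using one_in_Gamma assms(2) by (intro image_eqI[OF _ one_in_Gamma]) simp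
  ultimately show "\<exists>c\<in>\<Gamma> \<sigma>. h = g \<otimes>\<^bsub>G \<sigma>\<^esub> c" by (auto simp: pi_eq)
next
  assume "\<exists>c\<in>\<Gamma> \<sigma>. h = g \<otimes>\<^bsub>G \<sigma>\<^esub> c"
  then have "h \<in> g <#\<^bsub>G \<sigma>\<^esub> \<Gamma> \<sigma>" by (auto simp: l_coset_def)
  then show "\<pi> \<sigma> g = \<pi> \<sigma> h" unfolding \<pi>_def using GG.l_repr_independence[OF _ assms(1) Gamma_subgroup] by blast
qed

lemma topspace_quotient: "topspace (G_mod_\<Gamma>_top \<sigma>) = \<pi> \<sigma> ` carrier (G \<sigma>)"
  by (simp add: G_mod_\<Gamma>_top_def topspace_quotient_topology topspace_G_top)

lemma openin_quotient:
  "openin (G_mod_\<Gamma>_top \<sigma>) U \<longleftrightarrow> U \<subseteq> \<pi> \<sigma> ` carrier (G \<sigma>) \<and> openin (G_top \<sigma>) {x \<in> carrier (G \<sigma>). \<pi> \<sigma> x \<in> U}"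
  by (simp add: G_mod_\<Gamma>_top_def openin_quotient_topology topspace_G_top)

lemma continuous_pi: "continuous_map (G_top \<sigma>) (G_mod_\<Gamma>_top \<sigma>) (\<pi> \<sigma>)"
  unfolding G_mod_\<Gamma>_top_def by (rule quotient_imp_continuous_map[OF quotient_map_quotient_topology])

lemma orbit_of_pi:
  assumes "H \<subseteq> carrier (G \<sigma>)" "g \<in> carrier (G \<sigma>)"
  shows "orbit_of \<sigma> H (\<pi> \<sigma> g) = \<pi> \<sigma> ` ((\<lambda>h. h \<otimes>\<^bsub>G \<sigma>\<^esub> g) ` H)"
  unfolding orbit_of_def \<pi>_def image_image
  by (intro image_cong refl) (use assms GG.lcos_m_assoc[OF Gamma_subset] in auto)

text \<open>Closures in the quotient are computed by sequences in the group.\<close>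

lemma closure_of_pi_image:
  assumes A: "A \<subseteq> carrier (G \<sigma>)" and g: "g \<in> carrier (G \<sigma>)"
  shows "\<pi> \<sigma> g \<in> G_mod_\<Gamma>_top \<sigma> closure_of (\<pi> \<sigma> ` A) \<longleftrightarrow>
    (\<exists>a c. (\<forall>n. a n \<in> A \<and> c n \<in> \<Gamma> \<sigma>) \<and> (\<lambda>n::nat. a n \<otimes>\<^bsub>G \<sigma>\<^esub> c n) \<longlonglongrightarrow> g)" (is "?L \<longleftrightarrow> ?R")
proof
  assume ?R
  then obtain a c where ac: "\<And>n. a n \<in> A" "\<And>n. c n \<in> \<Gamma> \<sigma>" "(\<lambda>n::nat. a n \<otimes>\<^bsub>G \<sigma>\<^esub> c n) \<longlonglongrightarrow> g" by auto
  show ?L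
    unfolding in_closure_of topspace_quotient
  proof (intro conjI allI impI)
    show "\<pi> \<sigma> g \<in> \<pi> \<sigma> ` carrier (G \<sigma>)" using g by blast
    fix U assume U: "\<pi> \<sigma> g \<in> U \<and> openin (G_mod_\<Gamma>_top \<sigma>) U"
    then obtain W where W: "open W" "{x \<in> carrier (G \<sigma>). \<pi> \<sigma> x \<in> U} = carrier (G \<sigma>) \<inter> W"
      unfolding openin_quotient G_top_def openin_open by blast
    then have "g \<in> W" using U g by blast
    then have "eventually (\<lambda>n. a n \<otimes>\<^bsub>G \<sigma>\<^esub> c n \<in> W) sequentially" using topological_tendstoD[OF ac(3) W(1)] by blast
    then obtain n where n: "a n \<otimes>\<^bsub>G \<sigma>\<^esub> c n \<in> W" unfolding eventually_sequentially by blast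
    have mem: "a n \<in> carrier (G \<sigma>)" "c n \<in> carrier (G \<sigma>)" using ac A Gamma_subset by blast+
    then have "a n \<otimes>\<^bsub>G \<sigma>\<^esub> c n \<in> carrier (G \<sigma>)" by simp
    then have "\<pi> \<sigma> (a n \<otimes>\<^bsub>G \<sigma>\<^esub> c n) \<in> U" using n W(2) by blast
    moreover have "\<pi> \<sigma> (a n) = \<pi> \<sigma> (a n \<otimes>\<^bsub>G \<sigma>\<^esub> c n)"
      using pi_eq_iff[of "a n" "a n \<otimes>\<^bsub>G \<sigma>\<^esub> c n"] mem ac(2) by auto
    ultimately have "\<pi> \<sigma> (a n) \<in> U" by simp
    then show "\<exists>y. y \<in> \<pi> \<sigma> ` A \<and> y \<in> U" using ac(1) by blast
  qed
next
  assume L: ?L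
  define X where "X = {a \<otimes>\<^bsub>G \<sigma>\<^esub> c | a c. a \<in> A \<and> c \<in> \<Gamma> \<sigma>}"
  have Xsub: "X \<subseteq> carrier (G \<sigma>)" using A Gamma_subset by (auto simp: X_def)
  define W where "W = carrier (G \<sigma>) - closure X"
  have inv: "x \<otimes>\<^bsub>G \<sigma>\<^esub> c \<in> closure X" if x: "x \<in> closure X" and c: "c \<in> \<Gamma> \<sigma>" for x c
  proof -
    obtain s where s: "\<forall>n. s n \<in> X" "s \<longlonglongrightarrow> x" using x unfolding closure_sequential by blast
    have "s n \<otimes>\<^bsub>G \<sigma>\<^esub> c \<in> X" for n
    proof -
      have "s n \<in> X" using s(1) by simp
      then obtain a b where ab: "s n = a \<otimes>\<^bsub>G \<sigma>\<^esub> b" "a \<in> A" "b \<in> \<Gamma> \<sigma>"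
        unfolding X_def by (elim CollectE exE conjE)
      then have "s n \<otimes>\<^bsub>G \<sigma>\<^esub> c = a \<otimes>\<^bsub>G \<sigma>\<^esub> (b \<otimes>\<^bsub>G \<sigma>\<^esub> c)"
        using A Gamma_subset c by (simp add: GG.m_assoc subset_iff)
      moreover have "b \<otimes>\<^bsub>G \<sigma>\<^esub> c \<in> \<Gamma> \<sigma>" using subgroup.m_closed[OF Gamma_subgroup ab(3) c] .
      ultimately show ?thesis using ab(2) by (auto simp: X_def)
    qed
    moreover have "(\<lambda>n. s n \<otimes>\<^bsub>G \<sigma>\<^esub> c) \<longlonglongrightarrow> x \<otimes>\<^bsub>G \<sigma>\<^esub> c"
      unfolding G_mult by (rule tendsto_fun_mult[OF s(2) tendsto_const])
    ultimately show ?thesis unfolding closure_sequential by (intro exI[of _ "\<lambda>n. s n \<otimes>\<^bsub>G \<sigma>\<^esub> c"] conjI allI)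
  qed
  have pre: "{x \<in> carrier (G \<sigma>). \<pi> \<sigma> x \<in> \<pi> \<sigma> ` W} = W"
  proof (intro equalityI subsetI)
    fix x assume x': "x \<in> {x \<in> carrier (G \<sigma>). \<pi> \<sigma> x \<in> \<pi> \<sigma> ` W}"
    then have x: "x \<in> carrier (G \<sigma>)" and "\<pi> \<sigma> x \<in> \<pi> \<sigma> ` W" by simp_all
    then obtain y where y: "y \<in> W" "\<pi> \<sigma> x = \<pi> \<sigma> y" by (elim imageE)
    then have yc: "y \<in> carrier (G \<sigma>)" by (simp add: W_def)
    obtain c where c: "c \<in> \<Gamma> \<sigma>" "y = x \<otimes>\<^bsub>G \<sigma>\<^esub> c"
      using y(2) unfolding pi_eq_iff[OF x yc] by (elim bexE)
    have "x \<notin> closure X"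
    proof
      assume "x \<in> closure X"
      then have "y \<in> closure X" unfolding c(2) using c(1) by (rule inv)
      then show False using y by (simp add: W_def)
    qed
    then show "x \<in> W" using x by (simp add: W_def)
  qed (auto simp: W_def)
  have "openin (G_top \<sigma>) W"
  proof -
    have "W = carrier (G \<sigma>) \<inter> (- closure X)" by (auto simp: W_def)
    then show ?thesis unfolding G_top_def openin_open using open_Compl[OF closed_closure[of X]] by blast
  qed
  then have op: "openin (G_mod_\<Gamma>_top \<sigma>) (\<pi> \<sigma> ` W)"
    unfolding openin_quotient pre by (auto simp: W_def)
  have "g \<notin> W"
  proof
    assume "g \<in> W"
    then have "\<pi> \<sigma> g \<in> \<pi> \<sigma> ` W" by blast
    then have "\<exists>y. y \<in> \<pi> \<sigma> ` A \<and> y \<in> \<pi> \<sigma> ` W"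
      using op L[unfolded in_closure_of, THEN conjunct2, THEN spec, of "\<pi> \<sigma> ` W"] by simp
    then obtain y where y: "y \<in> \<pi> \<sigma> ` A" "y \<in> \<pi> \<sigma> ` W" by (elim exE conjE)
    obtain a where a: "a \<in> A" "y = \<pi> \<sigma> a" using y(1) by (elim imageE)
    obtain w where w: "w \<in> W" "y = \<pi> \<sigma> w" using y(2) by (elim imageE)
    have aw: "a \<in> A" "w \<in> W" "\<pi> \<sigma> w = \<pi> \<sigma> a" using a w by simp_all
    have wc: "w \<in> carrier (G \<sigma>)" and ac: "a \<in> carrier (G \<sigma>)" using aw A by (auto simp: W_def)
    obtain c where c: "c \<in> \<Gamma> \<sigma>" "w = a \<otimes>\<^bsub>G \<sigma>\<^esub> c"
      using aw(3)[symmetric] unfolding pi_eq_iff[OF ac wc] by (elim bexE)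
    then have "w \<in> X" using aw(1) by (auto simp: X_def)
    then show False using aw(2) closure_subset[of X] by (auto simp: W_def)
  qed
  then have "g \<in> closure X" using g by (simp add: W_def)
  then obtain s where s: "\<forall>n. s n \<in> X" "s \<longlonglongrightarrow> g" unfolding closure_sequential by blast
  have "\<exists>p. s n = fst p \<otimes>\<^bsub>G \<sigma>\<^esub> snd p \<and> fst p \<in> A \<and> snd p \<in> \<Gamma> \<sigma>" for n
  proof -
    have "s n \<in> X" using s(1) by simp
    then obtain a b where "s n = a \<otimes>\<^bsub>G \<sigma>\<^esub> b" "a \<in> A" "b \<in> \<Gamma> \<sigma>"
      unfolding X_def by (elim CollectE exE conjE)
    then show ?thesis by (intro exI[of _ "(a, b)"]) simp
  qed
  then have "\<forall>n. \<exists>p. s n = fst p \<otimes>\<^bsub>G \<sigma>\<^esub> snd p \<and> fst p \<in> A \<and> snd p \<in> \<Gamma> \<sigma>" ..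
  from choice[OF this] obtain p where p: "\<forall>n. s n = fst (p n) \<otimes>\<^bsub>G \<sigma>\<^esub> snd (p n) \<and> fst (p n) \<in> A \<and> snd (p n) \<in> \<Gamma> \<sigma>" ..
  then have "s = (\<lambda>n. fst (p n) \<otimes>\<^bsub>G \<sigma>\<^esub> snd (p n))" by blast
  then show ?R using p s(2) by (intro exI[of _ "\<lambda>n. fst (p n)"] exI[of _ "\<lambda>n. snd (p n)"]) simp
qed

text \<open>
  Differences of late terms are small at all places.
\<close>
lemma convergent_algebraic_ints_eventually_const:
  assumes x: "\<And>n. algebraic_int (x n)" and lim: "\<And>i. convergent (\<lambda>n. \<sigma> i (x n))"
  obtains N where "\<And>n. n \<ge> N \<Longrightarrow> x n = x (N::nat)"
proof -
  obtain c where c: "c > 0" "\<And>x. algebraic_int x \<Longrightarrow> (\<And>j. norm (\<sigma> j x) < c) \<Longrightarrow> x = 0"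
    using not_all_small by blast
  have "\<exists>N. \<forall>m\<ge>N. \<forall>n\<ge>N. norm (\<sigma> i (x m) - \<sigma> i (x n)) < c" for i
    using convergent_Cauchy[OF lim[of i]] c(1) unfolding Cauchy_iff by blast
  then have "\<forall>i. \<exists>N. \<forall>m\<ge>N. \<forall>n\<ge>N. norm (\<sigma> i (x m) - \<sigma> i (x n)) < c" by blast
  from choice[OF this] obtain N where N: "\<forall>i. \<forall>m\<ge>N i. \<forall>n\<ge>N i. norm (\<sigma> i (x m) - \<sigma> i (x n)) < c" ..
  define M where "M = Max (range N)"
  have M: "N i \<le> M" for i unfolding M_def by (rule Max_ge) auto
  show thesis
  proof (rule that[of M])
    fix n assume n: "n \<ge> M"
    have "x n - x M = 0"
    proof (rule c(2))
      show "algebraic_int (x n - x M)" by (intro algebraic_int_diff x)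
      fix j
      show "norm (\<sigma> j (x n - x M)) < c"
        unfolding emb_diff[OF emb] using N M[of j] n by (meson order_trans)
    qed
    then show "x n = x M" by simp
  qed
qed

lemma Gamma_convergent_eventually_const:
  assumes c: "\<And>n. c n \<in> \<Gamma> \<sigma>" and lim: "c \<longlonglongrightarrow> l"
  shows "\<exists>N. \<forall>n\<ge>N. c n = c (N::nat)"
proof -
  have "\<forall>n. \<exists>A. A \<in> SLO \<and> c n = diagonal_embedding \<sigma> A" using c by (auto simp: \<Gamma>_def)
  from choice[OF this] obtain A where A: "\<forall>n. A n \<in> SLO \<and> c n = diagonal_embedding \<sigma> (A n)" ..
  have "\<exists>N. \<forall>n\<ge>N. A n $ a $ b = A N $ a $ b" for a b
  proof -
    have "convergent (\<lambda>n. \<sigma> i (A n $ a $ b))" for i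
    proof -
      have "(\<lambda>n. c n i $ a $ b) \<longlonglongrightarrow> l i $ a $ b" using lim unfolding tendsto_fun_mat2_iff by blast
      then show ?thesis using A by (auto simp: diagonal_embedding_def convergent_def)
    qed
    moreover have "algebraic_int (A n $ a $ b)" for n using A by (auto simp: SL2_carrier)
    ultimately obtain N where "\<And>n. n \<ge> N \<Longrightarrow> A n $ a $ b = A N $ a $ b"
      using convergent_algebraic_ints_eventually_const[of "\<lambda>n. A n $ a $ b"] by blast
    then show ?thesis by blast
  qed
  then have "\<forall>p. \<exists>N. \<forall>n\<ge>N. A n $ fst p $ snd p = A N $ fst p $ snd p" by blast
  from choice[OF this] obtain N where N: "\<forall>p. \<forall>n\<ge>N p. A n $ fst p $ snd p = A (N p) $ fst p $ snd p" ..
  define M where "M = Max (range N)"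
  have M: "N p \<le> M" for p unfolding M_def by (rule Max_ge) auto
  have "A n = A M" if n: "n \<ge> M" for n
  proof -
    have "A n $ a $ b = A M $ a $ b" for a b
    proof -
      have "A n $ fst (a,b) $ snd (a,b) = A (N (a,b)) $ fst (a,b) $ snd (a,b)"
        using N M[of "(a,b)"] n order_trans by blast
      moreover have "A M $ fst (a,b) $ snd (a,b) = A (N (a,b)) $ fst (a,b) $ snd (a,b)"
        using N M[of "(a,b)"] by blast
      ultimately show ?thesis by simp
    qed
    then show ?thesis by (simp add: vec_eq_iff)
  qed
  then have "c n = c M" if "n \<ge> M" for n using A that by metis
  then show ?thesis by (intro exI[of _ M] allI impI)
qed

section \<open>Divergent orbits\<close>

lemma exp_image_K: "(\<exists>z\<in>K i. t = exp z) \<longleftrightarrow> t \<in> K i \<and> t \<noteq> 0 \<and> (real_place i \<longrightarrow> Re t > 0)"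
proof
  assume "\<exists>z\<in>K i. t = exp z"
  then obtain z where z: "z \<in> K i" "t = exp z" by blast
  then show "t \<in> K i \<and> t \<noteq> 0 \<and> (real_place i \<longrightarrow> Re t > 0)"
    using K_exp[OF z(1)] by (auto simp: K_real exp_of_real elim!: Reals_cases)
next
  assume t: "t \<in> K i \<and> t \<noteq> 0 \<and> (real_place i \<longrightarrow> Re t > 0)"
  show "\<exists>z\<in>K i. t = exp z"
  proof (cases "real_place i")
    case True
    have tr: "t = of_real (Re t)" using t True by (simp add: K_real)
    have "Re t > 0" using t True by simp
    then have "exp (of_real (ln (Re t))) = (of_real (Re t) :: complex)" by (simp add: exp_of_real)
    then have "t = exp (of_real (ln (Re t)))" using tr by (simp only:)
    then show ?thesis by (rule bexI[OF _ K_of_real])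
  next
    case False
    then have "Ln t \<in> K i" by (simp add: K_complex)
    moreover have "t = exp (Ln t)" using t by simp
    ultimately show ?thesis by (rule bexI[rotated])
  qed
qed

lemma D_entry: "d \<in> D \<sigma> I \<Longrightarrow> i \<in> I \<Longrightarrow> \<exists>z\<in>K i. d i = dg (exp z)"
  and D_outside: "d \<in> D \<sigma> I \<Longrightarrow> i \<notin> I \<Longrightarrow> d i = mat 1"
  by (simp_all add: D_iff)

lemma D_offdiag:
  assumes d: "d \<in> D \<sigma> I"
  shows "d j $ 1 $ 2 = 0" "d j $ 2 $ 1 = 0"
proof -
  have "d j $ 1 $ 2 = 0 \<and> d j $ 2 $ 1 = 0"
  proof (cases "j \<in> I")
    case True
    then obtain z where "d j = dg (exp z)" using D_entry[OF d] by auto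
    then show ?thesis by (simp add: dg_nth)
  next
    case False
    then show ?thesis using D_outside[OF d] by (simp add: mat2_one)
  qed
  then show "d j $ 1 $ 2 = 0" "d j $ 2 $ 1 = 0" by simp_all
qed

text \<open>
  Positivity of the entries at real places survives in the limit, because the determinant is
  \<open>1\<close>.
\<close>
lemma D_limit:
  assumes d: "\<And>n. d n \<in> D \<sigma> I" and lim: "d \<longlonglongrightarrow> l"
  shows "l \<in> D \<sigma> I"
  unfolding D_iff
proof (intro conjI ballI allI impI)
  have entry: "(\<lambda>n. d n i $ a $ b) \<longlonglongrightarrow> l i $ a $ b" for i a b
    using lim unfolding tendsto_fun_mat2_iff by blast
  have det: "det (l i) = 1" for i
    by (rule G_det[OF closed_sequentially[OF closed_G _ lim]]) (rule subsetD[OF D_subset d])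
  have off: "l i $ 1 $ 2 = 0" "l i $ 2 $ 1 = 0" for i
    using entry[of i 1 2] entry[of i 2 1] D_offdiag[OF d] by (simp_all add: LIMSEQ_const_iff)
  {
    fix i assume i: "i \<in> I"
    have prod: "l i $ 1 $ 1 * l i $ 2 $ 2 = 1" using det[of i] off by (simp add: det_2)
    have t: "d n i $ 1 $ 1 \<in> K i \<and> d n i $ 1 $ 1 \<noteq> 0 \<and> (real_place i \<longrightarrow> Re (d n i $ 1 $ 1) > 0)" for n
    proof -
      obtain z where "z \<in> K i" "d n i = dg (exp z)" using D_entry[OF d[of n] i] by blast
      then show ?thesis using exp_image_K[of i "exp z"] by (auto simp: dg_nth)
    qed
    have "l i $ 1 $ 1 \<in> K i" by (rule closed_sequentially[OF closed_K _ entry]) (use t in blast)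
    moreover have "Re (l i $ 1 $ 1) > 0" if r: "real_place i"
    proof -
      have "Re (l i $ 1 $ 1) \<ge> 0"
        by (rule LIMSEQ_le_const[OF tendsto_Re[OF entry]]) (use t r less_imp_le in blast)
      moreover have "l i $ 1 $ 1 \<noteq> 0" using prod by auto
      moreover have "Im (l i $ 1 $ 1) = 0" using \<open>l i $ 1 $ 1 \<in> K i\<close> K_real[OF r] by (simp add: complex_is_Real_iff)
      ultimately show ?thesis by (auto simp: complex_eq_iff)
    qed
    ultimately obtain z where z: "z \<in> K i" "l i $ 1 $ 1 = exp z"
      using exp_image_K[of i "l i $ 1 $ 1"] prod by auto
    have "l i $ 2 $ 2 = inverse (exp z)" using prod z(2) by (simp add: inverse_unique)
    then have "l i = dg (exp z)" using off z(2) by (simp add: mat2_eq_iff dg_nth)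
    then show "\<exists>z\<in>K i. l i = dg (exp z)" using z(1) by blast
  next
    fix i assume i: "i \<notin> I"
    have "l i $ a $ b = mat 1 $ a $ b" for a b
      using entry[of i a b] D_outside[OF d i] by (simp add: LIMSEQ_const_iff)
    then show "l i = mat 1" by (simp add: vec_eq_iff)
  }
qed

text \<open>
  The columns of \<open>inverse q\<close>, cleared of denominators, are integral vectors that
  \<open>g\<close> maps at the place \<open>i\<close> to multiples of the columns of
  \<open>n\<close>.
\<close>
lemma scaled_columns_of_integral_vectors:
  assumes q: "q \<in> carrier (SL2 UNIV)" and gi: "g i = n ** map_matrix (\<sigma> i) q"
  shows "\<exists>m v1 v2. m \<noteq> 0 \<and> int_vec v1 \<and> int_vec v2 \<and> v1 \<noteq> 0 \<and> v2 \<noteq> 0 \<and>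
    (\<forall>a. app g v1 i a = m * n $ a $ 1) \<and> (\<forall>a. app g v2 i a = m * n $ a $ 2)"
proof -
  have "finite {q$1$1, q$1$2, q$2$1, q$2$2}" by simp
  then obtain m :: nat where m: "m > 0" "\<And>x. x \<in> {q$1$1, q$1$2, q$2$1, q$2$2} \<Longrightarrow> algebraic_int (of_nat m * x)"
    using common_denominator_algebraic_int[OF nf, of "{q$1$1, q$1$2, q$2$1, q$2$2}"] by blast
  have dq: "q$1$1 * q$2$2 - q$1$2 * q$2$1 = 1" using q by (simp add: SL2_carrier det_2)
  have \<sigma>dq: "\<sigma> i (q$1$1) * \<sigma> i (q$2$2) - \<sigma> i (q$1$2) * \<sigma> i (q$2$1) = 1"
    using arg_cong[OF dq, of "\<sigma> i"] by (simp add: emb_diff[OF emb] emb_mult[OF emb] emb_1[OF emb])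
  have mi: "algebraic_int (of_nat m * q$1$1)" "algebraic_int (of_nat m * q$1$2)" "algebraic_int (of_nat m * q$2$1)" "algebraic_int (of_nat m * q$2$2)"
    by (rule m; simp)+
  show ?thesis
  proof (rule exI[of _ "of_nat m"], rule exI[of _ "(of_nat m * q$2$2, - (of_nat m * q$2$1))"],
      rule exI[of _ "(- (of_nat m * q$1$2), of_nat m * q$1$1)"], intro conjI allI)
    show "of_nat m \<noteq> (0::complex)" using m by simp
    show "int_vec (of_nat m * q$2$2, - (of_nat m * q$2$1))" "int_vec (- (of_nat m * q$1$2), of_nat m * q$1$1)"
      using mi by (auto simp: int_vec_def)
    show "(of_nat m * q$2$2, - (of_nat m * q$2$1)) \<noteq> 0" "(- (of_nat m * q$1$2), of_nat m * q$1$1) \<noteq> 0"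
      using dq m(1) by (auto simp: zero_prod_def)
    fix a
    have "app g (of_nat m * q$2$2, - (of_nat m * q$2$1)) i a
        = of_nat m * n $ a $ 1 * (\<sigma> i (q$1$1) * \<sigma> i (q$2$2) - \<sigma> i (q$1$2) * \<sigma> i (q$2$1))"
      by (simp add: app_def gi mat2_mult emb_mult[OF emb] emb_minus[OF emb] emb_of_nat[OF emb] algebra_simps)
    then show "app g (of_nat m * q$2$2, - (of_nat m * q$2$1)) i a = of_nat m * n $ a $ 1" by (simp only: \<sigma>dq mult_1_right)
    have "app g (- (of_nat m * q$1$2), of_nat m * q$1$1) i a
        = of_nat m * n $ a $ 2 * (\<sigma> i (q$1$1) * \<sigma> i (q$2$2) - \<sigma> i (q$1$2) * \<sigma> i (q$2$1))"
      by (simp add: app_def gi mat2_mult emb_mult[OF emb] emb_minus[OF emb] emb_of_nat[OF emb] algebra_simps)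
    then show "app g (- (of_nat m * q$1$2), of_nat m * q$1$1) i a = of_nat m * n $ a $ 2" by (simp only: \<sigma>dq mult_1_right)
  qed
qed

text \<open>
  The zero entries of a monomial \<open>n\<close> are annihilated vectors of
  \<open>K\<^sup>2\<close>, and conversely two annihilated vectors are the columns of
  \<open>inverse q\<close> up to scaling.
\<close>
lemma aligned_single_iff:
  assumes g: "g \<in> carrier (G \<sigma>)"
  shows "aligned {i} g \<longleftrightarrow> (\<exists>v. int_vec v \<and> v \<noteq> 0 \<and> app g v i 1 = 0) \<and> (\<exists>v. int_vec v \<and> v \<noteq> 0 \<and> app g v i 2 = 0)"
proof
  assume "aligned {i} g"
  then obtain q n where q: "q \<in> carrier (SL2 UNIV)" and n: "monomial n" and gi: "g i = n ** map_matrix (\<sigma> i) q"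
    unfolding aligned_def by auto
  obtain m v1 v2 where v: "m \<noteq> 0" "int_vec v1" "int_vec v2" "v1 \<noteq> 0" "v2 \<noteq> 0"
    "\<forall>a. app g v1 i a = m * n $ a $ 1" "\<forall>a. app g v2 i a = m * n $ a $ 2"
    using scaled_columns_of_integral_vectors[of q g i n, OF q gi] by (elim exE conjE)
  have "app g v2 i 1 = 0 \<and> app g v1 i 2 = 0 \<or> app g v1 i 1 = 0 \<and> app g v2 i 2 = 0"
    using n v(6,7) by (auto simp: monomial_def)
  then show "(\<exists>v. int_vec v \<and> v \<noteq> 0 \<and> app g v i 1 = 0) \<and> (\<exists>v. int_vec v \<and> v \<noteq> 0 \<and> app g v i 2 = 0)" (is ?thesis)
  proof (elim disjE conjE)
    assume "app g v2 i 1 = 0" "app g v1 i 2 = 0"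
    then show ?thesis using v(2-5) by (intro conjI, intro exI[of _ v2] conjI, simp_all del: split_paired_Ex) (rule exI[of _ v1], simp)
  next
    assume "app g v1 i 1 = 0" "app g v2 i 2 = 0"
    then show ?thesis using v(2-5) by (intro conjI, intro exI[of _ v1] conjI, simp_all del: split_paired_Ex) (rule exI[of _ v2], simp)
  qed
next
  assume R: "(\<exists>v. int_vec v \<and> v \<noteq> 0 \<and> app g v i 1 = 0) \<and> (\<exists>v. int_vec v \<and> v \<noteq> 0 \<and> app g v i 2 = 0)"
  obtain u where u: "u \<noteq> 0" "app g u i 1 = 0" using R[THEN conjunct1] by (elim exE conjE)
  obtain v where v: "v \<noteq> 0" "app g v i 2 = 0" using R[THEN conjunct2] by (elim exE conjE)
  have det: "det (g i) = 1" by (rule G_det[OF g])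
  define \<delta> where "\<delta> = det2 v u"
  have "\<sigma> i \<delta> = app g v i 1 * app g u i 2" using app_det[of g i v u, OF det] u v by (simp add: \<delta>_def)
  moreover have "app g v i 1 \<noteq> 0" "app g u i 2 \<noteq> 0"
    using app_nonzero[of g i v, OF det v(1)] app_nonzero[of g i u, OF det u(1)] u(2) v(2) by simp_all
  ultimately have \<delta>0: "\<delta> \<noteq> 0" using emb_eq_0[OF emb, of i \<delta>] by auto
  define q :: "'k^2^2" where "q = vector [vector [snd u, - fst u], vector [- (snd v / \<delta>), fst v / \<delta>]]"
  have qn: "q$1$1 = snd u" "q$1$2 = - fst u" "q$2$1 = - (snd v / \<delta>)" "q$2$2 = fst v / \<delta>"
    by (simp_all add: q_def)
  have "fst v * snd u - snd v * fst u = \<delta>" by (simp add: \<delta>_def det2_def)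
  then have "det q = 1" using \<delta>0 by (simp add: det_2 qn field_simps)
  then have q: "q \<in> carrier (SL2 UNIV)" by (simp add: SL2_carrier)
  define n where "n = g i ** adj2 (map_matrix (\<sigma> i) q)"
  have "n $ a $ 1 = app g v i a / \<sigma> i \<delta>" "n $ a $ 2 = app g u i a" for a
    by (simp_all add: n_def mat2_mult adj2_nth qn app_def emb_divide[OF emb] emb_minus[OF emb] add_divide_distrib)
  then have "monomial n" using u v by (simp add: monomial_def)
  moreover have "g i = n ** map_matrix (\<sigma> i) q"
    using \<open>det q = 1\<close> by (simp add: n_def adj2_cancel emb_mat_det emb_1[OF emb])
  ultimately show "aligned {i} g" unfolding aligned_def using g q by auto
qed

text \<open>
  If the row \<open>b0\<close> of \<open>g\<^sub>i\<close> kills \<open>v\<close>, then only the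
  entry \<open>d i $ a0 $ a0\<close> acts on \<open>v\<close> at \<open>i\<close>. Writing
  \<open>v = A w\<close> with the integral vector \<open>w = inverse A v\<close>, a small entry
  makes \<open>w\<close> small at \<open>i\<close>, while boundedness of \<open>d g A\<close>
  keeps it bounded at the other places. A nonzero algebraic integer cannot be like that.
\<close>
lemma surviving_row_bound:
  assumes g: "g \<in> carrier (G \<sigma>)" and v: "int_vec v" "v \<noteq> 0" and ab: "app g v i b0 = 0" "b0 \<noteq> (a0::2)"
  shows "\<exists>c>0. \<forall>d\<in>D \<sigma> {i}. \<forall>A\<in>SLO. (\<forall>j a b. norm ((d j ** g j ** map_matrix (\<sigma> j) A) $ a $ b) \<le> B) \<longrightarrow> c \<le> norm (d i $ a0 $ a0)"
proof -
  define V where "V = (\<Sum>j\<in>UNIV. \<Sum>a\<in>(UNIV::2 set). norm (app g v j a))"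
  have V: "norm (app g v j a) \<le> V" for j a
  proof -
    have "norm (app g v j a) \<le> (\<Sum>a\<in>(UNIV::2 set). norm (app g v j a))" by (rule member_le_sum) auto
    also have "\<dots> \<le> V" unfolding V_def by (rule member_le_sum) (auto intro: sum_nonneg)
    finally show ?thesis .
  qed
  then have V0: "V \<ge> 0" by (meson norm_ge_zero order_trans)
  obtain c1 where c1: "c1 > 0" "\<And>x i. algebraic_int x \<Longrightarrow> x \<noteq> 0 \<Longrightarrow> (\<And>j. norm (\<sigma> j x) \<le> 2 * B * V) \<Longrightarrow> c1 \<le> norm (\<sigma> i x)"
    using bounded_away_from_0[of "2 * B * V"] by blast
  define c where "c = min 1 (c1 / (2 * \<bar>B\<bar> * V + 1))"
  have "2 * \<bar>B\<bar> * V + 1 > 0" using V0 by (simp add: add_nonneg_pos)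
  then have "c > 0" using c1(1) by (simp add: c_def)
  moreover have "c \<le> norm (d i $ a0 $ a0)"
    if d: "d \<in> D \<sigma> {i}" and A: "A \<in> SLO" and bd: "\<forall>j a b. norm ((d j ** g j ** map_matrix (\<sigma> j) A) $ a $ b) \<le> B" for d A
  proof (cases "norm (d i $ a0 $ a0) \<ge> 1")
    case True then show ?thesis by (simp add: c_def)
  next
    case False
    define s where "s = norm (d i $ a0 $ a0)"
    have s: "s \<le> 1" "s \<ge> 0" using False by (auto simp: s_def)
    define h where "h = (\<lambda>j. d j ** g j ** map_matrix (\<sigma> j) A)"
    have hB: "norm (h j $ a $ b) \<le> B" for j a b using bd by (simp add: h_def)
    have B0: "B \<ge> 0" using hB by (meson norm_ge_zero order_trans)
    define w where "w = (A$2$2 * fst v - A$1$2 * snd v, A$1$1 * snd v - A$2$1 * fst v)"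
    have detA: "A$1$1 * A$2$2 - A$1$2 * A$2$1 = 1" and Aint: "algebraic_int (A $ a $ b)" for a b
      using A by (auto simp: SL2_carrier det_2)
    have iw: "int_vec w" using v(1) Aint unfolding int_vec_def w_def fst_conv snd_conv
      by (intro conjI algebraic_int_diff algebraic_int_times) auto
    have recov: "A$1$1 * fst w + A$1$2 * snd w = fst v" "A$2$1 * fst w + A$2$2 * snd w = snd v"
    proof -
      have "A$1$1 * fst w + A$1$2 * snd w = (A$1$1 * A$2$2 - A$1$2 * A$2$1) * fst v"
        "A$2$1 * fst w + A$2$2 * snd w = (A$1$1 * A$2$2 - A$1$2 * A$2$1) * snd v"
        by (simp_all add: w_def algebra_simps)
      then show "A$1$1 * fst w + A$1$2 * snd w = fst v" "A$2$1 * fst w + A$2$2 * snd w = snd v"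
        by (simp_all add: detA)
    qed
    have w0: "w \<noteq> 0"
    proof
      assume "w = 0"
      then have "v = 0" using recov by (simp add: prod_eq_iff)
      then show False using v(2) by simp
    qed
    have detd: "det (d j) = 1" for j by (rule G_det[OF subsetD[OF D_subset d]])
    have deth: "det (h j) = 1" for j
      using A by (simp add: h_def det_mul detd G_det[OF g] emb_mat_det SL2_carrier emb_1[OF emb])
    have apph: "app h w j a = d j $ a $ a * app g v j a" for j a
    proof -
      have e: "app h w j a = (d j ** g j) $ a $ 1 * \<sigma> j (A$1$1 * fst w + A$1$2 * snd w) + (d j ** g j) $ a $ 2 * \<sigma> j (A$2$1 * fst w + A$2$2 * snd w)"
        by (simp add: app_def h_def mat2_mult[of "d j ** g j"] emb_add[OF emb] emb_mult[OF emb] algebra_simps)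
      have "a = 1 \<or> a = 2" by (rule exhaust_2)
      then show ?thesis unfolding e recov using D_offdiag[OF d, of j]
        by (elim disjE) (simp_all add: mat2_mult app_def algebra_simps)
    qed
    have small_i: "norm (app h w i a) \<le> s * V" for a
    proof (cases "a = a0")
      case True then show ?thesis unfolding apph norm_mult using V s by (simp add: s_def mult_left_mono)
    next
      case False
      then have "a = b0" using ab(2) exhaust_2[of a] exhaust_2[of a0] exhaust_2[of b0] by auto
      then show ?thesis unfolding apph using ab(1) s V0 by simp
    qed
    have small: "norm (app h w j a) \<le> V" for j a
    proof (cases "j = i")
      case True
      have "s * V \<le> V" using s V0 by (simp add: mult_left_le_one_le)
      then show ?thesis using small_i True order_trans by blast
    next
      case False
      then have "d j = mat 1" using D_outside[OF d] by simp
      moreover have "a = 1 \<or> a = 2" by (rule exhaust_2)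
      ultimately have "d j $ a $ a = 1" by (auto simp: mat2_one)
      then show ?thesis unfolding apph using V by simp
    qed
    have fs: "\<sigma> j (fst w) = h j $ 2 $ 2 * app h w j 1 - h j $ 1 $ 2 * app h w j 2"
      "\<sigma> j (snd w) = h j $ 1 $ 1 * app h w j 2 - h j $ 2 $ 1 * app h w j 1" for j
    proof -
      have "h j $ 2 $ 2 * app h w j 1 - h j $ 1 $ 2 * app h w j 2 = det (h j) * \<sigma> j (fst w)"
        "h j $ 1 $ 1 * app h w j 2 - h j $ 2 $ 1 * app h w j 1 = det (h j) * \<sigma> j (snd w)"
        by (simp_all add: app_def det_2 algebra_simps)
      then show "\<sigma> j (fst w) = h j $ 2 $ 2 * app h w j 1 - h j $ 1 $ 2 * app h w j 2"
        "\<sigma> j (snd w) = h j $ 1 $ 1 * app h w j 2 - h j $ 2 $ 1 * app h w j 1" by (simp_all add: deth)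
    qed
    have combo: "norm (x * y - x' * y') \<le> 2 * B * M"
      if "norm x \<le> B" "norm x' \<le> B" "norm y \<le> M" "norm y' \<le> M" for x y x' y' :: complex and M
    proof -
      have "norm (x * y - x' * y') \<le> norm x * norm y + norm x' * norm y'" by (metis norm_triangle_ineq4 norm_mult)
      also have "\<dots> \<le> B * M + B * M" using that B0 by (intro add_mono mult_mono) auto
      finally show ?thesis by simp
    qed
    have all: "norm (\<sigma> j (fst w)) \<le> 2 * B * V" "norm (\<sigma> j (snd w)) \<le> 2 * B * V" for j
      unfolding fs by (intro combo hB small)+
    have at_i: "norm (\<sigma> i (fst w)) \<le> 2 * B * (s * V)" "norm (\<sigma> i (snd w)) \<le> 2 * B * (s * V)"
      unfolding fs by (intro combo hB small_i)+
    have "c1 \<le> 2 * B * (s * V)"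
    proof (cases "fst w = 0")
      case False
      then have "c1 \<le> norm (\<sigma> i (fst w))" using iw all by (intro c1(2)) (auto simp: int_vec_def)
      then show ?thesis using at_i by simp
    next
      case True
      then have "snd w \<noteq> 0" using w0 by (auto simp: prod_eq_iff)
      then have "c1 \<le> norm (\<sigma> i (snd w))" using iw all by (intro c1(2)) (auto simp: int_vec_def)
      then show ?thesis using at_i by simp
    qed
    also have "\<dots> \<le> (2 * \<bar>B\<bar> * V + 1) * s" using s B0 by (simp add: algebra_simps)
    finally have "c1 / (2 * \<bar>B\<bar> * V + 1) \<le> s" using \<open>2 * \<bar>B\<bar> * V + 1 > 0\<close> by (simp add: divide_le_eq mult.commute)
    then show ?thesis by (simp add: c_def s_def)
  qed
  ultimately show ?thesis by blast
qed

text \<open>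
  Both diagonal entries are bounded away from \<open>0\<close> by the previous lemma and are
  inverse to each other, so \<open>d\<close> has a convergent subsequence; along it
  \<open>c\<close> converges as well, hence becomes constant.
\<close>
lemma convergent_orbit_subsequence:
  assumes g: "g \<in> carrier (G \<sigma>)" and al: "aligned {i} g"
    and d: "\<And>n. d n \<in> D \<sigma> {i}" and c: "\<And>n. c n \<in> \<Gamma> \<sigma>"
    and lim: "(\<lambda>n. d n \<otimes>\<^bsub>G \<sigma>\<^esub> g \<otimes>\<^bsub>G \<sigma>\<^esub> c n) \<longlonglongrightarrow> h"
  shows "\<exists>r d' \<gamma>. strict_mono r \<and> (\<lambda>n::nat. d (r n)) \<longlonglongrightarrow> d' \<and> d' \<in> D \<sigma> {i} \<and> \<gamma> \<in> \<Gamma> \<sigma> \<and> h = d' \<otimes>\<^bsub>G \<sigma>\<^esub> g \<otimes>\<^bsub>G \<sigma>\<^esub> \<gamma>"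
proof -
  obtain B where B: "\<And>n j a b. norm ((d n j ** g j ** c n j) $ a $ b) \<le> B"
    using convergent_fun_mat2_bounded[OF lim[unfolded G_mult]] by blast
  note al' = al[unfolded aligned_single_iff[OF g]]
  obtain u where u: "int_vec u" "u \<noteq> 0" "app g u i 1 = 0" using al'[THEN conjunct1] by (elim exE conjE)
  obtain v where v: "int_vec v" "v \<noteq> 0" "app g v i 2 = 0" using al'[THEN conjunct2] by (elim exE conjE)
  obtain c1 where c1: "c1 > 0" "\<forall>d\<in>D \<sigma> {i}. \<forall>A\<in>SLO. (\<forall>j a b. norm ((d j ** g j ** map_matrix (\<sigma> j) A) $ a $ b) \<le> B) \<longrightarrow> c1 \<le> norm (d i $ 2 $ 2)"
    using surviving_row_bound[OF g u(1,2,3), of 2 B] by auto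
  obtain c2 where c2: "c2 > 0" "\<forall>d\<in>D \<sigma> {i}. \<forall>A\<in>SLO. (\<forall>j a b. norm ((d j ** g j ** map_matrix (\<sigma> j) A) $ a $ b) \<le> B) \<longrightarrow> c2 \<le> norm (d i $ 1 $ 1)"
    using surviving_row_bound[OF g v(1,2,3), of 1 B] by auto
  have low: "c1 \<le> norm (d n i $ 2 $ 2)" "c2 \<le> norm (d n i $ 1 $ 1)" for n
  proof -
    obtain A where A: "A \<in> SLO" "c n = diagonal_embedding \<sigma> A" using c[of n] by (auto simp: \<Gamma>_def)
    have "\<forall>j a b. norm ((d n j ** g j ** map_matrix (\<sigma> j) A) $ a $ b) \<le> B"
      using B[of n] A(2) by (simp add: diagonal_embedding_def)
    then show "c1 \<le> norm (d n i $ 2 $ 2)" "c2 \<le> norm (d n i $ 1 $ 1)"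
      using c1(2) c2(2) d[of n] A(1) by blast+
  qed
  define M where "M = 1 + inverse c1 + inverse c2"
  have M: "M \<ge> 1" "M \<ge> inverse c1" "M \<ge> inverse c2" using c1(1) c2(1) by (auto simp: M_def)
  have bd: "norm (d n j $ a $ b) \<le> M" for n j a b
  proof (cases "j = i")
    case False
    then have "d n j = mat 1" using D_outside[OF d] by simp
    then show ?thesis using M(1) exhaust_2[of a] exhaust_2[of b] by (auto simp: mat2_one)
  next
    case True
    obtain z where z: "d n i = dg (exp z)" using D_entry[OF d[of n], of i] by blast
    have "norm (exp z) \<le> inverse c1"
    proof -
      have "c1 \<le> inverse (norm (exp z))" using low(1)[of n] by (simp add: z dg_nth norm_inverse)
      then have "inverse (inverse (norm (exp z))) \<le> inverse c1" using c1(1) by (rule le_imp_inverse_le)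
      then show ?thesis by simp
    qed
    moreover have "norm (inverse (exp z)) \<le> inverse c2"
    proof -
      have "c2 \<le> norm (exp z)" using low(2)[of n] by (simp add: z dg_nth)
      then have "inverse (norm (exp z)) \<le> inverse c2" using c2(1) by (rule le_imp_inverse_le)
      then show ?thesis by (simp add: norm_inverse)
    qed
    ultimately have "norm (dg (exp z) $ a $ b) \<le> M"
      using M exhaust_2[of a] exhaust_2[of b] by (auto simp: dg_nth)
    then show ?thesis using True z by simp
  qed
  obtain r d' where r: "strict_mono r" "(\<lambda>n. d (r n)) \<longlonglongrightarrow> d'"
    using bounded_convergent_subsequence_fun[of d M, OF bd] by blast
  have d': "d' \<in> D \<sigma> {i}" by (rule D_limit[OF _ r(2)]) (rule d)
  have dc: "d n \<in> carrier (G \<sigma>)" "c n \<in> carrier (G \<sigma>)" for n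
    by (rule subsetD[OF D_subset d], rule subsetD[OF Gamma_subset c])
  have lim': "(\<lambda>n. d (r n) \<otimes>\<^bsub>G \<sigma>\<^esub> g \<otimes>\<^bsub>G \<sigma>\<^esub> c (r n)) \<longlonglongrightarrow> h"
    using LIMSEQ_subseq_LIMSEQ[OF lim r(1)] by (simp add: o_def)
  define e where "e = (\<lambda>n. \<lambda>j. adj2 (d (r n) j ** g j))"
  have e: "e \<longlonglongrightarrow> (\<lambda>j. adj2 (d' j ** g j))"
    unfolding e_def by (intro tendsto_fun_adj2 tendsto_fun_mult r(2) tendsto_const)
  have ceq: "(\<lambda>j. e n j ** (d (r n) \<otimes>\<^bsub>G \<sigma>\<^esub> g \<otimes>\<^bsub>G \<sigma>\<^esub> c (r n)) j) = c (r n)" for n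
  proof
    fix j
    have "det (d (r n) j ** g j) = 1" by (simp add: det_mul G_det[OF g] G_det[OF dc(1)])
    then show "e n j ** (d (r n) \<otimes>\<^bsub>G \<sigma>\<^esub> g \<otimes>\<^bsub>G \<sigma>\<^esub> c (r n)) j = c (r n) j"
      unfolding G_mult e_def by (rule adj2_cancel_left(1))
  qed
  have "(\<lambda>n. c (r n)) \<longlonglongrightarrow> (\<lambda>j. adj2 (d' j ** g j) ** h j)"
    using tendsto_fun_mult[OF e lim'] unfolding ceq .
  from Gamma_convergent_eventually_const[OF c this]
  obtain N where N: "\<forall>n\<ge>N. c (r n) = c (r N)" ..
  have fixed: "(\<lambda>n. d (r n) \<otimes>\<^bsub>G \<sigma>\<^esub> g \<otimes>\<^bsub>G \<sigma>\<^esub> c (r N)) \<longlonglongrightarrow> d' \<otimes>\<^bsub>G \<sigma>\<^esub> g \<otimes>\<^bsub>G \<sigma>\<^esub> c (r N)"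
    unfolding G_mult by (intro tendsto_fun_mult r(2) tendsto_const)
  have "eventually (\<lambda>n. d (r n) \<otimes>\<^bsub>G \<sigma>\<^esub> g \<otimes>\<^bsub>G \<sigma>\<^esub> c (r N) = d (r n) \<otimes>\<^bsub>G \<sigma>\<^esub> g \<otimes>\<^bsub>G \<sigma>\<^esub> c (r n)) sequentially"
    unfolding eventually_sequentially
  proof (intro exI[of _ N] allI impI)
    fix n assume "N \<le> n"
    then have eq: "c (r n) = c (r N)" using N by blast
    show "d (r n) \<otimes>\<^bsub>G \<sigma>\<^esub> g \<otimes>\<^bsub>G \<sigma>\<^esub> c (r N) = d (r n) \<otimes>\<^bsub>G \<sigma>\<^esub> g \<otimes>\<^bsub>G \<sigma>\<^esub> c (r n)"
      unfolding eq ..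
  qed
  then have "(\<lambda>n. d (r n) \<otimes>\<^bsub>G \<sigma>\<^esub> g \<otimes>\<^bsub>G \<sigma>\<^esub> c (r n)) \<longlonglongrightarrow> d' \<otimes>\<^bsub>G \<sigma>\<^esub> g \<otimes>\<^bsub>G \<sigma>\<^esub> c (r N)"
    by (rule Lim_transform_eventually[OF fixed])
  then have "h = d' \<otimes>\<^bsub>G \<sigma>\<^esub> g \<otimes>\<^bsub>G \<sigma>\<^esub> c (r N)" by (rule LIMSEQ_unique[OF lim'])
  then show ?thesis using r d' c[of "r N"]
    by (intro exI[of _ r] exI[of _ d'] exI[of _ "c (r N)"] conjI)
qed

text \<open>
  Properness amounts to closedness of the orbit map and compactness of its fibres. Both follow
  from the extraction of convergent subsequences.
\<close>
lemma divergent_if_aligned: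
  assumes al: "aligned {i} g"
  shows "divergent_orbit \<sigma> (D \<sigma> {i}) (\<pi> \<sigma> g)"
proof -
  define X where "X = subtopology (G_top \<sigma>) (D \<sigma> {i})"
  define f where "f = (\<lambda>h. h <#\<^bsub>G \<sigma>\<^esub> \<pi> \<sigma> g)"
  have g: "g \<in> carrier (G \<sigma>)" using al by (simp add: aligned_def)
  have X: "topspace X = D \<sigma> {i}" using D_subset by (auto simp: X_def topspace_G_top)
  have Xeq: "X = top_of_set (D \<sigma> {i})"
    using D_subset[of "{i}"] by (simp add: X_def G_top_def subtopology_subtopology Int_absorb1)
  have dc: "d \<in> carrier (G \<sigma>)" if "d \<in> D \<sigma> {i}" for d by (rule subsetD[OF D_subset that])
  have f: "f d = \<pi> \<sigma> (d \<otimes>\<^bsub>G \<sigma>\<^esub> g)" if "d \<in> D \<sigma> {i}" for d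
    unfolding f_def \<pi>_def by (rule GG.lcos_m_assoc[OF Gamma_subset dc[OF that] g])
  have "closed_map X (G_mod_\<Gamma>_top \<sigma>) f"
    unfolding closed_map_def
  proof (intro allI impI)
    fix C assume "closedin X C"
    then have C: "closedin (top_of_set (D \<sigma> {i})) C" by (simp only: Xeq)
    then have CD: "C \<subseteq> D \<sigma> {i}" using closedin_subset by fastforce
    have fC: "f ` C = \<pi> \<sigma> ` ((\<lambda>d. d \<otimes>\<^bsub>G \<sigma>\<^esub> g) ` C)"
      unfolding image_image by (rule image_cong[OF refl f]) (rule subsetD[OF CD])
    have Ag: "(\<lambda>d. d \<otimes>\<^bsub>G \<sigma>\<^esub> g) ` C \<subseteq> carrier (G \<sigma>)"
      using CD dc g by auto
    have "G_mod_\<Gamma>_top \<sigma> closure_of (f ` C) \<subseteq> f ` C"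
    proof
      fix y assume y: "y \<in> G_mod_\<Gamma>_top \<sigma> closure_of (f ` C)"
      then have "y \<in> topspace (G_mod_\<Gamma>_top \<sigma>)" by (simp add: in_closure_of)
      then obtain h where h: "h \<in> carrier (G \<sigma>)" "y = \<pi> \<sigma> h" unfolding topspace_quotient by (elim imageE)
      obtain a c where ac: "\<forall>n. a n \<in> (\<lambda>d. d \<otimes>\<^bsub>G \<sigma>\<^esub> g) ` C \<and> c n \<in> \<Gamma> \<sigma>" "(\<lambda>n::nat. a n \<otimes>\<^bsub>G \<sigma>\<^esub> c n) \<longlonglongrightarrow> h"
        using y unfolding fC h(2) closure_of_pi_image[OF Ag h(1)] by (elim exE conjE)
      have "\<forall>n. \<exists>d. d \<in> C \<and> a n = d \<otimes>\<^bsub>G \<sigma>\<^esub> g" using ac(1) by auto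
      from choice[OF this] obtain d where d: "\<forall>n. d n \<in> C \<and> a n = d n \<otimes>\<^bsub>G \<sigma>\<^esub> g" ..
      have lim: "(\<lambda>n. d n \<otimes>\<^bsub>G \<sigma>\<^esub> g \<otimes>\<^bsub>G \<sigma>\<^esub> c n) \<longlonglongrightarrow> h" using ac(2) d by simp
      obtain r d' \<gamma> where r: "strict_mono r" "(\<lambda>n. d (r n)) \<longlonglongrightarrow> d'" "d' \<in> D \<sigma> {i}" "\<gamma> \<in> \<Gamma> \<sigma>" "h = d' \<otimes>\<^bsub>G \<sigma>\<^esub> g \<otimes>\<^bsub>G \<sigma>\<^esub> \<gamma>"
        using convergent_orbit_subsequence[OF g al _ _ lim] d CD ac(1) by (auto simp: subset_iff)
      obtain T where T: "closed T" "C = D \<sigma> {i} \<inter> T" using C by (auto simp: closedin_closed)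
      have "d' \<in> T" by (rule closed_sequentially[OF T(1) _ r(2)]) (use d T(2) in simp)
      then have "d' \<in> C" using r(3) T(2) by simp
      have "\<pi> \<sigma> (d' \<otimes>\<^bsub>G \<sigma>\<^esub> g) = \<pi> \<sigma> h"
      proof (subst pi_eq_iff)
        show "d' \<otimes>\<^bsub>G \<sigma>\<^esub> g \<in> carrier (G \<sigma>)" using dc[OF r(3)] g by simp
      qed (use h r(4,5) in auto)
      then have "y = f d'" using f[OF r(3)] h(2) by simp
      then show "y \<in> f ` C" using \<open>d' \<in> C\<close> by (rule image_eqI)
    qed
    moreover have "f ` C \<subseteq> topspace (G_mod_\<Gamma>_top \<sigma>)"
      unfolding fC topspace_quotient using Ag by (rule image_mono)
    ultimately show "closedin (G_mod_\<Gamma>_top \<sigma>) (f ` C)" using closure_of_subset_eq by blast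
  qed
  moreover have "compactin X {x \<in> topspace X. f x = y}" if yt: "y \<in> topspace (G_mod_\<Gamma>_top \<sigma>)" for y
  proof -
    obtain h where h: "h \<in> carrier (G \<sigma>)" "y = \<pi> \<sigma> h" using yt unfolding topspace_quotient by (elim imageE)
    define S where "S = {x \<in> D \<sigma> {i}. f x = y}"
    have "seq_compact S"
      unfolding seq_compact_def
    proof (intro allI impI)
      fix x :: "nat \<Rightarrow> 'r \<Rightarrow> complex^2^2" assume x: "\<forall>n. x n \<in> S"
      have "\<forall>n. \<exists>c. c \<in> \<Gamma> \<sigma> \<and> h = x n \<otimes>\<^bsub>G \<sigma>\<^esub> g \<otimes>\<^bsub>G \<sigma>\<^esub> c"
      proof
        fix n
        have xn: "x n \<in> D \<sigma> {i}" "\<pi> \<sigma> (x n \<otimes>\<^bsub>G \<sigma>\<^esub> g) = \<pi> \<sigma> h" using x f h by (auto simp: S_def)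
        then have "\<exists>c\<in>\<Gamma> \<sigma>. h = x n \<otimes>\<^bsub>G \<sigma>\<^esub> g \<otimes>\<^bsub>G \<sigma>\<^esub> c"
          using dc g h(1) by (subst (asm) pi_eq_iff) auto
        then show "\<exists>c. c \<in> \<Gamma> \<sigma> \<and> h = x n \<otimes>\<^bsub>G \<sigma>\<^esub> g \<otimes>\<^bsub>G \<sigma>\<^esub> c" by auto
      qed
      from choice[OF this] obtain c where c: "\<forall>n. c n \<in> \<Gamma> \<sigma> \<and> h = x n \<otimes>\<^bsub>G \<sigma>\<^esub> g \<otimes>\<^bsub>G \<sigma>\<^esub> c n" ..
      have "(\<lambda>n. x n \<otimes>\<^bsub>G \<sigma>\<^esub> g \<otimes>\<^bsub>G \<sigma>\<^esub> c n) = (\<lambda>n. h)" using c by (intro ext) simp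
      then have lim: "(\<lambda>n. x n \<otimes>\<^bsub>G \<sigma>\<^esub> g \<otimes>\<^bsub>G \<sigma>\<^esub> c n) \<longlonglongrightarrow> h" by simp
      have xD: "x n \<in> D \<sigma> {i}" and cG: "c n \<in> \<Gamma> \<sigma>" for n using x c by (auto simp: S_def)
      obtain r d' \<gamma> where r: "strict_mono r" "(\<lambda>n. x (r n)) \<longlonglongrightarrow> d'" "d' \<in> D \<sigma> {i}" "\<gamma> \<in> \<Gamma> \<sigma>" "h = d' \<otimes>\<^bsub>G \<sigma>\<^esub> g \<otimes>\<^bsub>G \<sigma>\<^esub> \<gamma>"
        using convergent_orbit_subsequence[OF g al xD cG lim] by (elim exE conjE)
      have "\<pi> \<sigma> (d' \<otimes>\<^bsub>G \<sigma>\<^esub> g) = \<pi> \<sigma> h"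
      proof (subst pi_eq_iff)
        show "d' \<otimes>\<^bsub>G \<sigma>\<^esub> g \<in> carrier (G \<sigma>)" using dc[OF r(3)] g by simp
      qed (use h r(4,5) in auto)
      then have "d' \<in> S" using r(3) f h(2) by (simp add: S_def)
      then show "\<exists>l\<in>S. \<exists>r. strict_mono r \<and> (x \<circ> r) \<longlonglongrightarrow> l"
        using r(1,2) by (intro bexI[of _ d'] exI[of _ r]) (simp_all add: o_def)
    qed
    then have "compact S" using compact_eq_seq_compact_metric by blast
    then show ?thesis unfolding X unfolding Xeq S_def by (simp add: compactin_subtopology)
  qed
  ultimately show ?thesis unfolding divergent_orbit_def proper_map_def X_def[symmetric] f_def[symmetric] by blast
qed

text \<open>
  The two ends of \<open>D\<^sub>i\<close> are reached with \<open>s = 1\<close> and \<open>s =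
  - 1\<close>.
\<close>
definition ray :: "real \<Rightarrow> 'r \<Rightarrow> nat \<Rightarrow> 'r \<Rightarrow> real" where
  "ray s i n j = (if j = i then exp (s * n) else 1)"

lemma ray_pos: "ray s i n j > 0"
  by (simp add: ray_def)

lemma compact_bounded_part: "compact {x \<in> carrier (G \<sigma>). \<forall>i a b. norm (x i $ a $ b) \<le> R}"
proof -
  have "seq_compact {x \<in> carrier (G \<sigma>). \<forall>i a b. norm (x i $ a $ b) \<le> R}"
    unfolding seq_compact_def
  proof (intro allI impI)
    fix x :: "nat \<Rightarrow> 'r \<Rightarrow> complex^2^2"
    assume x: "\<forall>n. x n \<in> {x \<in> carrier (G \<sigma>). \<forall>i a b. norm (x i $ a $ b) \<le> R}"
    then have bd: "norm (x n i $ a $ b) \<le> R" for n i a b by simp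
    obtain l r where r: "strict_mono r" "(\<lambda>n. x (r n)) \<longlonglongrightarrow> l"
      using bounded_convergent_subsequence_fun[of x R, OF bd] by blast
    have "l \<in> carrier (G \<sigma>)" by (rule closed_sequentially[OF closed_G _ r(2)]) (use x in simp)
    moreover have "norm (l i $ a $ b) \<le> R" for i a b
    proof -
      have "(\<lambda>n. norm (x (r n) i $ a $ b)) \<longlonglongrightarrow> norm (l i $ a $ b)"
        using r(2) unfolding tendsto_fun_mat2_iff by (intro tendsto_norm) simp
      then show ?thesis by (rule LIMSEQ_le_const2) (use bd in blast)
    qed
    ultimately show "\<exists>l\<in>{x \<in> carrier (G \<sigma>). \<forall>i a b. norm (x i $ a $ b) \<le> R}. \<exists>r. strict_mono r \<and> (x \<circ> r) \<longlonglongrightarrow> l"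
      using r by (intro bexI[of _ l] exI[of _ r]) (simp_all add: o_def)
  qed
  then show ?thesis using compact_eq_seq_compact_metric by blast
qed

text \<open>
  Otherwise \<open>bounded_returns\<close> would bring infinitely many points of the ray back
  into the image of one compact set, contradicting properness.
\<close>
lemma divergent_short_vectors:
  assumes g: "g \<in> carrier (G \<sigma>)" and div: "divergent_orbit \<sigma> (D \<sigma> {i}) (\<pi> \<sigma> g)" and s: "\<bar>s\<bar> = 1" and eps: "\<epsilon> > 0"
  shows "\<exists>n0. \<forall>n\<ge>n0. short_vec g (ray s i n) \<epsilon>"
proof (rule ccontr)
  assume no: "\<not> ?thesis"
  define N where "N = {n. \<not> short_vec g (ray s i n) \<epsilon>}"
  have "infinite N" unfolding infinite_nat_iff_unbounded_le N_def using no by auto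
  have real: "g j $ a $ b \<in> \<real>" if "real_place j" for j a b using G_entry[OF g, of j a b] K_real[OF that] by simp
  obtain R where "infinite {n\<in>N. \<exists>A\<in>SLO. \<forall>j a b. wt (ray s i n) j a * norm ((g j ** map_matrix (\<sigma> j) A) $ a $ b) \<le> R}"
    using bounded_returns[of g \<epsilon> "\<lambda>n. ray s i n" N, OF G_det[OF g] real eps ray_pos \<open>infinite N\<close>] by (auto simp: N_def)
  then have inf: "infinite {n. \<exists>A\<in>SLO. \<forall>j a b. wt (ray s i n) j a * norm ((g j ** map_matrix (\<sigma> j) A) $ a $ b) \<le> R}"
    by (rule infinite_super[rotated]) auto
  define C where "C = {x \<in> carrier (G \<sigma>). \<forall>i a b. norm (x i $ a $ b) \<le> R}"
  define X where "X = subtopology (G_top \<sigma>) (D \<sigma> {i})"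
  define f where "f = (\<lambda>h. h <#\<^bsub>G \<sigma>\<^esub> \<pi> \<sigma> g)"
  have Xeq: "X = top_of_set (D \<sigma> {i})"
    using D_subset[of "{i}"] by (simp add: X_def G_top_def subtopology_subtopology Int_absorb1)
  have "compactin (G_top \<sigma>) C"
    using compact_bounded_part[of R] by (auto simp: C_def G_top_def compactin_subtopology)
  then have "compactin (G_mod_\<Gamma>_top \<sigma>) (\<pi> \<sigma> ` C)" by (rule image_compactin[OF _ continuous_pi])
  moreover have "proper_map X (G_mod_\<Gamma>_top \<sigma>) f" using div by (simp add: divergent_orbit_def X_def f_def)
  ultimately have "compactin X {x \<in> topspace X. f x \<in> \<pi> \<sigma> ` C}" by (intro compactin_proper_map_preimage)
  then have cpt: "compact {x \<in> D \<sigma> {i}. f x \<in> \<pi> \<sigma> ` C}" by (simp add: Xeq compactin_subtopology)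
  have cont: "continuous_on UNIV (\<lambda>x :: 'r \<Rightarrow> complex^2^2. norm (x i $ 1 $ 1) + norm (x i $ 2 $ 2))"
    by (intro continuous_intros continuous_on_product_coordinates)
  have "compact ((\<lambda>x. norm (x i $ 1 $ 1) + norm (x i $ 2 $ 2)) ` {x \<in> D \<sigma> {i}. f x \<in> \<pi> \<sigma> ` C})"
    by (rule compact_continuous_image[OF continuous_on_subset[OF cont] cpt]) simp
  then have "bounded ((\<lambda>x. norm (x i $ 1 $ 1) + norm (x i $ 2 $ 2)) ` {x \<in> D \<sigma> {i}. f x \<in> \<pi> \<sigma> ` C})"
    by (rule compact_imp_bounded)
  then obtain M where M: "\<forall>y\<in>(\<lambda>x. norm (x i $ 1 $ 1) + norm (x i $ 2 $ 2)) ` {x \<in> D \<sigma> {i}. f x \<in> \<pi> \<sigma> ` C}. norm y \<le> M"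
    unfolding bounded_iff by (elim exE)
  obtain k :: nat where k: "real k > M" using reals_Archimedean2 by blast
  obtain n A where n: "n \<ge> k" and A: "A \<in> SLO"
    and bd: "\<forall>j a b. wt (ray s i n) j a * norm ((g j ** map_matrix (\<sigma> j) A) $ a $ b) \<le> R"
    using inf unfolding infinite_nat_iff_unbounded_le by blast
  define d where "d = (\<lambda>j. if j \<in> {i} then dg (exp (of_real (s * n))) else mat 1)"
  have d: "d \<in> D \<sigma> {i}" unfolding d_def by (rule D_normal_form[of "\<lambda>_. of_real (s * n)"]) (rule K_of_real)
  have d': "d j = dg (of_real (ray s i n j))" for j
    by (simp add: d_def ray_def exp_of_real dg_one del: of_real_mult)
  have dc: "d \<in> carrier (G \<sigma>)" by (rule subsetD[OF D_subset d])
  define \<gamma> where "\<gamma> = diagonal_embedding \<sigma> A"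
  have \<gamma>: "\<gamma> \<in> \<Gamma> \<sigma>" using A by (simp add: \<gamma>_def \<Gamma>_def)
  then have \<gamma>c: "\<gamma> \<in> carrier (G \<sigma>)" by (rule subsetD[OF Gamma_subset])
  have "norm ((d j ** g j ** \<gamma> j) $ a $ b) \<le> R" for j a b
  proof -
    have "norm ((d j ** (g j ** \<gamma> j)) $ a $ b) = wt (ray s i n) j a * norm ((g j ** \<gamma> j) $ a $ b)"
      unfolding d' using exhaust_2[of a] ray_pos[of s i n j]
      by (auto simp: dg_mult_left norm_mult wt_def norm_inverse)
    also have "\<dots> \<le> R" using bd by (simp add: \<gamma>_def diagonal_embedding_def)
    finally show ?thesis by (simp add: matrix_mul_assoc)
  qed
  then have inC: "d \<otimes>\<^bsub>G \<sigma>\<^esub> g \<otimes>\<^bsub>G \<sigma>\<^esub> \<gamma> \<in> C"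
    using GG.m_closed[OF GG.m_closed[OF dc g] \<gamma>c] by (simp add: C_def G_mult)
  have "f d = \<pi> \<sigma> (d \<otimes>\<^bsub>G \<sigma>\<^esub> g)"
    unfolding f_def \<pi>_def by (rule GG.lcos_m_assoc[OF Gamma_subset dc g])
  also have "\<dots> = \<pi> \<sigma> (d \<otimes>\<^bsub>G \<sigma>\<^esub> g \<otimes>\<^bsub>G \<sigma>\<^esub> \<gamma>)"
    using dc g \<gamma> \<gamma>c by (subst pi_eq_iff) auto
  finally have "f d \<in> \<pi> \<sigma> ` C" using inC by (rule image_eqI)
  then have "norm (norm (d i $ 1 $ 1) + norm (d i $ 2 $ 2)) \<le> M" using M d by blast
  then have "exp (s * n) + exp (- (s * n)) \<le> M"
    by (simp add: d' dg_nth ray_def norm_inverse exp_minus)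
  moreover have "exp (real n) \<le> exp (s * n) + exp (- (s * n))"
  proof -
    have "s = 1 \<or> s = -1" using s by linarith
    then show ?thesis by auto
  qed
  moreover have "real n < exp (real n)" using exp_ge_add_one_self[of "real n"] by linarith
  ultimately show False using k n by linarith
qed

text \<open>
  Vectors that are shorter than a suitable \<open>\<epsilon>\<close> at two consecutive times
  \<open>n\<close> and \<open>Suc n\<close> have a determinant that is too small to be a nonzero
  algebraic integer. So all short vectors \<open>v n\<close> lie on one line of
  \<open>K\<^sup>2\<close>. If the expanding row did not vanish on this line, then the scalars
  \<open>x n\<close> would decay exponentially at \<open>i\<close> and remain bounded elsewhere,
  which is impossible for nonzero elements with a common denominator \<open>z\<close>.
\<close>
lemma contracted_vector:
  assumes g: "g \<in> carrier (G \<sigma>)" and s: "\<bar>s\<bar> = 1"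
    and short: "\<And>\<epsilon>. \<epsilon> > 0 \<Longrightarrow> \<exists>n0. \<forall>n\<ge>n0. short_vec g (ray s i n) \<epsilon>"
  shows "\<exists>v. int_vec v \<and> v \<noteq> 0 \<and> app g v i (if s = 1 then 1 else 2) = 0"
proof -
  define a0 :: 2 where "a0 = (if s = 1 then 1 else 2)"
  have s': "s = 1 \<or> s = -1" using s by linarith
  have det: "det (g j) = 1" for j by (rule G_det[OF g])
  have wa0: "wt (ray s i n) i a0 = exp (real n)" for n
    using s' by (auto simp: wt_def ray_def a0_def exp_minus)
  have wp: "wt (ray s i n) j a > 0" for n j a by (rule wt_pos[OF ray_pos])
  have w1: "wt (ray s i n) j a = 1" if "j \<noteq> i" for n j a using that by (simp add: wt_def ray_def)
  \<comment> \<open>the weights change by at most a factor of \<open>exp 1 \<le> 3\<close> between consecutive times\<close>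
  have ratio: "1 \<le> 3 * (wt (ray s i n) j a * wt (ray s i (Suc n)) j b)" if ab: "a \<noteq> b" for n j a b
  proof (cases "j = i")
    case False then show ?thesis by (simp add: w1)
  next
    case True
    have e3: "exp 1 \<le> (3::real)" by (rule exp_le)
    have cases: "a = 1 \<and> b = 2 \<or> a = 2 \<and> b = 1" using ab exhaust_2[of a] exhaust_2[of b] by auto
    have "wt (ray s i n) i a * wt (ray s i (Suc n)) i b = exp (s * n - s * Suc n) \<or>
        wt (ray s i n) i a * wt (ray s i (Suc n)) i b = exp (s * Suc n - s * n)"
      using cases by (auto simp: wt_def ray_def exp_diff divide_inverse mult.commute)
    moreover have "s * n - s * Suc n = - s" "s * Suc n - s * n = s" by (simp_all add: algebra_simps)
    ultimately have "wt (ray s i n) i a * wt (ray s i (Suc n)) i b = exp 1 \<or> wt (ray s i n) i a * wt (ray s i (Suc n)) i b = exp (- 1)"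
      using s' by auto
    moreover have "1 \<le> 3 * exp (1::real)" using exp_ge_add_one_self[of 1] by linarith
    moreover have "1 \<le> 3 * exp (- 1 :: real)" using e3 by (simp add: exp_minus field_simps)
    ultimately show ?thesis using True by auto
  qed
  obtain c where c: "c > 0" "\<And>x. algebraic_int x \<Longrightarrow> (\<And>j. norm (\<sigma> j x) < c) \<Longrightarrow> x = 0"
    using not_all_small by blast
  define \<epsilon> where "\<epsilon> = min 1 (c / 6)"
  have eps: "\<epsilon> > 0" "6 * \<epsilon>\<^sup>2 \<le> c"
  proof -
    show "\<epsilon> > 0" using c by (simp add: \<epsilon>_def)
    have "\<epsilon>\<^sup>2 \<le> 1 * (c / 6)" unfolding power2_eq_square using \<open>\<epsilon> > 0\<close> c(1) by (intro mult_mono) (auto simp: \<epsilon>_def)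
    then show "6 * \<epsilon>\<^sup>2 \<le> c" by simp
  qed
  obtain n0 where n0: "\<forall>n\<ge>n0. short_vec g (ray s i n) \<epsilon>" using short[OF eps(1)] ..
  have "\<forall>n. \<exists>v. n0 \<le> n \<longrightarrow> int_vec v \<and> v \<noteq> 0 \<and> (\<forall>j a. wt (ray s i n) j a * norm (app g v j a) < \<epsilon>)"
    using n0 unfolding short_vec_def by simp
  from choice[OF this] obtain v where v': "\<forall>n. n0 \<le> n \<longrightarrow> int_vec (v n) \<and> v n \<noteq> 0 \<and> (\<forall>j a. wt (ray s i n) j a * norm (app g (v n) j a) < \<epsilon>)" ..
  have v: "int_vec (v n)" "v n \<noteq> 0" "wt (ray s i n) j a * norm (app g (v n) j a) < \<epsilon>" if "n0 \<le> n" for n j a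
    using v' that by simp_all
  have step: "det2 (v n) (v (Suc n)) = 0" if n: "n0 \<le> n" for n
  proof (rule c(2))
    show "algebraic_int (det2 (v n) (v (Suc n)))"
      using v(1)[OF n] v(1)[of "Suc n"] n by (auto simp: int_vec_def det2_def intro!: algebraic_int_diff algebraic_int_times)
    fix j
    have prod: "norm (app g (v n) j a * app g (v (Suc n)) j b) < 3 * \<epsilon>\<^sup>2" if ab: "a \<noteq> b" for a b
    proof -
      define p where "p = norm (app g (v n) j a)"
      define q where "q = norm (app g (v (Suc n)) j b)"
      define wp' where "wp' = wt (ray s i n) j a"
      define wq where "wq = wt (ray s i (Suc n)) j b"
      have pos: "wp' > 0" "wq > 0" "p \<ge> 0" "q \<ge> 0" using wp by (auto simp: wp'_def wq_def p_def q_def)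
      have lt: "wp' * p < \<epsilon>" "wq * q < \<epsilon>" using v(3)[OF n, of j a] v(3)[of "Suc n" j b] n by (auto simp: wp'_def wq_def p_def q_def)
      have "p * q \<le> (3 * (wp' * wq)) * (p * q)"
        using mult_right_mono[OF ratio[OF ab, of n j], of "p * q"] pos by (simp add: wp'_def wq_def)
      also have "\<dots> = 3 * ((wp' * p) * (wq * q))" by (simp add: mult_ac)
      also have "\<dots> < 3 * (\<epsilon> * \<epsilon>)" using lt pos eps(1) by (intro mult_strict_left_mono mult_strict_mono) auto
      finally show ?thesis by (simp add: norm_mult p_def q_def power2_eq_square)
    qed
    have "norm (\<sigma> j (det2 (v n) (v (Suc n)))) \<le> norm (app g (v n) j 1 * app g (v (Suc n)) j 2) + norm (app g (v n) j 2 * app g (v (Suc n)) j 1)"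
      unfolding app_det[of g j "v n" "v (Suc n)", OF det, symmetric] by (rule norm_triangle_ineq4)
    also have "\<dots> < c" using prod[of 1 2] prod[of 2 1] eps(2) by simp
    finally show "norm (\<sigma> j (det2 (v n) (v (Suc n)))) < c" .
  qed
  have multiple: "\<exists>x. x \<noteq> 0 \<and> v n = (x * fst (v n0), x * snd (v n0))" if "n0 \<le> n" for n
    using that
  proof (induction n rule: dec_induct)
    case base show ?case by (intro exI[of _ 1]) simp
  next
    case (step n)
    then obtain x where x: "x \<noteq> 0" "v n = (x * fst (v n0), x * snd (v n0))" by blast
    have nz: "v n0 \<noteq> 0" "v (Suc n) \<noteq> 0" using v(2) step by auto
    have "x * (fst (v n0) * snd (v (Suc n)) - snd (v n0) * fst (v (Suc n))) = 0"
      using \<open>\<And>n. n0 \<le> n \<Longrightarrow> det2 (v n) (v (Suc n)) = 0\<close>[OF step(1)] x(2) by (simp add: det2_def algebra_simps)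
    then have eq: "fst (v n0) * snd (v (Suc n)) = snd (v n0) * fst (v (Suc n))" using x(1) by simp
    show ?case
    proof (cases "fst (v n0) = 0")
      case False
      then have "v (Suc n) = (fst (v (Suc n)) / fst (v n0) * fst (v n0), fst (v (Suc n)) / fst (v n0) * snd (v n0))"
        using eq by (simp add: prod_eq_iff field_simps)
      moreover have "fst (v (Suc n)) \<noteq> 0"
      proof
        assume "fst (v (Suc n)) = 0"
        then have "snd (v (Suc n)) = 0" using eq False by simp
        then show False using nz(2) \<open>fst (v (Suc n)) = 0\<close> by (simp add: prod_eq_iff)
      qed
      ultimately show ?thesis using False by (intro exI[of _ "fst (v (Suc n)) / fst (v n0)"]) simp
    next
      case True
      then have s0: "snd (v n0) \<noteq> 0" using nz(1) by (auto simp: prod_eq_iff)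
      then have f0: "fst (v (Suc n)) = 0" using eq True by simp
      then have "snd (v (Suc n)) \<noteq> 0" using nz(2) by (auto simp: prod_eq_iff)
      then show ?thesis using s0 f0 True by (intro exI[of _ "snd (v (Suc n)) / snd (v n0)"]) (simp add: prod_eq_iff)
    qed
  qed
  have "\<exists>x. n0 \<le> n \<longrightarrow> x \<noteq> 0 \<and> v n = (x * fst (v n0), x * snd (v n0))" for n using multiple[of n] by auto
  then have "\<forall>n. \<exists>x. n0 \<le> n \<longrightarrow> x \<noteq> 0 \<and> v n = (x * fst (v n0), x * snd (v n0))" ..
  from choice[OF this] obtain x where x: "\<forall>n. n0 \<le> n \<longrightarrow> x n \<noteq> 0 \<and> v n = (x n * fst (v n0), x n * snd (v n0))" ..
  have appx: "app g (v n) j a = \<sigma> j (x n) * app g (v n0) j a" if n: "n0 \<le> n" for n j a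
  proof -
    have "v n = (x n * fst (v n0), x n * snd (v n0))" using x n by blast
    then have "app g (v n) j a = app g (x n * fst (v n0), x n * snd (v n0)) j a" by (rule arg_cong)
    also have "\<dots> = \<sigma> j (x n) * app g (v n0) j a" by (simp add: app_def emb_mult[OF emb] algebra_simps)
    finally show ?thesis .
  qed
  have "app g (v n0) i a0 = 0"
  proof (rule ccontr)
    assume nz: "app g (v n0) i a0 \<noteq> 0"
    define \<alpha> where "\<alpha> = norm (app g (v n0) i a0)"
    have \<alpha>: "\<alpha> > 0" using nz by (simp add: \<alpha>_def)
    have "\<exists>z. z \<noteq> 0 \<and> (\<forall>n\<ge>n0. algebraic_int (x n * z))"
    proof (cases "fst (v n0) = 0")
      case False
      have "algebraic_int (x n * fst (v n0))" if n: "n \<ge> n0" for n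
      proof -
        have "v n = (x n * fst (v n0), x n * snd (v n0))" using x n by blast
        then have "fst (v n) = x n * fst (v n0)" by (metis fst_conv)
        then show ?thesis using v(1)[OF n] by (simp add: int_vec_def)
      qed
      then show ?thesis using False by (intro exI[of _ "fst (v n0)"]) simp
    next
      case True
      then have "snd (v n0) \<noteq> 0" using v(2)[of n0] by (auto simp: prod_eq_iff)
      moreover have "algebraic_int (x n * snd (v n0))" if n: "n \<ge> n0" for n
      proof -
        have "v n = (x n * fst (v n0), x n * snd (v n0))" using x n by blast
        then have "snd (v n) = x n * snd (v n0)" by (metis snd_conv)
        then show ?thesis using v(1)[OF n] by (simp add: int_vec_def)
      qed
      ultimately show ?thesis by (intro exI[of _ "snd (v n0)"]) simp
    qed
    then obtain z where z: "z \<noteq> 0" "\<forall>n\<ge>n0. algebraic_int (x n * z)" by (elim exE conjE)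
    define \<beta> where "\<beta> = (\<lambda>j. if j = i then \<alpha> else max (norm (app g (v n0) j 1)) (norm (app g (v n0) j 2)))"
    have \<beta>: "\<beta> j > 0" for j using \<alpha> app_nonzero[of g j "v n0", OF det v(2)] by (auto simp: \<beta>_def less_max_iff_disj)
    have xb: "norm (\<sigma> j (x n)) * \<beta> j < \<epsilon>" if n: "n0 \<le> n" for n j
    proof (cases "j = i")
      case True
      have "norm (\<sigma> i (x n)) * \<alpha> \<le> exp (real n) * (norm (\<sigma> i (x n)) * \<alpha>)"
        using mult_right_mono[of 1 "exp (real n)" "norm (\<sigma> i (x n)) * \<alpha>"] \<alpha> by simp
      also have "\<dots> < \<epsilon>" using v(3)[OF n, of i a0] by (simp add: wa0 appx[OF n] norm_mult \<alpha>_def)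
      finally show ?thesis using True by (simp add: \<beta>_def)
    next
      case False
      then show ?thesis using v(3)[OF n, of j 1] v(3)[OF n, of j 2]
        by (auto simp: w1 appx[OF n] norm_mult \<beta>_def max_def)
    qed
    define Q where "Q = (\<Sum>j\<in>UNIV. \<epsilon> / \<beta> j * norm (\<sigma> j z))"
    have Q: "norm (\<sigma> j (x n * z)) \<le> Q" if n: "n0 \<le> n" for n j
    proof -
      have "norm (\<sigma> j (x n)) \<le> \<epsilon> / \<beta> j" using xb[OF n, of j] \<beta>[of j] by (simp add: pos_le_divide_eq)
      then have "norm (\<sigma> j (x n * z)) \<le> \<epsilon> / \<beta> j * norm (\<sigma> j z)"
        by (simp add: emb_mult[OF emb] norm_mult mult_right_mono del: times_divide_eq_left)
      also have "\<dots> \<le> Q" unfolding Q_def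
        by (rule member_le_sum) (auto intro!: divide_nonneg_pos mult_nonneg_nonneg simp: \<beta> less_imp_le[OF eps(1)])
      finally show ?thesis .
    qed
    obtain c' where c': "c' > 0" "\<And>y l. algebraic_int y \<Longrightarrow> y \<noteq> 0 \<Longrightarrow> (\<And>j. norm (\<sigma> j y) \<le> Q) \<Longrightarrow> c' \<le> norm (\<sigma> l y)"
      using bounded_away_from_0[of Q] by blast
    have lower: "c' \<le> norm (\<sigma> i (x n * z))" if n: "n0 \<le> n" for n
    proof (rule c'(2))
      show "algebraic_int (x n * z)" by (rule z(2)[rule_format, OF n])
      have "x n \<noteq> 0" by (rule conjunct1[OF x[rule_format, OF n]])
      then show "x n * z \<noteq> 0" using z(1) by simp
    qed (rule Q[OF n])
    obtain k :: nat where k: "real k > \<epsilon> * norm (\<sigma> i z) / (\<alpha> * c')" using reals_Archimedean2 by blast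
    define n where "n = max k n0"
    have n: "n0 \<le> n" "k \<le> n" by (simp_all add: n_def)
    have "exp (real n) * (norm (\<sigma> i (x n)) * \<alpha>) < \<epsilon>" using v(3)[OF n(1), of i a0] by (simp add: wa0 appx[OF n(1)] norm_mult \<alpha>_def)
    then have "exp (real n) * (norm (\<sigma> i (x n)) * \<alpha>) * norm (\<sigma> i z) \<le> \<epsilon> * norm (\<sigma> i z)" by (intro mult_right_mono) auto
    then have "exp (real n) * \<alpha> * norm (\<sigma> i (x n * z)) \<le> \<epsilon> * norm (\<sigma> i z)"
      by (simp add: emb_mult[OF emb] norm_mult mult_ac)
    moreover have "exp (real n) * \<alpha> * c' \<le> exp (real n) * \<alpha> * norm (\<sigma> i (x n * z))"
      using lower[OF n(1)] \<alpha> by (intro mult_left_mono) auto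
    ultimately have "exp (real n) * \<alpha> * c' \<le> \<epsilon> * norm (\<sigma> i z)" by (rule order_trans[rotated])
    then have "exp (real n) \<le> \<epsilon> * norm (\<sigma> i z) / (\<alpha> * c')" using \<alpha> c'(1) by (simp add: pos_le_divide_eq mult.assoc)
    moreover have "real n < exp (real n)" using exp_ge_add_one_self[of "real n"] by linarith
    ultimately show False using k n(2) by linarith
  qed
  then show ?thesis using v(1,2)[of n0] unfolding a0_def by (intro exI[of _ "v n0"]) simp
qed

theorem divergent_iff_aligned:
  assumes g: "g \<in> carrier (G \<sigma>)"
  shows "divergent_orbit \<sigma> (D \<sigma> {i}) (\<pi> \<sigma> g) \<longleftrightarrow> aligned {i} g"
proof
  assume div: "divergent_orbit \<sigma> (D \<sigma> {i}) (\<pi> \<sigma> g)"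
  have "\<exists>v. int_vec v \<and> v \<noteq> 0 \<and> app g v i (if (1::real) = 1 then 1 else 2) = 0"
    by (rule contracted_vector[OF g]) (simp, rule divergent_short_vectors[OF g div], simp_all)
  moreover have "\<exists>v. int_vec v \<and> v \<noteq> 0 \<and> app g v i (if (- 1::real) = 1 then 1 else 2) = 0"
    by (rule contracted_vector[OF g]) (simp, rule divergent_short_vectors[OF g div], simp_all)
  ultimately show "aligned {i} g" unfolding aligned_single_iff[OF g] by simp
qed (rule divergent_if_aligned)

end

section \<open>Limits of diagonal translates of a rational point\<close>

text \<open>
  The largest linear subspace inside a subgroup; for a closed subgroup it is the Lie algebra of
  the group.
\<close>
definition line_part :: "'a::euclidean_space set \<Rightarrow> 'a set" where
  "line_part L = {v. \<forall>t. t *\<^sub>R v \<in> L}"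

text \<open>
  Otherwise there are arbitrarily small elements \<open>w n\<close> of \<open>L\<close>
  orthogonal to \<open>line_part L\<close>. Suitable integer multiples of them approximate every
  real multiple of a limit direction \<open>l\<close>, so that \<open>l\<close> would belong to
  \<open>line_part L\<close> and be orthogonal to it.
\<close>
lemma closed_subgroup_locally_linear:
  fixes L :: "'a::euclidean_space set"
  assumes cl: "closed L" and zero: "0 \<in> L" and diff: "\<And>x y. x \<in> L \<Longrightarrow> y \<in> L \<Longrightarrow> x - y \<in> L"
  shows "subspace (line_part L)" "line_part L \<subseteq> L" "\<exists>e>0. \<forall>x\<in>L. norm x < e \<longrightarrow> x \<in> line_part L"
proof -
  have neg: "- x \<in> L" if "x \<in> L" for x using diff[OF zero that] by simp
  have add: "x + y \<in> L" if "x \<in> L" "y \<in> L" for x y using diff[OF that(1) neg[OF that(2)]] by simp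
  have nat_mult: "real k *\<^sub>R x \<in> L" if x: "x \<in> L" for x and k :: nat
    by (induction k) (auto simp: zero scaleR_left_distrib intro: add x)
  have int_mult: "real_of_int k *\<^sub>R x \<in> L" if "x \<in> L" for x k
    using nat_mult[OF that, of "nat \<bar>k\<bar>"] neg by (cases "k \<ge> 0") fastforce+
  show sub: "subspace (line_part L)"
    by (rule subspaceI) (auto simp: line_part_def zero scaleR_right_distrib intro: add)
  show VL: "line_part L \<subseteq> L"
  proof
    fix v assume "v \<in> line_part L"
    then have "1 *\<^sub>R v \<in> L" unfolding line_part_def by blast
    then show "v \<in> L" by simp
  qed
  show "\<exists>e>0. \<forall>x\<in>L. norm x < e \<longrightarrow> x \<in> line_part L"
  proof (rule ccontr)
    assume no: "\<not> ?thesis"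
    have "\<exists>w. w \<in> L \<and> w \<noteq> 0 \<and> norm w < inverse (real (Suc n)) \<and> (\<forall>v\<in>line_part L. orthogonal w v)" for n
    proof -
      have "inverse (real (Suc n)) > 0" by simp
      then obtain x where x: "x \<in> L" "norm x < inverse (real (Suc n))" "x \<notin> line_part L" using no by blast
      obtain y w where yw: "y \<in> span (line_part L)" "\<And>v. v \<in> span (line_part L) \<Longrightarrow> orthogonal w v" "x = y + w"
        using orthogonal_subspace_decomp_exists[of "line_part L" x] by metis
      have sp: "span (line_part L) = line_part L" using sub by (simp add: span_eq_iff)
      have y: "y \<in> line_part L" using yw(1) sp by simp
      then have "w \<in> L" using diff[OF x(1), of y] VL yw(3) by auto
      moreover have "w \<noteq> 0" using x(3) y yw(3) by auto
      moreover have "norm w \<le> norm x"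
      proof -
        have "orthogonal y w" using yw(2)[OF yw(1)] by (simp add: orthogonal_commute)
        then have "(norm x)\<^sup>2 = (norm y)\<^sup>2 + (norm w)\<^sup>2" unfolding yw(3) by (rule norm_add_Pythagorean)
        then have "(norm w)\<^sup>2 \<le> (norm x)\<^sup>2" by simp
        then show ?thesis by (rule power2_le_imp_le) simp
      qed
      ultimately show ?thesis using x(2) yw(2) sp by (intro exI[of _ w]) auto
    qed
    then have "\<forall>n. \<exists>w. w \<in> L \<and> w \<noteq> 0 \<and> norm w < inverse (real (Suc n)) \<and> (\<forall>v\<in>line_part L. orthogonal w v)" ..
    from choice[OF this] obtain w where
      w: "\<forall>n. w n \<in> L \<and> w n \<noteq> 0 \<and> norm (w n) < inverse (real (Suc n)) \<and> (\<forall>v\<in>line_part L. orthogonal (w n) v)" ..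
    define u where "u = (\<lambda>n. w n /\<^sub>R norm (w n))"
    have nu: "norm (u n) = 1" for n using w by (simp add: u_def)
    then have "bounded (range u)" unfolding bounded_iff by (intro exI[of _ 1]) auto
    then obtain l r where r: "strict_mono r" "(u \<circ> r) \<longlonglongrightarrow> l"
      using bounded_imp_convergent_subsequence by blast
    have w0: "(\<lambda>n. norm (w (r n))) \<longlonglongrightarrow> 0"
    proof -
      have le: "norm (w n) \<le> inverse (real (Suc n))" for n
        by (rule less_imp_le) (use w in simp)
      have "(\<lambda>n. norm (w n)) \<longlonglongrightarrow> 0"
        by (rule tendsto_sandwich[OF always_eventually always_eventually tendsto_const LIMSEQ_inverse_real_of_nat])
          (use le in simp_all)
      from LIMSEQ_subseq_LIMSEQ[OF this r(1)] show ?thesis by (simp only: o_def)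
    qed
    have "t *\<^sub>R l \<in> L" for t
    proof -
      define k where "k = (\<lambda>n. \<lfloor>t / norm (w (r n))\<rfloor>)"
      have kw: "real_of_int (k n) *\<^sub>R w (r n) \<in> L" for n by (rule int_mult) (use w in simp)
      have "\<bar>real_of_int (k n) * norm (w (r n)) - t\<bar> \<le> norm (w (r n))" for n
      proof -
        have p: "norm (w (r n)) > 0" using w by simp
        have "real_of_int (k n) \<le> t / norm (w (r n))" "t / norm (w (r n)) < real_of_int (k n) + 1"
          unfolding k_def by linarith+
        then have "real_of_int (k n) * norm (w (r n)) \<le> t" "t < (real_of_int (k n) + 1) * norm (w (r n))"
          using p by (simp_all add: pos_le_divide_eq pos_divide_less_eq)
        then show ?thesis by (simp add: algebra_simps)
      qed
      then have "(\<lambda>n. real_of_int (k n) * norm (w (r n)) - t) \<longlonglongrightarrow> 0"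
        by (intro Lim_null_comparison[OF _ w0]) simp
      then have "(\<lambda>n. real_of_int (k n) * norm (w (r n))) \<longlonglongrightarrow> t" by (simp add: LIM_zero_iff)
      then have "(\<lambda>n. (real_of_int (k n) * norm (w (r n))) *\<^sub>R u (r n)) \<longlonglongrightarrow> t *\<^sub>R l"
        using r(2) by (intro tendsto_scaleR) (simp_all add: o_def)
      moreover have "(real_of_int (k n) * norm (w (r n))) *\<^sub>R u (r n) = real_of_int (k n) *\<^sub>R w (r n)" for n
        using w by (simp add: u_def)
      ultimately have "(\<lambda>n. real_of_int (k n) *\<^sub>R w (r n)) \<longlonglongrightarrow> t *\<^sub>R l" by simp
      then show ?thesis by (rule closed_sequentially[OF cl kw])
    qed
    then have l: "l \<in> line_part L" by (simp add: line_part_def)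
    have "u n \<bullet> l = 0" for n
    proof -
      have "w n \<bullet> l = 0" using w l by (simp add: orthogonal_def)
      then show ?thesis by (simp add: u_def)
    qed
    then have "(\<lambda>n. (u \<circ> r) n \<bullet> l) = (\<lambda>n. 0)" by simp
    moreover have "(\<lambda>n. (u \<circ> r) n \<bullet> l) \<longlonglongrightarrow> l \<bullet> l" by (intro tendsto_inner r(2) tendsto_const)
    ultimately have "l \<bullet> l = 0" using LIMSEQ_unique[OF _ tendsto_const] by metis
    moreover have "(\<lambda>n. norm ((u \<circ> r) n)) \<longlonglongrightarrow> norm l" by (intro tendsto_norm r(2))
    then have "norm l = 1" using nu LIMSEQ_unique[OF _ tendsto_const[of 1]] by simp
    ultimately show False by simp
  qed
qed

text \<open>
  The hypotheses say that the quadratic forms \<open>x y \<circ> M\<close> and \<open>x y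
  \<circ> N\<close> have the same coefficients. So \<open>M ** adj2 N\<close> preserves the form
  \<open>x y\<close>; since its determinant is \<open>1\<close>, it does not swap the two
  isotropic lines.
\<close>
lemma same_split_form_diagonal:
  fixes M N :: "'a::field_char_0^2^2"
  assumes "det M = 1" "det N = 1"
    and "M$1$1 * M$2$1 = N$1$1 * N$2$1" "M$1$2 * M$2$2 = N$1$2 * N$2$2"
    and "M$1$1 * M$2$2 + M$1$2 * M$2$1 = N$1$1 * N$2$2 + N$1$2 * N$2$1"
  shows "(M ** adj2 N) $ 1 $ 2 = 0" "(M ** adj2 N) $ 2 $ 1 = 0"
proof -
  define X where "X = M ** adj2 N"
  have X: "X$1$1 = M$1$1 * N$2$2 - M$1$2 * N$2$1" "X$1$2 = M$1$2 * N$1$1 - M$1$1 * N$1$2"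
    "X$2$1 = M$2$1 * N$2$2 - M$2$2 * N$2$1" "X$2$2 = M$2$2 * N$1$1 - M$2$1 * N$1$2"
    by (simp_all add: X_def mat2_mult adj2_nth)
  have n: "N$1$1 * N$2$2 - N$1$2 * N$2$1 = 1" using assms(2) by (simp add: det_2)
  have "det X = 1" using assms by (simp add: X_def det_mul det_adj2)
  then have d: "X$1$1 * X$2$2 - X$1$2 * X$2$1 = 1" by (simp add: det_2)
  define P1 P2 P3 where P: "P1 = N$1$1 * N$2$1" "P2 = N$1$2 * N$2$2" "P3 = N$1$1 * N$2$2 + N$1$2 * N$2$1"
  have mp: "M$1$1 * M$2$1 = P1" "M$1$2 * M$2$2 = P2" "M$1$1 * M$2$2 + M$1$2 * M$2$1 = P3" using assms P by simp_all
  have a: "X$1$1 * X$2$1 = P1 * (N$2$2)\<^sup>2 - P3 * (N$2$2 * N$2$1) + P2 * (N$2$1)\<^sup>2"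
    unfolding X mp[symmetric] by (simp add: algebra_simps power2_eq_square)
  have b: "X$1$2 * X$2$2 = P2 * (N$1$1)\<^sup>2 - P3 * (N$1$1 * N$1$2) + P1 * (N$1$2)\<^sup>2"
    unfolding X mp[symmetric] by (simp add: algebra_simps power2_eq_square)
  have c: "X$1$1 * X$2$2 + X$1$2 * X$2$1 = P3 * (N$1$1 * N$2$2 + N$1$2 * N$2$1) - 2 * P1 * (N$1$2 * N$2$2) - 2 * P2 * (N$1$1 * N$2$1)"
    unfolding X mp[symmetric] by (simp add: algebra_simps)
  have a0: "X$1$1 * X$2$1 = 0" unfolding a P by (simp add: algebra_simps power2_eq_square)
  have b0: "X$1$2 * X$2$2 = 0" unfolding b P by (simp add: algebra_simps power2_eq_square)
  have "X$1$1 * X$2$2 + X$1$2 * X$2$1 = (N$1$1 * N$2$2 - N$1$2 * N$2$1)\<^sup>2"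
    unfolding c P by (simp add: algebra_simps power2_eq_square)
  then have c1: "X$1$1 * X$2$2 + X$1$2 * X$2$1 = 1" by (simp add: n)
  have "2 * (X$1$1 * X$2$2) = (X$1$1 * X$2$2 + X$1$2 * X$2$1) + (X$1$1 * X$2$2 - X$1$2 * X$2$1)" by simp
  also have "\<dots> = 2" unfolding c1 d by simp
  finally have "X$1$1 * X$2$2 = 1" by simp
  then have "X$1$1 \<noteq> 0" "X$2$2 \<noteq> 0" by auto
  then show "(M ** adj2 N) $ 1 $ 2 = 0" "(M ** adj2 N) $ 2 $ 1 = 0"
    using a0 b0 unfolding X_def[symmetric] by auto
qed

definition is_diag :: "complex^2^2 \<Rightarrow> bool" where
  "is_diag A \<longleftrightarrow> A$1$2 = 0 \<and> A$2$1 = 0"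

lemma is_diag_mult: "is_diag A \<Longrightarrow> is_diag B \<Longrightarrow> is_diag (A ** B)"
  by (simp add: is_diag_def mat2_mult)

lemma is_diag_adj2: "is_diag A \<Longrightarrow> is_diag (adj2 A)"
  by (simp add: is_diag_def adj2_nth)

lemma is_diag_commute: "is_diag A \<Longrightarrow> is_diag B \<Longrightarrow> A ** B = B ** A"
  by (simp add: is_diag_def mat2_eq_iff mat2_mult)

lemma is_diag_eq_dg: "is_diag A \<Longrightarrow> det A = 1 \<Longrightarrow> A = dg (A$1$1)"
  by (auto simp: is_diag_def det_2 mat2_eq_iff dg_nth intro: inverse_unique[symmetric])

context archimedean_places
begin

lemma D_is_diag: "d \<in> D \<sigma> I \<Longrightarrow> is_diag (d j)"
  using D_offdiag by (simp add: is_diag_def)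

text \<open>
  The coefficients of \<open>x y \<circ> (q A\<^sub>n)\<close> are algebraic integers up to a
  fixed denominator, and they are continuous functions of the convergent sequence because
  diagonal factors of determinant \<open>1\<close> preserve \<open>x y\<close>.
\<close>
lemma split_form_eventually_const:
  assumes q: "q \<in> carrier (SL2 UNIV)" and A: "\<And>n. A n \<in> SLO"
    and d: "\<And>n i. is_diag (d n i)" "\<And>n i. det (d n i) = 1"
    and lim: "(\<lambda>n i. d n i ** map_matrix (\<sigma> i) (q ** A n)) \<longlonglongrightarrow> h"
  shows "\<exists>N::nat. \<forall>n\<ge>N. \<forall>i. is_diag (map_matrix (\<sigma> i) (q ** A n ** adj2 (q ** A N)))"
proof -
  have "finite {q$1$1, q$1$2, q$2$1, q$2$2}" by simp
  then obtain m :: nat where m: "m > 0" "\<And>x. x \<in> {q$1$1, q$1$2, q$2$1, q$2$2} \<Longrightarrow> algebraic_int (of_nat m * x)"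
    using common_denominator_algebraic_int[OF nf, of "{q$1$1, q$1$2, q$2$1, q$2$2}"] by blast
  have qm: "algebraic_int (of_nat m * q $ a $ b)" for a b
    using m(2) exhaust_2[of a] exhaust_2[of b] by auto
  define W where "W = (\<lambda>n. q ** A n)"
  have Aint: "algebraic_int (A n $ a $ b)" for n a b using A by (auto simp: SL2_carrier)
  have Wm: "algebraic_int (of_nat m * W n $ a $ b)" for n a b
  proof -
    have "of_nat m * W n $ a $ b = (of_nat m * q $ a $ 1) * A n $ 1 $ b + (of_nat m * q $ a $ 2) * A n $ 2 $ b"
      by (simp add: W_def mat2_mult algebra_simps)
    then show ?thesis by (simp only:) (intro algebraic_int_plus algebraic_int_times qm Aint)
  qed
  have detW: "det (W n) = 1" for n
    using q A[of n] by (simp add: W_def det_mul SL2_carrier)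
  have lim': "(\<lambda>n. (d n i ** map_matrix (\<sigma> i) (W n)) $ a $ b) \<longlonglongrightarrow> h i $ a $ b" for i a b
    using lim unfolding tendsto_fun_mat2_iff W_def by blast
  have dd: "d n i $ 1 $ 1 * d n i $ 2 $ 2 = 1" "d n i $ 1 $ 2 = 0" "d n i $ 2 $ 1 = 0" for n i
    using d[of n i] by (auto simp: is_diag_def det_2)
  have prod: "(d n i ** map_matrix (\<sigma> i) (W n)) $ 1 $ a * (d n i ** map_matrix (\<sigma> i) (W n)) $ 2 $ b = \<sigma> i (W n $ 1 $ a * W n $ 2 $ b)" for n i a b
  proof -
    have "(d n i ** map_matrix (\<sigma> i) (W n)) $ 1 $ a * (d n i ** map_matrix (\<sigma> i) (W n)) $ 2 $ b
        = (d n i $ 1 $ 1 * d n i $ 2 $ 2) * \<sigma> i (W n $ 1 $ a * W n $ 2 $ b)"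
      by (simp add: mat2_mult dd(2,3) emb_mult[OF emb] mult_ac)
    then show ?thesis by (simp add: dd(1))
  qed
  have conv: "(\<lambda>n. \<sigma> i (W n $ 1 $ a * W n $ 2 $ b)) \<longlonglongrightarrow> h i $ 1 $ a * h i $ 2 $ b" for i a b
    using tendsto_mult[OF lim'[of i 1 a] lim'[of i 2 b]] unfolding prod .
  have const: "\<exists>N. \<forall>n\<ge>N. of_nat m * of_nat m * (W n $ 1 $ a * W n $ 2 $ b) = of_nat m * of_nat m * (W N $ 1 $ a * W N $ 2 $ b)" for a b
  proof -
    have int: "algebraic_int (of_nat m * of_nat m * (W n $ 1 $ a * W n $ 2 $ b))" for n
    proof -
      have "of_nat m * of_nat m * (W n $ 1 $ a * W n $ 2 $ b) = (of_nat m * W n $ 1 $ a) * (of_nat m * W n $ 2 $ b)"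
        by (simp add: mult_ac)
      then show ?thesis by (simp only:) (intro algebraic_int_times Wm)
    qed
    have "convergent (\<lambda>n. \<sigma> i (of_nat m * of_nat m * (W n $ 1 $ a * W n $ 2 $ b)))" for i
    proof -
      have "(\<lambda>n. \<sigma> i (of_nat m * of_nat m) * \<sigma> i (W n $ 1 $ a * W n $ 2 $ b)) \<longlonglongrightarrow> \<sigma> i (of_nat m * of_nat m) * (h i $ 1 $ a * h i $ 2 $ b)"
        by (intro tendsto_mult tendsto_const conv)
      then show ?thesis unfolding convergent_def emb_mult[OF emb, of i "of_nat m * of_nat m"] by blast
    qed
    from convergent_algebraic_ints_eventually_const[of "\<lambda>n. of_nat m * of_nat m * (W n $ 1 $ a * W n $ 2 $ b)", OF int this]
    show ?thesis by blast
  qed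
  have "\<forall>p. \<exists>N. \<forall>n\<ge>N. of_nat m * of_nat m * (W n $ 1 $ fst p * W n $ 2 $ snd p) = of_nat m * of_nat m * (W N $ 1 $ fst p * W N $ 2 $ snd p)"
    using const by blast
  from choice[OF this] obtain N where
    N: "\<forall>p. \<forall>n\<ge>N p. of_nat m * of_nat m * (W n $ 1 $ fst p * W n $ 2 $ snd p) = of_nat m * of_nat m * (W (N p) $ 1 $ fst p * W (N p) $ 2 $ snd p)" ..
  define M where "M = Max (range N)"
  have M: "N p \<le> M" for p unfolding M_def by (rule Max_ge) auto
  have same: "W n $ 1 $ a * W n $ 2 $ b = W M $ 1 $ a * W M $ 2 $ b" if n: "n \<ge> M" for n a b
  proof -
    have "of_nat m * of_nat m * (W n $ 1 $ a * W n $ 2 $ b) = of_nat m * of_nat m * (W (N (a,b)) $ 1 $ a * W (N (a,b)) $ 2 $ b)"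
      using N[THEN spec, of "(a,b)"] M[of "(a,b)"] n by simp
    moreover have "of_nat m * of_nat m * (W M $ 1 $ a * W M $ 2 $ b) = of_nat m * of_nat m * (W (N (a,b)) $ 1 $ a * W (N (a,b)) $ 2 $ b)"
      using N[THEN spec, of "(a,b)"] M[of "(a,b)"] by simp
    ultimately have "of_nat m * of_nat m * (W n $ 1 $ a * W n $ 2 $ b) = of_nat m * of_nat m * (W M $ 1 $ a * W M $ 2 $ b)" by (simp only:)
    moreover have "of_nat m * of_nat m \<noteq> (0::'k)" using m(1) by simp
    ultimately show ?thesis using mult_left_cancel by blast
  qed
  have "is_diag (map_matrix (\<sigma> i) (W n ** adj2 (W M)))" if n: "n \<ge> M" for n i
    using same_split_form_diagonal[OF detW[of n] detW[of M] same[OF n] same[OF n]] same[OF n]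
    by (simp add: is_diag_def emb_0[OF emb])
  then show ?thesis unfolding W_def by blast
qed

lemma exp_dg_in_D: "(\<And>i. z $ i \<in> K i) \<Longrightarrow> (\<lambda>i. dg (exp (z $ i))) \<in> D \<sigma> UNIV"
  by (auto simp: D_iff)

definition diag_G :: "('r \<Rightarrow> complex^2^2) set" where
  "diag_G = {a \<in> carrier (G \<sigma>). \<forall>i. is_diag (a i)}"

lemma diag_G_closed: "closed diag_G"
  unfolding closed_sequential_limits
proof (intro allI impI, elim conjE)
  fix x l assume x: "\<forall>n. x n \<in> diag_G" and lim: "x \<longlonglongrightarrow> l"
  have "l \<in> carrier (G \<sigma>)" by (rule closed_sequentially[OF closed_G _ lim]) (use x in \<open>simp add: diag_G_def\<close>)
  moreover have "is_diag (l i)" for i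
  proof -
    have c: "(\<lambda>n. x n i $ 1 $ 2) \<longlonglongrightarrow> l i $ 1 $ 2" "(\<lambda>n. x n i $ 2 $ 1) \<longlonglongrightarrow> l i $ 2 $ 1"
      using lim unfolding tendsto_fun_mat2_iff by blast+
    have "(\<lambda>n. x n i $ 1 $ 2) = (\<lambda>n. 0)" "(\<lambda>n. x n i $ 2 $ 1) = (\<lambda>n. 0)" using x by (simp_all add: diag_G_def is_diag_def)
    then show ?thesis using c LIMSEQ_unique[OF _ tendsto_const] unfolding is_diag_def by metis
  qed
  ultimately show "l \<in> diag_G" by (simp add: diag_G_def)
qed

text \<open>
  The identity component of \<open>closure P\<close> is the exponential image \<open>S\<close>
  of a linear space, and it is open in \<open>closure P\<close>; thus it meets every coset of
  \<open>S\<close> in an element of the dense subgroup \<open>P\<close>. The linear space is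
  obtained from the closed group \<open>L\<close> of logarithms, so that no structure theory of
  Lie groups is involved.
\<close>
lemma connected_part_of_diagonal_group:
  assumes P: "P \<subseteq> diag_G" and one: "(\<lambda>i. mat 1) \<in> P"
    and mult: "\<And>a b. a \<in> P \<Longrightarrow> b \<in> P \<Longrightarrow> (\<lambda>i. a i ** b i) \<in> P"
    and inv: "\<And>a. a \<in> P \<Longrightarrow> (\<lambda>i. adj2 (a i)) \<in> P"
    and DP: "D \<sigma> I \<subseteq> P"
  shows "\<exists>S. subgroup S (G \<sigma>) \<and> S \<subseteq> D \<sigma> UNIV \<and> closedin (G_top \<sigma>) S \<and> connectedin (G_top \<sigma>) S \<and>
    D \<sigma> I \<subseteq> S \<and> S \<subseteq> closure P \<and> (\<forall>a\<in>closure P. \<exists>s\<in>S. \<exists>p\<in>P. a = (\<lambda>i. s i ** p i))"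
proof -
  define H where "H = closure P"
  have Hd: "H \<subseteq> diag_G" unfolding H_def by (rule closure_minimal[OF P diag_G_closed])
  have Hdet: "det (a i) = 1" and Hdg: "is_diag (a i)" if "a \<in> H" for a i
    using subsetD[OF Hd that] G_det by (auto simp: diag_G_def)
  have PH: "P \<subseteq> H" by (simp add: H_def closure_subset)
  have Hseq: "\<exists>p. (\<forall>n. p n \<in> P) \<and> p \<longlonglongrightarrow> a" if "a \<in> H" for a
    using that unfolding H_def closure_sequential .
  have Hlim: "a \<in> H" if "\<And>n::nat. p n \<in> H" "p \<longlonglongrightarrow> a" for p a
    by (rule closed_sequentially[OF _ that]) (simp add: H_def)
  have Hone: "(\<lambda>i. mat 1) \<in> H" using one PH by blast
  have Hmult: "(\<lambda>i. a i ** b i) \<in> H" if a: "a \<in> H" and b: "b \<in> H" for a b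
  proof -
    obtain p where p: "\<forall>n. p n \<in> P" "p \<longlonglongrightarrow> a" using Hseq[OF a] by (elim exE conjE)
    obtain p' where p': "\<forall>n. p' n \<in> P" "p' \<longlonglongrightarrow> b" using Hseq[OF b] by (elim exE conjE)
    show ?thesis
      by (rule Hlim[OF _ tendsto_fun_mult[OF p(2) p'(2)]])
        (rule subsetD[OF PH mult[OF p(1)[rule_format] p'(1)[rule_format]]])
  qed
  have Hinv: "(\<lambda>i. adj2 (a i)) \<in> H" if a: "a \<in> H" for a
  proof -
    obtain p where p: "\<forall>n. p n \<in> P" "p \<longlonglongrightarrow> a" using Hseq[OF a] by (elim exE conjE)
    show ?thesis
      by (rule Hlim[OF _ tendsto_fun_adj2[OF p(2)]]) (rule subsetD[OF PH inv[OF p(1)[rule_format]]])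
  qed
  define ez where "ez = (\<lambda>(z :: complex^'r) i. dg (exp (z $ i)))"
  define L where "L = {z. (\<forall>i. z $ i \<in> K i) \<and> ez z \<in> H}"
  have ez_diff: "ez (x - y) = (\<lambda>i. ez x i ** adj2 (ez y i))" for x y
    by (simp add: ez_def exp_diff adj2_dg dg_mult divide_inverse)
  have ez0: "ez 0 = (\<lambda>i. mat 1)" by (simp add: ez_def dg_one)
  have K0: "0 \<in> K i" and Kdiff: "x \<in> K i \<Longrightarrow> y \<in> K i \<Longrightarrow> x - y \<in> K i" for x y i
  proof -
    show "0 \<in> K i" using ring_closed_K[of i] by (simp add: ring_closed_def)
    show "x - y \<in> K i" if "x \<in> K i" "y \<in> K i"
    proof -
      have "x + - y \<in> K i" using ring_closed_K[of i] that unfolding ring_closed_def by blast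
      then show ?thesis by simp
    qed
  qed
  have ez_cont: "continuous_on A ez" for A
    unfolding ez_def
    by (intro continuous_on_coordinatewise_then_product)
      (rule continuous_on_compose2[OF continuous_on_dg_exp[of UNIV]], auto intro!: continuous_intros)
  have L: "closed L" "0 \<in> L" "\<And>x y. x \<in> L \<Longrightarrow> y \<in> L \<Longrightarrow> x - y \<in> L"
  proof -
    show "closed L" unfolding closed_sequential_limits
    proof (intro allI impI, elim conjE)
      fix x l assume x: "\<forall>n. x n \<in> L" and lim: "x \<longlonglongrightarrow> l"
      have "l $ i \<in> K i" for i
        by (rule closed_sequentially[OF closed_K _ tendsto_vec_nth[OF lim]]) (use x in \<open>simp add: L_def\<close>)
      moreover have "(\<lambda>n. ez (x n)) \<longlonglongrightarrow> ez l"
        by (rule continuous_on_tendsto_compose[OF ez_cont[of UNIV] lim]) auto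
      then have "ez l \<in> H" by (rule Hlim[rotated]) (use x in \<open>simp add: L_def\<close>)
      ultimately show "l \<in> L" by (simp add: L_def)
    qed
    show "0 \<in> L" by (simp add: L_def ez0 Hone K0)
    show "x - y \<in> L" if "x \<in> L" "y \<in> L" for x y
      using that by (auto simp: L_def ez_diff intro!: Hmult Hinv Kdiff)
  qed
  note V = closed_subgroup_locally_linear[OF L]
  define S where "S = ez ` line_part L"
  have VL: "z $ i \<in> K i" "ez z \<in> H" if "z \<in> line_part L" for z i
    using subsetD[OF V(2) that] by (auto simp: L_def)
  have SH: "S \<subseteq> H" using VL(2) by (auto simp: S_def)
  have SD: "S \<subseteq> D \<sigma> UNIV" unfolding S_def ez_def using exp_dg_in_D[OF VL(1)] by blast
  have SG: "S \<subseteq> carrier (G \<sigma>)" using SD D_subset by blast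
  have Sdiff: "(\<lambda>i. a i ** adj2 (b i)) \<in> S" if ab: "a \<in> S" "b \<in> S" for a b
  proof -
    obtain x y where xy: "x \<in> line_part L" "a = ez x" "y \<in> line_part L" "b = ez y" using ab unfolding S_def by (elim imageE)
    have "x - y \<in> line_part L" by (rule subspace_diff[OF V(1) xy(1) xy(3)])
    then show ?thesis unfolding xy(2,4) S_def ez_diff[symmetric] by (rule imageI)
  qed
  have Sone: "(\<lambda>i. mat 1) \<in> S" unfolding S_def ez0[symmetric] by (rule imageI[OF subspace_0[OF V(1)]])
  have Sinv: "(\<lambda>i. adj2 (b i)) \<in> S" if "b \<in> S" for b using Sdiff[OF Sone that] by simp
  have Smult: "(\<lambda>i. a i ** b i) \<in> S" if "a \<in> S" "b \<in> S" for a b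
  proof -
    have "adj2 (adj2 (b i)) = b i" for i by (simp add: mat2_eq_iff adj2_nth)
    then show ?thesis using Sdiff[OF that(1) Sinv[OF that(2)]] by simp
  qed
  have DS: "D \<sigma> I \<subseteq> S"
  proof
    fix d assume d: "d \<in> D \<sigma> I"
    have "\<forall>i. \<exists>z. i \<in> I \<longrightarrow> z \<in> K i \<and> d i = dg (exp z)" using d unfolding D_iff by blast
    from choice[OF this] obtain z where z: "\<forall>i. i \<in> I \<longrightarrow> z i \<in> K i \<and> d i = dg (exp (z i))" ..
    define v :: "complex^'r" where "v = (\<chi> i. if i \<in> I then z i else 0)"
    have tv: "(t *\<^sub>R v) $ i = (if i \<in> I then of_real t * z i else 0)" for t i
      by (simp add: v_def scaleR_conv_of_real[where 'a=complex])
    have tvK: "(t *\<^sub>R v) $ i \<in> K i" for t i unfolding tv using z K_scaleR K0 by simp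
    have "t *\<^sub>R v \<in> L" for t
    proof -
      have "(\<lambda>i. if i \<in> I then dg (exp ((t *\<^sub>R v) $ i)) else mat 1) \<in> D \<sigma> I"
        by (rule D_normal_form[OF tvK])
      moreover have "(\<lambda>i. if i \<in> I then dg (exp ((t *\<^sub>R v) $ i)) else mat 1) = ez (t *\<^sub>R v)"
        unfolding ez_def tv by (auto simp: dg_one)
      ultimately have "ez (t *\<^sub>R v) \<in> D \<sigma> I" by (simp only:)
      then have "ez (t *\<^sub>R v) \<in> H" using DP PH by blast
      then show ?thesis using tvK by (simp add: L_def)
    qed
    then have "v \<in> line_part L" by (simp add: line_part_def)
    moreover have "d = ez v"
      using z D_outside[OF d] by (auto simp: ez_def v_def dg_one)
    ultimately show "d \<in> S" by (simp add: S_def)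
  qed
  \<comment> \<open>Near the identity, \<open>H\<close> is no larger than \<open>S\<close>.\<close>
  have local: "\<exists>n. a n \<in> S" if aH: "\<And>n::nat. a n \<in> H" and lim: "a \<longlonglongrightarrow> (\<lambda>i. mat 1)" for a
  proof -
    define z :: "nat \<Rightarrow> complex^'r" where "z = (\<lambda>n. \<chi> i. Ln (a n i $ 1 $ 1))"
    have e1: "(\<lambda>n. a n i $ 1 $ 1) \<longlonglongrightarrow> 1" for i
    proof -
      have "(\<lambda>n. a n i $ 1 $ 1) \<longlonglongrightarrow> (mat 1 :: complex^2^2) $ 1 $ 1" using lim unfolding tendsto_fun_mat2_iff by (elim allE)
      then show ?thesis by (simp add: mat2_one)
    qed
    have "(\<lambda>n. Ln (a n i $ 1 $ 1)) \<longlonglongrightarrow> Ln 1" for i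
      by (rule tendsto_Ln[OF e1]) simp
    then have "(\<lambda>n. z n $ i) \<longlonglongrightarrow> 0 $ i" for i by (simp add: z_def)
    then have "z \<longlonglongrightarrow> 0" by (rule vec_tendstoI)
    then have z0: "(\<lambda>n. norm (z n)) \<longlonglongrightarrow> 0" by (rule tendsto_norm_zero)
    obtain e where e: "e > 0" "\<forall>x\<in>L. norm x < e \<longrightarrow> x \<in> line_part L" using V(3) by blast
    have ev1: "\<forall>\<^sub>F n in sequentially. norm (z n) < e" by (rule order_tendstoD(2)[OF z0 e(1)])
    have ev2: "\<forall>\<^sub>F n in sequentially. \<forall>i. 0 < Re (a n i $ 1 $ 1)"
    proof (rule eventually_all_finite)
      fix i
      have "(\<lambda>n. Re (a n i $ 1 $ 1)) \<longlonglongrightarrow> Re 1" by (rule tendsto_Re[OF e1])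
      then show "\<forall>\<^sub>F n in sequentially. 0 < Re (a n i $ 1 $ 1)" by (rule order_tendstoD(1)) simp
    qed
    obtain n where n: "norm (z n) < e" "\<And>i. 0 < Re (a n i $ 1 $ 1)"
      using eventually_happens'[OF sequentially_bot eventually_conj[OF ev1 ev2]] by blast
    have ent: "a n i $ 1 $ 1 \<in> K i" for i
      using subsetD[OF Hd aH[of n]] G_entry by (simp add: diag_G_def)
    have nz: "a n i $ 1 $ 1 \<noteq> 0" for i using n(2)[of i] by auto
    have ezn: "ez (z n) = a n"
    proof
      fix i
      show "ez (z n) i = a n i"
        using is_diag_eq_dg[OF Hdg[OF aH] Hdet[OF aH], of n i] nz[of i] by (simp add: ez_def z_def)
    qed
    have "z n $ i \<in> K i" for i
    proof (cases "real_place i")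
      case True
      then have "a n i $ 1 $ 1 \<in> \<real>" using ent[of i] K_real by simp
      then obtain t where t: "a n i $ 1 $ 1 = of_real t" by (elim Reals_cases)
      have "t > 0" using n(2)[of i] t by simp
      then have "Ln (a n i $ 1 $ 1) = of_real (ln t)" unfolding t by (rule Ln_of_real)
      then show ?thesis using K_of_real by (simp add: z_def)
    next
      case False then show ?thesis by (simp add: K_complex)
    qed
    then have "z n \<in> L" using aH[of n] by (simp add: L_def ezn)
    then have "z n \<in> line_part L" using e(2) n(1) by simp
    then have "ez (z n) \<in> S" unfolding S_def by (rule imageI)
    then show ?thesis unfolding ezn by (rule exI)
  qed
  have near: "\<exists>n. (\<lambda>i. adj2 (p n i) ** a i) \<in> S" if pH: "\<And>n::nat. p n \<in> H" and lim: "p \<longlonglongrightarrow> a" for p a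
  proof (rule local[of "\<lambda>n i. adj2 (p n i) ** a i"])
    have a: "a \<in> H" by (rule Hlim[OF pH lim])
    show "(\<lambda>i. adj2 (p n i) ** a i) \<in> H" for n by (rule Hmult[OF Hinv[OF pH] a])
    have "(\<lambda>n i. adj2 (p n i) ** a i) \<longlonglongrightarrow> (\<lambda>i. adj2 (a i) ** a i)"
      by (intro tendsto_fun_mult tendsto_fun_adj2 lim tendsto_const)
    then show "(\<lambda>n i. adj2 (p n i) ** a i) \<longlonglongrightarrow> (\<lambda>i. mat 1)" by (simp add: adj2_mult Hdet[OF a])
  qed
  have dec: "\<forall>a\<in>closure P. \<exists>s\<in>S. \<exists>p\<in>P. a = (\<lambda>i. s i ** p i)"
  proof
    fix a assume "a \<in> closure P"
    then have a: "a \<in> H" by (simp add: H_def)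
    obtain p where p: "\<forall>n. p n \<in> P" "p \<longlonglongrightarrow> a" using Hseq[OF a] by (elim exE conjE)
    have pH: "p n \<in> H" for n by (rule subsetD[OF PH p(1)[rule_format]])
    obtain n where n: "(\<lambda>i. adj2 (p n i) ** a i) \<in> S" using near[OF pH p(2)] ..
    have "a = (\<lambda>i. (adj2 (p n i) ** a i) ** p n i)"
    proof
      fix i
      have "(adj2 (p n i) ** a i) ** p n i = (a i ** adj2 (p n i)) ** p n i"
        by (simp add: is_diag_commute[OF is_diag_adj2[OF Hdg[OF pH]] Hdg[OF a]])
      then show "a i = (adj2 (p n i) ** a i) ** p n i" by (simp add: adj2_cancel[OF Hdet[OF pH]])
    qed
    then show "\<exists>s\<in>S. \<exists>p\<in>P. a = (\<lambda>i. s i ** p i)"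
      by (rule bexI[OF bexI[of _ "p n"] n]) (rule p(1)[rule_format])
  qed
  have Sclosed: "closed S" unfolding closed_sequential_limits
  proof (intro allI impI, elim conjE)
    fix x l assume x: "\<forall>n. x n \<in> S" and lim: "x \<longlonglongrightarrow> l"
    have xH: "x n \<in> H" for n using x SH by blast
    obtain n where n: "(\<lambda>i. adj2 (x n i) ** l i) \<in> S" using near[OF xH lim] ..
    have "(\<lambda>i. x n i ** (adj2 (x n i) ** l i)) \<in> S" by (rule Smult[OF x[rule_format] n])
    then show "l \<in> S" by (simp add: adj2_cancel_left[OF Hdet[OF xH]])
  qed
  have "subgroup S (G \<sigma>)"
  proof (rule GG.subgroupI[OF SG])
    show "S \<noteq> {}" using Sone by blast
    show "inv\<^bsub>G \<sigma>\<^esub> a \<in> S" if "a \<in> S" for a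
      unfolding G_inv[OF subsetD[OF SG that]] by (rule Sinv[OF that])
    show "a \<otimes>\<^bsub>G \<sigma>\<^esub> b \<in> S" if "a \<in> S" "b \<in> S" for a b
      unfolding G_mult by (rule Smult[OF that])
  qed
  moreover have "closedin (G_top \<sigma>) S"
    unfolding G_top_def by (rule closed_subset[OF SG Sclosed])
  moreover have "connectedin (G_top \<sigma>) S"
  proof -
    have "connected (line_part L)" by (rule convex_connected[OF subspace_imp_convex[OF V(1)]])
    then have "connected S" unfolding S_def by (rule connected_continuous_image[OF ez_cont])
    then show ?thesis using SG by (simp add: G_top_def connectedin_subtopology)
  qed
  ultimately show ?thesis using SD DS SH dec unfolding H_def by (intro exI[of _ S] conjI)
qed

lemma D_mult: "d \<in> D \<sigma> I \<Longrightarrow> d' \<in> D \<sigma> I \<Longrightarrow> (\<lambda>i. d i ** d' i) \<in> D \<sigma> I"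
  and D_inv: "d \<in> D \<sigma> I \<Longrightarrow> (\<lambda>i. adj2 (d i)) \<in> D \<sigma> I"
  and D_one: "(\<lambda>i. mat 1) \<in> D \<sigma> I"
proof -
  have K: "x \<in> K i \<Longrightarrow> y \<in> K i \<Longrightarrow> x + y \<in> K i" "x \<in> K i \<Longrightarrow> - x \<in> K i" "0 \<in> K i" for x y i
    using ring_closed_K[of i] by (auto simp: ring_closed_def)
  show "(\<lambda>i. d i ** d' i) \<in> D \<sigma> I" if d: "d \<in> D \<sigma> I" and d': "d' \<in> D \<sigma> I"
    unfolding D_iff
  proof (intro conjI ballI allI impI)
    fix i assume i: "i \<in> I"
    obtain z where z: "z \<in> K i" "d i = dg (exp z)" using D_entry[OF d i] ..
    obtain y where y: "y \<in> K i" "d' i = dg (exp y)" using D_entry[OF d' i] ..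
    show "\<exists>z\<in>K i. d i ** d' i = dg (exp z)"
      by (rule bexI[OF _ K(1)[OF z(1) y(1)]]) (simp add: z y dg_mult exp_add)
  qed (simp add: D_outside[OF d] D_outside[OF d'])
  show "(\<lambda>i. adj2 (d i)) \<in> D \<sigma> I" if d: "d \<in> D \<sigma> I"
    unfolding D_iff
  proof (intro conjI ballI allI impI)
    fix i assume i: "i \<in> I"
    obtain z where z: "z \<in> K i" "d i = dg (exp z)" using D_entry[OF d i] ..
    show "\<exists>z\<in>K i. adj2 (d i) = dg (exp z)"
      by (rule bexI[OF _ K(2)[OF z(1)]]) (simp add: z adj2_dg exp_minus)
  qed (simp add: D_outside[OF d] mat2_eq_iff adj2_nth mat2_one)
  have "(mat 1 :: complex^2^2) = dg (exp 0)" by (simp add: dg_one)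
  then show "(\<lambda>i. mat 1) \<in> D \<sigma> I" unfolding D_iff using K(3) by blast
qed

lemma Gamma_mult: "c \<in> \<Gamma> \<sigma> \<Longrightarrow> c' \<in> \<Gamma> \<sigma> \<Longrightarrow> (\<lambda>i. c i ** c' i) \<in> \<Gamma> \<sigma>"
  and Gamma_inv: "c \<in> \<Gamma> \<sigma> \<Longrightarrow> (\<lambda>i. adj2 (c i)) \<in> \<Gamma> \<sigma>"
  using subgroup.m_closed[OF Gamma_subgroup, of c c'] subgroup.m_inv_closed[OF Gamma_subgroup, of c]
    G_inv[OF subsetD[OF Gamma_subset], of c] by (simp_all add: G_mult)

text \<open>
  With \<open>g = N Q\<close>, where \<open>Q\<close> is the image of \<open>q\<close>, all
  limits of \<open>D\<^sub>I g \<Gamma>\<close> have the form \<open>N a Q c\<close> with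
  \<open>a\<close> in the closure of \<open>D\<^sub>I \<Delta>\<close>. Here
  \<open>\<Delta>\<close> is the group of diagonal elements of \<open>G\<close> that lie in
  \<open>Q \<Gamma> inverse Q\<close>; it acts trivially on the coset \<open>Q \<Gamma>\<close>.
  Splitting \<open>a\<close> into an element of the connected part \<open>S\<close> and an
  element of \<open>D\<^sub>I \<Delta>\<close> shows that the closure is the orbit of the torus
  \<open>N S inverse N\<close>.
\<close>
theorem closure_torus_orbit_if_aligned:
  assumes al: "aligned I g"
  shows "is_torus_orbit \<sigma> (G_mod_\<Gamma>_top \<sigma> closure_of orbit_of \<sigma> (D \<sigma> I) (\<pi> \<sigma> g))"
proof -
  have g: "g \<in> carrier (G \<sigma>)" using al by (simp add: aligned_def)
  obtain q where q: "q \<in> carrier (SL2 UNIV)" and n: "\<forall>i\<in>I. \<exists>n. monomial n \<and> g i = n ** map_matrix (\<sigma> i) q"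
    using al unfolding aligned_def by blast
  define Q where "Q = diagonal_embedding \<sigma> q"
  define N where "N = (\<lambda>i. g i ** adj2 (Q i))"
  have Qc: "Q \<in> carrier (G \<sigma>)" unfolding Q_def by (rule emb_mat_closed[OF q])
  have Nc: "N \<in> carrier (G \<sigma>)" unfolding N_def by (rule G_mult_closed[OF g G_adj2_closed[OF Qc]])
  have Qdet: "det (Q i) = 1" and Ndet: "det (N i) = 1" for i by (rule G_det[OF Qc], rule G_det[OF Nc])
  have Qi: "Q i = map_matrix (\<sigma> i) q" for i by (simp add: Q_def diagonal_embedding_def)
  have gNQ: "g i = N i ** Q i" for i by (simp add: N_def adj2_cancel[OF Qdet])
  have Nmono: "\<forall>i\<in>I. monomial (N i)"
  proof
    fix i assume "i \<in> I"
    then obtain n where n: "monomial n" "g i = n ** Q i" using n unfolding Qi by blast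
    then show "monomial (N i)" by (simp add: N_def adj2_cancel[OF Qdet])
  qed
  have Nmono': "\<forall>i\<in>I. monomial (adj2 (N i))" using Nmono monomial_adj2 by blast
  have adj_adj: "adj2 (adj2 A) = A" for A :: "complex^2^2" by (simp add: mat2_eq_iff adj2_nth)
  have conjN: "(\<lambda>i. N i ** d i ** adj2 (N i)) \<in> D \<sigma> I" if "d \<in> D \<sigma> I" for d
    by (rule conj_in_D[OF Nmono Ndet that])
  have conjN': "(\<lambda>i. adj2 (N i) ** d i ** N i) \<in> D \<sigma> I" if "d \<in> D \<sigma> I" for d
    using conj_in_D[OF Nmono' _ that] by (simp add: det_adj2 Ndet adj_adj)
  define \<Delta> where "\<Delta> = {\<delta> \<in> diag_G. \<exists>c\<in>\<Gamma> \<sigma>. \<forall>i. \<delta> i ** Q i = Q i ** c i}"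
  have \<Delta>d: "\<delta> \<in> diag_G" if "\<delta> \<in> \<Delta>" for \<delta> using that by (simp add: \<Delta>_def)
  have \<Delta>c: "\<exists>c\<in>\<Gamma> \<sigma>. \<forall>i. \<delta> i ** Q i = Q i ** c i" if "\<delta> \<in> \<Delta>" for \<delta> using that by (simp add: \<Delta>_def)
  have dG_det: "det (a i) = 1" and dG_diag: "is_diag (a i)" if "a \<in> diag_G" for a i
    using that G_det by (simp_all add: diag_G_def)
  have dG_mult: "(\<lambda>i. a i ** b i) \<in> diag_G" if "a \<in> diag_G" "b \<in> diag_G" for a b
    using that G_mult_closed by (simp add: diag_G_def is_diag_mult)
  have dG_adj: "(\<lambda>i. adj2 (a i)) \<in> diag_G" if "a \<in> diag_G" for a
    using that G_adj2_closed by (simp add: diag_G_def is_diag_adj2)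
  have D_dG: "d \<in> diag_G" if "d \<in> D \<sigma> I" for d
    using subsetD[OF D_subset that] D_is_diag[OF that] by (simp add: diag_G_def)
  have one_dG: "(\<lambda>i. mat 1) \<in> diag_G" by (rule D_dG[OF D_one])
  have \<Delta>_one: "(\<lambda>i. mat 1) \<in> \<Delta>"
    unfolding \<Delta>_def using one_dG one_in_Gamma unfolding G_one
    by (intro CollectI conjI bexI[of _ "\<lambda>i. mat 1"]) simp_all
  have \<Delta>_mult: "(\<lambda>i. a i ** b i) \<in> \<Delta>" if a: "a \<in> \<Delta>" and b: "b \<in> \<Delta>" for a b
  proof -
    obtain c where c: "c \<in> \<Gamma> \<sigma>" "\<forall>i. a i ** Q i = Q i ** c i" using \<Delta>c[OF a] ..
    obtain c' where c': "c' \<in> \<Gamma> \<sigma>" "\<forall>i. b i ** Q i = Q i ** c' i" using \<Delta>c[OF b] ..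
    have "a i ** b i ** Q i = Q i ** (c i ** c' i)" for i
    proof -
      have "a i ** b i ** Q i = a i ** (Q i ** c' i)" using c'(2) by (simp add: matrix_mul_assoc[symmetric])
      also have "\<dots> = (Q i ** c i) ** c' i" using c(2) by (simp add: matrix_mul_assoc)
      finally show ?thesis by (simp add: matrix_mul_assoc)
    qed
    then show ?thesis unfolding \<Delta>_def using dG_mult[OF \<Delta>d[OF a] \<Delta>d[OF b]] Gamma_mult[OF c(1) c'(1)]
      by (intro CollectI conjI bexI[of _ "\<lambda>i. c i ** c' i"]) simp_all
  qed
  have \<Delta>_inv: "(\<lambda>i. adj2 (a i)) \<in> \<Delta>" if a: "a \<in> \<Delta>" for a
  proof -
    obtain c where c: "c \<in> \<Gamma> \<sigma>" "\<forall>i. a i ** Q i = Q i ** c i" using \<Delta>c[OF a] ..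
    have cdet: "det (c i) = 1" for i by (rule G_det[OF subsetD[OF Gamma_subset c(1)]])
    have "adj2 (a i) ** Q i = Q i ** adj2 (c i)" for i
    proof -
      have "adj2 (a i) ** Q i = adj2 (a i) ** (Q i ** c i ** adj2 (c i))" by (simp add: adj2_cancel[OF cdet])
      also have "\<dots> = adj2 (a i) ** (a i ** (Q i ** adj2 (c i)))" using c(2) by (simp add: matrix_mul_assoc)
      finally show ?thesis by (simp add: adj2_cancel_left[OF dG_det[OF \<Delta>d[OF a]]])
    qed
    then show ?thesis unfolding \<Delta>_def using dG_adj[OF \<Delta>d[OF a]] Gamma_inv[OF c(1)]
      by (intro CollectI conjI bexI[of _ "\<lambda>i. adj2 (c i)"]) simp_all
  qed
  define P where "P = {(\<lambda>i. d i ** \<delta> i) | d \<delta>. d \<in> D \<sigma> I \<and> \<delta> \<in> \<Delta>}"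
  have PI: "(\<lambda>i. d i ** \<delta> i) \<in> P" if "d \<in> D \<sigma> I" "\<delta> \<in> \<Delta>" for d \<delta> using that by (auto simp: P_def)
  have PE: "\<exists>d \<delta>. p = (\<lambda>i. d i ** \<delta> i) \<and> d \<in> D \<sigma> I \<and> \<delta> \<in> \<Delta>" if "p \<in> P" for p
    using that unfolding P_def by simp
  have "\<exists>S. subgroup S (G \<sigma>) \<and> S \<subseteq> D \<sigma> UNIV \<and> closedin (G_top \<sigma>) S \<and> connectedin (G_top \<sigma>) S \<and>
    D \<sigma> I \<subseteq> S \<and> S \<subseteq> closure P \<and> (\<forall>a\<in>closure P. \<exists>s\<in>S. \<exists>p\<in>P. a = (\<lambda>i. s i ** p i))"
  proof (rule connected_part_of_diagonal_group)
    show "P \<subseteq> diag_G"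
    proof
      fix p assume p: "p \<in> P"
      obtain d \<delta> where *: "p = (\<lambda>i. d i ** \<delta> i)" "d \<in> D \<sigma> I" "\<delta> \<in> \<Delta>" using PE[OF p] by (elim exE conjE)
      show "p \<in> diag_G" unfolding *(1) by (rule dG_mult[OF D_dG[OF *(2)] \<Delta>d[OF *(3)]])
    qed
    show "(\<lambda>i. mat 1) \<in> P" using PI[OF D_one \<Delta>_one] by simp
    show "(\<lambda>i. a i ** b i) \<in> P" if a: "a \<in> P" and b: "b \<in> P" for a b
    proof -
      obtain d \<delta> where *: "a = (\<lambda>i. d i ** \<delta> i)" "d \<in> D \<sigma> I" "\<delta> \<in> \<Delta>" using PE[OF a] by (elim exE conjE)
      obtain d' \<delta>' where **: "b = (\<lambda>i. d' i ** \<delta>' i)" "d' \<in> D \<sigma> I" "\<delta>' \<in> \<Delta>" using PE[OF b] by (elim exE conjE)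
      have "a i ** b i = (d i ** d' i) ** (\<delta> i ** \<delta>' i)" for i
      proof -
        have "\<delta> i ** d' i = d' i ** \<delta> i" by (rule is_diag_commute[OF dG_diag[OF \<Delta>d[OF *(3)]] dG_diag[OF D_dG[OF **(2)]]])
        then have "d i ** (\<delta> i ** d' i) ** \<delta>' i = d i ** (d' i ** \<delta> i) ** \<delta>' i" by (simp only:)
        then show ?thesis unfolding *(1) **(1) by (simp add: matrix_mul_assoc)
      qed
      then show ?thesis using PI[OF D_mult[OF *(2) **(2)] \<Delta>_mult[OF *(3) **(3)]] by simp
    qed
    show "(\<lambda>i. adj2 (a i)) \<in> P" if a: "a \<in> P" for a
    proof -
      obtain d \<delta> where *: "a = (\<lambda>i. d i ** \<delta> i)" "d \<in> D \<sigma> I" "\<delta> \<in> \<Delta>" using PE[OF a] by (elim exE conjE)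
      have "adj2 (a i) = adj2 (d i) ** adj2 (\<delta> i)" for i
        unfolding *(1) using dG_diag[OF \<Delta>d[OF *(3)], of i] dG_diag[OF D_dG[OF *(2)], of i]
        by (simp add: mat2_eq_iff adj2_nth mat2_mult is_diag_def)
      then show ?thesis using PI[OF D_inv[OF *(2)] \<Delta>_inv[OF *(3)]] by simp
    qed
    show "D \<sigma> I \<subseteq> P"
    proof
      fix d assume "d \<in> D \<sigma> I"
      from PI[OF this \<Delta>_one] show "d \<in> P" by simp
    qed
  qed
  then obtain S where S: "subgroup S (G \<sigma>)" "S \<subseteq> D \<sigma> UNIV" "closedin (G_top \<sigma>) S" "connectedin (G_top \<sigma>) S"
    "D \<sigma> I \<subseteq> S" "S \<subseteq> closure P" "\<forall>a\<in>closure P. \<exists>s\<in>S. \<exists>p\<in>P. a = (\<lambda>i. s i ** p i)" by (elim exE conjE)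
  have Sc: "s \<in> carrier (G \<sigma>)" if "s \<in> S" for s using S(1) that by (rule subgroup.mem_carrier)
  define T where "T = N <#\<^bsub>G \<sigma>\<^esub> S #>\<^bsub>G \<sigma>\<^esub> inv\<^bsub>G \<sigma>\<^esub> N"
  have torus: "torus \<sigma> T" unfolding torus_def using S(1-4) Nc T_def by blast
  have T_eq: "T = (\<lambda>s i. N i ** s i ** adj2 (N i)) ` S"
    unfolding T_def l_coset_def r_coset_def G_inv[OF Nc] by (auto simp: G_mult)
  define B where "B = (\<lambda>(s :: 'r \<Rightarrow> complex^2^2) i. N i ** s i ** Q i)"
  have Bc: "B s \<in> carrier (G \<sigma>)" if "s \<in> S" for s
    unfolding B_def by (rule G_mult_closed[OF G_mult_closed[OF Nc Sc[OF that]] Qc])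
  have TG: "T \<subseteq> carrier (G \<sigma>)" unfolding T_eq
    using G_mult_closed[OF G_mult_closed[OF Nc Sc] G_adj2_closed[OF Nc]] by blast
  have Tg: "(\<lambda>h. h \<otimes>\<^bsub>G \<sigma>\<^esub> g) ` T = B ` S"
  proof -
    have "(\<lambda>i. N i ** s i ** adj2 (N i)) \<otimes>\<^bsub>G \<sigma>\<^esub> g = B s" for s
      unfolding G_mult B_def gNQ by (simp add: matrix_mul_assoc adj2_cancel[OF Ndet])
    then show ?thesis unfolding T_eq image_image by simp
  qed
  have orbT: "orbit_of \<sigma> T (\<pi> \<sigma> g) = \<pi> \<sigma> ` (B ` S)" unfolding orbit_of_pi[OF TG g] Tg ..
  define A where "A = (\<lambda>h. h \<otimes>\<^bsub>G \<sigma>\<^esub> g) ` D \<sigma> I"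
  have AG: "A \<subseteq> carrier (G \<sigma>)" unfolding A_def using D_subset g by auto
  have orbD: "orbit_of \<sigma> (D \<sigma> I) (\<pi> \<sigma> g) = \<pi> \<sigma> ` A" unfolding A_def by (rule orbit_of_pi[OF D_subset g])
  have "G_mod_\<Gamma>_top \<sigma> closure_of (\<pi> \<sigma> ` A) = \<pi> \<sigma> ` (B ` S)"
  proof (intro equalityI subsetI)
    fix y assume "y \<in> \<pi> \<sigma> ` (B ` S)"
    then obtain s where s: "s \<in> S" "y = \<pi> \<sigma> (B s)" by (elim imageE) simp
    have "\<exists>p. (\<forall>n. p n \<in> P) \<and> p \<longlonglongrightarrow> s" using subsetD[OF S(6) s(1)] unfolding closure_sequential .
    then obtain p where p: "\<forall>n. p n \<in> P" "p \<longlonglongrightarrow> s" by (elim exE conjE)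
    have "\<forall>n. \<exists>a c. a \<in> A \<and> c \<in> \<Gamma> \<sigma> \<and> a \<otimes>\<^bsub>G \<sigma>\<^esub> c = B (p n)"
    proof
      fix n
      obtain d \<delta> where *: "p n = (\<lambda>i. d i ** \<delta> i)" "d \<in> D \<sigma> I" "\<delta> \<in> \<Delta>" using PE[OF p(1)[rule_format, of n]] by (elim exE conjE)
      obtain c where c: "c \<in> \<Gamma> \<sigma>" "\<forall>i. \<delta> i ** Q i = Q i ** c i" using \<Delta>c[OF *(3)] ..
      have "(\<lambda>i. N i ** d i ** adj2 (N i)) \<otimes>\<^bsub>G \<sigma>\<^esub> g \<otimes>\<^bsub>G \<sigma>\<^esub> c = B (p n)"
      proof
        fix i
        have "((\<lambda>i. N i ** d i ** adj2 (N i)) \<otimes>\<^bsub>G \<sigma>\<^esub> g \<otimes>\<^bsub>G \<sigma>\<^esub> c) i = N i ** d i ** (Q i ** c i)"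
          unfolding G_mult gNQ by (simp add: matrix_mul_assoc adj2_cancel[OF Ndet])
        also have "\<dots> = N i ** d i ** (\<delta> i ** Q i)" using c(2) by simp
        finally show "((\<lambda>i. N i ** d i ** adj2 (N i)) \<otimes>\<^bsub>G \<sigma>\<^esub> g \<otimes>\<^bsub>G \<sigma>\<^esub> c) i = B (p n) i"
          by (simp add: B_def *(1) matrix_mul_assoc)
      qed
      moreover have "(\<lambda>i. N i ** d i ** adj2 (N i)) \<otimes>\<^bsub>G \<sigma>\<^esub> g \<in> A" unfolding A_def by (rule imageI[OF conjN[OF *(2)]])
      ultimately show "\<exists>a c. a \<in> A \<and> c \<in> \<Gamma> \<sigma> \<and> a \<otimes>\<^bsub>G \<sigma>\<^esub> c = B (p n)" using c(1) by blast
    qed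
    from choice[OF this] obtain a where "\<forall>n. \<exists>c. a n \<in> A \<and> c \<in> \<Gamma> \<sigma> \<and> a n \<otimes>\<^bsub>G \<sigma>\<^esub> c = B (p n)" ..
    from choice[OF this] obtain c where ac: "\<forall>n. a n \<in> A \<and> c n \<in> \<Gamma> \<sigma> \<and> a n \<otimes>\<^bsub>G \<sigma>\<^esub> c n = B (p n)" ..
    have "(\<lambda>n. B (p n)) \<longlonglongrightarrow> B s"
      unfolding B_def by (intro tendsto_fun_mult tendsto_const p(2))
    then have lim: "(\<lambda>n. a n \<otimes>\<^bsub>G \<sigma>\<^esub> c n) \<longlonglongrightarrow> B s" using ac by simp
    show "y \<in> G_mod_\<Gamma>_top \<sigma> closure_of (\<pi> \<sigma> ` A)"
      unfolding s(2) closure_of_pi_image[OF AG Bc[OF s(1)]]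
      by (rule exI[of _ a], rule exI[of _ c]) (use ac lim in simp)
  next
    fix y assume y: "y \<in> G_mod_\<Gamma>_top \<sigma> closure_of (\<pi> \<sigma> ` A)"
    then have "y \<in> topspace (G_mod_\<Gamma>_top \<sigma>)" by (simp add: in_closure_of)
    then obtain h where h: "h \<in> carrier (G \<sigma>)" "y = \<pi> \<sigma> h" unfolding topspace_quotient by (elim imageE)
    obtain a c where ac: "\<forall>n. a n \<in> A \<and> c n \<in> \<Gamma> \<sigma>" "(\<lambda>n::nat. a n \<otimes>\<^bsub>G \<sigma>\<^esub> c n) \<longlonglongrightarrow> h"
      using y unfolding h(2) closure_of_pi_image[OF AG h(1)] by (elim exE conjE)
    have "\<forall>n. \<exists>d. d \<in> D \<sigma> I \<and> a n = (\<lambda>i. d i ** g i)"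
      using ac(1) unfolding A_def G_mult by blast
    from choice[OF this] obtain d where d: "\<forall>n. d n \<in> D \<sigma> I \<and> a n = (\<lambda>i. d n i ** g i)" ..
    have dD: "d n \<in> D \<sigma> I" for n using d by blast
    have "\<forall>n. \<exists>A. A \<in> SLO \<and> c n = diagonal_embedding \<sigma> A" using ac(1) unfolding \<Gamma>_def by blast
    from choice[OF this] obtain W where W: "\<forall>n. W n \<in> SLO \<and> c n = diagonal_embedding \<sigma> (W n)" ..
    have WO: "W n \<in> SLO" for n using W by blast
    have ci: "c n i = map_matrix (\<sigma> i) (W n)" for n i using W by (simp add: diagonal_embedding_def)
    have cG: "c n \<in> \<Gamma> \<sigma>" for n using ac(1) by blast
    have cdet: "det (c n i) = 1" for n i by (rule G_det[OF subsetD[OF Gamma_subset cG]])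
    define d' where "d' = (\<lambda>n i. adj2 (N i) ** d n i ** N i)"
    have d'D: "d' n \<in> D \<sigma> I" for n unfolding d'_def by (rule conjN'[OF dD])
    define k where "k = (\<lambda>i. adj2 (N i) ** h i)"
    have QW: "map_matrix (\<sigma> i) (q ** W n) = Q i ** c n i" for i n by (simp only: emb_mat_mult ci Qi)
    have lim: "(\<lambda>n i. d' n i ** map_matrix (\<sigma> i) (q ** W n)) \<longlonglongrightarrow> k"
    proof -
      have eq: "d' n i ** map_matrix (\<sigma> i) (q ** W n) = adj2 (N i) ** (a n \<otimes>\<^bsub>G \<sigma>\<^esub> c n) i" for n i
        unfolding QW using d by (simp add: d'_def G_mult gNQ matrix_mul_assoc)
      show ?thesis unfolding eq k_def by (intro tendsto_fun_mult tendsto_const ac(2))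
    qed
    obtain M where M: "\<forall>n\<ge>M. \<forall>i. is_diag (map_matrix (\<sigma> i) (q ** W n ** adj2 (q ** W M)))"
      using split_form_eventually_const[OF q WO dG_diag[OF D_dG[OF d'D]] dG_det[OF D_dG[OF d'D]] lim] ..
    define R where "R = (\<lambda>i. adj2 (Q i ** c M i))"
    have RG: "R \<in> carrier (G \<sigma>)" unfolding R_def
      by (rule G_adj2_closed[OF G_mult_closed[OF Qc subsetD[OF Gamma_subset cG]]])
    have Req: "R i = adj2 (c M i) ** adj2 (Q i)" for i
      by (simp add: R_def mat2_eq_iff adj2_nth mat2_mult algebra_simps)
    define \<delta> where "\<delta> = (\<lambda>n i. Q i ** c n i ** R i)"
    have \<delta>: "\<delta> n \<in> \<Delta>" if n: "M \<le> n" for n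
    proof -
      have "is_diag (\<delta> n i)" for i
      proof -
        have "\<delta> n i = map_matrix (\<sigma> i) (q ** W n ** adj2 (q ** W M))"
          by (simp only: \<delta>_def R_def QW[symmetric] emb_mat_mult[of i "q ** W n"] emb_mat_adj2)
        then show ?thesis using M[rule_format, OF n, of i] by (simp only:)
      qed
      moreover have "\<delta> n \<in> carrier (G \<sigma>)" unfolding \<delta>_def
        by (rule G_mult_closed[OF G_mult_closed[OF Qc subsetD[OF Gamma_subset cG]] RG])
      moreover have "\<delta> n i ** Q i = Q i ** (c n i ** adj2 (c M i))" for i
        by (simp add: \<delta>_def Req matrix_mul_assoc adj2_cancel[OF Qdet])
      ultimately show ?thesis unfolding \<Delta>_def diag_G_def
        using Gamma_mult[OF cG Gamma_inv[OF cG[of M]], of n]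
        by (intro CollectI conjI bexI[of _ "\<lambda>i. c n i ** adj2 (c M i)"]) simp_all
    qed
    define p where "p = (\<lambda>n i. d' n i ** \<delta> n i)"
    have "p \<longlonglongrightarrow> (\<lambda>i. k i ** R i)"
    proof -
      have "p = (\<lambda>n i. d' n i ** map_matrix (\<sigma> i) (q ** W n) ** R i)"
        unfolding p_def \<delta>_def QW by (simp add: matrix_mul_assoc)
      then show ?thesis by (simp only:) (intro tendsto_fun_mult lim tendsto_const)
    qed
    then have plim: "(\<lambda>n. p (n + M)) \<longlonglongrightarrow> (\<lambda>i. k i ** R i)" by (rule LIMSEQ_ignore_initial_segment)
    have "p (n + M) \<in> P" for n unfolding p_def by (rule PI[OF d'D \<delta>]) simp
    then have "(\<lambda>i. k i ** R i) \<in> closure P" unfolding closure_sequential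
      using plim by (intro exI[of _ "\<lambda>n. p (n + M)"] conjI allI)
    from bspec[OF S(7) this] obtain s p' where s: "s \<in> S" "p' \<in> P" "(\<lambda>i. k i ** R i) = (\<lambda>i. s i ** p' i)" by (elim bexE)
    obtain e \<epsilon> where *: "p' = (\<lambda>i. e i ** \<epsilon> i)" "e \<in> D \<sigma> I" "\<epsilon> \<in> \<Delta>" using PE[OF s(2)] by (elim exE conjE)
    obtain b where b: "b \<in> \<Gamma> \<sigma>" "\<forall>i. \<epsilon> i ** Q i = Q i ** b i" using \<Delta>c[OF *(3)] ..
    have se: "(\<lambda>i. s i ** e i) \<in> S" using subgroup.m_closed[OF S(1) s(1) subsetD[OF S(5) *(2)]] by (simp only: G_mult)
    have "h = B (\<lambda>i. s i ** e i) \<otimes>\<^bsub>G \<sigma>\<^esub> (\<lambda>i. b i ** c M i)"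
    proof
      fix i
      have "k i ** R i = s i ** (e i ** \<epsilon> i)" using fun_cong[OF s(3), of i] by (simp only: *(1))
      then have "k i ** R i ** (Q i ** c M i) = s i ** (e i ** \<epsilon> i) ** (Q i ** c M i)" by (simp only:)
      moreover have "k i ** R i ** (Q i ** c M i) = k i"
        unfolding R_def by (rule adj2_cancel) (simp add: det_mul Qdet cdet)
      moreover have "s i ** (e i ** \<epsilon> i) ** (Q i ** c M i) = s i ** e i ** (\<epsilon> i ** Q i) ** c M i" by (simp add: matrix_mul_assoc)
      ultimately have "k i = s i ** e i ** (Q i ** b i) ** c M i" using b(2) by (simp only:)
      moreover have "h i = N i ** k i" by (simp add: k_def adj2_cancel_left[OF Ndet])
      ultimately show "h i = (B (\<lambda>i. s i ** e i) \<otimes>\<^bsub>G \<sigma>\<^esub> (\<lambda>i. b i ** c M i)) i"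
        by (simp add: B_def G_mult matrix_mul_assoc)
    qed
    then have "\<pi> \<sigma> (B (\<lambda>i. s i ** e i)) = \<pi> \<sigma> h"
      unfolding pi_eq_iff[OF Bc[OF se] h(1)] using Gamma_mult[OF b(1) cG] by (rule bexI)
    then show "y \<in> \<pi> \<sigma> ` (B ` S)" unfolding h(2) by (rule subst) (intro imageI se)
  qed
  then have "G_mod_\<Gamma>_top \<sigma> closure_of orbit_of \<sigma> (D \<sigma> I) (\<pi> \<sigma> g) = orbit_of \<sigma> T (\<pi> \<sigma> g)" by (simp only: orbT orbD)
  moreover have "\<pi> \<sigma> g \<in> lcosets\<^bsub>G \<sigma>\<^esub> (\<Gamma> \<sigma>)" unfolding LCOSETS_def \<pi>_def using g by blast
  ultimately show ?thesis unfolding is_torus_orbit_def using torus by blast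
qed

end

section \<open>Closures of orbits that are not aligned\<close>

definition mat22 :: "'a \<Rightarrow> 'a \<Rightarrow> 'a \<Rightarrow> 'a \<Rightarrow> 'a::zero^2^2" where
  "mat22 a b c d = vector [vector [a, b], vector [c, d]]"

lemma mat22_nth: "mat22 a b c d $ 1 $ 1 = a" "mat22 a b c d $ 1 $ 2 = b" "mat22 a b c d $ 2 $ 1 = c" "mat22 a b c d $ 2 $ 2 = d"
  by (simp_all add: mat22_def vector_2)

lemma is_diag_conj_monomial: "monomial A \<Longrightarrow> is_diag B \<Longrightarrow> is_diag (adj2 A ** B ** A)"
  by (auto simp: monomial_def is_diag_def mat2_mult adj2_nth)

text \<open>
  The factor on the right is the product of the lower unipotent matrix with entry
  \<open>y\<close> and the upper one with entry \<open>x\<close>. If \<open>p$1$1 = 0\<close>,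
  the monomial factor \<open>m\<close> also exchanges the rows.
\<close>
lemma nonmonomial_decomposition:
  fixes p :: "'a::field^2^2"
  assumes det: "det p = 1" and non: "\<not> (p$1$2 = 0 \<and> p$2$1 = 0 \<or> p$1$1 = 0 \<and> p$2$2 = 0)"
  shows "\<exists>m x y. p = m ** mat22 1 x y (1 + y * x) \<and> det m = 1 \<and>
    (m$1$2 = 0 \<and> m$2$1 = 0 \<or> m$1$1 = 0 \<and> m$2$2 = 0) \<and> (x \<noteq> 0 \<or> y \<noteq> 0)"
proof (cases "p$1$1 = 0")
  case False
  have "p$2$2 = (1 + p$1$2 * p$2$1) / p$1$1" using det False by (simp add: det_2 field_simps)
  then have "p = mat22 (p$1$1) 0 0 (inverse (p$1$1)) ** mat22 1 (p$1$2 / p$1$1) (p$2$1 * p$1$1) (1 + p$2$1 * p$1$1 * (p$1$2 / p$1$1))"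
    using False by (simp add: mat2_eq_iff mat2_mult mat22_nth field_simps)
  then show ?thesis using False non
    by (rule_tac exI[of _ "mat22 (p$1$1) 0 0 (inverse (p$1$1))"], rule_tac exI[of _ "p$1$2 / p$1$1"], rule_tac exI[of _ "p$2$1 * p$1$1"])
      (auto simp: det_2 mat22_nth)
next
  case True
  then have bc: "p$1$2 * p$2$1 = - 1" using det by (simp add: det_2 minus_equation_iff)
  then have ne: "p$1$2 \<noteq> 0" "p$2$1 \<noteq> 0" by auto
  have inv: "p$1$2 = - inverse (p$2$1)" using bc ne by (simp add: field_simps)
  have "p = mat22 0 (- inverse (p$2$1)) (p$2$1) 0 ** mat22 1 (p$2$2 / p$2$1) 0 (1 + 0 * (p$2$2 / p$2$1))"
    using ne True inv by (simp add: mat2_eq_iff mat2_mult mat22_nth)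
  moreover have "p$2$2 / p$2$1 \<noteq> 0" using non True ne by simp
  ultimately show ?thesis using ne
    by (rule_tac exI[of _ "mat22 0 (- inverse (p$2$1)) (p$2$1) 0"], rule_tac exI[of _ "p$2$2 / p$2$1"], rule_tac exI[of _ 0])
      (auto simp: det_2 mat22_nth)
qed

text \<open>
  The matrix in the middle is the conjugate of the diagonal matrix with entries \<open>inverse
  \<eta>\<close> and \<open>\<eta>\<close> by the upper unipotent matrix with entry
  \<open>x\<close>. It is congruent to \<open>1\<close>. One factor \<open>of_nat M\<close> of
  the modulus is needed to clear the denominator of each of \<open>adj2 q\<close>,
  \<open>x\<close> and \<open>q\<close>.
\<close>
lemma conj_of_congruent_unit_integral:
  fixes q :: "'k::field_char_0^2^2"
  assumes q: "det q = 1" "\<And>a b. algebraic_int (of_nat M * q $ a $ b)" and x: "algebraic_int (of_nat M * x)"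
    and \<eta>: "\<eta> \<noteq> 0" "inverse \<eta> = 1 + of_nat M ^ 3 * u" "\<eta> = 1 + of_nat M ^ 3 * v" "algebraic_int u" "algebraic_int v"
  shows "adj2 q ** mat22 (inverse \<eta>) (x * (inverse \<eta> - \<eta>)) 0 \<eta> ** q \<in> carrier (SL2 {x. algebraic_int x})"
proof -
  define Y where "Y = adj2 q ** mat22 (inverse \<eta>) (x * (inverse \<eta> - \<eta>)) 0 \<eta> ** q"
  have "det Y = 1" using q(1) \<eta>(1) by (simp add: Y_def det_mul det_adj2, simp add: det_2 mat22_nth)
  moreover have "algebraic_int (Y $ a $ b)" for a b
  proof -
    define s where "s = (\<lambda>c::2. of_nat M * adj2 q $ a $ c)"
    have s: "algebraic_int (s c)" for c
      using q(2) exhaust_2[of a] exhaust_2[of c] by (auto simp: s_def adj2_nth)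
    have "(adj2 q ** q) $ a $ b = (mat 1 :: 'k^2^2) $ a $ b" by (simp only: adj2_mult(1)[OF q(1)])
    then have id: "adj2 q $ a $ 1 * q $ 1 $ b + adj2 q $ a $ 2 * q $ 2 $ b = (if a = b then 1 else 0)"
      by (simp add: mat2_mult mat_def)
    have "Y $ a $ b = adj2 q $ a $ 1 * inverse \<eta> * q $ 1 $ b + (adj2 q $ a $ 1 * (x * (inverse \<eta> - \<eta>)) + adj2 q $ a $ 2 * \<eta>) * q $ 2 $ b"
      by (simp add: Y_def mat2_mult mat22_nth)
    also have "\<dots> = (adj2 q $ a $ 1 * q $ 1 $ b + adj2 q $ a $ 2 * q $ 2 $ b) + of_nat M * u * s 1 * (of_nat M * q $ 1 $ b)
        + s 1 * (of_nat M * x) * (u - v) * (of_nat M * q $ 2 $ b) + of_nat M * v * s 2 * (of_nat M * q $ 2 $ b)"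
      unfolding \<eta>(2) by (subst (1 2) \<eta>(3)) (simp add: s_def algebra_simps power3_eq_cube)
    finally show ?thesis unfolding id
      by (simp only:) (intro algebraic_int_plus algebraic_int_times algebraic_int_diff algebraic_int_of_nat s q(2) x \<eta>(4,5), simp)
  qed
  ultimately show ?thesis by (simp add: SL2_carrier Y_def)
qed

definition bounded_mats :: "(nat \<Rightarrow> complex^2^2) \<Rightarrow> bool" where
  "bounded_mats F \<longleftrightarrow> (\<exists>B. \<forall>n a b. norm (F n $ a $ b) \<le> B)"

lemma bounded_mats_const: "bounded_mats (\<lambda>n. A)"
  unfolding bounded_mats_def
proof (intro exI allI)
  fix a b :: 2
  show "norm (A $ a $ b) \<le> norm (A$1$1) + norm (A$1$2) + norm (A$2$1) + norm (A$2$2)"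
    using exhaust_2[of a] exhaust_2[of b] by auto
qed

lemma bounded_mats_mult:
  assumes "bounded_mats F" "bounded_mats H"
  shows "bounded_mats (\<lambda>n. F n ** H n)"
proof -
  obtain B where B: "\<forall>n a b. norm (F n $ a $ b) \<le> B" using assms(1) by (auto simp: bounded_mats_def)
  obtain C where C: "\<forall>n a b. norm (H n $ a $ b) \<le> C" using assms(2) by (auto simp: bounded_mats_def)
  have B0: "B \<ge> 0" using B norm_ge_zero order_trans by blast
  have "norm ((F n ** H n) $ a $ b) \<le> B * C + B * C" for n a b
    unfolding mat2_mult
    by (rule norm_triangle_le, unfold norm_mult) (intro add_mono mult_mono B[rule_format] C[rule_format] B0 norm_ge_zero)
  then show ?thesis by (auto simp: bounded_mats_def)
qed

context archimedean_places
begin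

lemma emb_mat22: "map_matrix (\<sigma> i) (mat22 a b c d) = mat22 (\<sigma> i a) (\<sigma> i b) (\<sigma> i c) (\<sigma> i d)"
  by (simp add: mat2_eq_iff mat22_nth)

text \<open>
  The base point of the orbit may be moved to \<open>g\<close>. The torus is conjugate to a
  group of diagonal matrices, hence abelian.
\<close>
lemma torus_orbit_commuting_group:
  assumes Y: "is_torus_orbit \<sigma> Y" and g: "g \<in> carrier (G \<sigma>)" "\<pi> \<sigma> g \<in> Y"
  shows "\<exists>T. T \<subseteq> carrier (G \<sigma>) \<and> (\<forall>s\<in>T. \<forall>t\<in>T. (\<lambda>i. s i ** adj2 (t i)) \<in> T) \<and> (\<forall>s\<in>T. \<forall>t\<in>T. \<forall>i. s i ** t i = t i ** s i) \<and>
    (\<forall>h\<in>carrier (G \<sigma>). \<pi> \<sigma> h \<in> Y \<longrightarrow> (\<exists>t\<in>T. \<exists>c\<in>\<Gamma> \<sigma>. h = (\<lambda>i. t i ** g i ** c i)))"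
proof -
  obtain T x where T: "x \<in> lcosets\<^bsub>G \<sigma>\<^esub> (\<Gamma> \<sigma>)" "torus \<sigma> T" "Y = orbit_of \<sigma> T x"
    using Y unfolding is_torus_orbit_def by blast
  obtain g0 where g0: "g0 \<in> carrier (G \<sigma>)" "x = \<pi> \<sigma> g0" using T(1) unfolding LCOSETS_def \<pi>_def by blast
  obtain S a where S: "a \<in> carrier (G \<sigma>)" "subgroup S (G \<sigma>)" "S \<subseteq> D \<sigma> UNIV" "T = a <#\<^bsub>G \<sigma>\<^esub> S #>\<^bsub>G \<sigma>\<^esub> inv\<^bsub>G \<sigma>\<^esub> a"
    using T(2) unfolding torus_def by blast
  have adet: "det (a i) = 1" for i by (rule G_det[OF S(1)])
  have Teq: "T = (\<lambda>s i. a i ** s i ** adj2 (a i)) ` S"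
    unfolding S(4) l_coset_def r_coset_def G_inv[OF S(1)] by (auto simp: G_mult)
  have Sc: "s \<in> carrier (G \<sigma>)" if "s \<in> S" for s using S(2) that by (rule subgroup.mem_carrier)
  have TG: "T \<subseteq> carrier (G \<sigma>)" unfolding Teq
    using G_mult_closed[OF G_mult_closed[OF S(1) Sc] G_adj2_closed[OF S(1)]] by blast
  have diff: "\<forall>s\<in>T. \<forall>t\<in>T. (\<lambda>i. s i ** adj2 (t i)) \<in> T"
  proof (intro ballI)
    fix s t assume st: "s \<in> T" "t \<in> T"
    obtain s' where s: "s' \<in> S" "s = (\<lambda>i. a i ** s' i ** adj2 (a i))" using st(1) unfolding Teq by (elim imageE)
    obtain t' where t: "t' \<in> S" "t = (\<lambda>i. a i ** t' i ** adj2 (a i))" using st(2) unfolding Teq by (elim imageE)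
    have adjt: "adj2 (t i) = a i ** adj2 (t' i) ** adj2 (a i)" for i
      unfolding t(2) by (simp add: mat2_eq_iff adj2_nth mat2_mult algebra_simps)
    have "s i ** adj2 (t i) = a i ** (s' i ** adj2 (t' i)) ** adj2 (a i)" for i
      unfolding adjt s(2) by (simp add: matrix_mul_assoc adj2_cancel[OF adet])
    moreover have "(\<lambda>i. s' i ** adj2 (t' i)) \<in> S"
      using subgroup.m_closed[OF S(2) s(1) subgroup.m_inv_closed[OF S(2) t(1)]] by (simp only: G_mult G_inv[OF Sc[OF t(1)]])
    ultimately show "(\<lambda>i. s i ** adj2 (t i)) \<in> T" unfolding Teq by auto
  qed
  have comm: "\<forall>s\<in>T. \<forall>t\<in>T. \<forall>i. s i ** t i = t i ** s i"
  proof (intro ballI allI)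
    fix s t i assume st: "s \<in> T" "t \<in> T"
    obtain s' where s: "s' \<in> S" "s = (\<lambda>i. a i ** s' i ** adj2 (a i))" using st(1) unfolding Teq by (elim imageE)
    obtain t' where t: "t' \<in> S" "t = (\<lambda>i. a i ** t' i ** adj2 (a i))" using st(2) unfolding Teq by (elim imageE)
    have "s' i ** t' i = t' i ** s' i"
      by (rule is_diag_commute[OF D_is_diag[OF subsetD[OF S(3) s(1)]] D_is_diag[OF subsetD[OF S(3) t(1)]]])
    then have "a i ** (s' i ** t' i) ** adj2 (a i) = a i ** (t' i ** s' i) ** adj2 (a i)" by (simp only:)
    then show "s i ** t i = t i ** s i" unfolding s(2) t(2) by (simp add: matrix_mul_assoc adj2_cancel[OF adet])
  qed
  have rep: "\<exists>t\<in>T. \<exists>c\<in>\<Gamma> \<sigma>. h = (\<lambda>i. t i ** g0 i ** c i)" if h: "h \<in> carrier (G \<sigma>)" "\<pi> \<sigma> h \<in> Y" for h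
  proof -
    obtain t where t: "t \<in> T" "\<pi> \<sigma> h = \<pi> \<sigma> (t \<otimes>\<^bsub>G \<sigma>\<^esub> g0)"
      using h(2) unfolding T(3) g0(2) orbit_of_pi[OF TG g0(1)] by (elim imageE) simp
    have "t \<otimes>\<^bsub>G \<sigma>\<^esub> g0 \<in> carrier (G \<sigma>)" using TG t(1) g0(1) by blast
    from pi_eq_iff[OF this h(1)] t(2) obtain c where "c \<in> \<Gamma> \<sigma>" "h = t \<otimes>\<^bsub>G \<sigma>\<^esub> g0 \<otimes>\<^bsub>G \<sigma>\<^esub> c" by auto
    then show ?thesis using t(1) unfolding G_mult by blast
  qed
  obtain t0 c0 where 0: "t0 \<in> T" "c0 \<in> \<Gamma> \<sigma>" "g = (\<lambda>i. t0 i ** g0 i ** c0 i)" using rep[OF g] by (elim bexE)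
  have t0: "det (t0 i) = 1" and c0: "det (c0 i) = 1" for i
    by (rule G_det[OF subsetD[OF TG 0(1)]], rule G_det[OF subsetD[OF Gamma_subset 0(2)]])
  have "\<forall>h\<in>carrier (G \<sigma>). \<pi> \<sigma> h \<in> Y \<longrightarrow> (\<exists>t\<in>T. \<exists>c\<in>\<Gamma> \<sigma>. h = (\<lambda>i. t i ** g i ** c i))"
  proof (intro ballI impI)
    fix h assume h: "h \<in> carrier (G \<sigma>)" "\<pi> \<sigma> h \<in> Y"
    obtain t c where tc: "t \<in> T" "c \<in> \<Gamma> \<sigma>" "h = (\<lambda>i. t i ** g0 i ** c i)" using rep[OF h] by (elim bexE)
    have "h i = (t i ** adj2 (t0 i)) ** g i ** (adj2 (c0 i) ** c i)" for i
      unfolding 0(3) tc(3) by (simp add: matrix_mul_assoc adj2_cancel[OF t0] adj2_cancel[OF c0])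
    moreover have "(\<lambda>i. t i ** adj2 (t0 i)) \<in> T" using diff tc(1) 0(1) by blast
    moreover have "(\<lambda>i. adj2 (c0 i) ** c i) \<in> \<Gamma> \<sigma>" by (rule Gamma_mult[OF Gamma_inv[OF 0(2)] tc(2)])
    ultimately show "\<exists>t\<in>T. \<exists>c\<in>\<Gamma> \<sigma>. h = (\<lambda>i. t i ** g i ** c i)"
      by (intro bexI[of _ "\<lambda>i. t i ** adj2 (t0 i)"] bexI[of _ "\<lambda>i. adj2 (c0 i) ** c i"] ext)
  qed
  then show ?thesis using TG diff comm by (intro exI[of _ T] conjI)
qed

text \<open>
  For each real \<open>\<tau>\<close>, the point \<open>d \<tau> g\<close> is \<open>t g
  c\<close> with \<open>t \<in> T\<close> and \<open>c \<in> \<Gamma>\<close>. As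
  \<open>\<Gamma>\<close> is countable, the same \<open>c\<close> occurs for two parameters, so
  the abelian group \<open>T\<close> contains \<open>d (\<tau> - \<tau>')\<close>. Whatever
  commutes with this element is diagonal at the places of \<open>I\<close>.
\<close>
lemma torus_orbit_closure_diagonal:
  assumes Y: "is_torus_orbit \<sigma> Y" and g: "g \<in> carrier (G \<sigma>)" and sub: "\<And>d. d \<in> D \<sigma> I \<Longrightarrow> \<pi> \<sigma> (d \<otimes>\<^bsub>G \<sigma>\<^esub> g) \<in> Y"
    and h: "h \<in> carrier (G \<sigma>)" "\<pi> \<sigma> h \<in> Y"
  shows "\<exists>t c. c \<in> \<Gamma> \<sigma> \<and> h = (\<lambda>i. t i ** g i ** c i) \<and> (\<forall>i\<in>I. is_diag (t i)) \<and> (\<forall>i. det (t i) = 1)"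
proof -
  have gY: "\<pi> \<sigma> g \<in> Y" using sub[OF D_one] by (simp add: G_mult)
  obtain T where T: "T \<subseteq> carrier (G \<sigma>)" "\<forall>s\<in>T. \<forall>t\<in>T. (\<lambda>i. s i ** adj2 (t i)) \<in> T" "\<forall>s\<in>T. \<forall>t\<in>T. \<forall>i. s i ** t i = t i ** s i"
    "\<forall>h\<in>carrier (G \<sigma>). \<pi> \<sigma> h \<in> Y \<longrightarrow> (\<exists>t\<in>T. \<exists>c\<in>\<Gamma> \<sigma>. h = (\<lambda>i. t i ** g i ** c i))"
    using torus_orbit_commuting_group[OF Y g gY] by (elim exE conjE)
  define d where "d = (\<lambda>(\<tau>::real) i. if i \<in> I then dg (exp (of_real \<tau>)) else mat 1)"
  have dD: "d \<tau> \<in> D \<sigma> I" for \<tau> unfolding d_def by (rule D_normal_form[of "\<lambda>_. of_real \<tau>"]) (rule K_of_real)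
  have "\<forall>\<tau>. \<exists>c. c \<in> \<Gamma> \<sigma> \<and> (\<exists>t\<in>T. (\<lambda>i. d \<tau> i ** g i) = (\<lambda>i. t i ** g i ** c i))"
  proof
    fix \<tau>
    have "d \<tau> \<otimes>\<^bsub>G \<sigma>\<^esub> g \<in> carrier (G \<sigma>)" using D_subset dD g by blast
    then have "\<exists>t\<in>T. \<exists>c\<in>\<Gamma> \<sigma>. d \<tau> \<otimes>\<^bsub>G \<sigma>\<^esub> g = (\<lambda>i. t i ** g i ** c i)" using T(4) sub[OF dD] by blast
    then show "\<exists>c. c \<in> \<Gamma> \<sigma> \<and> (\<exists>t\<in>T. (\<lambda>i. d \<tau> i ** g i) = (\<lambda>i. t i ** g i ** c i))" unfolding G_mult by blast
  qed
  from choice[OF this] obtain c where c: "\<forall>\<tau>. c \<tau> \<in> \<Gamma> \<sigma> \<and> (\<exists>t\<in>T. (\<lambda>i. d \<tau> i ** g i) = (\<lambda>i. t i ** g i ** c \<tau> i))" ..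
  have "\<not> inj c"
  proof
    assume inj: "inj c"
    have "countable (range c)" by (rule countable_subset[OF _ Gamma_countable]) (use c in blast)
    then have "countable (UNIV :: real set)" using inj by (rule countable_image_inj_on)
    then show False using uncountable_UNIV_real by blast
  qed
  then obtain \<tau> \<tau>' where \<tau>: "c \<tau> = c \<tau>'" "\<tau> \<noteq> \<tau>'" by (auto simp: inj_def)
  obtain t where t: "t \<in> T" "(\<lambda>i. d \<tau> i ** g i) = (\<lambda>i. t i ** g i ** c \<tau> i)" using c by blast
  obtain t' where t': "t' \<in> T" "(\<lambda>i. d \<tau>' i ** g i) = (\<lambda>i. t' i ** g i ** c \<tau> i)" using c unfolding \<tau>(1) by blast
  have cdet: "det (c \<tau> i) = 1" for i using G_det[OF subsetD[OF Gamma_subset, of "c \<tau>"]] c by blast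
  have gdet: "det (g i) = 1" for i by (rule G_det[OF g])
  have gc: "det (g i ** c \<tau> i ** adj2 (g i)) = 1" for i by (simp add: det_mul det_adj2 cdet gdet)
  have tdet: "det (t i) = 1" "det (t' i) = 1" for i using G_det T(1) t(1) t'(1) by blast+
  have dt: "d \<tau> i = t i ** (g i ** c \<tau> i ** adj2 (g i))" for i
  proof -
    have "d \<tau> i ** g i ** adj2 (g i) = t i ** g i ** c \<tau> i ** adj2 (g i)" using fun_cong[OF t(2), of i] by (simp only:)
    then show ?thesis by (simp add: adj2_cancel[OF gdet] matrix_mul_assoc)
  qed
  have dt': "d \<tau>' i = t' i ** (g i ** c \<tau> i ** adj2 (g i))" for i
  proof -
    have "d \<tau>' i ** g i ** adj2 (g i) = t' i ** g i ** c \<tau> i ** adj2 (g i)" using fun_cong[OF t'(2), of i] by (simp only:)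
    then show ?thesis by (simp add: adj2_cancel[OF gdet] matrix_mul_assoc)
  qed
  have diff: "t i ** adj2 (t' i) = d \<tau> i ** adj2 (d \<tau>' i)" for i
  proof -
    define w where "w = g i ** c \<tau> i ** adj2 (g i)"
    have w: "det w = 1" using gc[of i] by (simp add: w_def)
    have "adj2 (t' i ** w) = adj2 w ** adj2 (t' i)" by (simp add: mat2_eq_iff adj2_nth mat2_mult algebra_simps)
    then show ?thesis unfolding dt dt' w_def[symmetric] by (simp add: matrix_mul_assoc adj2_cancel[OF w])
  qed
  have e: "(\<lambda>i. t i ** adj2 (t' i)) \<in> T" using T(2) t(1) t'(1) by blast
  have diag: "is_diag (s i)" if s: "s \<in> T" and i: "i \<in> I" for s i
  proof -
    have "t i ** adj2 (t' i) = dg (exp (of_real (\<tau> - \<tau>')))"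
      unfolding diff using i by (simp add: d_def adj2_dg dg_mult exp_diff divide_inverse)
    then have com: "dg (exp (of_real (\<tau> - \<tau>'))) ** s i = s i ** dg (exp (of_real (\<tau> - \<tau>')))"
      using T(3)[rule_format, OF e s, of i] by simp
    define E :: complex where "E = exp (of_real (\<tau> - \<tau>'))"
    have E0: "E \<noteq> 0" by (simp add: E_def)
    have "\<tau> - \<tau>' \<noteq> 0" using \<tau>(2) by simp
    then have E1: "E * E \<noteq> 1" unfolding E_def by (rule exp_of_real_square_neq_1)
    have ne: "E \<noteq> inverse E" using E0 E1 by (metis right_inverse)
    have "E * s i $ 1 $ 2 = s i $ 1 $ 2 * inverse E" "inverse E * s i $ 2 $ 1 = s i $ 2 $ 1 * E"
      using com unfolding E_def[symmetric] by (simp_all add: mat2_eq_iff mat2_mult dg_nth)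
    then have "(E - inverse E) * s i $ 1 $ 2 = 0" "(inverse E - E) * s i $ 2 $ 1 = 0" by (simp_all add: algebra_simps)
    then show ?thesis using ne ne[symmetric] by (simp add: is_diag_def)
  qed
  obtain s b where s: "s \<in> T" "b \<in> \<Gamma> \<sigma>" "h = (\<lambda>i. s i ** g i ** b i)" using T(4)[rule_format, OF h] by (elim bexE)
  have "\<forall>i. det (s i) = 1" using G_det T(1) s(1) by blast
  moreover have "\<forall>i\<in>I. is_diag (s i)" using diag[OF s(1)] by (rule ballI)
  ultimately show ?thesis using s(2,3) by (rule_tac exI[of _ s], rule_tac exI[of _ b]) (intro conjI)
qed

text \<open>
  At suitable places \<open>i1\<close> and \<open>i2\<close>, and after changing the monomial
  factors, \<open>g\<close> has components \<open>N1 q\<close> and \<open>N2 E q\<close>, where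
  \<open>E\<close> is the product of a lower unipotent matrix with entry \<open>y\<close> and an
  upper unipotent one with entry \<open>x\<close>, not both trivial. For units
  \<open>\<eta>\<close> that are small at \<open>i1\<close> and large at \<open>i2\<close>,
  multiply \<open>g\<close> by \<open>inverse q X q \<in> \<Gamma>\<close> on the right, where
  \<open>X\<close> is the unipotent conjugate of \<open>diag (inverse \<eta>, \<eta>)\<close>,
  and by \<open>diag (\<eta>, inverse \<eta>)\<close>, conjugated by \<open>N1\<close> and
  \<open>N2\<close>, on the left. In the limit both \<open>1\<close> and \<open>E\<close> are
  replaced by the upper unipotent matrix with entry \<open>x\<close>. If the limit and
  \<open>g\<close> differed by diagonal factors at both places and one element of
  \<open>\<Gamma>\<close>, then \<open>E\<close> would be diagonal.
\<close>
lemma not_torus_orbit_if_not_aligned: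
  assumes g: "g \<in> carrier (G \<sigma>)" and single: "\<forall>i\<in>I. aligned {i} g" and non: "\<not> aligned I g"
  shows "\<not> is_torus_orbit \<sigma> (G_mod_\<Gamma>_top \<sigma> closure_of orbit_of \<sigma> (D \<sigma> I) (\<pi> \<sigma> g))"
proof
  define Y where "Y = G_mod_\<Gamma>_top \<sigma> closure_of orbit_of \<sigma> (D \<sigma> I) (\<pi> \<sigma> g)"
  assume "is_torus_orbit \<sigma> (G_mod_\<Gamma>_top \<sigma> closure_of orbit_of \<sigma> (D \<sigma> I) (\<pi> \<sigma> g))"
  then have Y: "is_torus_orbit \<sigma> Y" by (simp only: Y_def)
  define A where "A = (\<lambda>h. h \<otimes>\<^bsub>G \<sigma>\<^esub> g) ` D \<sigma> I"
  have AG: "A \<subseteq> carrier (G \<sigma>)" unfolding A_def using D_subset g by auto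
  have YA: "Y = G_mod_\<Gamma>_top \<sigma> closure_of (\<pi> \<sigma> ` A)" unfolding Y_def A_def orbit_of_pi[OF D_subset g] ..
  have sub: "\<pi> \<sigma> (d \<otimes>\<^bsub>G \<sigma>\<^esub> g) \<in> Y" if d: "d \<in> D \<sigma> I" for d
  proof -
    have "\<pi> \<sigma> ` A \<subseteq> Y" unfolding YA
      by (rule closure_of_subset) (use AG in \<open>auto simp: topspace_quotient\<close>)
    moreover have "d \<otimes>\<^bsub>G \<sigma>\<^esub> g \<in> A" unfolding A_def using d by (rule imageI)
    ultimately show ?thesis by blast
  qed
  have gdet: "det (g i) = 1" for i by (rule G_det[OF g])
  \<comment> \<open>two places with incompatible alignments\<close>
  have ex: "\<exists>q\<in>carrier (SL2 (UNIV :: 'k set)). \<exists>n. monomial n \<and> g i = n ** map_matrix (\<sigma> i) q" if i: "i \<in> I" for i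
    using bspec[OF single i] by (simp add: aligned_def)
  have "I \<noteq> {}"
  proof
    assume "I = {}"
    then have "aligned I g" using g SL2_one_closed[OF ring_closed_UNIV] by (auto simp: aligned_def)
    then show False using non by simp
  qed
  then obtain i1 where i1: "i1 \<in> I" by blast
  obtain q N1 where q: "q \<in> carrier (SL2 UNIV)" and N1: "monomial N1" "g i1 = N1 ** map_matrix (\<sigma> i1) q"
    using ex[OF i1] by (elim bexE exE conjE)
  have "\<not> (\<forall>i\<in>I. \<exists>n. monomial n \<and> g i = n ** map_matrix (\<sigma> i) q)"
    using non g q unfolding aligned_def by blast
  then obtain i2 where i2: "i2 \<in> I" and nomon: "\<And>n. monomial n \<Longrightarrow> g i2 \<noteq> n ** map_matrix (\<sigma> i2) q" by auto
  obtain q' n2 where q': "q' \<in> carrier (SL2 UNIV)" and n2: "monomial n2" "g i2 = n2 ** map_matrix (\<sigma> i2) q'"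
    using ex[OF i2] by (elim bexE exE conjE)
  have ne: "i1 \<noteq> i2" using nomon[OF N1(1)] N1(2) by blast
  have qdet: "det q = 1" "det q' = 1" using q q' by (simp_all add: SL2_carrier)
  have qdet': "det (map_matrix (\<sigma> i) q) = 1" for i by (simp add: emb_mat_det qdet emb_1[OF emb])
  define p where "p = q' ** adj2 q"
  have pq: "q' = p ** q" by (simp add: p_def adj2_cancel[OF qdet(1)])
  have pdet: "det p = 1" by (simp add: p_def det_mul det_adj2 qdet)
  have emb_mono: "monomial (map_matrix (\<sigma> i) m)" if "m$1$2 = 0 \<and> m$2$1 = 0 \<or> m$1$1 = 0 \<and> m$2$2 = 0" for m i
    using that by (auto simp: monomial_def emb_0[OF emb])
  have pnon: "\<not> (p$1$2 = 0 \<and> p$2$1 = 0 \<or> p$1$1 = 0 \<and> p$2$2 = 0)"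
  proof
    assume "p$1$2 = 0 \<and> p$2$1 = 0 \<or> p$1$1 = 0 \<and> p$2$2 = 0"
    from monomial_mult[OF n2(1) emb_mono[OF this, of i2]] nomon
    have "g i2 \<noteq> n2 ** map_matrix (\<sigma> i2) p ** map_matrix (\<sigma> i2) q" by blast
    then show False using n2(2) unfolding pq emb_mat_mult by (simp add: matrix_mul_assoc)
  qed
  obtain m x y where m: "p = m ** mat22 1 x y (1 + y * x)" "det m = 1" "m$1$2 = 0 \<and> m$2$1 = 0 \<or> m$1$1 = 0 \<and> m$2$2 = 0"
    "x \<noteq> 0 \<or> y \<noteq> 0"
    using nonmonomial_decomposition[OF pdet pnon] by (elim exE conjE)
  define E where "E = mat22 1 x y (1 + y * x)"
  define N2 where "N2 = n2 ** map_matrix (\<sigma> i2) m"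
  have N2: "monomial N2" "g i2 = N2 ** map_matrix (\<sigma> i2) E ** map_matrix (\<sigma> i2) q"
    unfolding N2_def using monomial_mult[OF n2(1) emb_mono[OF m(3)]] n2(2)
    unfolding pq m(1) E_def[symmetric] emb_mat_mult by (simp_all add: matrix_mul_assoc)
  have Edet: "det E = 1" by (simp add: E_def det_2 mat22_nth algebra_simps)
  have Ndet: "det N1 = 1" "det N2 = 1"
    using gdet[of i1] gdet[of i2] unfolding N1(2) N2(2) by (simp_all add: det_mul emb_mat_det qdet(1) Edet emb_1[OF emb])
  \<comment> \<open>units that expand at \<open>i2\<close> and contract at \<open>i1\<close>, congruent to 1 modulo all denominators\<close>
  have "finite {x, q$1$1, q$1$2, q$2$1, q$2$2}" by simp
  then obtain M :: nat where M: "M > 0" "\<And>z. z \<in> {x, q$1$1, q$1$2, q$2$1, q$2$2} \<Longrightarrow> algebraic_int (of_nat M * z)"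
    using common_denominator_algebraic_int[OF nf, of "{x, q$1$1, q$1$2, q$2$1, q$2$2}"] by blast
  have qM: "algebraic_int (of_nat M * q $ a $ b)" for a b
    using M(2) exhaust_2[of a] exhaust_2[of b] by auto
  have xM: "algebraic_int (of_nat M * x)" by (rule M(2)) simp
  define m0 :: 'k where "m0 = of_nat M ^ 3"
  have m0: "algebraic_int m0" "m0 \<noteq> 0"
    using M(1) by (simp_all add: m0_def power3_eq_cube algebraic_int_times algebraic_int_of_nat)
  obtain C where C: "\<forall>R. \<exists>\<epsilon>. \<epsilon> \<noteq> 0 \<and> algebraic_int ((\<epsilon> - 1) / m0) \<and> algebraic_int ((inverse \<epsilon> - 1) / m0) \<and>
     norm (\<sigma> i2 \<epsilon>) \<ge> R \<and> norm (\<sigma> i1 (inverse \<epsilon>)) \<ge> R \<and>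
     (\<forall>j. j \<noteq> i1 \<longrightarrow> j \<noteq> i2 \<longrightarrow> norm (\<sigma> j \<epsilon>) \<le> C \<and> norm (\<sigma> j (inverse \<epsilon>)) \<le> C)"
    using separating_units[OF ne m0] ..
  then have "\<forall>n::nat. \<exists>\<epsilon>. \<epsilon> \<noteq> 0 \<and> algebraic_int ((\<epsilon> - 1) / m0) \<and> algebraic_int ((inverse \<epsilon> - 1) / m0) \<and>
     norm (\<sigma> i2 \<epsilon>) \<ge> real (Suc n) \<and> norm (\<sigma> i1 (inverse \<epsilon>)) \<ge> real (Suc n) \<and>
     (\<forall>j. j \<noteq> i1 \<longrightarrow> j \<noteq> i2 \<longrightarrow> norm (\<sigma> j \<epsilon>) \<le> C \<and> norm (\<sigma> j (inverse \<epsilon>)) \<le> C)" by (intro allI) (rule spec)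
  from choice[OF this] obtain \<epsilon> where "\<forall>n::nat. \<epsilon> n \<noteq> 0 \<and> algebraic_int ((\<epsilon> n - 1) / m0) \<and> algebraic_int ((inverse (\<epsilon> n) - 1) / m0) \<and>
     norm (\<sigma> i2 (\<epsilon> n)) \<ge> real (Suc n) \<and> norm (\<sigma> i1 (inverse (\<epsilon> n))) \<ge> real (Suc n) \<and>
     (\<forall>j. j \<noteq> i1 \<longrightarrow> j \<noteq> i2 \<longrightarrow> norm (\<sigma> j (\<epsilon> n)) \<le> C \<and> norm (\<sigma> j (inverse (\<epsilon> n))) \<le> C)" ..
  then have \<epsilon>: "\<epsilon> n \<noteq> 0" "algebraic_int ((\<epsilon> n - 1) / m0)" "algebraic_int ((inverse (\<epsilon> n) - 1) / m0)"
     "norm (\<sigma> i2 (\<epsilon> n)) \<ge> real (Suc n)" "norm (\<sigma> i1 (inverse (\<epsilon> n))) \<ge> real (Suc n)"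
     "\<And>j. j \<noteq> i1 \<Longrightarrow> j \<noteq> i2 \<Longrightarrow> norm (\<sigma> j (\<epsilon> n)) \<le> C" "\<And>j. j \<noteq> i1 \<Longrightarrow> j \<noteq> i2 \<Longrightarrow> norm (\<sigma> j (inverse (\<epsilon> n))) \<le> C" for n
    by simp_all
  \<comment> \<open>squares, since the entries of elements of \<open>D\<^sub>I\<close> are positive at real places\<close>
  define \<eta> where "\<eta> = (\<lambda>n. \<epsilon> n * \<epsilon> n)"
  have \<eta>0: "\<eta> n \<noteq> 0" for n using \<epsilon>(1) by (simp add: \<eta>_def)
  have sq_cong: "\<exists>v. algebraic_int v \<and> z * z = 1 + m0 * v" if "algebraic_int ((z - 1) / m0)" for z
  proof -
    define v where "v = (z - 1) / m0"
    have z: "z = 1 + m0 * v" using m0(2) by (simp add: v_def)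
    have "algebraic_int v" using that by (simp add: v_def)
    then have "algebraic_int (v * (2 + m0 * v))" using m0(1) by (intro algebraic_int_times algebraic_int_plus) auto
    moreover have "z * z = 1 + m0 * (v * (2 + m0 * v))" unfolding z by (simp add: algebra_simps)
    ultimately show ?thesis by blast
  qed
  define X where "X = (\<lambda>n. mat22 (inverse (\<eta> n)) (x * (inverse (\<eta> n) - \<eta> n)) 0 (\<eta> n))"
  define W where "W = (\<lambda>n. adj2 q ** X n ** q)"
  have WO: "W n \<in> SLO" for n
  proof -
    obtain v where v: "algebraic_int v" "\<eta> n = 1 + m0 * v" using sq_cong[OF \<epsilon>(2)[of n]] unfolding \<eta>_def by (elim exE conjE)
    have inv: "inverse (\<eta> n) = inverse (\<epsilon> n) * inverse (\<epsilon> n)" by (simp add: \<eta>_def)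
    obtain u where u: "algebraic_int u" "inverse (\<eta> n) = 1 + m0 * u" using sq_cong[OF \<epsilon>(3)[of n]] unfolding inv by (elim exE conjE)
    show ?thesis unfolding W_def X_def
      by (rule conj_of_congruent_unit_integral[OF qdet(1) qM xM \<eta>0 u(2)[unfolded m0_def] v(2)[unfolded m0_def] u(1) v(1)])
  qed
  define c where "c = (\<lambda>n. diagonal_embedding \<sigma> (W n))"
  have cG: "c n \<in> \<Gamma> \<sigma>" for n unfolding c_def \<Gamma>_def by (rule imageI[OF WO])
  have ci: "c n i = adj2 (map_matrix (\<sigma> i) q) ** map_matrix (\<sigma> i) (X n) ** map_matrix (\<sigma> i) q" for n i
    by (simp only: c_def W_def diagonal_embedding_def emb_mat_mult emb_mat_adj2)
  define H where "H = (\<lambda>i. if i = i1 then N1 else if i = i2 then N2 else mat 1)"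
  define d where "d = (\<lambda>n i. if i = i1 \<or> i = i2 then dg (\<sigma> i (\<eta> n)) else mat 1)"
  define d' where "d' = (\<lambda>n i. H i ** d n i ** adj2 (H i))"
  have Hm: "\<forall>i\<in>I. monomial (H i)" using N1(1) N2(1) by (simp add: H_def) (simp add: monomial_def mat2_one)
  have Hd: "det (H i) = 1" for i using Ndet by (simp add: H_def)
  have dD: "d n \<in> D \<sigma> I" for n
    unfolding D_iff
  proof (intro conjI ballI allI impI)
    fix i assume "i \<in> I"
    show "\<exists>z\<in>K i. d n i = dg (exp z)"
    proof (cases "i = i1 \<or> i = i2")
      case True
      have "real_place i \<longrightarrow> Re (\<sigma> i (\<eta> n)) > 0"
      proof
        assume "real_place i"
        then have "\<sigma> i (\<epsilon> n) \<in> \<real>" using range_subset_K K_real by blast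
        then obtain t where t: "\<sigma> i (\<epsilon> n) = of_real t" by (elim Reals_cases)
        then have "t \<noteq> 0" using \<epsilon>(1)[of n] emb_eq_0[OF emb, of i "\<epsilon> n"] by auto
        then have "0 < t * t" using not_real_square_gt_zero by blast
        moreover have "\<sigma> i (\<eta> n) = of_real (t * t)" by (simp add: \<eta>_def emb_mult[OF emb] t)
        ultimately show "Re (\<sigma> i (\<eta> n)) > 0" by simp
      qed
      then have "\<exists>z\<in>K i. \<sigma> i (\<eta> n) = exp z"
        unfolding exp_image_K using range_subset_K \<eta>0 by (simp add: emb_eq_0[OF emb])
      then show ?thesis using True by (auto simp: d_def)
    next
      case False
      then have "d n i = dg (exp 0)" by (simp add: d_def dg_one)
      moreover have "0 \<in> K i" using ring_closed_K[of i] by (simp add: ring_closed_def)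
      ultimately show ?thesis by blast
    qed
  qed (use i1 i2 in \<open>auto simp: d_def\<close>)
  have d'D: "d' n \<in> D \<sigma> I" for n unfolding d'_def by (rule conj_in_D[OF Hm Hd dD])
  define f where "f = (\<lambda>n i. d' n i ** g i ** c n i)"
  have fG: "f n \<in> carrier (G \<sigma>)" for n unfolding f_def
    by (rule G_mult_closed[OF G_mult_closed[OF subsetD[OF D_subset d'D] g] subsetD[OF Gamma_subset cG]])
  have Xi: "map_matrix (\<sigma> i) (X n) = mat22 (inverse (\<sigma> i (\<eta> n))) (\<sigma> i x * (inverse (\<sigma> i (\<eta> n)) - \<sigma> i (\<eta> n))) 0 (\<sigma> i (\<eta> n))" for i n
    by (simp only: X_def emb_mat22 emb_mult[OF emb] emb_diff[OF emb] emb_inverse[OF emb] emb_0[OF emb])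
  have Ei: "map_matrix (\<sigma> i) E = mat22 1 (\<sigma> i x) (\<sigma> i y) (1 + \<sigma> i y * \<sigma> i x)" for i
    by (simp only: E_def emb_mat22 emb_mult[OF emb] emb_add[OF emb] emb_1[OF emb])
  have dg_mat: "dg e ** mat22 (inverse e) (z * (inverse e - e)) 0 e = mat22 1 (z * (1 - e * e)) 0 1"
    "dg e ** mat22 1 z w (1 + w * z) ** mat22 (inverse e) (z * (inverse e - e)) 0 e
      = mat22 1 z (w * (inverse e * inverse e)) (1 + w * z * (inverse e * inverse e))" if "e \<noteq> 0" for e z w
    using that by (simp_all add: mat2_eq_iff mat2_mult mat22_nth dg_nth field_simps)
  have dgX: "dg (\<sigma> i (\<eta> n)) ** map_matrix (\<sigma> i) (X n) = mat22 1 (\<sigma> i x * (1 - \<sigma> i (\<eta> n) * \<sigma> i (\<eta> n))) 0 1" for i n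
    unfolding Xi by (rule dg_mat) (simp add: \<eta>0 emb_eq_0[OF emb])
  have f1: "f n i1 = N1 ** mat22 1 (\<sigma> i1 x * (1 - \<sigma> i1 (\<eta> n) * \<sigma> i1 (\<eta> n))) 0 1 ** map_matrix (\<sigma> i1) q" for n
    unfolding dgX[symmetric]
    by (simp add: f_def d'_def H_def d_def N1(2) ci matrix_mul_assoc adj2_cancel[OF Ndet(1)] adj2_cancel[OF qdet'])
  have dgEX: "dg (\<sigma> i (\<eta> n)) ** map_matrix (\<sigma> i) E ** map_matrix (\<sigma> i) (X n)
      = mat22 1 (\<sigma> i x) (\<sigma> i y * (inverse (\<sigma> i (\<eta> n)) * inverse (\<sigma> i (\<eta> n)))) (1 + \<sigma> i y * \<sigma> i x * (inverse (\<sigma> i (\<eta> n)) * inverse (\<sigma> i (\<eta> n))))" for i n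
    unfolding Xi Ei by (rule dg_mat) (simp add: \<eta>0 emb_eq_0[OF emb])
  have f2: "f n i2 = N2 ** mat22 1 (\<sigma> i2 x) (\<sigma> i2 y * (inverse (\<sigma> i2 (\<eta> n)) * inverse (\<sigma> i2 (\<eta> n))))
      (1 + \<sigma> i2 y * \<sigma> i2 x * (inverse (\<sigma> i2 (\<eta> n)) * inverse (\<sigma> i2 (\<eta> n)))) ** map_matrix (\<sigma> i2) q" for n
    unfolding dgEX[symmetric] using ne
    by (simp add: f_def d'_def H_def d_def N2(2) ci matrix_mul_assoc adj2_cancel[OF Ndet(2)] adj2_cancel[OF qdet'])
  have to0: "(\<lambda>n. z n) \<longlonglongrightarrow> 0" if z: "\<And>n. norm (inverse (z n)) \<ge> real (Suc n)" for z :: "nat \<Rightarrow> complex"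
  proof (rule Lim_null_comparison[OF always_eventually LIMSEQ_inverse_real_of_nat], rule allI)
    fix n
    have "real (Suc n) \<le> inverse (norm (z n))" using z[of n] by (simp only: norm_inverse)
    then have "inverse (inverse (norm (z n))) \<le> inverse (real (Suc n))" by (rule le_imp_inverse_le) simp
    then show "norm (z n) \<le> inverse (real (Suc n))" by simp
  qed
  have lim1: "(\<lambda>n. \<sigma> i1 (\<eta> n)) \<longlonglongrightarrow> 0"
  proof -
    have "(\<lambda>n. \<sigma> i1 (\<epsilon> n)) \<longlonglongrightarrow> 0" by (rule to0) (use \<epsilon>(5) in \<open>simp only: emb_inverse[OF emb]\<close>)
    from tendsto_mult[OF this this] show ?thesis by (simp add: \<eta>_def emb_mult[OF emb])
  qed
  have lim2: "(\<lambda>n. inverse (\<sigma> i2 (\<eta> n))) \<longlonglongrightarrow> 0"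
  proof -
    have "(\<lambda>n. inverse (\<sigma> i2 (\<epsilon> n))) \<longlonglongrightarrow> 0" by (rule to0) (use \<epsilon>(4) in \<open>simp only: inverse_inverse_eq\<close>)
    from tendsto_mult[OF this this] show ?thesis by (simp add: \<eta>_def emb_mult[OF emb])
  qed
  \<comment> \<open>away from \<open>i1\<close> and \<open>i2\<close> the sequence stays bounded\<close>
  define F where "F = (\<lambda>n i. if i = i1 \<or> i = i2 then mat 1 else f n i)"
  have bX: "bounded_mats (\<lambda>n. map_matrix (\<sigma> i) (X n))" if i: "i \<noteq> i1" "i \<noteq> i2" for i
    unfolding bounded_mats_def
  proof (intro exI allI)
    fix n and a b :: 2
    have C0: "C \<ge> 0" using \<epsilon>(6)[OF i] norm_ge_zero order_trans by blast
    have e: "norm (\<sigma> i (\<eta> n)) \<le> C * C" unfolding \<eta>_def emb_mult[OF emb] norm_mult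
      by (intro mult_mono \<epsilon>(6)[OF i] C0 norm_ge_zero)
    have e': "norm (inverse (\<sigma> i (\<eta> n))) \<le> C * C" unfolding \<eta>_def emb_mult[OF emb] norm_mult inverse_mult_distrib
      using \<epsilon>(7)[OF i, of n] unfolding emb_inverse[OF emb] by (intro mult_mono C0 norm_ge_zero)
    define P1 P2 where P: "P1 = C * C" "P2 = norm (\<sigma> i x) * (C * C + C * C)"
    have "norm (\<sigma> i x * (inverse (\<sigma> i (\<eta> n)) - \<sigma> i (\<eta> n))) \<le> P2"
      unfolding norm_mult P by (intro mult_left_mono norm_ge_zero order_trans[OF norm_triangle_ineq4 add_mono[OF e' e]])
    moreover have "0 \<le> P1" "0 \<le> P2" using C0 by (simp_all add: P)
    moreover note e[folded P] e'[folded P]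
    ultimately have "norm (map_matrix (\<sigma> i) (X n) $ a $ b) \<le> P1 + P2"
      using exhaust_2[of a] exhaust_2[of b] unfolding Xi
      by (auto simp: mat22_nth simp del: norm_inverse norm_mult)
    then show "norm (map_matrix (\<sigma> i) (X n) $ a $ b) \<le> C * C + norm (\<sigma> i x) * (C * C + C * C)" by (simp only: P)
  qed
  have bF: "bounded_mats (\<lambda>n. F n i)" for i
  proof (cases "i = i1 \<or> i = i2")
    case True then show ?thesis by (simp add: F_def bounded_mats_const)
  next
    case False
    then have i: "i \<noteq> i1" "i \<noteq> i2" by simp_all
    have "bounded_mats (\<lambda>n. g i ** (adj2 (map_matrix (\<sigma> i) q) ** map_matrix (\<sigma> i) (X n) ** map_matrix (\<sigma> i) q))"
      by (intro bounded_mats_mult bounded_mats_const bX i)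
    moreover have "F n i = g i ** (adj2 (map_matrix (\<sigma> i) q) ** map_matrix (\<sigma> i) (X n) ** map_matrix (\<sigma> i) q)" for n
    proof -
      have "adj2 (mat 1 :: complex^2^2) = mat 1" by (simp add: mat2_eq_iff adj2_nth mat2_one)
      then show ?thesis using i by (simp add: F_def f_def d'_def d_def H_def ci)
    qed
    ultimately show ?thesis by (simp only:)
  qed
  have "\<forall>i. \<exists>B. \<forall>n a b. norm (F n i $ a $ b) \<le> B" using bF unfolding bounded_mats_def by (rule allI)
  from choice[OF this] obtain B where B: "\<forall>i n a b. norm (F n i $ a $ b) \<le> B i" ..
  have B': "norm (F n i $ a $ b) \<le> Max (range B)" for n i a b
    by (rule order_trans[OF B[rule_format] Max_ge]) auto
  obtain l r where r: "strict_mono r" "(\<lambda>n. F (r n)) \<longlonglongrightarrow> l"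
    using bounded_convergent_subsequence_fun[of F, OF B'] by blast
  define u where "u = (\<lambda>i. mat22 1 (\<sigma> i x) 0 1)"
  define h where "h = (\<lambda>i. if i = i1 \<or> i = i2 then H i ** u i ** map_matrix (\<sigma> i) q else l i)"
  have sub1: "(\<lambda>n. \<sigma> i1 (\<eta> (r n))) \<longlonglongrightarrow> 0" using LIMSEQ_subseq_LIMSEQ[OF lim1 r(1)] by (simp only: o_def)
  have sub2: "(\<lambda>n. inverse (\<sigma> i2 (\<eta> (r n)))) \<longlonglongrightarrow> 0" using LIMSEQ_subseq_LIMSEQ[OF lim2 r(1)] by (simp only: o_def)
  have sq1: "(\<lambda>n. \<sigma> i1 (\<eta> (r n)) * \<sigma> i1 (\<eta> (r n))) \<longlonglongrightarrow> 0" using tendsto_mult[OF sub1 sub1] by simp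
  have sq2: "(\<lambda>n. inverse (\<sigma> i2 (\<eta> (r n))) * inverse (\<sigma> i2 (\<eta> (r n)))) \<longlonglongrightarrow> 0" using tendsto_mult[OF sub2 sub2] by simp
  have lim: "(\<lambda>n. f (r n)) \<longlonglongrightarrow> h"
    unfolding tendsto_fun_mat2_iff
  proof (intro allI)
    fix i and a b :: 2
    have H2: "H i2 = N2" "H i1 = N1" using ne by (simp_all add: H_def)
    consider "i = i1" | "i = i2" | "i \<noteq> i1" "i \<noteq> i2" by blast
    then show "(\<lambda>n. f (r n) i $ a $ b) \<longlonglongrightarrow> h i $ a $ b"
    proof cases
      case 1
      have "(\<lambda>n. \<sigma> i1 x * (1 - \<sigma> i1 (\<eta> (r n)) * \<sigma> i1 (\<eta> (r n)))) \<longlonglongrightarrow> \<sigma> i1 x * (1 - 0)"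
        by (intro tendsto_intros sq1)
      then show ?thesis unfolding 1 f1 h_def H2 u_def
        by (simp add: mat2_mult mat22_nth) (intro tendsto_intros)
    next
      case 2
      have "(\<lambda>n. \<sigma> i2 y * (inverse (\<sigma> i2 (\<eta> (r n))) * inverse (\<sigma> i2 (\<eta> (r n))))) \<longlonglongrightarrow> \<sigma> i2 y * 0"
        "(\<lambda>n. 1 + \<sigma> i2 y * \<sigma> i2 x * (inverse (\<sigma> i2 (\<eta> (r n))) * inverse (\<sigma> i2 (\<eta> (r n))))) \<longlonglongrightarrow> 1 + \<sigma> i2 y * \<sigma> i2 x * 0"
        by (intro tendsto_intros sq2)+
      then have l: "(\<lambda>n. \<sigma> i2 y * (inverse (\<sigma> i2 (\<eta> (r n))) * inverse (\<sigma> i2 (\<eta> (r n))))) \<longlonglongrightarrow> 0"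
        "(\<lambda>n. 1 + \<sigma> i2 y * \<sigma> i2 x * (inverse (\<sigma> i2 (\<eta> (r n))) * inverse (\<sigma> i2 (\<eta> (r n))))) \<longlonglongrightarrow> 1" by simp_all
      have "(\<lambda>n. ((N2 $ a $ 1 * 1 + N2 $ a $ 2 * (\<sigma> i2 y * (inverse (\<sigma> i2 (\<eta> (r n))) * inverse (\<sigma> i2 (\<eta> (r n)))))) * map_matrix (\<sigma> i2) q $ 1 $ b
          + (N2 $ a $ 1 * \<sigma> i2 x + N2 $ a $ 2 * (1 + \<sigma> i2 y * \<sigma> i2 x * (inverse (\<sigma> i2 (\<eta> (r n))) * inverse (\<sigma> i2 (\<eta> (r n)))))) * map_matrix (\<sigma> i2) q $ 2 $ b))
          \<longlonglongrightarrow> (N2 $ a $ 1 * 1 + N2 $ a $ 2 * 0) * map_matrix (\<sigma> i2) q $ 1 $ b + (N2 $ a $ 1 * \<sigma> i2 x + N2 $ a $ 2 * 1) * map_matrix (\<sigma> i2) q $ 2 $ b"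
        by (intro tendsto_add tendsto_mult tendsto_const l)
      then show ?thesis unfolding 2 f2 h_def H2 u_def
        by (simp only: mat2_mult mat22_nth if_True simp_thms)
    next
      case 3
      have "(\<lambda>n. F (r n) i $ a $ b) \<longlonglongrightarrow> l i $ a $ b" using r(2) unfolding tendsto_fun_mat2_iff by blast
      then show ?thesis using 3 by (simp add: F_def h_def)
    qed
  qed
  have hG: "h \<in> carrier (G \<sigma>)" by (rule closed_sequentially[OF closed_G _ lim]) (rule fG)
  have hY: "\<pi> \<sigma> h \<in> Y"
    unfolding YA closure_of_pi_image[OF AG hG]
  proof (rule exI[of _ "\<lambda>n. d' (r n) \<otimes>\<^bsub>G \<sigma>\<^esub> g"], rule exI[of _ "\<lambda>n. c (r n)"], intro conjI allI)
    show "d' (r n) \<otimes>\<^bsub>G \<sigma>\<^esub> g \<in> A" for n unfolding A_def by (rule imageI[OF d'D])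
    show "c (r n) \<in> \<Gamma> \<sigma>" for n by (rule cG)
    show "(\<lambda>n. d' (r n) \<otimes>\<^bsub>G \<sigma>\<^esub> g \<otimes>\<^bsub>G \<sigma>\<^esub> c (r n)) \<longlonglongrightarrow> h" using lim unfolding f_def G_mult .
  qed
  \<comment> \<open>so \<open>h\<close> differs from \<open>g\<close> by an element that is diagonal at both places\<close>
  have "\<exists>t b. b \<in> \<Gamma> \<sigma> \<and> h = (\<lambda>i. t i ** g i ** b i) \<and> (\<forall>i\<in>I. is_diag (t i)) \<and> (\<forall>i. det (t i) = 1)"
    by (rule torus_orbit_closure_diagonal[OF Y g _ hG hY]) (rule sub)
  then obtain t b where t: "b \<in> \<Gamma> \<sigma>" "h = (\<lambda>i. t i ** g i ** b i)" "\<forall>i\<in>I. is_diag (t i)" "\<forall>i. det (t i) = 1"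
    by (elim exE conjE)
  obtain V where V: "V \<in> SLO" "b = diagonal_embedding \<sigma> V" using t(1) unfolding \<Gamma>_def by (elim imageE)
  have Vdet: "det V = 1" using V(1) by (simp add: SL2_carrier)
  \<comment> \<open>over \<open>K\<close>, both \<open>Z\<close> and \<open>Z ** adj2 E\<close> turn out to be diagonal\<close>
  define Z where "Z = mat22 1 x 0 1 ** q ** adj2 V ** adj2 q"
  have Zdet: "det Z = 1" by (simp add: Z_def det_mul det_adj2 qdet Vdet, simp add: det_2 mat22_nth)
  have uZ: "u i ** map_matrix (\<sigma> i) q = map_matrix (\<sigma> i) Z ** map_matrix (\<sigma> i) q ** map_matrix (\<sigma> i) V" for i
  proof -
    have "mat22 1 x 0 1 ** q = Z ** q ** V"
      by (simp add: Z_def adj2_cancel[OF qdet(1)] adj2_cancel[OF Vdet])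
    then have "map_matrix (\<sigma> i) (mat22 1 x 0 1 ** q) = map_matrix (\<sigma> i) (Z ** q ** V)" by (rule arg_cong)
    then show ?thesis unfolding emb_mat_mult emb_mat22 by (simp add: u_def emb_0[OF emb] emb_1[OF emb])
  qed
  define RR where "RR = (\<lambda>i. map_matrix (\<sigma> i) q ** map_matrix (\<sigma> i) V)"
  have Rdet: "det (RR i) = 1" for i by (simp add: RR_def det_mul emb_mat_det qdet(1) Vdet emb_1[OF emb])
  have bi: "b i = map_matrix (\<sigma> i) V" for i by (simp add: V(2) diagonal_embedding_def)
  have Zd1: "is_diag (map_matrix (\<sigma> i1) Z)"
  proof -
    have "N1 ** map_matrix (\<sigma> i1) Z ** RR i1 = t i1 ** N1 ** RR i1"
    proof -
      have "h i1 = N1 ** (u i1 ** map_matrix (\<sigma> i1) q)" by (simp add: h_def H_def matrix_mul_assoc)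
      moreover have "h i1 = t i1 ** (N1 ** map_matrix (\<sigma> i1) q) ** map_matrix (\<sigma> i1) V" using t(2) by (simp only: N1(2) bi)
      ultimately show ?thesis unfolding uZ RR_def by (simp add: matrix_mul_assoc)
    qed
    then have "N1 ** map_matrix (\<sigma> i1) Z ** RR i1 ** adj2 (RR i1) = t i1 ** N1 ** RR i1 ** adj2 (RR i1)" by (simp only:)
    then have eq: "N1 ** map_matrix (\<sigma> i1) Z = t i1 ** N1" by (simp only: adj2_cancel[OF Rdet])
    have "map_matrix (\<sigma> i1) Z = adj2 N1 ** (N1 ** map_matrix (\<sigma> i1) Z)" by (simp add: adj2_cancel_left[OF Ndet(1)])
    then have "map_matrix (\<sigma> i1) Z = adj2 N1 ** t i1 ** N1" unfolding eq by (simp add: matrix_mul_assoc)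
    then show ?thesis using is_diag_conj_monomial[OF N1(1)] t(3) i1 by simp
  qed
  have Zd2: "is_diag (map_matrix (\<sigma> i2) (Z ** adj2 E))"
  proof -
    define R' where "R' = map_matrix (\<sigma> i2) E ** RR i2"
    have R'det: "det R' = 1" by (simp add: R'_def det_mul Rdet emb_mat_det Edet emb_1[OF emb])
    have E'det: "det (map_matrix (\<sigma> i2) E) = 1" by (simp add: emb_mat_det Edet emb_1[OF emb])
    have "N2 ** map_matrix (\<sigma> i2) (Z ** adj2 E) ** R' = t i2 ** N2 ** R'"
    proof -
      have "h i2 = N2 ** (u i2 ** map_matrix (\<sigma> i2) q)" using ne by (simp add: h_def H_def matrix_mul_assoc)
      moreover have "h i2 = t i2 ** (N2 ** map_matrix (\<sigma> i2) E ** map_matrix (\<sigma> i2) q) ** map_matrix (\<sigma> i2) V" using t(2) by (simp only: N2(2) bi)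
      ultimately show ?thesis unfolding uZ RR_def R'_def emb_mat_mult[of i2 Z] emb_mat_adj2
        by (simp add: matrix_mul_assoc adj2_cancel[OF E'det])
    qed
    then have "N2 ** map_matrix (\<sigma> i2) (Z ** adj2 E) ** R' ** adj2 R' = t i2 ** N2 ** R' ** adj2 R'" by (simp only:)
    then have eq: "N2 ** map_matrix (\<sigma> i2) (Z ** adj2 E) = t i2 ** N2" by (simp only: adj2_cancel[OF R'det])
    have "map_matrix (\<sigma> i2) (Z ** adj2 E) = adj2 N2 ** (N2 ** map_matrix (\<sigma> i2) (Z ** adj2 E))" by (simp only: adj2_cancel_left[OF Ndet(2)])
    then have "map_matrix (\<sigma> i2) (Z ** adj2 E) = adj2 N2 ** t i2 ** N2" unfolding eq by (simp add: matrix_mul_assoc)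
    then show ?thesis using is_diag_conj_monomial[OF N2(1)] t(3) i2 by simp
  qed
  have Z0: "Z$1$2 = 0" "Z$2$1 = 0" using Zd1 by (simp_all add: is_diag_def emb_eq_0[OF emb])
  have ZE0: "(Z ** adj2 E)$1$2 = 0" "(Z ** adj2 E)$2$1 = 0" using Zd2 unfolding is_diag_def by (simp_all add: emb_eq_0[OF emb])
  have "Z$1$1 * Z$2$2 = 1" using Zdet Z0 by (simp add: det_2)
  then have "Z$1$1 \<noteq> 0" "Z$2$2 \<noteq> 0" by auto
  then show False using ZE0 Z0 m(4) by (simp add: mat2_mult adj2_nth E_def mat22_nth)
qed

section \<open>The characterization\<close>

lemma aligned_subset: "aligned I g \<Longrightarrow> J \<subseteq> I \<Longrightarrow> aligned J g"
  unfolding aligned_def by (intro conjI) (simp, elim conjE bexE, rule bexI, auto)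

text \<open>
  Take the identity at one place \<open>i1\<close> and the upper unipotent matrix with entry
  \<open>1\<close> at all others. An element \<open>p\<close> that witnesses alignment at
  \<open>i1\<close> is itself monomial, and then the component at the second place would be
  monomial.
\<close>
lemma singly_aligned_not_aligned:
  assumes I: "card I \<ge> 2"
  shows "\<exists>g. (\<forall>i\<in>I. aligned {i} g) \<and> \<not> aligned I g"
proof -
  have "\<exists>i1 i2. i1 \<in> I \<and> i2 \<in> I \<and> i1 \<noteq> i2"
  proof (rule ccontr)
    assume no: "\<not> ?thesis"
    then have "card I \<le> Suc 0" unfolding card_le_Suc0_iff_eq[OF finite] by blast
    then show False using I by simp
  qed
  then obtain i1 i2 where i: "i1 \<in> I" "i2 \<in> I" "i1 \<noteq> i2" by (elim exE conjE)
  define a :: "'r \<Rightarrow> 'k" where "a = (\<lambda>i. if i = i1 then 0 else 1)"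
  define q where "q = (\<lambda>i. mat22 1 (a i) 0 1)"
  define g where "g = (\<lambda>i. map_matrix (\<sigma> i) (q i))"
  have q: "q i \<in> carrier (SL2 UNIV)" for i by (simp add: SL2_carrier q_def det_2 mat22_nth)
  have g: "g \<in> carrier (G \<sigma>)"
    unfolding G_carrier
  proof
    fix i
    show "g i \<in> carrier (SL2 (K i))"
      using emb_mat_closed[OF q[of i]] unfolding G_carrier by (simp add: diagonal_embedding_def g_def)
  qed
  have one: "monomial (mat 1)" by (simp add: monomial_def mat2_one)
  have single: "aligned {i} g" for i
    unfolding aligned_def using g q[of i] one by (intro conjI bexI[of _ "q i"] ballI exI[of _ "mat 1"]) (simp_all add: g_def)
  have "\<not> aligned I g"
  proof
    assume "aligned I g"
    then obtain p where p: "p \<in> carrier (SL2 UNIV)" "\<forall>i\<in>I. \<exists>n. monomial n \<and> g i = n ** map_matrix (\<sigma> i) p"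
      unfolding aligned_def by blast
    obtain n1 where n1: "monomial n1" "g i1 = n1 ** map_matrix (\<sigma> i1) p" using bspec[OF p(2) i(1)] by (elim exE conjE)
    obtain n2 where n2: "monomial n2" "g i2 = n2 ** map_matrix (\<sigma> i2) p" using bspec[OF p(2) i(2)] by (elim exE conjE)
    have e1: "n1 ** map_matrix (\<sigma> i1) p = mat22 1 0 0 1" using n1(2) by (simp add: g_def q_def a_def emb_mat22 emb_0[OF emb] emb_1[OF emb])
    have e2: "n2 ** map_matrix (\<sigma> i2) p = mat22 1 1 0 1" using n2(2) i(3) by (simp add: g_def q_def a_def emb_mat22 emb_0[OF emb] emb_1[OF emb])
    have eq1: "p$1$2 = 0 \<and> p$2$1 = 0 \<or> p$1$1 = 0 \<and> p$2$2 = 0"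
      using e1 n1(1) by (auto simp: mat2_eq_iff mat2_mult mat22_nth monomial_def emb_eq_0[OF emb])
    show False using eq1 e2 n2(1)
      by (auto simp: mat2_eq_iff mat2_mult mat22_nth monomial_def emb_0[OF emb])
  qed
  then show ?thesis using single by blast
qed

end

theorem corollary1p9:
  fixes \<sigma> :: "'r::finite \<Rightarrow> 'k::field_char_0 \<Rightarrow> complex" and I :: "'r set"
  assumes "number_field TYPE('k)"
    and "archimedean_completions \<sigma>"
    and "CARD('r) \<ge> 2"
    and "card I \<ge> 2"
  shows "normalizer (G \<sigma>) (D \<sigma> I) <#>\<^bsub>G \<sigma>\<^esub> G_K \<sigma>
           \<subset> (\<Inter>i\<in>I. normalizer (G \<sigma>) (D \<sigma> {i}) <#>\<^bsub>G \<sigma>\<^esub> G_K \<sigma>)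
       \<and> (\<forall>g\<in>carrier (G \<sigma>).
            locally_divergent_orbit \<sigma> I g \<and>
            \<not> is_torus_orbit \<sigma> (G_mod_\<Gamma>_top \<sigma> closure_of orbit_of \<sigma> (D \<sigma> I) (\<pi> \<sigma> g))
            \<longleftrightarrow> g \<in> (\<Inter>i\<in>I. normalizer (G \<sigma>) (D \<sigma> {i}) <#>\<^bsub>G \<sigma>\<^esub> G_K \<sigma>)
                    - (normalizer (G \<sigma>) (D \<sigma> I) <#>\<^bsub>G \<sigma>\<^esub> G_K \<sigma>))"
proof -
  interpret archimedean_places \<sigma>
    by unfold_locales (use assms in auto)
  have all: "g \<in> normalizer (G \<sigma>) (D \<sigma> I) <#>\<^bsub>G \<sigma>\<^esub> G_K \<sigma> \<longleftrightarrow> aligned I g" for g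
    by (rule normalizer_G_K_iff)
  have each: "g \<in> (\<Inter>i\<in>I. normalizer (G \<sigma>) (D \<sigma> {i}) <#>\<^bsub>G \<sigma>\<^esub> G_K \<sigma>) \<longleftrightarrow> (\<forall>i\<in>I. aligned {i} g)" for g
    by (simp add: normalizer_G_K_iff)
  have mono: "\<forall>i\<in>I. aligned {i} g" if "aligned I g" for g
    using aligned_subset[OF that] by simp
  obtain g where g: "\<forall>i\<in>I. aligned {i} g" "\<not> aligned I g"
    using singly_aligned_not_aligned[OF assms(4)] by (elim exE conjE)
  show ?thesis
  proof (intro conjI psubsetI subsetI ballI)
    fix h assume "h \<in> normalizer (G \<sigma>) (D \<sigma> I) <#>\<^bsub>G \<sigma>\<^esub> G_K \<sigma>"
    then show "h \<in> (\<Inter>i\<in>I. normalizer (G \<sigma>) (D \<sigma> {i}) <#>\<^bsub>G \<sigma>\<^esub> G_K \<sigma>)" unfolding all each by (rule mono)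
  next
    show "normalizer (G \<sigma>) (D \<sigma> I) <#>\<^bsub>G \<sigma>\<^esub> G_K \<sigma> \<noteq> (\<Inter>i\<in>I. normalizer (G \<sigma>) (D \<sigma> {i}) <#>\<^bsub>G \<sigma>\<^esub> G_K \<sigma>)"
    proof
      assume "normalizer (G \<sigma>) (D \<sigma> I) <#>\<^bsub>G \<sigma>\<^esub> G_K \<sigma> = (\<Inter>i\<in>I. normalizer (G \<sigma>) (D \<sigma> {i}) <#>\<^bsub>G \<sigma>\<^esub> G_K \<sigma>)"
      then have "aligned I g \<longleftrightarrow> (\<forall>i\<in>I. aligned {i} g)" unfolding all[symmetric] each[symmetric] by (rule arg_cong)
      then show False using g by simp
    qed
  next
    fix h assume h: "h \<in> carrier (G \<sigma>)"
    have "locally_divergent_orbit \<sigma> I h \<longleftrightarrow> (\<forall>i\<in>I. aligned {i} h)"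
      by (simp add: locally_divergent_orbit_def divergent_iff_aligned[OF h])
    moreover have "is_torus_orbit \<sigma> (G_mod_\<Gamma>_top \<sigma> closure_of orbit_of \<sigma> (D \<sigma> I) (\<pi> \<sigma> h)) \<longleftrightarrow> aligned I h"
      if each_h: "\<forall>i\<in>I. aligned {i} h"
    proof (rule iffI, rule ccontr)
      assume torus: "is_torus_orbit \<sigma> (G_mod_\<Gamma>_top \<sigma> closure_of orbit_of \<sigma> (D \<sigma> I) (\<pi> \<sigma> h))" and "\<not> aligned I h"
      show False by (rule notE[OF not_torus_orbit_if_not_aligned[OF h each_h \<open>\<not> aligned I h\<close>] torus])
    qed (rule closure_torus_orbit_if_aligned)
    ultimately show "(locally_divergent_orbit \<sigma> I h \<and>
            \<not> is_torus_orbit \<sigma> (G_mod_\<Gamma>_top \<sigma> closure_of orbit_of \<sigma> (D \<sigma> I) (\<pi> \<sigma> h)))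
            \<longleftrightarrow> h \<in> (\<Inter>i\<in>I. normalizer (G \<sigma>) (D \<sigma> {i}) <#>\<^bsub>G \<sigma>\<^esub> G_K \<sigma>)
                    - (normalizer (G \<sigma>) (D \<sigma> I) <#>\<^bsub>G \<sigma>\<^esub> G_K \<sigma>)"
      unfolding Diff_iff all each by (simp cong: conj_cong)
  qed
qed

end
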